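(* For every integer $L\ge1$ there exists $\varepsilon=\varepsilon(L)>0$ such that for every complex rational map $f$ of degree $2$, the number of repelling periodic cycles $\{p,f(p),\dots,f^{l-1}(p)\}$ of period $l\le L$ whose multiplier satisfies $|(f^l)'(p)|<(1+\varepsilon)^l$ is at most $4$. *)

theory Defs
  imports "HOL-Analysis.Analysis" "HOL-Computational_Algebra.Polynomial"
begin

text \<open>The Riemann sphere is modelled as \<open>complex option\<close>: \<open>Some z\<close> is the finite
point z, \<open>None\<close> is the point at infinity.\<close>

definition deg2_pair :: "complex poly \<Rightarrow> complex poly \<Rightarrow> bool" where
  "deg2_pair P Q \<longleftrightarrow> coprime P Q \<and> max (degree P) (degree Q) = 2"

definition rat_map :: "complex poly \<Rightarrow> complex poly \<Rightarrow> complex option \<Rightarrow> complex option" where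
  "rat_map P Q p = (case p of
      Some z \<Rightarrow> (if poly Q z = 0 then None else Some (poly P z / poly Q z))
    | None \<Rightarrow> (if degree Q < degree P then None
               else Some (coeff P (degree Q) / lead_coeff Q)))"

definition chart :: "complex option \<Rightarrow> complex option \<Rightarrow> complex" where
  "chart p q = (case p of
      Some _ \<Rightarrow> (case q of Some z \<Rightarrow> z | None \<Rightarrow> 0)
    | None \<Rightarrow> (case q of Some z \<Rightarrow> 1 / z | None \<Rightarrow> 0))"

definition chart_inv :: "complex option \<Rightarrow> complex \<Rightarrow> complex option" where
  "chart_inv p w = (case p of
      Some _ \<Rightarrow> Some w
    | None \<Rightarrow> (if w = 0 then None else Some (1 / w)))"

text \<open>Derivative of a map g of the sphere at p, computed in the charts at p
and at g p.  For a fixed point p of g this is the multiplier g'(p).\<close>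
definition sphere_deriv :: "(complex option \<Rightarrow> complex option) \<Rightarrow> complex option \<Rightarrow> complex" where
  "sphere_deriv g p = deriv (\<lambda>w. chart (g p) (g (chart_inv p w))) (chart p p)"

definition exact_period :: "('a \<Rightarrow> 'a) \<Rightarrow> 'a \<Rightarrow> nat \<Rightarrow> bool" where
  "exact_period f p l \<longleftrightarrow> 0 < l \<and> (f ^^ l) p = p \<and> (\<forall>k. 0 < k \<and> k < l \<longrightarrow> (f ^^ k) p \<noteq> p)"

definition cycle_of :: "('a \<Rightarrow> 'a) \<Rightarrow> 'a \<Rightarrow> nat \<Rightarrow> 'a set" where
  "cycle_of f p l = (\<lambda>i. (f ^^ i) p) ` {..<l}"

end

(*
Suppose that there are maps with five repelling cycles of period at most L whose multipliers tend to the unit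
circle. After a conjugation that puts the critical points at 0 and infinity and a small perturbation, they are
F(z) = (z^2 + b) / (c z^2 + 1), and the multipliers of the points of period m are the roots of a polynomial in x
whose coefficients are polynomials in b and c. The coefficient vectors converge in projective space along a
subsequence, even if the parameters (b, c) tend to infinity. A curve selection argument yields a meromorphic
germ s -> (b(s), c(s)) whose coefficient vectors have the same limits for s -> 0. So for small s there are still
at least five cycles with multipliers close to the unit circle. By Puiseux these multipliers are meromorphic
functions rho + A t^k + ... of a root t of s with |rho| = 1 and k > 0, and they are not constant. For a suitable
finite set of directions of t each of them is inside the unit disc exactly half of the time. Hence some map has
at least 5/2 attracting cycles, and this contradicts Fatou's bound of two.
*)
theory Submission
  imports Defs "HOL-Complex_Analysis.Complex_Analysis" "HOL-Computational_Algebra.Fundamental_Theorem_Algebra"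
    "Jordan_Normal_Form.Determinant"
begin

text \<open>The cycles themselves need not converge when the parameters diverge: they may collide or
  run to infinity. Only the polynomial of the multipliers has a limit, up to a scalar, so everything
  is phrased through root counts. A point of period l dividing m is fixed by the m-th iterate, and
  its multiplier there is the power m / l of its own. Hence the annuli (1 - \<eta>)^m < |x| < (1 +
  \<eta>)^m, which select the same cycles for every m. The number of cycles is a linear combination
  of these root counts whose coefficients may have either sign. For that reason the average over the
  directions has to be an equality for each m; inequalities could not be combined. The curve must
  also keep each multiplier branch different from its limit \<rho> on the unit circle, so \<rho>
  must not be a multiplier identically along it. This is one more polynomial condition on (b, c),
  and it can be met because at b = 0, c = 12 no multiplier has modulus 1.\<close>

hide_const (open) Module.smult

section \<open>Norms and polynomial families\<close>

text \<open>\<open>norm_det N e \<phi> B\<close> is the norm of \<open>B\<close> from the quotient ring modulo \<open>\<phi>\<close>, that is the product of \<open>B\<close> over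
  the roots of \<open>\<phi>\<close>. The powers of the leading coefficient of \<open>\<phi>\<close> clear the denominators, so that it
  is a polynomial in the coefficients of \<open>\<phi>\<close> and \<open>B\<close>.\<close>

primrec companion_power :: "nat \<Rightarrow> complex poly \<Rightarrow> nat \<Rightarrow> nat \<Rightarrow> nat \<Rightarrow> complex" where
  "companion_power N \<phi> 0 i j = (if i = j then 1 else 0)"
| "companion_power N \<phi> (Suc k) i j = (\<Sum>m<N. companion_power N \<phi> k i m *
      (if m + 1 < N then (if j = m + 1 then coeff \<phi> N else 0) else - coeff \<phi> j))"

text \<open>Every row of the cleared companion matrix except the last shifts z^m to z^(m+1) times
  the coefficient of degree \<open>N\<close>; the last row does the same because
  \<open>\<phi>\<close> vanishes at z. This holds also when that coefficient is 0.\<close>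

lemma companion_power_eigenvector:
  assumes "poly \<phi> z = 0" "degree \<phi> \<le> N" "i < N"
  shows "(\<Sum>j<N. companion_power N \<phi> k i j * z ^ j) = (coeff \<phi> N * z) ^ k * z ^ i"
  using assms(3)
proof (induction k arbitrary: i)
  case 0
  have "(\<Sum>j<N. companion_power N \<phi> 0 i j * z ^ j) = (\<Sum>j<N. if j = i then z ^ j else 0)"
    by (intro sum.cong) auto
  then show ?case using 0 by simp
next
  case (Suc k)
  let ?C = "\<lambda>m j. if m + 1 < N then (if j = m + 1 then coeff \<phi> N else 0) else - coeff \<phi> j"
  have C: "(\<Sum>j<N. ?C m j * z ^ j) = coeff \<phi> N * z * z ^ m" if m: "m < N" for m
  proof (cases "m + 1 < N")
    case True
    have "(\<Sum>j<N. ?C m j * z ^ j) = (\<Sum>j<N. if j = m + 1 then coeff \<phi> N * z ^ j else 0)"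
      using True by (intro sum.cong) auto
    also have "\<dots> = coeff \<phi> N * z ^ (m + 1)" using True by simp
    finally show ?thesis by simp
  next
    case False
    then have N: "N = Suc m" using m by simp
    have "poly \<phi> z = (\<Sum>j\<le>N. coeff \<phi> j * z ^ j)"
      unfolding poly_altdef by (rule sum.mono_neutral_left) (use assms(2) in \<open>auto simp: coeff_eq_0\<close>)
    also have "\<dots> = (\<Sum>j<N. coeff \<phi> j * z ^ j) + coeff \<phi> N * z ^ N"
      by (simp add: lessThan_Suc_atMost[symmetric])
    finally have "- (\<Sum>j<N. coeff \<phi> j * z ^ j) = coeff \<phi> N * z ^ N" using assms(1) by (simp add: neg_eq_iff_add_eq_0)
    then show ?thesis using False N by (simp add: sum_negf[symmetric] mult.assoc)
  qed
  have "(\<Sum>j<N. companion_power N \<phi> (Suc k) i j * z ^ j) =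
      (\<Sum>j<N. \<Sum>m<N. companion_power N \<phi> k i m * (?C m j * z ^ j))"
    by (simp add: sum_distrib_right mult.assoc)
  also have "\<dots> = (\<Sum>m<N. companion_power N \<phi> k i m * (\<Sum>j<N. ?C m j * z ^ j))"
    by (subst sum.swap) (simp add: sum_distrib_left)
  also have "\<dots> = (\<Sum>m<N. companion_power N \<phi> k i m * (coeff \<phi> N * z * z ^ m))"
    by (rule sum.cong[OF refl], subst C) auto
  also have "\<dots> = coeff \<phi> N * z * (\<Sum>m<N. companion_power N \<phi> k i m * z ^ m)"
    by (simp add: sum_distrib_left mult_ac)
  finally show ?case using Suc by (simp add: mult_ac)
qed

text \<open>With C the cleared companion matrix and a = \<open>coeff \<phi> N\<close>, this is a^e
  B(C / a), homogenised so that no division by a occurs.\<close>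

definition norm_matrix :: "nat \<Rightarrow> nat \<Rightarrow> complex poly \<Rightarrow> complex poly \<Rightarrow> nat \<Rightarrow> nat \<Rightarrow> complex" where
  "norm_matrix N e \<phi> B i j = (\<Sum>k\<le>e. coeff B k * coeff \<phi> N ^ (e - k) * companion_power N \<phi> k i j)"

definition norm_det :: "nat \<Rightarrow> nat \<Rightarrow> complex poly \<Rightarrow> complex poly \<Rightarrow> complex" where
  "norm_det N e \<phi> B = Determinant.det (Matrix.mat N N (\<lambda>(i, j). norm_matrix N e \<phi> B i j))"

lemma norm_matrix_eigenvector:
  assumes "poly \<phi> z = 0" "degree \<phi> \<le> N" "degree B \<le> e" "i < N"
  shows "(\<Sum>j<N. norm_matrix N e \<phi> B i j * z ^ j) = coeff \<phi> N ^ e * poly B z * z ^ i"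
proof -
  have "(\<Sum>j<N. norm_matrix N e \<phi> B i j * z ^ j) =
      (\<Sum>j<N. \<Sum>k\<le>e. coeff B k * coeff \<phi> N ^ (e - k) * (companion_power N \<phi> k i j * z ^ j))"
    by (simp add: norm_matrix_def sum_distrib_right mult.assoc)
  also have "\<dots> = (\<Sum>k\<le>e. coeff B k * coeff \<phi> N ^ (e - k) * (\<Sum>j<N. companion_power N \<phi> k i j * z ^ j))"
    by (subst sum.swap) (simp add: sum_distrib_left)
  also have "\<dots> = (\<Sum>k\<le>e. coeff B k * coeff \<phi> N ^ (e - k) * ((coeff \<phi> N * z) ^ k * z ^ i))"
    by (simp add: companion_power_eigenvector[OF assms(1,2,4)])
  also have "\<dots> = (\<Sum>k\<le>e. coeff \<phi> N ^ e * (coeff B k * z ^ k) * z ^ i)"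
  proof (intro sum.cong refl)
    fix k assume "k \<in> {..e}"
    then have "coeff \<phi> N ^ e = coeff \<phi> N ^ (e - k) * coeff \<phi> N ^ k" by (simp add: power_add[symmetric])
    then show "coeff B k * coeff \<phi> N ^ (e - k) * ((coeff \<phi> N * z) ^ k * z ^ i) =
       coeff \<phi> N ^ e * (coeff B k * z ^ k) * z ^ i"
      by (simp add: power_mult_distrib mult_ac)
  qed
  also have "\<dots> = coeff \<phi> N ^ e * (\<Sum>k\<le>e. coeff B k * z ^ k) * z ^ i"
    by (simp add: sum_distrib_left sum_distrib_right)
  also have "(\<Sum>k\<le>e. coeff B k * z ^ k) = poly B z"
    unfolding poly_altdef by (rule sum.mono_neutral_right) (use assms(3) in \<open>auto simp: coeff_eq_0\<close>)
  finally show ?thesis .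
qed

text \<open>A common root z makes the vector of the powers of z a kernel vector, and its entry of
  index 0 is 1. The degree of \<open>\<phi>\<close> may be smaller than \<open>N\<close>
  here.\<close>

lemma norm_det_nonzero_imp:
  assumes "norm_det N e \<phi> B \<noteq> 0" "poly \<phi> z = 0" "degree \<phi> \<le> N" "degree B \<le> e" "N > 0"
  shows "poly B z \<noteq> 0"
proof
  assume B: "poly B z = 0"
  let ?A = "Matrix.mat N N (\<lambda>(i, j). norm_matrix N e \<phi> B i j)"
  let ?v = "Matrix.vec N (\<lambda>j. z ^ j)"
  have "?A *\<^sub>v ?v = 0\<^sub>v N"
  proof (rule eq_vecI)
    fix i assume "i < dim_vec (0\<^sub>v N :: complex Matrix.vec)"
    then have i: "i < N" by simp
    then have "vec_index (?A *\<^sub>v ?v) i = (\<Sum>j<N. norm_matrix N e \<phi> B i j * z ^ j)"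
      by (simp add: scalar_prod_def atLeast0LessThan)
    then show "vec_index (?A *\<^sub>v ?v) i = vec_index (0\<^sub>v N) i"
      using norm_matrix_eigenvector[OF assms(2,3,4) i] B i by simp
  qed simp
  moreover have "?v \<noteq> 0\<^sub>v N"
  proof
    assume "?v = 0\<^sub>v N"
    then have "vec_index ?v 0 = vec_index (0\<^sub>v N :: complex Matrix.vec) 0" by simp
    then show False using assms(5) by simp
  qed
  moreover have "?v \<in> carrier_vec N" by simp
  ultimately have "Determinant.det ?A = 0"
    using det_0_iff_vec_prod_zero[of ?A N] mat_carrier by blast
  then show False using assms(1) by (simp add: norm_det_def)
qed

text \<open>With \<open>N\<close> distinct roots the eigenvectors form a Vandermonde matrix V such
  that A V = V D with D diagonal, and det V cancels.\<close>

lemma norm_det_prod: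
  assumes "degree \<phi> = N" "degree B \<le> e" "N > 0" "card {z. poly \<phi> z = 0} = N"
  shows "norm_det N e \<phi> B = (\<Prod>z | poly \<phi> z = 0. coeff \<phi> N ^ e * poly B z)"
proof -
  let ?R = "{z. poly \<phi> z = 0}"
  have fin: "finite ?R" using assms(3,4) by (metis card.infinite less_irrefl)
  obtain \<zeta> where \<zeta>: "bij_betw \<zeta> {0..<N} ?R" using ex_bij_betw_nat_finite[OF fin] assms(4) by auto
  have root: "poly \<phi> (\<zeta> k) = 0" if "k < N" for k using bij_betwE[OF \<zeta>] that by auto
  define \<mu> where "\<mu> k = coeff \<phi> N ^ e * poly B (\<zeta> k)" for k
  let ?A = "Matrix.mat N N (\<lambda>(i, j). norm_matrix N e \<phi> B i j)"
  let ?V = "Matrix.mat N N (\<lambda>(i, k). \<zeta> k ^ i)"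
  let ?D = "Matrix.mat N N (\<lambda>(i, k). if i = k then \<mu> k else 0)"
  have "?A * ?V = ?V * ?D"
  proof (rule eq_matI)
    fix i k assume "i < dim_row (?V * ?D)" "k < dim_col (?V * ?D)"
    then have ik: "i < N" "k < N" by auto
    have "(?A * ?V) $$ (i, k) = (\<Sum>j<N. norm_matrix N e \<phi> B i j * \<zeta> k ^ j)"
      using ik by (simp add: scalar_prod_def atLeast0LessThan)
    also have "\<dots> = \<mu> k * \<zeta> k ^ i"
      using norm_matrix_eigenvector[OF root[OF ik(2)] _ assms(2) ik(1)] assms(1) by (simp add: \<mu>_def)
    also have "\<dots> = (?V * ?D) $$ (i, k)"
      using ik by (simp add: scalar_prod_def if_distrib[of "(*) _"] sum.delta cong: if_cong)
    finally show "(?A * ?V) $$ (i, k) = (?V * ?D) $$ (i, k)" .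
  qed auto
  then have "Determinant.det ?A * Determinant.det ?V = Determinant.det ?V * Determinant.det ?D"
    by (subst (1 2) det_mult[symmetric, of _ N]) auto
  moreover have "Determinant.det ?D = prod_list (diag_mat ?D)"
    by (rule det_upper_triangular[of _ N]) (auto simp: upper_triangular_def)
  then have "Determinant.det ?D = (\<Prod>k<N. \<mu> k)"
    by (simp add: prod_list_diag_prod atLeast0LessThan)
  \<comment> \<open>A kernel vector of the transpose is the coefficient vector of a polynomial of
    degree below \<open>N\<close> that has \<open>N\<close> roots.\<close>
  moreover have "Determinant.det ?V \<noteq> 0"
  proof
    assume "Determinant.det ?V = 0"
    then have "Determinant.det (transpose_mat ?V) = 0" by (subst det_transpose[of _ N]) auto
    then obtain v where v: "v \<in> carrier_vec N" "v \<noteq> 0\<^sub>v N" "transpose_mat ?V *\<^sub>v v = 0\<^sub>v N"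
      using det_0_iff_vec_prod_zero[of "transpose_mat ?V" N] by auto
    define p where "p = (\<Sum>i<N. monom (vec_index v i) i)"
    have p0: "poly p (\<zeta> k) = 0" if k: "k < N" for k
    proof -
      have "vec_index (transpose_mat ?V *\<^sub>v v) k = (\<Sum>i<N. \<zeta> k ^ i * vec_index v i)"
        using k v(1) by (auto simp: scalar_prod_def atLeast0LessThan)
      then show ?thesis using v(3) k by (simp add: p_def poly_sum poly_monom mult.commute)
    qed
    have sub: "?R \<subseteq> {z. poly p z = 0}"
    proof
      fix x assume "x \<in> ?R"
      then have "x \<in> \<zeta> ` {0..<N}" using \<zeta> unfolding bij_betw_def by blast
      then obtain k where "k < N" "x = \<zeta> k" by auto
      then show "x \<in> {z. poly p z = 0}" using p0 by simp
    qed
    have cp: "coeff p i = (if i < N then vec_index v i else 0)" for i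
      by (auto simp: p_def coeff_sum)
    have "p = 0"
    proof (rule ccontr)
      assume p: "p \<noteq> 0"
      have "N \<le> card {z. poly p z = 0}"
        using card_mono[OF poly_roots_finite[OF p] sub] assms(4) by simp
      also have "\<dots> \<le> degree p" by (rule card_poly_roots_bound[OF p])
      also have "degree p < N" 
      proof -
        have "degree p \<le> N - 1" by (rule degree_le) (auto simp: cp)
        then show ?thesis using assms(3) by simp
      qed
      finally show False by simp
    qed
    then have "vec_index v i = 0" if "i < N" for i using cp[of i] that by simp
    then have "v = 0\<^sub>v N" using v(1) by (intro eq_vecI) auto
    then show False using v(2) by simp
  qed
  ultimately have "Determinant.det ?A = (\<Prod>k<N. \<mu> k)" by simp
  also have "\<dots> = (\<Prod>z | poly \<phi> z = 0. coeff \<phi> N ^ e * poly B z)"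
    unfolding \<mu>_def using prod.reindex_bij_betw[OF \<zeta>, of "\<lambda>z. coeff \<phi> N ^ e * poly B z"]
    by (simp add: atLeast0LessThan)
  finally show ?thesis by (simp add: norm_det_def)
qed

text \<open>The outer variable of a polynomial in two variables is \<open>y\<close>, the coefficients are polynomials in \<open>x\<close>.\<close>

definition eval2 :: "complex poly poly \<Rightarrow> complex \<Rightarrow> complex \<Rightarrow> complex" where
  "eval2 p x y = poly (poly p [:y:]) x"

lemma eval2_ring [simp]:
  "eval2 0 x y = 0" "eval2 1 x y = 1" "eval2 (p + q) x y = eval2 p x y + eval2 q x y"
  "eval2 (p - q) x y = eval2 p x y - eval2 q x y" "eval2 (- p) x y = - eval2 p x y"
  "eval2 (p * q) x y = eval2 p x y * eval2 q x y" "eval2 (p ^ n) x y = eval2 p x y ^ n"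
  "eval2 [:[:a:]:] x y = a" "eval2 [:[:0, 1:]:] x y = x" "eval2 [:0, 1:] x y = y"
  by (auto simp: eval2_def poly_power)

lemma eval2_sum [simp]: "eval2 (\<Sum>i\<in>I. p i) x y = (\<Sum>i\<in>I. eval2 (p i) x y)"
  by (induction I rule: infinite_finite_induct) auto

lemma eval2_prod [simp]: "eval2 (\<Prod>i\<in>I. p i) x y = (\<Prod>i\<in>I. eval2 (p i) x y)"
  by (induction I rule: infinite_finite_induct) auto

text \<open>The variable t is the outermost one: fixing it leaves a polynomial in x and y, and
  expanding in it gives coefficients in x and y. Both views are applied to the multiplier
  polynomial.\<close>

definition polyfun3 :: "(complex \<Rightarrow> complex \<Rightarrow> complex \<Rightarrow> complex) \<Rightarrow> bool" where
  "polyfun3 g \<longleftrightarrow> (\<exists>p :: complex poly poly poly. \<forall>x y t. g x y t = eval2 (poly p [:[:t:]:]) x y)"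

lemma polyfun3_const: "polyfun3 (\<lambda>x y t. a)"
  unfolding polyfun3_def by (rule exI[of _ "[:[:[:a:]:]:]"]) simp

lemma polyfun3_vars: "polyfun3 (\<lambda>x y t. x)" "polyfun3 (\<lambda>x y t. y)" "polyfun3 (\<lambda>x y t. t)"
proof -
  show "polyfun3 (\<lambda>x y t. x)" unfolding polyfun3_def by (rule exI[of _ "[:[:[:0, 1:]:]:]"]) simp
  show "polyfun3 (\<lambda>x y t. y)" unfolding polyfun3_def by (rule exI[of _ "[:[:0, 1:]:]"]) simp
  show "polyfun3 (\<lambda>x y t. t)" unfolding polyfun3_def by (rule exI[of _ "[:0, 1:]"]) simp
qed

lemma polyfun3_add: "polyfun3 f \<Longrightarrow> polyfun3 g \<Longrightarrow> polyfun3 (\<lambda>x y t. f x y t + g x y t)"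
  unfolding polyfun3_def by (elim exE, rule_tac x = "p + pa" in exI) simp

lemma polyfun3_mult: "polyfun3 f \<Longrightarrow> polyfun3 g \<Longrightarrow> polyfun3 (\<lambda>x y t. f x y t * g x y t)"
  unfolding polyfun3_def by (elim exE, rule_tac x = "p * pa" in exI) simp

lemma polyfun3_uminus: "polyfun3 f \<Longrightarrow> polyfun3 (\<lambda>x y t. - f x y t)"
  using polyfun3_mult[OF polyfun3_const[of "-1"], of f] by simp

lemma polyfun3_diff: "polyfun3 f \<Longrightarrow> polyfun3 g \<Longrightarrow> polyfun3 (\<lambda>x y t. f x y t - g x y t)"
  using polyfun3_add[OF _ polyfun3_uminus, of f g] by simp

lemma polyfun3_power: "polyfun3 f \<Longrightarrow> polyfun3 (\<lambda>x y t. f x y t ^ n)"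
  by (induction n) (auto intro: polyfun3_const polyfun3_mult)

lemma polyfun3_sum: "(\<And>i. i \<in> I \<Longrightarrow> polyfun3 (f i)) \<Longrightarrow> polyfun3 (\<lambda>x y t. \<Sum>i\<in>I. f i x y t)"
  by (induction I rule: infinite_finite_induct) (auto intro: polyfun3_const polyfun3_add)

lemma polyfun3_prod: "(\<And>i. i \<in> I \<Longrightarrow> polyfun3 (f i)) \<Longrightarrow> polyfun3 (\<lambda>x y t. \<Prod>i\<in>I. f i x y t)"
  by (induction I rule: infinite_finite_induct) (auto intro: polyfun3_const polyfun3_mult)

lemma polyfun3_coeffs:
  assumes "polyfun3 g"
  obtains q d where "\<And>x y t. g x y t = (\<Sum>j\<le>d. eval2 (q j) x y * t ^ j)"
proof -
  obtain p :: "complex poly poly poly" where p: "\<And>x y t. g x y t = eval2 (poly p [:[:t:]:]) x y"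
    using assms unfolding polyfun3_def by blast
  have "g x y t = (\<Sum>j\<le>degree p. eval2 (coeff p j) x y * t ^ j)" for x y t
    unfolding p by (subst poly_altdef) simp
  then show ?thesis using that by blast
qed

text \<open>The Leibniz expansion exhibits the determinant as a polynomial in the coefficients of
  both arguments.\<close>

lemma polyfun3_norm_det:
  assumes \<phi>: "\<And>i. polyfun3 (\<lambda>x y t. coeff (\<phi> x y) i)" and B: "\<And>i. polyfun3 (\<lambda>x y t. coeff (B x y t) i)"
  shows "polyfun3 (\<lambda>x y t. norm_det N e (\<phi> x y) (B x y t))"
proof -
  have cp: "polyfun3 (\<lambda>x y t. companion_power N (\<phi> x y) k i j)" for k i j
  proof (induction k arbitrary: i j)
    case (Suc k)
    have "polyfun3 (\<lambda>x y t. if m + 1 < N then (if j = m + 1 then coeff (\<phi> x y) N else 0) else - coeff (\<phi> x y) j)" for m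
      by (cases "m + 1 < N"; cases "j = m + 1") (auto intro: polyfun3_const \<phi> polyfun3_uminus)
    then show ?case unfolding companion_power.simps by (intro polyfun3_sum polyfun3_mult Suc)
  qed (simp add: polyfun3_const)
  have nm: "polyfun3 (\<lambda>x y t. norm_matrix N e (\<phi> x y) (B x y t) i j)" for i j
    unfolding norm_matrix_def by (intro polyfun3_sum polyfun3_mult polyfun3_power cp \<phi> B)
  have "norm_det N e (\<phi> x y) (B x y t) = (\<Sum>p\<in>{p. p permutes {0..<N}}. signof p *
     (\<Prod>i = 0..<N. norm_matrix N e (\<phi> x y) (B x y t) i (p i)))" for x y t
    unfolding norm_det_def by (subst det_def'[of _ N]) (auto intro!: sum.cong prod.cong simp: permutes_def)
  then show ?thesis by (auto intro!: polyfun3_sum polyfun3_mult polyfun3_prod nm polyfun3_const)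
qed

section \<open>Meromorphic germs and Puiseux expansions\<close>

text \<open>k is the order and A the leading coefficient of the Laurent series. A limit statement
  composes directly with sequences and with powers of t.\<close>

lemma meromorphic_at_0_cases:
  assumes "f meromorphic_on {0}"
  obtains "eventually (\<lambda>t. f t = 0) (at 0)"
  | k A where "A \<noteq> 0" "((\<lambda>t. f t * t powi (-k)) \<longlongrightarrow> A) (at (0::complex))"
proof -
  obtain F where F: "f has_laurent_expansion F"
    using assms unfolding meromorphic_on_def by auto
  show ?thesis
  proof (cases "F = 0")
    case True
    then have "eventually (\<lambda>t. f t = 0) (at 0)"
      using F by (auto simp: has_laurent_expansion_def)
    then show ?thesis by (rule that(1))
  next
    case False
    define n where "n = fls_subdegree F"
    define A where "A = fls_nth F n"
    have A: "A \<noteq> 0" using False by (simp add: A_def n_def)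
    have "f \<sim>[at 0] (\<lambda>z. A * z powi n)"
      using has_laurent_expansion_imp_asymp_equiv_0[OF F] by (simp add: A_def n_def)
    then have "(\<lambda>z. f z * z powi (-n)) \<sim>[at 0] (\<lambda>z. (A * z powi n) * z powi (-n))"
      by (intro asymp_equiv_intros)
    also have "(\<lambda>z. (A * z powi n) * z powi (-n)) \<sim>[at 0] (\<lambda>z. A)"
      by (rule asymp_equiv_refl_ev)
         (auto simp: eventually_at_filter power_int_minus)
    finally have "((\<lambda>z. f z * z powi (-n)) \<longlongrightarrow> A) (at 0)"
      by (rule asymp_equivD_const)
    then show ?thesis using A that(2) by blast
  qed
qed

lemma meromorphic_at_0_compose_power:
  assumes "f meromorphic_on {0}" "M \<ge> 1"
  shows "(\<lambda>t. f (t ^ M)) meromorphic_on {0}"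
  by (rule meromorphic_on_compose[OF assms(1)])
     (use assms(2) in \<open>auto intro!: analytic_intros\<close>)

lemma meromorphic_at_0_extension:
  assumes "f meromorphic_on {0}" "(f \<longlongrightarrow> c) (at (0::complex))"
  obtains g r where "r > 0" "g holomorphic_on ball 0 r" "g 0 = c"
    "\<And>t. t \<in> ball 0 r \<Longrightarrow> t \<noteq> 0 \<Longrightarrow> g t = f t"
proof -
  have "isolated_singularity_at f 0"
    using assms(1) by (simp add: meromorphic_at_iff)
  then have "(\<lambda>y. if y = 0 then c else f y) analytic_on {0}"
    using assms(2) by (rule removable_singularity')
  then obtain r where "r > 0" "(\<lambda>y. if y = 0 then c else f y) holomorphic_on ball 0 r"
    by (auto simp: analytic_on_def)
  then show ?thesis by (intro that[of r "\<lambda>y. if y = 0 then c else f y"]) auto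
qed

lemma filterlim_power_at_0:
  assumes "M \<ge> 1"
  shows "filterlim (\<lambda>t::complex. t ^ M) (at 0) (at 0)"
proof -
  have "((\<lambda>t::complex. t ^ M) \<longlongrightarrow> 0 ^ M) (at 0)" by (intro tendsto_intros)
  then have "((\<lambda>t::complex. t ^ M) \<longlongrightarrow> 0) (at 0)" using assms by (simp add: zero_power)
  moreover have "eventually (\<lambda>t::complex. t ^ M \<noteq> 0) (at 0)"
    using eventually_neq_at_within[of 0 0] by (rule eventually_mono) simp
  ultimately show ?thesis by (simp add: filterlim_at)
qed

lemma eventually_at_0_compose_power:
  assumes "eventually P (at (0::complex))" "M \<ge> 1"
  shows "eventually (\<lambda>t. P (t ^ M)) (at 0)"
  using assms(1) filterlim_power_at_0[OF assms(2)] by (rule eventually_compose_filterlim)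

section \<open>Polynomials whose coefficients are meromorphic germs\<close>

definition mero_poly :: "(complex \<Rightarrow> complex poly) \<Rightarrow> bool" where
  "mero_poly W \<longleftrightarrow> (\<forall>i. (\<lambda>t. coeff (W t) i) meromorphic_on {0})"

lemma mero_poly_const: "mero_poly (\<lambda>_. p)"
  by (simp add: mero_poly_def meromorphic_on_const)

lemma mero_poly_mult: "mero_poly U \<Longrightarrow> mero_poly V \<Longrightarrow> mero_poly (\<lambda>t. U t * V t)"
  by (auto simp: mero_poly_def coeff_mult intro!: meromorphic_intros)

lemma mero_poly_smult: "a meromorphic_on {0} \<Longrightarrow> mero_poly V \<Longrightarrow> mero_poly (\<lambda>t. smult (a t) (V t))"
  by (auto simp: mero_poly_def intro!: meromorphic_intros)

lemma mero_poly_sum: "(\<And>i. i \<in> I \<Longrightarrow> mero_poly (U i)) \<Longrightarrow> mero_poly (\<lambda>t. \<Sum>i\<in>I. U i t)"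
  by (auto simp: mero_poly_def coeff_sum intro!: meromorphic_intros)

lemma mero_poly_power: "mero_poly U \<Longrightarrow> mero_poly (\<lambda>t. U t ^ n)"
  by (induction n) (auto intro: mero_poly_mult mero_poly_const[of 1])

lemma mero_poly_pCons: "a meromorphic_on {0} \<Longrightarrow> mero_poly U \<Longrightarrow> mero_poly (\<lambda>t. pCons (a t) (U t))"
  unfolding mero_poly_def
proof (intro allI)
  fix i assume *: "a meromorphic_on {0}" "\<forall>i. (\<lambda>t. coeff (U t) i) meromorphic_on {0}"
  show "(\<lambda>t. coeff (pCons (a t) (U t)) i) meromorphic_on {0}"
    using * by (cases i) auto
qed

lemma mero_poly_compose_power: "mero_poly U \<Longrightarrow> M \<ge> 1 \<Longrightarrow> mero_poly (\<lambda>t. U (t ^ M))"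
  by (auto simp: mero_poly_def intro: meromorphic_at_0_compose_power)

text \<open>Lagrange interpolation with nodes that do not move: holomorphic values of a polynomial
  family at finitely many fixed points yield holomorphic coefficients.\<close>

lemma coeff_by_interpolation:
  fixes y :: "nat \<Rightarrow> complex"
  assumes "inj_on y {..k}"
  obtains L where "\<And>p i. degree p \<le> k \<Longrightarrow> coeff p i = (\<Sum>j\<le>k. L j i * poly p (y j))"
proof -
  define l where "l j = smult (inverse (\<Prod>m\<in>{..k}-{j}. y j - y m)) (\<Prod>m\<in>{..k}-{j}. [:- y m, 1:])" for j
  have l1: "poly (l j) (y i) = (if i = j then 1 else 0)" if "j \<le> k" "i \<le> k" for i j
  proof (cases "i = j")
    case True
    have "(\<Prod>m\<in>{..k}-{j}. y j - y m) \<noteq> 0"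
      using assms that by (auto simp: inj_on_def)
    then show ?thesis using True by (simp add: l_def poly_prod)
  next
    case False
    then have "(\<Prod>m\<in>{..k}-{j}. y i - y m) = 0" using that by auto
    then show ?thesis using False by (simp add: l_def poly_prod)
  qed
  have deg: "degree (l j) \<le> k" if "j \<le> k" for j
  proof -
    have "degree (l j) \<le> degree (\<Prod>m\<in>{..k}-{j}. [:- y m, 1:])" by (simp add: l_def)
    also have "\<dots> \<le> (\<Sum>m\<in>{..k}-{j}. degree [:- y m, 1:])" using degree_prod_sum_le[of "{..k}-{j}" "\<lambda>m. [:- y m, 1:]"] by simp
    also have "\<dots> = k" using that by simp
    finally show ?thesis .
  qed
  have main: "p = (\<Sum>j\<le>k. smult (poly p (y j)) (l j))" if "degree p \<le> k" for p
  proof (rule poly_eqI_degree[where A = "y ` {..k}"])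
    fix x assume "x \<in> y ` {..k}"
    then obtain i where i: "i \<le> k" "x = y i" by auto
    have "poly (\<Sum>j\<le>k. smult (poly p (y j)) (l j)) x = (\<Sum>j\<le>k. poly p (y j) * (if i = j then 1 else 0))"
      using i by (simp add: poly_sum l1)
    also have "\<dots> = poly p x" using i by (simp add: if_distrib[of "(*) _"] sum.delta cong: if_cong)
    finally show "poly p x = poly (\<Sum>j\<le>k. smult (poly p (y j)) (l j)) x" by simp
  next
    have c: "card (y ` {..k}) = Suc k" using assms by (simp add: card_image)
    then show "card (y ` {..k}) > degree p" using that by simp
    have "degree (\<Sum>j\<le>k. smult (poly p (y j)) (l j)) \<le> k"
      by (intro degree_sum_le) (auto intro: order_trans[OF degree_smult_le] deg)
    then show "card (y ` {..k}) > degree (\<Sum>j\<le>k. smult (poly p (y j)) (l j))" using c by simp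
  qed
  show ?thesis
  proof (rule that[of "\<lambda>j i. coeff (l j) i"])
    fix p :: "complex poly" and i assume "degree p \<le> k"
    then have "coeff p i = coeff (\<Sum>j\<le>k. smult (poly p (y j)) (l j)) i" using main[of p] by simp
    then show "coeff p i = (\<Sum>j\<le>k. coeff (l j) i * poly p (y j))" by (simp add: coeff_sum mult.commute)
  qed
qed

lemma pderiv_sum0: "pderiv (\<Sum>i\<in>A. f i) = (\<Sum>i\<in>A. pderiv (f i :: complex poly))"
  by (induction A rule: infinite_finite_induct) (auto simp: pderiv_add)


section \<open>Root sums as contour integrals, and the splitting of a polynomial family\<close>

lemma poly_monic_proots:
  fixes p :: "complex poly"
  assumes "lead_coeff p = 1"
  shows "p = (\<Prod>x\<in>#proots p. [:-x, 1:])"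
  using complex_poly_decompose_multiset[of p] unfolding assms smult_1_left by (rule sym)

lemma poly_linear_prod_mset:
  "poly (\<Prod>x\<in>#X. [:-x, 1:]) (z::complex) = (\<Prod>x\<in>#X. z - x)"
  by (induction X) (auto simp: algebra_simps)

lemma lead_coeff_linear_prod_mset:
  "lead_coeff (\<Prod>x\<in>#X. [:-x, 1::complex:]) = 1"
  by (induction X) (auto simp: lead_coeff_mult simp del: mult_pCons_left)

lemma degree_linear_prod_mset:
  "degree (\<Prod>x\<in>#X. [:-x, 1::complex:]) = size X"
proof (induction X)
  case (add x X)
  have "(\<Prod>x\<in>#X. [:-x, 1::complex:]) \<noteq> 0" using lead_coeff_linear_prod_mset[of X] by auto
  then show ?case using add by (simp add: degree_mult_eq del: mult_pCons_left)
qed simp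

lemma pderiv_linear_prod_mset:
  assumes "\<And>x. x \<in># X \<Longrightarrow> z \<noteq> x"
  shows "poly (pderiv (\<Prod>x\<in>#X. [:-x, 1:])) z / poly (\<Prod>x\<in>#X. [:-x, 1:]) z
       = (\<Sum>x\<in>#X. 1 / (z - x :: complex))"
  using assms
proof (induction X)
  case (add x X)
  let ?P = "\<Prod>x\<in>#X. [:-x, 1:]"
  have 1: "poly ?P z \<noteq> 0" using add.prems by (auto simp: poly_linear_prod_mset)
  have 2: "z - x \<noteq> 0" using add.prems by auto
  have IH: "poly (pderiv ?P) z / poly ?P z = (\<Sum>x\<in>#X. 1 / (z - x))"
    using add by auto
  have e: "(\<Prod>x\<in>#add_mset x X. [:-x, 1:]) = [:-x, 1:] * ?P" by (simp del: mult_pCons_left)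
  have "poly (pderiv ([:-x, 1:] * ?P)) z = (z - x) * poly (pderiv ?P) z + poly ?P z"
    unfolding pderiv_mult poly_add poly_mult by (simp add: pderiv_pCons)
  moreover have "poly ([:-x, 1:] * ?P) z = (z - x) * poly ?P z"
    unfolding poly_mult by simp
  moreover have "(u * p' + p) / (u * p) = 1 / u + p' / p" if "u \<noteq> 0" "p \<noteq> 0" for u p p' :: complex
    using that by (simp add: field_simps)
  ultimately show ?case unfolding e using 1 2 IH by simp
qed simp

text \<open>One pole at a time: Cauchy's formula if x lies inside the circle, Cauchy's theorem if it
  lies outside. \<open>H\<close> = 1 counts the roots inside; a logarithm as \<open>H\<close> gives
  the values of the factor that they form.\<close>

lemma contour_integral_circle_log_deriv:
  assumes "\<delta> > 0" "H holomorphic_on S" "open S" "cball \<xi> \<delta> \<subseteq> S"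
    and "\<And>x. x \<in># X \<Longrightarrow> dist \<xi> x \<noteq> \<delta>"
  shows "((\<lambda>z. H z * (\<Sum>x\<in>#X. 1 / (z - x))) has_contour_integral
           2 * of_real pi * \<i> * (\<Sum>x\<in>#filter_mset (\<lambda>x. x \<in> ball \<xi> \<delta>) X. H x)) (circlepath \<xi> \<delta>)"
  using assms(5)
proof (induction X)
  case empty
  then show ?case by (simp add: has_contour_integral_0)
next
  case (add x X)
  have IH: "((\<lambda>z. H z * (\<Sum>x\<in>#X. 1 / (z - x))) has_contour_integral
           2 * of_real pi * \<i> * (\<Sum>x\<in>#filter_mset (\<lambda>x. x \<in> ball \<xi> \<delta>) X. H x)) (circlepath \<xi> \<delta>)"
    using add by auto
  have hol: "H holomorphic_on cball \<xi> \<delta>" using assms(2,4) holomorphic_on_subset by blast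
  have one: "((\<lambda>z. H z / (z - x)) has_contour_integral
          2 * of_real pi * \<i> * (if x \<in> ball \<xi> \<delta> then H x else 0)) (circlepath \<xi> \<delta>)"
  proof (cases "x \<in> ball \<xi> \<delta>")
    case True
    have "((\<lambda>z. H z / (z - x)) has_contour_integral 2 * of_real pi * \<i> * H x) (circlepath \<xi> \<delta>)"
      using True hol
      by (intro Cauchy_integral_circlepath_simple) (auto simp: dist_norm norm_minus_commute)
    then show ?thesis using True by simp
  next
    case False
    then have d: "dist \<xi> x > \<delta>" using add.prems[of x] by auto
    define \<delta>' where "\<delta>' = dist \<xi> x"
    \<comment> \<open>Cauchy's theorem for a disc needs an open disc around the closed one, so the
      closed disc is enlarged within \<open>S\<close>; \<open>e'\<close> below also keeps x
      outside.\<close>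
    have "\<exists>e>\<delta>. ball \<xi> e \<subseteq> S"
    proof -
      have "compact (cball \<xi> \<delta>)" by simp
      then obtain e where e: "e > 0" "(\<Union>y\<in>cball \<xi> \<delta>. ball y e) \<subseteq> S"
        using compact_subset_open_imp_ball_epsilon_subset[of "cball \<xi> \<delta>" S] assms(3,4) by blast
      have "ball \<xi> (\<delta> + e) \<subseteq> (\<Union>y\<in>cball \<xi> \<delta>. ball y e)"
      proof
        fix u assume u: "u \<in> ball \<xi> (\<delta> + e)"
        show "u \<in> (\<Union>y\<in>cball \<xi> \<delta>. ball y e)"
        proof (cases "u \<in> cball \<xi> \<delta>")
          case True
          then show ?thesis using e(1) by force
        next
          case False
          define v where "v = \<xi> + of_real (\<delta> / norm (u - \<xi>)) * (u - \<xi>)"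
          have nz: "norm (u - \<xi>) > \<delta>" using False by (simp add: dist_norm norm_minus_commute)
          have n0: "norm (u - \<xi>) > 0" using nz assms(1) by linarith
          have v1: "v \<in> cball \<xi> \<delta>" using n0 assms(1) by (simp add: v_def dist_norm norm_mult norm_divide)
          have "u - v = of_real (1 - \<delta> / norm (u - \<xi>)) * (u - \<xi>)"
            by (simp add: v_def algebra_simps)
          then have "norm (u - v) = \<bar>1 - \<delta> / norm (u - \<xi>)\<bar> * norm (u - \<xi>)"
            by (metis norm_mult norm_of_real)
          also have "\<dots> = norm (u - \<xi>) - \<delta>" using nz n0 by (simp add: abs_if field_simps)
          also have "\<dots> < e" using u by (simp add: dist_norm norm_minus_commute)
          finally show ?thesis using v1 by (auto simp: dist_norm norm_minus_commute)
        qed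
      qed
      then show ?thesis using e by (intro exI[of _ "\<delta> + e"]) auto
    qed
    then obtain e where e: "e > \<delta>" "ball \<xi> e \<subseteq> S" by blast
    define e' where "e' = min e \<delta>'"
    have "(\<lambda>z. H z / (z - x)) holomorphic_on ball \<xi> e'"
    proof (intro holomorphic_intros)
      show "H holomorphic_on ball \<xi> e'" using assms(2) e by (rule_tac holomorphic_on_subset[of _ S]) (auto simp: e'_def)
      show "\<And>z. z \<in> ball \<xi> e' \<Longrightarrow> z - x \<noteq> 0" by (auto simp: e'_def \<delta>'_def)
    qed
    then have "((\<lambda>z. H z / (z - x)) has_contour_integral 0) (circlepath \<xi> \<delta>)"
      by (rule Cauchy_theorem_disc_simple)
         (use assms(1) d e in \<open>auto simp: e'_def \<delta>'_def path_image_circlepath sphere_def\<close>)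
    then show ?thesis using False by simp
  qed
  have "((\<lambda>z. H z / (z - x) + H z * (\<Sum>x\<in>#X. 1 / (z - x))) has_contour_integral
     2 * of_real pi * \<i> * (if x \<in> ball \<xi> \<delta> then H x else 0) +
     2 * of_real pi * \<i> * (\<Sum>x\<in>#filter_mset (\<lambda>x. x \<in> ball \<xi> \<delta>) X. H x)) (circlepath \<xi> \<delta>)"
    by (rule has_contour_integral_add[OF one IH])
  then show ?case by (simp add: algebra_simps split: if_splits)
qed

text \<open>Differentiation under the integral sign; the denominators do not vanish because no root
  lies on the circle.\<close>

lemma holomorphic_circle_integral_param:
  fixes g :: "nat \<Rightarrow> complex \<Rightarrow> complex" and V :: "complex \<Rightarrow> complex poly"
  assumes "\<And>i. i \<le> d \<Longrightarrow> g i holomorphic_on ball 0 r"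
    and V: "\<And>t. V t = (\<Sum>i\<le>d. monom (g i t) i)"
    and nz: "\<And>t z. t \<in> ball 0 r \<Longrightarrow> z \<in> sphere \<xi> \<delta> \<Longrightarrow> poly (V t) z \<noteq> 0"
    and H: "continuous_on (sphere \<xi> \<delta>) H" and "\<delta> > 0"
  shows "(\<lambda>t. contour_integral (circlepath \<xi> \<delta>) (\<lambda>z. H z * (poly (pderiv (V t)) z / poly (V t) z)))
           holomorphic_on ball 0 r"
proof -
  define D where "D t z = (\<Sum>i\<le>d. g i t * z ^ i)" for t z
  define E where "E t z = (\<Sum>i\<le>d. g i t * (of_nat i * z ^ (i - 1)))" for t z
  define D' where "D' t z = (\<Sum>i\<le>d. deriv (g i) t * z ^ i)" for t z
  define E' where "E' t z = (\<Sum>i\<le>d. deriv (g i) t * (of_nat i * z ^ (i - 1)))" for t z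
  have pD: "poly (V t) z = D t z" for t z by (simp add: V D_def poly_sum poly_monom)
  have pE: "poly (pderiv (V t)) z = E t z" for t z
    by (simp add: V E_def pderiv_sum0 pderiv_monom poly_sum poly_monom algebra_simps)
  define \<gamma> where "\<gamma> = circlepath \<xi> \<delta>"
  define \<gamma>' where "\<gamma>' s = 2 * of_real pi * \<i> * of_real \<delta> * exp (2 * of_real pi * \<i> * of_real s)" for s :: real
  have sph: "\<gamma> s \<in> sphere \<xi> \<delta>" for s
    using \<open>\<delta> > 0\<close> by (simp add: \<gamma>_def circlepath dist_norm norm_mult)
  have c\<gamma>: "continuous_on A \<gamma>" for A
    unfolding \<gamma>_def circlepath by (intro continuous_intros)
  have c\<gamma>': "continuous_on A \<gamma>'" for A
    unfolding \<gamma>'_def by (intro continuous_intros)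
  have cH: "continuous_on A (\<lambda>s. H (\<gamma> s))" for A
    by (rule continuous_on_compose2[OF H c\<gamma>]) (use sph in auto)
  have cg: "continuous_on (ball 0 r) (g i)" "continuous_on (ball 0 r) (deriv (g i))" if "i \<le> d" for i
    using assms(1)[OF that] by (auto intro: holomorphic_on_imp_continuous_on holomorphic_deriv)
  have cgf: "continuous_on (ball 0 r \<times> A) (\<lambda>x. g i (fst x))"
            "continuous_on (ball 0 r \<times> A) (\<lambda>x. deriv (g i) (fst x))" if "i \<le> d" for i and A :: "real set"
    by (rule continuous_on_compose2[OF cg(1)[OF that]]; auto intro: continuous_intros)
       (rule continuous_on_compose2[OF cg(2)[OF that]]; auto intro: continuous_intros)
  have c\<gamma>s: "continuous_on (B \<times> A) (\<lambda>x. \<gamma> (snd x))" "continuous_on (B \<times> A) (\<lambda>x. \<gamma>' (snd x))"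
     "continuous_on (B \<times> A) (\<lambda>x. H (\<gamma> (snd x)))" for A and B :: "complex set"
    using continuous_on_compose2[OF c\<gamma>[of UNIV], of "B \<times> A" snd]
      continuous_on_compose2[OF c\<gamma>'[of UNIV], of "B \<times> A" snd]
      continuous_on_compose2[OF cH[of UNIV], of "B \<times> A" snd]
    by (simp_all add: continuous_on_snd)
  have dg: "(g i has_field_derivative deriv (g i) t) (at t within ball 0 r)" if "i \<le> d" "t \<in> ball 0 r" for i t
    using assms(1)[OF that(1)] that(2) holomorphic_derivI[of "g i" "ball 0 r" t] by auto
  have eq: "contour_integral (circlepath \<xi> \<delta>) (\<lambda>z. H z * (poly (pderiv (V t)) z / poly (V t) z)) =
      integral (cbox 0 1) (\<lambda>s. H (\<gamma> s) * (E t (\<gamma> s) / D t (\<gamma> s)) * \<gamma>' s)" for t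
    unfolding contour_integral_integral pD pE \<gamma>_def \<gamma>'_def vector_derivative_circlepath cbox_interval
    by (rule integral_cong) (simp add: vector_derivative_circlepath)
  have "(\<lambda>t. integral (cbox 0 1) (\<lambda>s. H (\<gamma> s) * (E t (\<gamma> s) / D t (\<gamma> s)) * \<gamma>' s)) holomorphic_on ball 0 r"
  proof (rule leibniz_rule_holomorphic)
    fix t :: complex and s :: real assume t: "t \<in> ball 0 r"
    have nzt: "D t (\<gamma> s) \<noteq> 0" using nz[OF t sph] pD by simp
    show "((\<lambda>t. H (\<gamma> s) * (E t (\<gamma> s) / D t (\<gamma> s)) * \<gamma>' s) has_field_derivative
       H (\<gamma> s) * ((E' t (\<gamma> s) * D t (\<gamma> s) - E t (\<gamma> s) * D' t (\<gamma> s)) / (D t (\<gamma> s) * D t (\<gamma> s))) * \<gamma>' s) (at t within ball 0 r)"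
    proof (intro DERIV_cmult DERIV_cmult_right DERIV_divide nzt)
      show "((\<lambda>t. E t (\<gamma> s)) has_field_derivative E' t (\<gamma> s)) (at t within ball 0 r)"
        unfolding E_def E'_def by (intro DERIV_sum DERIV_cmult_right dg t) auto
      show "((\<lambda>t. D t (\<gamma> s)) has_field_derivative D' t (\<gamma> s)) (at t within ball 0 r)"
        unfolding D_def D'_def by (intro DERIV_sum DERIV_cmult_right dg t) auto
    qed
  next
    fix t :: complex assume t: "t \<in> ball 0 r"
    have nzt: "D t (\<gamma> s) \<noteq> 0" for s using nz[OF t sph] pD by simp
    show "(\<lambda>s. H (\<gamma> s) * (E t (\<gamma> s) / D t (\<gamma> s)) * \<gamma>' s) integrable_on cbox 0 1"
      unfolding E_def D_def
      by (intro integrable_continuous continuous_intros c\<gamma> c\<gamma>' cH) (use nzt in \<open>simp add: D_def\<close>)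
  next
    show "continuous_on (ball 0 r \<times> cbox 0 1) (\<lambda>(t, s). H (\<gamma> s) *
      ((E' t (\<gamma> s) * D t (\<gamma> s) - E t (\<gamma> s) * D' t (\<gamma> s)) / (D t (\<gamma> s) * D t (\<gamma> s))) * \<gamma>' s)"
      unfolding E_def D_def E'_def D'_def case_prod_unfold
      by (intro continuous_intros c\<gamma>s cgf) (use nz[OF _ sph] pD in \<open>auto simp: D_def\<close>)
  qed simp
  then show ?thesis unfolding eq .
qed

lemma exists_isolated_root_disc:
  fixes p :: "complex poly"
  assumes "p \<noteq> 0"
  obtains \<delta> where "\<delta> > 0" "\<And>z. poly p z = 0 \<Longrightarrow> z \<noteq> a \<Longrightarrow> dist a z > \<delta>"
proof -
  have fin: "finite {z. poly p z = 0}" using assms by (rule poly_roots_finite)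
  then obtain d where d: "d > 0" "\<forall>z\<in>{z. poly p z = 0}. z \<noteq> a \<longrightarrow> d \<le> dist a z"
    using finite_set_avoid[OF fin, of a] by blast
  show ?thesis
  proof (rule that[of "d/2"])
    show "d / 2 > 0" using d by simp
    fix z assume "poly p z = 0" "z \<noteq> a"
    then have "d \<le> dist a z" using d by blast
    then show "dist a z > d / 2" using d(1) by linarith
  qed
qed

lemma distinct_points_outside_disc:
  fixes \<xi> :: complex
  assumes "R > 0"
  defines "y \<equiv> \<lambda>j::nat. \<xi> + of_real (R * (of_nat j + 1))"
  shows "inj_on y A" "dist \<xi> (y j) \<ge> R"
proof -
  show "inj_on y A" using assms by (auto simp: inj_on_def y_def)
  have "dist \<xi> (y j) = R * (of_nat j + 1)"
    using assms(1) unfolding y_def dist_norm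
    by (simp add: abs_mult del: of_real_mult of_real_add)
  also have "\<dots> \<ge> R" using assms(1) by (simp add: algebra_simps)
  finally show "dist \<xi> (y j) \<ge> R" .
qed

lemma exp_sum_mset_image: "exp (\<Sum>x\<in>#M. f x :: complex) = (\<Prod>x\<in>#M. exp (f x))"
  by (induction M) (auto simp: exp_add)

text \<open>The roots near \<xi> stay inside a fixed circle that no root crosses for small t;
  \<open>A\<close> is the product over the roots inside and \<open>B\<close> over the roots outside.
  The single roots need not be holomorphic in t, but contour integrals show that the values of
  \<open>A\<close> are.\<close>

lemma hensel_splitting:
  fixes U :: "complex \<Rightarrow> complex poly" and U0 :: "complex poly"
  assumes mero: "mero_poly U"
    and deg: "eventually (\<lambda>t. degree (U t) = d \<and> lead_coeff (U t) = 1) (at 0)"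
    and U0: "degree U0 = d" "lead_coeff U0 = 1"
    and lim: "\<And>i. ((\<lambda>t. coeff (U t) i) \<longlongrightarrow> coeff U0 i) (at 0)"
    and k: "k = order \<xi> U0"
  shows "\<exists>A B. mero_poly A \<and> mero_poly B \<and> eventually (\<lambda>t. U t = A t * B t \<and>
      degree (A t) = k \<and> lead_coeff (A t) = 1 \<and> degree (B t) = d - k \<and> lead_coeff (B t) = 1) (at 0)"
proof -
  have U0nz: "U0 \<noteq> 0" using U0 by auto
  obtain \<delta> where \<delta>: "\<delta> > 0" "\<And>z. poly U0 z = 0 \<Longrightarrow> z \<noteq> \<xi> \<Longrightarrow> dist \<xi> z > \<delta>"
    using exists_isolated_root_disc[OF U0nz] by blast
  \<comment> \<open>The coefficients have finite limits, so their singularities at t = 0 are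
    removable.\<close>
  have "\<exists>g r. r > 0 \<and> g holomorphic_on ball 0 r \<and> g 0 = coeff U0 i \<and>
       (\<forall>t. t \<in> ball 0 r \<longrightarrow> t \<noteq> 0 \<longrightarrow> g t = coeff (U t) i)" for i
    using meromorphic_at_0_extension[of "\<lambda>t. coeff (U t) i" "coeff U0 i"] mero lim[of i]
    unfolding mero_poly_def by metis
  then obtain g r where gr: "\<And>i. r i > 0" "\<And>i. g i holomorphic_on ball 0 (r i)" "\<And>i. g i 0 = coeff U0 i"
     "\<And>i t. t \<in> ball 0 (r i) \<Longrightarrow> t \<noteq> 0 \<Longrightarrow> g i t = coeff (U t) i"
    by metis
  obtain r0 where r0: "r0 > 0" "\<And>t. t \<noteq> 0 \<Longrightarrow> dist t 0 < r0 \<Longrightarrow> degree (U t) = d \<and> lead_coeff (U t) = 1"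
    using deg unfolding eventually_at by blast
  define r1 where "r1 = Min (insert r0 (r ` {..d}))"
  have r1: "r1 > 0" "r1 \<le> r0" "\<And>i. i \<le> d \<Longrightarrow> r1 \<le> r i"
    unfolding r1_def using gr(1) r0(1) by (auto intro: min.coboundedI2)
  define V where "V t = (\<Sum>i\<le>d. monom (g i t) i)" for t
  have cV: "coeff (V t) i = (if i \<le> d then g i t else 0)" for t i
    by (auto simp: V_def coeff_sum)
  have VU: "V t = U t" if "t \<in> ball 0 r1" "t \<noteq> 0" for t
  proof (rule poly_eqI)
    fix i
    have du: "degree (U t) = d" using r0(2)[of t] r1(2) that by (auto simp: dist_commute)
    show "coeff (V t) i = coeff (U t) i"
    proof (cases "i \<le> d")
      case True
      then have "g i t = coeff (U t) i" using gr(4)[of t i] r1(3)[of i] that by auto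
      then show ?thesis using True cV by simp
    next
      case False
      then show ?thesis using du cV by (simp add: coeff_eq_0)
    qed
  qed
  have V0: "V 0 = U0"
    by (rule poly_eqI) (use gr(3) U0(1) in \<open>auto simp: cV coeff_eq_0\<close>)
  have Vlc: "degree (V t) = d \<and> lead_coeff (V t) = 1" if "t \<in> ball 0 r1" for t
  proof (cases "t = 0")
    case True then show ?thesis using V0 U0 by simp
  next
    case False then show ?thesis using VU[OF that False] r0(2)[of t] r1(2) that by (auto simp: dist_commute)
  qed
  have ghol: "g i holomorphic_on ball 0 r1" if "i \<le> d" for i
    using gr(2)[of i] r1(3)[OF that] by (meson holomorphic_on_subset subset_ball)
  have nzev: "\<exists>r2>0. r2 \<le> r1 \<and> (\<forall>t\<in>ball 0 r2. \<forall>z\<in>sphere \<xi> \<delta>. poly (V t) z \<noteq> 0)"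
  proof -
    have comp: "compact (sphere \<xi> \<delta>)" by simp
    have ne: "sphere \<xi> \<delta> \<noteq> {}" using \<delta>(1) by simp
    have "continuous_on (sphere \<xi> \<delta>) (\<lambda>z. norm (poly U0 z))" by (intro continuous_intros)
    then obtain z0 where z0: "z0 \<in> sphere \<xi> \<delta>" "\<And>z. z \<in> sphere \<xi> \<delta> \<Longrightarrow> norm (poly U0 z0) \<le> norm (poly U0 z)"
      using continuous_attains_inf[OF comp ne] by blast
    define \<mu> where "\<mu> = norm (poly U0 z0)"
    have \<mu>: "\<mu> > 0" using z0(1) \<delta> unfolding \<mu>_def
      by (metis dist_self less_irrefl mem_sphere zero_less_norm_iff)
    define K where "K = norm \<xi> + \<delta>"
    have "((\<lambda>t. \<Sum>i\<le>d. norm (g i t - g i 0) * K ^ i) \<longlongrightarrow> (\<Sum>i\<le>d. norm (g i 0 - g i 0) * K ^ i)) (at 0)"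
    proof (intro tendsto_intros)
      fix i assume "i \<in> {..d}"
      then have "continuous_on (ball 0 r1) (g i)" using ghol holomorphic_on_imp_continuous_on by auto
      then have "isCont (g i) 0" using r1(1) by (simp add: continuous_on_eq_continuous_at)
      then show "(g i \<longlongrightarrow> g i 0) (at 0)" by (simp add: isCont_def)
    qed
    then have "((\<lambda>t. \<Sum>i\<le>d. norm (g i t - g i 0) * K ^ i) \<longlongrightarrow> 0) (at 0)" by simp
    then have "eventually (\<lambda>t. (\<Sum>i\<le>d. norm (g i t - g i 0) * K ^ i) < \<mu>) (at 0)"
      using \<mu> by (rule order_tendstoD)
    then obtain r2 where r2: "r2 > 0" "\<And>t. t \<noteq> 0 \<Longrightarrow> dist t 0 < r2 \<Longrightarrow> (\<Sum>i\<le>d. norm (g i t - g i 0) * K ^ i) < \<mu>"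
      unfolding eventually_at by blast
    have "poly (V t) z \<noteq> 0" if "t \<in> ball 0 (min r1 r2)" "z \<in> sphere \<xi> \<delta>" for t z
    proof -
      have s: "(\<Sum>i\<le>d. norm (g i t - g i 0) * K ^ i) < \<mu>"
        using r2(2)[of t] that(1) \<mu> by (cases "t = 0") (auto simp: dist_commute)
      have zK: "norm z \<le> K" using that(2) norm_triangle_ineq2[of z \<xi>] by (auto simp: K_def dist_norm norm_minus_commute)
      have "poly (V t) z - poly U0 z = (\<Sum>i\<le>d. (g i t - g i 0) * z ^ i)"
        unfolding V0[symmetric] by (simp add: V_def poly_sum poly_monom sum_subtractf algebra_simps)
      also have "norm \<dots> \<le> (\<Sum>i\<le>d. norm (g i t - g i 0) * K ^ i)"
        by (rule sum_norm_le) (auto simp: norm_mult norm_power intro!: mult_left_mono power_mono zK)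
      finally have "norm (poly (V t) z - poly U0 z) < \<mu>" using s by simp
      moreover have "norm (poly U0 z) \<ge> \<mu>" using z0(2)[OF that(2)] \<mu>_def by simp
      ultimately show ?thesis by auto
    qed
    then show ?thesis using r1(1) r2(1) by (intro exI[of _ "min r1 r2"]) auto
  qed
  then obtain r2 where r2: "r2 > 0" "r2 \<le> r1" "\<And>t z. t \<in> ball 0 r2 \<Longrightarrow> z \<in> sphere \<xi> \<delta> \<Longrightarrow> poly (V t) z \<noteq> 0"
    by blast
  define X where "X t = proots (V t)" for t
  have VX: "V t = (\<Prod>x\<in>#X t. [:-x, 1:])" if "t \<in> ball 0 r2" for t
    unfolding X_def by (rule poly_monic_proots) (use Vlc[of t] that r2(2) in auto)
  define Y where "Y t = filter_mset (\<lambda>x. x \<in> ball \<xi> \<delta>) (X t)" for t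
  have sub: "ball 0 r2 \<subseteq> (ball 0 r1 :: complex set)" using r2(2) by (rule subset_ball)
  define J where "J H t = contour_integral (circlepath \<xi> \<delta>) (\<lambda>z. H z * (poly (pderiv (V t)) z / poly (V t) z))" for H t
  have Jval: "J H t = 2 * of_real pi * \<i> * (\<Sum>x\<in>#Y t. H x)"
    if t: "t \<in> ball 0 r2" and H: "H holomorphic_on S" "open S" "cball \<xi> \<delta> \<subseteq> S" for H S t
  proof -
    have nx: "dist \<xi> x \<noteq> \<delta>" if "x \<in># X t" for x
    proof
      assume "dist \<xi> x = \<delta>"
      then have "poly (V t) x \<noteq> 0" using r2(3)[OF t, of x] by simp
      moreover have "poly (V t) x = 0"
        using that VX[OF t] by (simp add: poly_linear_prod_mset) 
      ultimately show False by simp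
    qed
    have "((\<lambda>z. H z * (\<Sum>x\<in>#X t. 1 / (z - x))) has_contour_integral
           2 * of_real pi * \<i> * (\<Sum>x\<in>#Y t. H x)) (circlepath \<xi> \<delta>)"
      unfolding Y_def using contour_integral_circle_log_deriv[OF \<delta>(1) H nx] by simp
    then have "((\<lambda>z. H z * (poly (pderiv (V t)) z / poly (V t) z)) has_contour_integral
           2 * of_real pi * \<i> * (\<Sum>x\<in>#Y t. H x)) (circlepath \<xi> \<delta>)"
    proof (rule has_contour_integral_eq)
      fix z assume "z \<in> path_image (circlepath \<xi> \<delta>)"
      then have "dist \<xi> z = \<delta>" using \<delta>(1) by (simp add: path_image_circlepath)
      then have "\<And>x. x \<in># X t \<Longrightarrow> z \<noteq> x" using nx by auto
      from pderiv_linear_prod_mset[of "X t" z, OF this]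
      show "H z * (\<Sum>x\<in>#X t. 1 / (z - x)) = H z * (poly (pderiv (V t)) z / poly (V t) z)"
        using VX[OF t] by simp
    qed
    then show ?thesis unfolding J_def by (rule contour_integral_unique)
  qed
  have Jhol: "J H holomorphic_on ball 0 r2" if "continuous_on (sphere \<xi> \<delta>) H" for H
    unfolding J_def
    by (rule holomorphic_circle_integral_param[where d = d and g = g])
       (use ghol r2(3) that \<delta>(1) sub in \<open>auto simp: V_def intro: holomorphic_on_subset\<close>)
  \<comment> \<open>The number of roots inside is a continuous integer on a connected disc, so it
    equals its value at t = 0, the multiplicity of \<xi>.\<close>
  have sizeY: "size (Y t) = k" if t: "t \<in> ball 0 r2" for t
  proof -
    have e: "(\<lambda>t. J (\<lambda>_. 1) t / (2 * of_real pi * \<i>)) t = of_nat (size (Y t))" if "t \<in> ball 0 r2" for t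
      using Jval[OF that, of "\<lambda>_. 1" UNIV] by simp
    have "continuous_on (ball 0 r2) (\<lambda>t. J (\<lambda>_. 1) t / (2 * of_real pi * \<i>))"
      by (intro continuous_intros holomorphic_on_imp_continuous_on Jhol) auto
    then have c: "continuous_on (ball 0 r2) (\<lambda>t. of_nat (size (Y t)) :: complex)"
      by (rule continuous_on_eq) (use e in auto)
    have sz: "size (Y t) \<le> d" if "t \<in> ball 0 r2" for t
    proof -
      have "size (Y t) \<le> size (X t)" unfolding Y_def by (rule size_mset_mono) simp
      also have "size (X t) = degree (V t)" using VX[OF that] degree_linear_prod_mset[of "X t"] by simp
      also have "\<dots> = d" using Vlc that sub by blast
      finally show ?thesis .
    qed
    have "(\<lambda>t. of_nat (size (Y t)) :: complex) ` ball 0 r2 \<subseteq> of_nat ` {..d}" using sz by auto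
    then have fin: "finite ((\<lambda>t. of_nat (size (Y t)) :: complex) ` ball 0 r2)"
      using finite_surj by (meson finite_atMost finite_imageI finite_subset)
    have "(\<lambda>t. of_nat (size (Y t)) :: complex) constant_on ball 0 r2"
      by (rule continuous_finite_range_constant[OF _ c fin]) simp
    then have "(of_nat (size (Y t)) :: complex) = of_nat (size (Y 0))"
      using t r2(1) unfolding constant_on_def by (metis centre_in_ball)
    then have "size (Y t) = size (Y 0)" by simp
    also have "Y 0 = filter_mset (\<lambda>x. x = \<xi>) (X 0)"
      unfolding Y_def
    proof (rule filter_mset_cong[OF refl])
      fix x assume "x \<in># X 0"
      then have "poly U0 x = 0" using V0 U0nz by (simp add: X_def)
      then show "(x \<in> ball \<xi> \<delta>) = (x = \<xi>)" using \<delta> by (metis centre_in_ball less_asym mem_ball)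
    qed
    also have "size \<dots> = count (X 0) \<xi>"
      by (simp add: filter_eq_replicate_mset)
    also have "\<dots> = k" using V0 U0nz k by (simp add: X_def)
    finally show ?thesis .
  qed
  define A where "A t = (\<Prod>x\<in>#Y t. [:-x, 1:])" for t
  define Z where "Z t = filter_mset (\<lambda>x. \<not> x \<in> ball \<xi> \<delta>) (X t)" for t
  define B where "B t = (\<Prod>x\<in>#Z t. [:-x, 1:])" for t
  have AB: "V t = A t * B t" if "t \<in> ball 0 r2" for t
  proof -
    have "X t = Y t + Z t" unfolding Y_def Z_def by (rule multiset_partition)
    then show ?thesis unfolding A_def B_def VX[OF that] by simp
  qed
  have dA: "degree (A t) = k" "lead_coeff (A t) = 1" if "t \<in> ball 0 r2" for t
    unfolding A_def using degree_linear_prod_mset[of "Y t"] lead_coeff_linear_prod_mset[of "Y t"] sizeY[OF that] by auto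
  have dB: "degree (B t) = d - k" "lead_coeff (B t) = 1" if "t \<in> ball 0 r2" for t
  proof -
    show lb: "lead_coeff (B t) = 1" unfolding B_def by (rule lead_coeff_linear_prod_mset)
    have "A t \<noteq> 0" "B t \<noteq> 0" using lb dA[OF that] by auto
    then have "degree (V t) = degree (A t) + degree (B t)" using AB[OF that] by (simp add: degree_mult_eq)
    then show "degree (B t) = d - k" using dA(1)[OF that] Vlc sub that by auto
  qed
  \<comment> \<open>The value at y is the exponential of a sum of logarithms over the roots inside.
    Dividing by y - \<xi> keeps the argument of \<open>Ln\<close> in the right half-plane on the
    disc of radius 2 \<delta>, so the principal branch is holomorphic there; the factor (y -
    \<xi>)^k restores the value.\<close>
  have Avals: "\<exists>h. h holomorphic_on ball 0 r2 \<and> (\<forall>t\<in>ball 0 r2. poly (A t) y = h t \<and> h t \<noteq> 0)"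
    if y: "dist \<xi> y \<ge> 2 * \<delta>" for y
  proof -
    define H where "H z = Ln (1 - (z - \<xi>) / (y - \<xi>))" for z
    have ny: "y \<noteq> \<xi>" using y \<delta>(1) by auto
    have re: "1 - (z - \<xi>) / (y - \<xi>) \<notin> \<real>\<^sub>\<le>\<^sub>0" if "z \<in> ball \<xi> (2 * \<delta>)" for z
    proof -
      have "norm ((z - \<xi>) / (y - \<xi>)) < 1"
        using that y ny by (simp add: norm_divide dist_norm norm_minus_commute)
      then have "Re ((z - \<xi>) / (y - \<xi>)) < 1" using complex_Re_le_cmod order_le_less_trans by blast
      then have "Re (1 - (z - \<xi>) / (y - \<xi>)) > 0" by simp
      then show ?thesis by (auto simp: complex_nonpos_Reals_iff)
    qed
    have Hh: "H holomorphic_on ball \<xi> (2 * \<delta>)"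
      unfolding H_def by (intro holomorphic_intros re) (use ny in auto)
    have cs: "cball \<xi> \<delta> \<subseteq> ball \<xi> (2 * \<delta>)" using \<delta>(1) by auto
    have Hc: "continuous_on (sphere \<xi> \<delta>) H"
      using holomorphic_on_imp_continuous_on[OF Hh] by (rule continuous_on_subset) (use \<delta>(1) in auto)
    define h where "h t = (y - \<xi>) ^ k * exp (J H t / (2 * of_real pi * \<i>))" for t
    have "h holomorphic_on ball 0 r2" unfolding h_def
      by (intro holomorphic_intros Jhol Hc) auto
    moreover have "poly (A t) y = h t" if t: "t \<in> ball 0 r2" for t
    proof -
      have yin: "x \<in> ball \<xi> (2 * \<delta>)" if "x \<in># Y t" for x using that \<delta>(1) by (auto simp: Y_def)
      have "J H t / (2 * of_real pi * \<i>) = (\<Sum>x\<in>#Y t. H x)"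
        unfolding Jval[OF t Hh open_ball cs] by (rule nonzero_mult_div_cancel_left) simp
      then have "exp (J H t / (2 * of_real pi * \<i>)) = (\<Prod>x\<in>#Y t. exp (H x))"
        by (simp add: exp_sum_mset_image)
      also have "\<dots> = (\<Prod>x\<in>#Y t. (y - x) / (y - \<xi>))"
      proof (rule arg_cong[where f = prod_mset], rule image_mset_cong)
        fix x assume "x \<in># Y t"
        then have "1 - (x - \<xi>) / (y - \<xi>) \<noteq> 0"
          using re[OF yin, of x] by (metis nonpos_Reals_zero_I)
        then have "exp (H x) = 1 - (x - \<xi>) / (y - \<xi>)" by (simp add: H_def)
        then show "exp (H x) = (y - x) / (y - \<xi>)" using ny by (simp add: field_simps)
      qed
      finally have e: "exp (J H t / (2 * of_real pi * \<i>)) = (\<Prod>x\<in>#Y t. (y - x) / (y - \<xi>))" .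
      have "(y - \<xi>) ^ size M * (\<Prod>x\<in>#M. (y - x) / (y - \<xi>)) = (\<Prod>x\<in>#M. y - x)" for M
        using ny by (induction M) (auto simp: field_simps)
      from this[of "Y t"] show ?thesis unfolding h_def e A_def poly_linear_prod_mset sizeY[OF t] by simp
    qed
    moreover have "h t \<noteq> 0" for t using ny by (simp add: h_def)
    ultimately show ?thesis by blast
  qed
  define y where "y j = \<xi> + of_real (2 * \<delta> * (of_nat j + 1))" for j :: nat
  have y: "inj_on y S" "dist \<xi> (y j) \<ge> 2 * \<delta>" for S j
    unfolding y_def using distinct_points_outside_disc[of "2 * \<delta>" \<xi>] \<delta>(1) by auto
  obtain h where h: "\<And>j. h j holomorphic_on ball 0 r2" "\<And>j t. t \<in> ball 0 r2 \<Longrightarrow> poly (A t) (y j) = h j t \<and> h j t \<noteq> 0"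
    using Avals[OF y(2)] by metis
  have mero_of_hol: "f meromorphic_on {0}"
    if "F holomorphic_on ball 0 r2" "\<And>t. t \<in> ball 0 r2 \<Longrightarrow> f t = F t" for f F
  proof -
    have ev: "eventually (\<lambda>t. f t = F t) (at 0)"
      unfolding eventually_at using r2(1) that(2) by (intro exI[of _ r2]) (auto simp: dist_commute)
    have "F analytic_on {0}" using that(1) r2(1) by (auto simp: analytic_on_def)
    then have "F meromorphic_on {0}" by (rule analytic_on_imp_meromorphic_on)
    then show ?thesis using meromorphic_on_cong[of "{0}" f F "{0}"] ev by auto
  qed
  have mA: "mero_poly A"
    unfolding mero_poly_def
  proof
    fix i
    obtain L where L: "\<And>p i. degree p \<le> k \<Longrightarrow> coeff p i = (\<Sum>j\<le>k. L j i * poly p (y j))"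
      using coeff_by_interpolation[OF y(1)] by metis
    show "(\<lambda>t. coeff (A t) i) meromorphic_on {0}"
    proof (rule mero_of_hol)
      show "(\<lambda>t. \<Sum>j\<le>k. L j i * h j t) holomorphic_on ball 0 r2" by (intro holomorphic_intros h(1))
      show "coeff (A t) i = (\<Sum>j\<le>k. L j i * h j t)" if "t \<in> ball 0 r2" for t
        using L[of "A t" i] dA(1)[OF that] h(2)[OF that] by simp
    qed
  qed
  \<comment> \<open>\<open>B\<close> is evaluated as the quotient of \<open>V\<close> by
    \<open>A\<close>, at nodes where \<open>A\<close> does not vanish.\<close>
  have mB: "mero_poly B"
    unfolding mero_poly_def
  proof
    fix i
    obtain L where L: "\<And>p i. degree p \<le> d - k \<Longrightarrow> coeff p i = (\<Sum>j\<le>d-k. L j i * poly p (y j))"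
      using coeff_by_interpolation[OF y(1)] by metis
    show "(\<lambda>t. coeff (B t) i) meromorphic_on {0}"
    proof (rule mero_of_hol)
      have "(\<lambda>t. poly (V t) (y j)) holomorphic_on ball 0 r2" for j
        unfolding V_def poly_sum poly_monom
        by (intro holomorphic_intros holomorphic_on_subset[OF ghol sub]) auto
      then show "(\<lambda>t. \<Sum>j\<le>d-k. L j i * (poly (V t) (y j) / h j t)) holomorphic_on ball 0 r2"
        by (intro holomorphic_intros h(1)) (use h(2) in auto)
      show "coeff (B t) i = (\<Sum>j\<le>d-k. L j i * (poly (V t) (y j) / h j t))" if "t \<in> ball 0 r2" for t
        using L[of "B t" i] dB(1)[OF that] h(2)[OF that] AB[OF that] by simp
    qed
  qed
  have "eventually (\<lambda>t. U t = A t * B t \<and>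
      degree (A t) = k \<and> lead_coeff (A t) = 1 \<and> degree (B t) = d - k \<and> lead_coeff (B t) = 1) (at 0)"
    unfolding eventually_at
  proof (intro exI[of _ r2] conjI r2(1) ballI impI)
    fix t :: complex assume "t \<noteq> 0 \<and> dist t 0 < r2"
    then have t: "t \<in> ball 0 r2" "t \<noteq> 0" by (auto simp: dist_commute)
    show "U t = A t * B t" using VU[of t] AB[OF t(1)] t sub by auto
  qed (use dA dB in \<open>auto simp: dist_commute\<close>)
  then show ?thesis using mA mB by blast
qed

section \<open>Newton-Puiseux expansions\<close>

definition puiseux_split :: "(complex \<Rightarrow> complex poly) \<Rightarrow> nat \<Rightarrow> (complex \<Rightarrow> complex) list \<Rightarrow> bool" where
  "puiseux_split W M \<phi>s \<longleftrightarrow> M \<ge> 1 \<and> (\<forall>\<phi>\<in>set \<phi>s. \<phi> meromorphic_on {0}) \<and>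
     eventually (\<lambda>t. W (t ^ M) = (\<Prod>\<phi>\<leftarrow>\<phi>s. [:- \<phi> t, 1:])) (at 0)"

lemma puiseux_split_power:
  assumes "puiseux_split W M \<phi>s" "N \<ge> 1"
  shows "puiseux_split W (M * N) (map (\<lambda>\<phi> t. \<phi> (t ^ N)) \<phi>s)"
proof -
  have "eventually (\<lambda>t. W ((t ^ N) ^ M) = (\<Prod>\<phi>\<leftarrow>\<phi>s. [:- \<phi> (t ^ N), 1:])) (at 0)"
    using assms by (intro eventually_at_0_compose_power) (auto simp: puiseux_split_def)
  then show ?thesis using assms
    by (auto simp: puiseux_split_def power_mult [symmetric] mult.commute[of N M] o_def
             intro: meromorphic_at_0_compose_power)
qed

lemma puiseux_split_mult:
  assumes "puiseux_split A M1 \<phi>s" "puiseux_split B M2 \<psi>s" "eventually (\<lambda>t. U t = A t * B t) (at 0)"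
  shows "\<exists>M \<theta>s. puiseux_split U M \<theta>s"
proof -
  have 1: "puiseux_split A (M1 * M2) (map (\<lambda>\<phi> t. \<phi> (t ^ M2)) \<phi>s)"
    using assms by (intro puiseux_split_power) (auto simp: puiseux_split_def)
  have 2: "puiseux_split B (M1 * M2) (map (\<lambda>\<phi> t. \<phi> (t ^ M1)) \<psi>s)"
    using puiseux_split_power[OF assms(2), of M1] assms(1) by (auto simp: puiseux_split_def mult.commute)
  have "M1 * M2 \<ge> 1" using 1 by (simp add: puiseux_split_def)
  then have "eventually (\<lambda>t. U (t ^ (M1 * M2)) = A (t ^ (M1 * M2)) * B (t ^ (M1 * M2))) (at 0)"
    using assms(3) by (intro eventually_at_0_compose_power) auto
  moreover have "eventually (\<lambda>t. A (t ^ (M1 * M2)) = (\<Prod>\<phi>\<leftarrow>map (\<lambda>\<phi> t. \<phi> (t ^ M2)) \<phi>s. [:- \<phi> t, 1:])) (at 0)"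
    "eventually (\<lambda>t. B (t ^ (M1 * M2)) = (\<Prod>\<phi>\<leftarrow>map (\<lambda>\<phi> t. \<phi> (t ^ M1)) \<psi>s. [:- \<phi> t, 1:])) (at 0)"
    using 1 2 by (auto simp: puiseux_split_def)
  ultimately have "eventually (\<lambda>t. U (t ^ (M1 * M2)) =
     (\<Prod>\<phi>\<leftarrow>map (\<lambda>\<phi> t. \<phi> (t ^ M2)) \<phi>s @ map (\<lambda>\<phi> t. \<phi> (t ^ M1)) \<psi>s. [:- \<phi> t, 1:])) (at 0)"
    by eventually_elim (simp only: map_append prod_list.append)
  then have "puiseux_split U (M1 * M2) (map (\<lambda>\<phi> t. \<phi> (t ^ M2)) \<phi>s @ map (\<lambda>\<phi> t. \<phi> (t ^ M1)) \<psi>s)"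
    using 1 2 by (auto simp: puiseux_split_def simp del: map_map)
  then show ?thesis by blast
qed

lemma poly_linear_prod_list: "poly (\<Prod>\<phi>\<leftarrow>\<phi>s. [:- \<phi> t, 1:]) y = (\<Prod>\<phi>\<leftarrow>\<phi>s. y - \<phi> t)" for y :: complex
  by (induction \<phi>s) (auto simp: algebra_simps)

text \<open>Replacing t by t^q multiplies the order by q. A monomial on the Newton edge keeps its
  coefficient in the limit, and one above the edge tends to 0.\<close>

lemma mero_coeff_tendsto:
  assumes "((\<lambda>t. f t * t powi (-v)) \<longlongrightarrow> A) (at (0::complex))" "q \<ge> 1" "s \<le> int q * v"
  shows "((\<lambda>t. f (t ^ q) * t powi (-s)) \<longlongrightarrow> (if s = int q * v then A else 0)) (at 0)"
proof -
  have 1: "((\<lambda>t. f (t ^ q) * (t ^ q) powi (-v)) \<longlongrightarrow> A) (at 0)"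
    using filterlim_compose[OF assms(1) filterlim_power_at_0[OF assms(2)]] by simp
  define n where "n = nat (int q * v - s)"
  have n: "int n = int q * v - s" using assms(3) by (simp add: n_def)
  have 2: "((\<lambda>t::complex. t ^ n) \<longlongrightarrow> 0 ^ n) (at 0)" by (intro tendsto_intros)
  have "((\<lambda>t. f (t ^ q) * (t ^ q) powi (-v) * t ^ n) \<longlongrightarrow> A * 0 ^ n) (at 0)"
    by (intro tendsto_intros 1) 
  also have "?this \<longleftrightarrow> ((\<lambda>t. f (t ^ q) * t powi (-s)) \<longlongrightarrow> A * 0 ^ n) (at 0)"
  proof (rule filterlim_cong[OF refl refl])
    show "\<forall>\<^sub>F t in at 0. f (t ^ q) * (t ^ q) powi (-v) * t ^ n = f (t ^ q) * t powi (-s)"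
      unfolding eventually_at_filter
    proof (rule always_eventually, intro allI impI)
      fix t :: complex assume t: "t \<noteq> 0"
      have "(t ^ q) powi (-v) * t ^ n = t powi (int q * (-v)) * t powi (int n)"
        by (simp only: power_int_mult power_int_of_nat)
      also have "\<dots> = t powi (int q * (-v) + int n)" using t by (subst power_int_add) auto
      also have "int q * (-v) + int n = -s" using n by simp
      finally show "f (t ^ q) * (t ^ q) powi (-v) * t ^ n = f (t ^ q) * t powi (-s)" by (simp add: mult.assoc)
    qed
  qed
  finally have "((\<lambda>t. f (t ^ q) * t powi (-s)) \<longlongrightarrow> A * 0 ^ n) (at 0)" .
  moreover have "A * 0 ^ n = (if s = int q * v then A else 0)"
    using n by (cases "n = 0") auto
  ultimately show ?thesis by simp
qed

lemma choose_pred: "0 < d \<Longrightarrow> d choose (d - Suc 0) = d"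
  by (cases d) auto

text \<open>Induction on the degree. Removing the subleading coefficient and rescaling by the least
  slope of the Newton polygon gives a limit polynomial that is not a power of a linear factor, so
  \<open>hensel_splitting\<close> produces factors of smaller degree.\<close>

theorem puiseux_monic:
  assumes "mero_poly W" "eventually (\<lambda>t. degree (W t) = d \<and> lead_coeff (W t) = 1) (at 0)"
  shows "\<exists>M \<phi>s. puiseux_split W M \<phi>s"
  using assms
proof (induction d arbitrary: W rule: less_induct)
  case (less d)
  note IH = less.IH and mW = less.prems(1) and dW = less.prems(2)
  show ?case
  proof (cases "d = 0")
    case True
    have "eventually (\<lambda>t. W (t ^ 1) = (\<Prod>\<phi>\<leftarrow>[]. [:- \<phi> t, 1:])) (at 0)"
      using dW by eventually_elim (use True in \<open>auto elim!: degree_eq_zeroE\<close>)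
    then have "puiseux_split W 1 []" by (auto simp: puiseux_split_def)
    then show ?thesis by blast
  next
    case False
    \<comment> \<open>The shift by a makes the sum of the roots 0, which later prevents all rescaled
      roots from having the same nonzero limit.\<close>
    define a where "a t = coeff (W t) (d - 1) / of_nat d" for t
    have ma: "a meromorphic_on {0}" unfolding a_def
      using mW by (intro meromorphic_intros) (auto simp: mero_poly_def)
    define V where "V t = (\<Sum>i\<le>d. smult (coeff (W t) i) ([:- a t, 1:] ^ i))" for t
    have mV: "mero_poly V" unfolding V_def
      using mW ma
      by (intro mero_poly_sum mero_poly_smult mero_poly_power mero_poly_pCons mero_poly_const meromorphic_intros)
         (auto simp: mero_poly_def)
    have VW: "poly (V t) y = poly (W t) (y - a t)" if "degree (W t) = d" for t y
      using that by (simp add: V_def poly_sum poly_altdef[of "W t"] algebra_simps)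
    have VW': "V t = pcompose (W t) [:- a t, 1:]" if "degree (W t) = d" for t
      by (rule poly_eq_poly_eq_iff[THEN iffD1]) (rule ext, simp add: VW[OF that] poly_pcompose)
    have dV: "eventually (\<lambda>t. degree (V t) = d \<and> lead_coeff (V t) = 1 \<and> coeff (V t) (d - 1) = 0) (at 0)"
      using dW
    proof eventually_elim
      case (elim t)
      have d: "degree (V t) = d" using elim by (simp add: VW' degree_pcompose)
      have "lead_coeff (V t) = 1" using elim lead_coeff_comp[of "[:- a t, 1:]" "W t"]
        by (auto simp: VW' degree_pcompose)
      moreover have "coeff (V t) (d - 1) = 0"
      proof -
        have low: "coeff ([:- a t, 1:] ^ i) (d - 1) = 0" if "i < d - 1" for i
        proof (rule coeff_eq_0)
          have "degree ([:- a t, 1:] ^ i) \<le> degree [:- a t, 1:] * i" by (rule degree_power_le)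
          then show "degree ([:- a t, 1:] ^ i) < d - 1" using that by simp
        qed
        have "coeff (V t) (d - 1) = (\<Sum>i\<in>{d - 1, d}. coeff (W t) i * coeff ([:- a t, 1:] ^ i) (d - 1))"
          unfolding V_def coeff_sum coeff_smult
          by (rule sum.mono_neutral_right) (use low in \<open>auto simp: nat_less_le\<close>)
        also have "\<dots> = coeff (W t) (d - 1) * 1 + coeff (W t) d * (of_nat d * (- a t))"
        proof -
          have "coeff ([:- a t, 1:] ^ d) (d - 1) = of_nat d * (- a t)"
            using False by (subst coeff_linear_poly_power) (auto simp: choose_pred)
          then show ?thesis using False by (simp add: coeff_linear_power)
        qed
        also have "\<dots> = 0" using elim False by (auto simp: a_def)
        finally show ?thesis .
      qed
      ultimately show ?case using d by simp
    qed
    have "\<exists>M \<psi>s. puiseux_split V M \<psi>s"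
    proof (cases "\<forall>i<d. eventually (\<lambda>t. coeff (V t) i = 0) (at 0)")
      case True
      then have "eventually (\<lambda>t. \<forall>i\<in>{..<d}. coeff (V t) i = 0) (at 0)"
        by (intro eventually_ball_finite) auto
      then have "eventually (\<lambda>t. V (t ^ 1) = (\<Prod>\<phi>\<leftarrow>replicate d (\<lambda>_. 0). [:- \<phi> t, 1:])) (at 0)"
        using dV
      proof eventually_elim
        case (elim t)
        have "V t = monom 1 d"
        proof (rule poly_eqI)
          fix n show "coeff (V t) n = coeff (monom 1 d) n"
            using elim by (cases n d rule: linorder_cases) (auto simp: coeff_eq_0)
        qed
        also have "monom 1 d = [:0, 1::complex:] ^ d" by (simp add: monom_altdef)
        finally show ?case by simp
      qed
      then have "puiseux_split V 1 (replicate d (\<lambda>_. 0))"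
        by (auto simp: puiseux_split_def intro: meromorphic_intros)
      then show ?thesis by blast
    next
      case nz: False
      define I where "I = {i. i < d \<and> \<not> eventually (\<lambda>t. coeff (V t) i = 0) (at 0)}"
      have I: "finite I" "I \<noteq> {}" using nz by (auto simp: I_def)
      have "\<exists>v A. A \<noteq> 0 \<and> ((\<lambda>t. coeff (V t) i * t powi (-v)) \<longlongrightarrow> A) (at 0)" if "i \<in> I" for i
      proof -
        have m: "(\<lambda>t. coeff (V t) i) meromorphic_on {0}" using mV by (simp add: mero_poly_def)
        show ?thesis by (rule meromorphic_at_0_cases[OF m]) (use that in \<open>auto simp: I_def\<close>)
      qed
      then obtain v A where vA: "\<And>i. i \<in> I \<Longrightarrow> A i \<noteq> 0"
        "\<And>i. i \<in> I \<Longrightarrow> ((\<lambda>t. coeff (V t) i * t powi (- v i)) \<longlongrightarrow> A i) (at 0)" by metis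
      \<comment> \<open>The least slope p / q is the order in t of the largest roots; passing to t^q
        makes this order integral.\<close>
      define slope where "slope i = (of_int (v i) :: real) / of_nat (d - i)" for i
      obtain i0 where i0: "i0 \<in> I" "\<And>i. i \<in> I \<Longrightarrow> slope i0 \<le> slope i"
        using I ex_min_if_finite[of "slope ` I"] by (metis (mono_tags, lifting) arg_min_if_finite(1) arg_min_least)
      define p q where "p = v i0" and "q = d - i0"
      have q: "q \<ge> 1" using i0 by (auto simp: q_def I_def)
      have slopes: "p * int (d - i) \<le> int q * v i" if "i \<in> I" for i
      proof -
        have di: "d - i > 0" using that by (auto simp: I_def)
        have "of_int p / of_nat q \<le> (of_int (v i) :: real) / of_nat (d - i)"
          using i0(2)[OF that] by (simp add: slope_def p_def q_def)
        then have "of_int p * of_nat (d - i) \<le> (of_int (v i) :: real) * of_nat q"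
          using q di by (simp add: divide_simps)
        then have "of_int (p * int (d - i)) \<le> (of_int (v i * int q) :: real)" by simp
        then show ?thesis by (simp only: of_int_le_iff mult.commute)
      qed
      \<comment> \<open>The substitution y = t^p Y, divided by t^(p d): coefficient i receives the
        exponent - p (d - i).\<close>
      define U where "U t = (\<Sum>i\<le>d. monom (coeff (V (t ^ q)) i * t powi (- (p * int (d - i)))) i)" for t
      have cU: "coeff (U t) i = (if i \<le> d then coeff (V (t ^ q)) i * t powi (- (p * int (d - i))) else 0)" for t i
        by (auto simp: U_def coeff_sum)
      have mU: "mero_poly U"
        unfolding mero_poly_def cU
      proof
        fix i
        show "(\<lambda>t. if i \<le> d then coeff (V (t ^ q)) i * t powi (- (p * int (d - i))) else 0) meromorphic_on {0}"
        proof (cases "i \<le> d")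
          case True
          have "(\<lambda>t. coeff (V (t ^ q)) i) meromorphic_on {0}"
            using mero_poly_compose_power[OF mV q] by (simp add: mero_poly_def)
          then show ?thesis using True by (auto intro!: meromorphic_intros)
        qed (auto intro: meromorphic_intros)
      qed
      define u where "u i = (if i = d then 1 else if i \<in> I \<and> p * int (d - i) = int q * v i then A i else 0)" for i
      define U0 where "U0 = (\<Sum>i\<le>d. monom (u i) i)"
      have cU0: "coeff U0 i = (if i \<le> d then u i else 0)" for i
        by (auto simp: U0_def coeff_sum)
      have evq: "eventually (\<lambda>t. degree (V (t ^ q)) = d \<and> lead_coeff (V (t ^ q)) = 1 \<and> coeff (V (t ^ q)) (d - 1) = 0) (at 0)"
        using dV q by (rule eventually_at_0_compose_power)
      have lim: "((\<lambda>t. coeff (U t) i) \<longlongrightarrow> coeff U0 i) (at 0)" for i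
      proof -
        consider "i > d" | "i = d" | "i \<in> I" | "i < d" "i \<notin> I" by (cases i d rule: linorder_cases) auto
        then show ?thesis
        proof cases
          case 1 then show ?thesis by (simp add: cU cU0)
        next
          case 2
          have "eventually (\<lambda>t. coeff (U t) i = 1) (at 0)"
            using evq by eventually_elim (use 2 in \<open>auto simp: cU\<close>)
          then show ?thesis using 2 by (simp add: cU0 u_def tendsto_eventually)
        next
          case 3
          have "((\<lambda>t. coeff (V (t ^ q)) i * t powi (- (p * int (d - i)))) \<longlongrightarrow>
             (if p * int (d - i) = int q * v i then A i else 0)) (at 0)"
            by (rule mero_coeff_tendsto[OF vA(2)[OF 3] q slopes[OF 3]])
          then show ?thesis using 3 by (auto simp: cU cU0 u_def I_def)
        next
          case 4
          then have "eventually (\<lambda>t. coeff (V t) i = 0) (at 0)" by (auto simp: I_def)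
          then have "eventually (\<lambda>t. coeff (V (t ^ q)) i = 0) (at 0)" using q by (rule eventually_at_0_compose_power)
          then have "eventually (\<lambda>t. coeff (U t) i = 0) (at 0)"
            by eventually_elim (simp add: cU)
          then show ?thesis using 4 by (simp add: cU0 u_def tendsto_eventually)
        qed
      qed
      have dU0: "degree U0 = d" "lead_coeff U0 = 1"
      proof -
        have "degree U0 \<le> d" by (rule degree_le) (auto simp: cU0)
        moreover have "degree U0 \<ge> d" by (rule le_degree) (simp add: cU0 u_def)
        ultimately show "degree U0 = d" by simp
        then show "lead_coeff U0 = 1" by (simp add: cU0 u_def)
      qed
      have dU: "eventually (\<lambda>t. degree (U t) = d \<and> lead_coeff (U t) = 1) (at 0)"
        using evq
      proof eventually_elim
        case (elim t)
        have "degree (U t) \<le> d" by (rule degree_le) (auto simp: cU)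
        moreover have c1: "coeff (U t) d = 1" using elim by (auto simp: cU)
        then have "degree (U t) \<ge> d" by (intro le_degree) simp
        ultimately have "degree (U t) = d" by simp
        then show ?case using c1 by simp
      qed
      have trace: "coeff U0 (d - 1) = 0"
      proof (rule tendsto_unique[OF _ lim[of "d - 1"]])
        show "((\<lambda>t. coeff (U t) (d - 1)) \<longlongrightarrow> 0) (at 0)"
          by (rule tendsto_eventually) (use evq in \<open>eventually_elim, auto simp: cU\<close>)
      qed simp
      have "degree U0 \<noteq> 0" using dU0 False by simp
      then obtain \<xi> where \<xi>: "poly U0 \<xi> = 0"
        using fundamental_theorem_of_algebra[of U0] by (auto simp: constant_degree)
      have U0nz: "U0 \<noteq> 0" using dU0 by auto
      define k where "k = order \<xi> U0"
      have k1: "k \<ge> 1" using \<xi> U0nz by (simp add: k_def order_root Suc_le_eq)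
      \<comment> \<open>If \<xi> were the only root, the vanishing trace would force \<xi> = 0; but
        the coefficient of index \<open>i0\<close> lies on the Newton edge and survives in the
        limit.\<close>
      have kd: "k < d"
      proof (rule ccontr)
        assume "\<not> k < d"
        then have kd: "k = d" using order_degree[OF U0nz, of \<xi>] dU0 by (simp add: k_def)
        have "[:- \<xi>, 1:] ^ d dvd U0" using order_1[of \<xi> U0] kd by (simp add: k_def)
        then obtain R where R: "U0 = [:- \<xi>, 1:] ^ d * R" by (auto simp: dvd_def)
        have Rnz: "R \<noteq> 0" "[:- \<xi>, 1:] ^ d \<noteq> 0" using R U0nz by auto
        have "degree U0 = d + degree R" using R Rnz by (simp add: degree_mult_eq degree_linear_power)
        then have "degree R = 0" using dU0 by simp
        then obtain r where r: "R = [:r:]" by (auto elim: degree_eq_zeroE)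
        have "coeff U0 d = r" using R r by (simp add: coeff_linear_power)
        then have "r = 1" using dU0 by auto
        then have U0e: "U0 = [:- \<xi>, 1:] ^ d" using R r by simp
        have "coeff U0 (d - 1) = of_nat d * (- \<xi>)"
          unfolding U0e using False by (subst coeff_linear_poly_power) (auto simp: choose_pred)
        then have "\<xi> = 0" using trace False by simp
        then have "U0 = monom 1 d" using U0e by (simp add: monom_altdef)
        then have "coeff U0 i0 = 0" using i0 by (auto simp: I_def)
        moreover have "coeff U0 i0 = A i0" using i0 by (auto simp: cU0 u_def I_def p_def q_def)
        ultimately show False using vA(1)[OF i0(1)] by simp
      qed
      obtain A' B' where AB: "mero_poly A'" "mero_poly B'" "eventually (\<lambda>t. U t = A' t * B' t \<and>
        degree (A' t) = k \<and> lead_coeff (A' t) = 1 \<and> degree (B' t) = d - k \<and> lead_coeff (B' t) = 1) (at 0)"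
        using hensel_splitting[OF mU dU dU0 lim k_def] by blast
      have "\<exists>M \<phi>s. puiseux_split A' M \<phi>s"
        by (rule IH[OF kd AB(1)]) (use AB(3) in \<open>auto elim: eventually_mono\<close>)
      moreover have "\<exists>M \<phi>s. puiseux_split B' M \<phi>s"
        by (rule IH[of "d - k", OF _ AB(2)]) (use AB(3) k1 kd in \<open>auto elim: eventually_mono\<close>)
      moreover have "eventually (\<lambda>t. U t = A' t * B' t) (at 0)" using AB(3) by (auto elim: eventually_mono)
      ultimately obtain M \<psi>s where M: "puiseux_split U M \<psi>s" using puiseux_split_mult by blast
      \<comment> \<open>This undoes y = t^p Y, with t replaced by t^M.\<close>
      define \<theta>s where "\<theta>s = map (\<lambda>\<psi> t. (t ^ M) powi p * \<psi> t) \<psi>s"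
      have M1: "M \<ge> 1" using M by (simp add: puiseux_split_def)
      have "eventually (\<lambda>t. V (t ^ (q * M)) = (\<Prod>\<theta>\<leftarrow>\<theta>s. [:- \<theta> t, 1:])) (at 0)"
      proof -
        have "eventually (\<lambda>t. U (t ^ M) = (\<Prod>\<phi>\<leftarrow>\<psi>s. [:- \<phi> t, 1:])) (at 0)"
          using M by (simp add: puiseux_split_def)
        moreover have "eventually (\<lambda>t. degree (V ((t ^ M) ^ q)) = d \<and> lead_coeff (V ((t ^ M) ^ q)) = 1 \<and> coeff (V ((t ^ M) ^ q)) (d - 1) = 0) (at 0)"
          using evq M1 by (rule eventually_at_0_compose_power)
        moreover have "eventually (\<lambda>t. t \<noteq> 0) (at (0::complex))" by (simp add: eventually_neq_at_within)
        moreover have "eventually (\<lambda>t. degree (U (t ^ M)) = d \<and> lead_coeff (U (t ^ M)) = 1) (at 0)"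
          using dU M1 by (rule eventually_at_0_compose_power)
        ultimately show ?thesis
        proof eventually_elim
          case (elim t)
          define s where "s = t ^ M"
          have s: "s \<noteq> 0" using elim by (auto simp: s_def)
          have dV': "degree (V (s ^ q)) = d" using elim by (auto simp: s_def)
          have len: "length \<psi>s = d"
          proof -
            have "degree (\<Prod>\<phi>\<leftarrow>\<psi>s. [:- \<phi> t, 1:]) = length \<psi>s"
            proof -
              have "(\<Prod>\<phi>\<leftarrow>\<psi>s. [:- \<phi> t, 1:]) = (\<Prod>x\<in>#mset (map (\<lambda>\<phi>. \<phi> t) \<psi>s). [:- x, 1:])"
                by (induction \<psi>s) auto
              then show ?thesis using degree_linear_prod_mset by (metis size_mset length_map)
            qed
            then show ?thesis using elim by auto
          qed
          have "poly (V (s ^ q)) y = poly (\<Prod>\<theta>\<leftarrow>\<theta>s. [:- \<theta> t, 1:]) y" for y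
          proof -
            have "poly (U s) (y * s powi (-p)) = (\<Sum>i\<le>d. coeff (V (s ^ q)) i * s powi (- (p * int (d - i))) * (y * s powi (-p)) ^ i)"
              by (simp add: U_def poly_sum poly_monom)
            also have "\<dots> = (\<Sum>i\<le>d. s powi (- (p * int d)) * (coeff (V (s ^ q)) i * y ^ i))"
            proof (rule sum.cong[OF refl])
              fix i assume i: "i \<in> {..d}"
              have "s powi (- (p * int (d - i))) * (s powi (-p)) ^ i = s powi (- (p * int (d - i)) + (-p) * int i)"
                using s by (subst power_int_add) (simp_all only: power_int_mult power_int_of_nat simp_thms)
              also have "- (p * int (d - i)) + (-p) * int i = - (p * int d)"
                using i by (simp add: of_nat_diff algebra_simps)
              finally show "coeff (V (s ^ q)) i * s powi (- (p * int (d - i))) * (y * s powi (-p)) ^ i =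
                 s powi (- (p * int d)) * (coeff (V (s ^ q)) i * y ^ i)"
                by (simp add: power_mult_distrib mult.assoc mult.left_commute)
            qed
            also have "\<dots> = s powi (- (p * int d)) * poly (V (s ^ q)) y"
              by (simp add: sum_distrib_left poly_altdef dV')
            finally have 1: "poly (V (s ^ q)) y = s powi (p * int d) * poly (U s) (y * s powi (-p))"
              using s by (simp add: power_int_minus)
            have "poly (U s) (y * s powi (-p)) = (\<Prod>\<phi>\<leftarrow>\<psi>s. y * s powi (-p) - \<phi> t)"
              using elim(1) by (simp add: s_def poly_linear_prod_list)
            then have 2: "poly (V (s ^ q)) y = (s powi p) ^ length \<psi>s * (\<Prod>\<phi>\<leftarrow>\<psi>s. y * s powi (-p) - \<phi> t)"
              using 1 len by (simp only: power_int_mult power_int_of_nat)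
            have "(s powi p) ^ length L * (\<Prod>\<phi>\<leftarrow>L. y * s powi (-p) - \<phi> t) = (\<Prod>\<phi>\<leftarrow>L. y - s powi p * \<phi> t)" for L
            proof (induction L)
              case (Cons \<phi> L)
              have "s powi p * (y * s powi (-p) - \<phi> t) = y - s powi p * \<phi> t"
                using s by (simp add: algebra_simps power_int_minus)
              then show ?case using Cons by (simp add: mult_ac)
            qed simp
            then have "poly (V (s ^ q)) y = (\<Prod>\<phi>\<leftarrow>\<psi>s. y - s powi p * \<phi> t)" using 2 by simp
            also have "\<dots> = poly (\<Prod>\<theta>\<leftarrow>\<theta>s. [:- \<theta> t, 1:]) y"
              unfolding poly_linear_prod_list by (simp add: \<theta>s_def o_def s_def)
            finally show ?thesis .
          qed
          then have "V (s ^ q) = (\<Prod>\<theta>\<leftarrow>\<theta>s. [:- \<theta> t, 1:])"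
            by (intro poly_eq_poly_eq_iff[THEN iffD1] ext)
          then show ?case by (simp add: s_def power_mult[symmetric] mult.commute)
        qed
      qed
      moreover have "\<forall>\<theta>\<in>set \<theta>s. \<theta> meromorphic_on {0}"
        using M by (auto simp: \<theta>s_def puiseux_split_def intro!: meromorphic_intros)
      ultimately have "puiseux_split V (q * M) \<theta>s" using q M1 by (simp add: puiseux_split_def)
      then show ?thesis by blast
    qed
    then obtain M \<psi>s where M: "puiseux_split V M \<psi>s" by blast
    define \<phi>s where "\<phi>s = map (\<lambda>\<psi> t. \<psi> t - a (t ^ M)) \<psi>s"
    have M1: "M \<ge> 1" using M by (simp add: puiseux_split_def)
    have "eventually (\<lambda>t. degree (W (t ^ M)) = d \<and> lead_coeff (W (t ^ M)) = 1) (at 0)"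
      using dW M1 by (rule eventually_at_0_compose_power)
    moreover have "eventually (\<lambda>t. V (t ^ M) = (\<Prod>\<phi>\<leftarrow>\<psi>s. [:- \<phi> t, 1:])) (at 0)"
      using M by (simp add: puiseux_split_def)
    ultimately have "eventually (\<lambda>t. W (t ^ M) = (\<Prod>\<phi>\<leftarrow>\<phi>s. [:- \<phi> t, 1:])) (at 0)"
    proof eventually_elim
      case (elim t)
      show ?case
      proof (intro poly_eq_poly_eq_iff[THEN iffD1] ext)
        fix y
        have "poly (W (t ^ M)) y = poly (V (t ^ M)) (y + a (t ^ M))" using elim VW[of "t ^ M" "y + a (t ^ M)"] by simp
        also have "\<dots> = (\<Prod>\<phi>\<leftarrow>\<psi>s. y + a (t ^ M) - \<phi> t)" using elim by (simp add: poly_linear_prod_list)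
        also have "\<dots> = poly (\<Prod>\<phi>\<leftarrow>\<phi>s. [:- \<phi> t, 1:]) y"
          unfolding poly_linear_prod_list by (simp add: \<phi>s_def o_def algebra_simps)
        finally show "poly (W (t ^ M)) y = poly (\<Prod>\<phi>\<leftarrow>\<phi>s. [:- \<phi> t, 1:]) y" .
      qed
    qed
    moreover have "\<forall>\<phi>\<in>set \<phi>s. \<phi> meromorphic_on {0}"
      using M M1 ma by (auto simp: \<phi>s_def puiseux_split_def intro!: meromorphic_intros meromorphic_at_0_compose_power)
    ultimately have "puiseux_split W M \<phi>s" using M1 by (simp add: puiseux_split_def)
    then show ?thesis by blast
  qed
qed

text \<open>A germ that is not 0 behaves like A t^k, so a single sequence already decides whether it
  tends to 0. This carries limits from a sequence over to a whole curve.\<close>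

lemma meromorphic_at_0_tendsto_along_seq:
  assumes "g meromorphic_on {0}" "filterlim \<tau> (at 0) sequentially" "(\<lambda>n. g (\<tau> n)) \<longlonglongrightarrow> 0"
  shows "(g \<longlongrightarrow> 0) (at (0::complex))"
proof (rule meromorphic_at_0_cases[OF assms(1)])
  assume "eventually (\<lambda>t. g t = 0) (at 0)"
  then show ?thesis by (rule tendsto_eventually)
next
  fix k A assume A: "A \<noteq> 0" "((\<lambda>t. g t * t powi (-k)) \<longlongrightarrow> A) (at 0)"
  have nz: "eventually (\<lambda>n. \<tau> n \<noteq> 0) sequentially"
    using assms(2) by (auto simp: filterlim_at)
  have t0: "\<tau> \<longlonglongrightarrow> 0" using assms(2) by (auto simp: filterlim_at)
  have lim: "(\<lambda>n. g (\<tau> n) * \<tau> n powi (-k)) \<longlonglongrightarrow> A"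
    using filterlim_compose[OF A(2) assms(2)] .
  show ?thesis
  proof (cases "k \<le> 0")
    case True
    define m where "m = nat (- k)"
    have m: "-k = int m" using True by (simp add: m_def)
    have "(\<lambda>n. g (\<tau> n) * \<tau> n powi (-k)) \<longlonglongrightarrow> 0 * 0 ^ m"
      unfolding m power_int_of_nat by (intro tendsto_intros assms t0)
    then show ?thesis using LIMSEQ_unique[OF lim] A(1) by simp
  next
    case False
    define m where "m = nat k"
    have m: "k = int m" "m > 0" using False by (auto simp: m_def)
    have "((\<lambda>t. (g t * t powi (-k)) * t ^ m) \<longlongrightarrow> A * 0 ^ m) (at 0)"
      by (intro tendsto_intros A)
    also have "?this \<longleftrightarrow> (g \<longlongrightarrow> A * 0 ^ m) (at 0)"
      by (rule filterlim_cong[OF refl refl]) (auto simp: eventually_at_filter m power_int_minus)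
    finally show ?thesis using m by (simp add: zero_power)
  qed
qed

lemma meromorphic_at_0_eventually_nonzero:
  assumes "g meromorphic_on {0}" "filterlim \<tau> (at 0) sequentially" "frequently (\<lambda>n. g (\<tau> n) \<noteq> 0) sequentially"
  shows "eventually (\<lambda>t. g t \<noteq> 0) (at (0::complex))"
proof (rule meromorphic_at_0_cases[OF assms(1)])
  assume "eventually (\<lambda>t. g t = 0) (at 0)"
  then have "eventually (\<lambda>n. g (\<tau> n) = 0) sequentially" using assms(2) by (rule eventually_compose_filterlim)
  then show ?thesis using assms(3) by (simp add: frequently_def)
next
  fix k A assume A: "A \<noteq> 0" "((\<lambda>t. g t * t powi (-k)) \<longlongrightarrow> A) (at 0)"
  have "eventually (\<lambda>t. g t * t powi (-k) \<noteq> 0) (at 0)"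
    using tendsto_imp_eventually_ne[OF A(2) A(1)] .
  then show ?thesis by eventually_elim auto
qed

lemma meromorphic_at_0_zero_or_nonzero:
  assumes "g meromorphic_on {0}"
  shows "eventually (\<lambda>t. g t = 0) (at 0) \<or> eventually (\<lambda>t. g t \<noteq> 0) (at (0::complex))"
proof (rule meromorphic_at_0_cases[OF assms(1)])
  fix k A assume A: "A \<noteq> 0" "((\<lambda>t. g t * t powi (-k)) \<longlongrightarrow> A) (at 0)"
  have "eventually (\<lambda>t. g t * t powi (-k) \<noteq> 0) (at 0)"
    using tendsto_imp_eventually_ne[OF A(2) A(1)] .
  then have "eventually (\<lambda>t. g t \<noteq> 0) (at 0)" by eventually_elim auto
  then show ?thesis ..
qed auto

theorem puiseux:
  assumes "mero_poly W" "eventually (\<lambda>t. degree (W t) = d \<and> W t \<noteq> 0) (at 0)"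
  shows "\<exists>M \<phi>s. M \<ge> 1 \<and> (\<forall>\<phi>\<in>set \<phi>s. \<phi> meromorphic_on {0}) \<and>
     eventually (\<lambda>t. W (t ^ M) = smult (lead_coeff (W (t ^ M))) (\<Prod>\<phi>\<leftarrow>\<phi>s. [:- \<phi> t, 1:])) (at 0)"
proof -
  define U where "U t = smult (1 / coeff (W t) d) (W t)" for t
  have "mero_poly U" unfolding U_def using assms(1)
    by (intro mero_poly_smult meromorphic_intros) (auto simp: mero_poly_def)
  moreover have "eventually (\<lambda>t. degree (U t) = d \<and> lead_coeff (U t) = 1) (at 0)"
    using assms(2) by eventually_elim (auto simp: U_def)
  ultimately obtain M \<phi>s where M: "puiseux_split U M \<phi>s" using puiseux_monic by blast
  then have M1: "M \<ge> 1" by (simp add: puiseux_split_def)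
  have "eventually (\<lambda>t. degree (W (t ^ M)) = d \<and> W (t ^ M) \<noteq> 0) (at 0)"
    using assms(2) M1 by (rule eventually_at_0_compose_power)
  moreover have "eventually (\<lambda>t. U (t ^ M) = (\<Prod>\<phi>\<leftarrow>\<phi>s. [:- \<phi> t, 1:])) (at 0)"
    using M by (simp add: puiseux_split_def)
  ultimately have "eventually (\<lambda>t. W (t ^ M) = smult (lead_coeff (W (t ^ M))) (\<Prod>\<phi>\<leftarrow>\<phi>s. [:- \<phi> t, 1:])) (at 0)"
  proof eventually_elim
    case (elim t)
    then have "coeff (W (t ^ M)) d \<noteq> 0" by auto
    then have "W (t ^ M) = smult (coeff (W (t ^ M)) d) (U (t ^ M))" by (simp add: U_def)
    then show ?case using elim by simp
  qed
  then show ?thesis using M M1 by (auto simp: puiseux_split_def)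
qed

text \<open>The exponents of the single families are replaced by their product, so that all branches
  become functions of the same root of the parameter.\<close>

theorem puiseux_family:
  assumes "finite I" "\<And>i. i \<in> I \<Longrightarrow> mero_poly (W i)"
    "\<And>i. i \<in> I \<Longrightarrow> \<exists>d. eventually (\<lambda>t. degree (W i t) = d \<and> W i t \<noteq> 0) (at 0)"
  shows "\<exists>M \<phi>s. M \<ge> 1 \<and> (\<forall>i\<in>I. (\<forall>\<phi>\<in>set (\<phi>s i). \<phi> meromorphic_on {0}) \<and>
     eventually (\<lambda>t. W i (t ^ M) = smult (lead_coeff (W i (t ^ M))) (\<Prod>\<phi>\<leftarrow>\<phi>s i. [:- \<phi> t, 1:])) (at 0))"
proof -
  have "\<exists>M \<phi>s. M \<ge> 1 \<and> (\<forall>\<phi>\<in>set \<phi>s. \<phi> meromorphic_on {0}) \<and>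
     eventually (\<lambda>t. W i (t ^ M) = smult (lead_coeff (W i (t ^ M))) (\<Prod>\<phi>\<leftarrow>\<phi>s. [:- \<phi> t, 1:])) (at 0)"
    if "i \<in> I" for i using puiseux assms(2,3) that by blast
  then have "\<forall>i\<in>I. \<exists>p. fst p \<ge> 1 \<and> (\<forall>\<phi>\<in>set (snd p). \<phi> meromorphic_on {0}) \<and>
     eventually (\<lambda>t. W i (t ^ fst p) = smult (lead_coeff (W i (t ^ fst p))) (\<Prod>\<phi>\<leftarrow>snd p. [:- \<phi> t, 1:])) (at 0)"
    by (simp add: split_paired_Ex)
  then obtain p where p: "\<forall>i\<in>I. fst (p i) \<ge> 1 \<and> (\<forall>\<phi>\<in>set (snd (p i)). \<phi> meromorphic_on {0}) \<and>
     eventually (\<lambda>t. W i (t ^ fst (p i)) = smult (lead_coeff (W i (t ^ fst (p i)))) (\<Prod>\<phi>\<leftarrow>snd (p i). [:- \<phi> t, 1:])) (at 0)"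
    by (rule bchoice[THEN exE]) blast
  define m \<phi> where "m = (\<lambda>i. fst (p i))" and "\<phi> = (\<lambda>i. snd (p i))"
  have m: "\<And>i. i \<in> I \<Longrightarrow> m i \<ge> (1::nat)"
    "\<And>i. i \<in> I \<Longrightarrow> (\<forall>\<phi>\<in>set (\<phi> i). \<phi> meromorphic_on {0})"
    "\<And>i. i \<in> I \<Longrightarrow> eventually (\<lambda>t. W i (t ^ m i) = smult (lead_coeff (W i (t ^ m i))) (\<Prod>\<phi>\<leftarrow>\<phi> i. [:- \<phi> t, 1:])) (at 0)"
    using p unfolding m_def \<phi>_def by auto
  define M where "M = (\<Prod>i\<in>I. m i)"
  define k where "k i = (\<Prod>j\<in>I-{i}. m j)" for i
  have M: "M = k i * m i" if "i \<in> I" for i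
    using that assms(1) by (simp add: M_def k_def prod.remove mult.commute)
  have M1: "M \<ge> 1" unfolding M_def using prod_mono[of I "\<lambda>_. 1" m] m(1) by simp
  have k1: "k i \<ge> 1" if "i \<in> I" for i using M[OF that] M1 by (cases "k i") auto
  define \<phi>s where "\<phi>s i = map (\<lambda>\<phi> t. \<phi> (t ^ k i)) (\<phi> i)" for i
  have "(\<forall>\<phi>\<in>set (\<phi>s i). \<phi> meromorphic_on {0}) \<and>
     eventually (\<lambda>t. W i (t ^ M) = smult (lead_coeff (W i (t ^ M))) (\<Prod>\<phi>\<leftarrow>\<phi>s i. [:- \<phi> t, 1:])) (at 0)" if i: "i \<in> I" for i
  proof -
    have "eventually (\<lambda>t. W i ((t ^ k i) ^ m i) = smult (lead_coeff (W i ((t ^ k i) ^ m i))) (\<Prod>\<phi>\<leftarrow>\<phi> i. [:- \<phi> (t ^ k i), 1:])) (at 0)"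
      using m(3)[OF i] k1[OF i] by (rule eventually_at_0_compose_power)
    then show ?thesis using m(2)[OF i] k1[OF i] 
      by (auto simp: \<phi>s_def o_def power_mult[symmetric] M[OF i] intro: meromorphic_at_0_compose_power)
  qed
  then show ?thesis using M1 by blast
qed

section \<open>Subsequences that converge on the sphere, and fibres of bivariate polynomials\<close>

lemma finite_range_constant_subseq:
  fixes u :: "nat \<Rightarrow> 'a"
  assumes "finite A" "\<And>n. u n \<in> A"
  obtains a r where "a \<in> A" "strict_mono (r :: nat \<Rightarrow> nat)" "\<And>n. u (r n) = a"
proof -
  have "\<exists>a\<in>A. infinite {n. u n = a}"
  proof (rule ccontr)
    assume "\<not> (\<exists>a\<in>A. infinite {n. u n = a})"
    then have "finite (\<Union>a\<in>A. {n. u n = a})" using assms(1) by auto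
    moreover have "(\<Union>a\<in>A. {n. u n = a}) = UNIV" using assms(2) by auto
    ultimately show False by simp
  qed
  then obtain a where a: "a \<in> A" "infinite {n. u n = a}" by blast
  obtain r where "strict_mono (r::nat \<Rightarrow> nat)" "\<And>n. r n \<in> {n. u n = a}"
    using infinite_enumerate[OF a(2)] by blast
  then show ?thesis using that[of a r] a(1) by auto
qed

lemma sphere_convergent_subseq:
  fixes u :: "nat \<Rightarrow> complex"
  obtains r where "strict_mono (r :: nat \<Rightarrow> nat)" "(\<exists>c. (u \<circ> r) \<longlonglongrightarrow> c) \<or> filterlim (u \<circ> r) at_infinity sequentially"
proof (cases "\<exists>B. infinite {n. norm (u n) \<le> B}")
  case True
  then obtain B where "infinite {n. norm (u n) \<le> B}" by blast
  then obtain r1 where r1: "strict_mono (r1::nat \<Rightarrow> nat)" "\<And>n. norm (u (r1 n)) \<le> B"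
    using infinite_enumerate by blast
  have "bounded (range (u \<circ> r1))" using r1(2) by (auto simp: bounded_iff)
  then obtain l r2 where "strict_mono (r2::nat \<Rightarrow> nat)" "((u \<circ> r1) \<circ> r2) \<longlonglongrightarrow> l"
    using bounded_imp_convergent_subsequence by blast
  then show ?thesis using that[of "r1 \<circ> r2"] r1(1) by (auto simp: o_assoc intro: strict_mono_o)
next
  case False
  have "filterlim u at_infinity sequentially"
    unfolding filterlim_at_infinity[OF order_refl]
  proof (intro allI impI)
    fix B :: real assume "0 < B"
    have "finite {n. norm (u n) \<le> B}" using False by blast
    then have "eventually (\<lambda>n. n \<notin> {n. norm (u n) \<le> B}) sequentially"
      by (simp add: cofinite_eq_sequentially[symmetric] eventually_cofinite)
    then show "eventually (\<lambda>n. B \<le> norm (u n)) sequentially" by eventually_elim auto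
  qed
  then show ?thesis using that[of id] by (auto simp: strict_mono_def o_def)
qed

lemma finite_sphere_convergent_subseq:
  fixes u :: "'a \<Rightarrow> nat \<Rightarrow> complex"
  assumes "finite A"
  shows "\<exists>r. strict_mono (r :: nat \<Rightarrow> nat) \<and>
     (\<forall>a\<in>A. (\<exists>c. (\<lambda>n. u a (r n)) \<longlonglongrightarrow> c) \<or> filterlim (\<lambda>n. u a (r n)) at_infinity sequentially)"
  using assms
proof (induction A)
  case empty
  show ?case by (rule exI[of _ id]) (auto simp: strict_mono_def)
next
  case (insert a A)
  then obtain r1 where r1: "strict_mono (r1 :: nat \<Rightarrow> nat)"
     "\<And>a. a \<in> A \<Longrightarrow> (\<exists>c. (\<lambda>n. u a (r1 n)) \<longlonglongrightarrow> c) \<or> filterlim (\<lambda>n. u a (r1 n)) at_infinity sequentially"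
    by auto
  obtain r2 where r2: "strict_mono (r2 :: nat \<Rightarrow> nat)"
     "(\<exists>c. ((\<lambda>n. u a (r1 n)) \<circ> r2) \<longlonglongrightarrow> c) \<or> filterlim ((\<lambda>n. u a (r1 n)) \<circ> r2) at_infinity sequentially"
    using sphere_convergent_subseq[of "\<lambda>n. u a (r1 n)"] by blast
  have r2': "filterlim r2 sequentially sequentially" using r2(1) by (rule filterlim_subseq)
  have "(\<exists>c. (\<lambda>n. u b (r1 (r2 n))) \<longlonglongrightarrow> c) \<or> filterlim (\<lambda>n. u b (r1 (r2 n))) at_infinity sequentially"
    if "b \<in> insert a A" for b
  proof (cases "b = a")
    case True then show ?thesis using r2(2) by (simp add: o_def)
  next
    case False
    then have "b \<in> A" using that by simp
    from r1(2)[OF this] show ?thesis using filterlim_compose[OF _ r2'] by blast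
  qed
  moreover have "strict_mono (\<lambda>n. r1 (r2 n))" using strict_mono_o[OF r1(1) r2(1)] by (simp add: o_def)
  ultimately show ?case by blast
qed

definition fibre_poly :: "complex poly poly \<Rightarrow> complex \<Rightarrow> complex poly" where
  "fibre_poly p x = map_poly (\<lambda>c. poly c x) p"

lemma coeff_fibre_poly: "coeff (fibre_poly p x) i = poly (coeff p i) x"
  by (simp add: fibre_poly_def coeff_map_poly)

lemma degree_fibre_poly_le: "degree (fibre_poly p x) \<le> degree p"
  by (rule degree_le) (simp add: coeff_fibre_poly coeff_eq_0)

lemma eval2_fibre_poly: "eval2 p x y = poly (fibre_poly p x) y"
proof -
  have "eval2 p x y = (\<Sum>i\<le>degree p. poly (coeff p i) x * y ^ i)"
    by (simp add: eval2_def poly_altdef[of p] poly_sum poly_power)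
  also have "\<dots> = poly (fibre_poly p x) y"
    unfolding poly_altdef[of "fibre_poly p x"]
    by (rule sum.mono_neutral_cong_right)
       (use degree_fibre_poly_le[of p x] in \<open>auto simp: coeff_fibre_poly[symmetric] coeff_eq_0\<close>)
  finally show ?thesis .
qed

lemma meromorphic_poly_compose: "f meromorphic_on A \<Longrightarrow> (\<lambda>t. poly p (f t)) meromorphic_on A"
  unfolding poly_altdef by (intro meromorphic_intros)

lemma meromorphic_eval2:
  assumes "X meromorphic_on A" "Y meromorphic_on A"
  shows "(\<lambda>t. eval2 p (X t) (Y t)) meromorphic_on A"
proof -
  have "eval2 p x y = (\<Sum>i\<le>degree p. poly (coeff p i) x * y ^ i)" for x y
    by (simp add: eval2_def poly_altdef[of p] poly_sum poly_power)
  then show ?thesis by (auto intro!: meromorphic_intros meromorphic_poly_compose assms)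
qed

section \<open>Curve selection\<close>

text \<open>\<open>S\<close> marks the factors in which w dominates. Each factor is asymptotic to
  its dominant term, w or the negative of \<open>D\<close>.\<close>

lemma prod_list_dominant:
  fixes D :: "'b \<Rightarrow> 'a \<Rightarrow> complex"
  assumes "\<And>d. d \<in> set L \<Longrightarrow> S d \<Longrightarrow> ((\<lambda>x. D d x / w x) \<longlongrightarrow> 0) F"
    and "\<And>d. d \<in> set L \<Longrightarrow> \<not> S d \<Longrightarrow> ((\<lambda>x. w x / D d x) \<longlongrightarrow> 0) F \<and> eventually (\<lambda>x. D d x \<noteq> 0) F"
    and "eventually (\<lambda>x. w x \<noteq> 0) F"
  shows "((\<lambda>x. (\<Prod>d\<leftarrow>L. w x - D d x) / (w x ^ length (filter S L) * (\<Prod>d\<leftarrow>filter (\<lambda>d. \<not> S d) L. - D d x))) \<longlongrightarrow> 1) F"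
  using assms(1,2)
proof (induction L)
  case Nil
  then show ?case by simp
next
  case (Cons d L)
  let ?R = "\<lambda>L x. (\<Prod>d\<leftarrow>L. w x - D d x) / (w x ^ length (filter S L) * (\<Prod>d\<leftarrow>filter (\<lambda>d. \<not> S d) L. - D d x))"
  have IH: "(?R L \<longlongrightarrow> 1) F" using Cons by auto
  show ?case
  proof (cases "S d")
    case True
    have "((\<lambda>x. (1 - D d x / w x) * ?R L x) \<longlongrightarrow> (1 - 0) * 1) F"
      using Cons.prems(1)[of d] True by (intro tendsto_intros IH) auto
    then have "((\<lambda>x. (1 - D d x / w x) * ?R L x) \<longlongrightarrow> 1) F" by simp
    moreover have "eventually (\<lambda>x. (1 - D d x / w x) * ?R L x = ?R (d # L) x) F"
      using assms(3)
    proof eventually_elim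
      case (elim x)
      then have "1 - D d x / w x = (w x - D d x) / w x" by (simp add: diff_divide_distrib)
      then show ?case using True by (simp add: mult.assoc)
    qed
    ultimately show ?thesis by (rule Lim_transform_eventually)
  next
    case False
    have "((\<lambda>x. (1 - w x / D d x) * ?R L x) \<longlongrightarrow> (1 - 0) * 1) F"
      using Cons.prems(2)[of d] False by (intro tendsto_intros IH) auto
    then have "((\<lambda>x. (1 - w x / D d x) * ?R L x) \<longlongrightarrow> 1) F" by simp
    moreover have "eventually (\<lambda>x. D d x \<noteq> 0) F" using Cons.prems(2)[of d] False by auto
    then have "eventually (\<lambda>x. (1 - w x / D d x) * ?R L x = ?R (d # L) x) F"
    proof eventually_elim
      case (elim x)
      then have "1 - w x / D d x = (w x - D d x) / (- D d x)" by (simp add: field_simps)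
      then show ?case using False by (simp add: mult_ac)
    qed
    ultimately show ?thesis by (rule Lim_transform_eventually)
  qed
qed

text \<open>Put P = - ln |\<tau>| and Q = - ln |w| at a single index where all the monomials have
  modulus below 1: each gives a strict inequality a P + b Q > 0, and the pair (1, 0) gives P > 0.
  Finitely many strict inequalities are open conditions, so Q / P may be replaced by a rational
  number.\<close>

lemma separating_exponents:
  fixes \<tau> w :: "nat \<Rightarrow> complex" and \<Lambda> :: "(int \<times> int) set"
  assumes "finite \<Lambda>" "(1, 0) \<in> \<Lambda>"
    and "eventually (\<lambda>n. \<tau> n \<noteq> 0 \<and> w n \<noteq> 0) sequentially"
    and "\<And>a b. (a, b) \<in> \<Lambda> \<Longrightarrow> (\<lambda>n. \<tau> n powi a * w n powi b) \<longlonglongrightarrow> 0"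
  obtains p q where "p \<ge> (1::int)" "\<And>a b. (a, b) \<in> \<Lambda> \<Longrightarrow> a * p + b * q > 0"
proof -
  have "eventually (\<lambda>n. \<forall>l\<in>\<Lambda>. norm (\<tau> n powi fst l * w n powi snd l) < 1) sequentially"
  proof (rule eventually_ball_finite[OF assms(1)], rule ballI)
    fix l assume "l \<in> \<Lambda>"
    then have "(\<lambda>n. norm (\<tau> n powi fst l * w n powi snd l)) \<longlonglongrightarrow> 0"
      using assms(4)[of "fst l" "snd l"] by (simp add: tendsto_norm_zero)
    then show "eventually (\<lambda>n. norm (\<tau> n powi fst l * w n powi snd l) < 1) sequentially"
      by (rule order_tendstoD) simp
  qed
  then have "eventually (\<lambda>n. (\<tau> n \<noteq> 0 \<and> w n \<noteq> 0) \<and> (\<forall>l\<in>\<Lambda>. norm (\<tau> n powi fst l * w n powi snd l) < 1)) sequentially"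
    using assms(3) by (rule eventually_conj[rotated])
  then obtain n where n: "\<tau> n \<noteq> 0" "w n \<noteq> 0" "\<And>l. l \<in> \<Lambda> \<Longrightarrow> norm (\<tau> n powi fst l * w n powi snd l) < 1"
    using eventually_happens'[OF sequentially_bot] by blast
  define P Q where "P = - ln (norm (\<tau> n))" and "Q = - ln (norm (w n))"
  have pos: "of_int a * P + of_int b * Q > 0" if "(a, b) \<in> \<Lambda>" for a b
  proof -
    have "norm (\<tau> n) powi a * norm (w n) powi b < 1" using n(3)[OF that] by (simp add: norm_mult norm_power_int)
    moreover have "norm (\<tau> n) powi a * norm (w n) powi b > 0" using n(1,2) by simp
    ultimately have "ln (norm (\<tau> n) powi a * norm (w n) powi b) < 0" by (rule ln_less_zero[rotated])
    also have "ln (norm (\<tau> n) powi a * norm (w n) powi b) = ln (norm (\<tau> n) powi a) + ln (norm (w n) powi b)"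
      using n(1,2) by (intro ln_mult_pos) auto
    also have "\<dots> = of_int a * ln (norm (\<tau> n)) + of_int b * ln (norm (w n))"
      using n(1,2) by (simp add: powr_real_of_int'[symmetric] ln_powr)
    finally show ?thesis by (simp add: P_def Q_def)
  qed
  have P: "P > 0" using pos[OF assms(2)] by simp
  define \<theta> where "\<theta> = Q / P"
  have pos\<theta>: "of_int a + of_int b * \<theta> > 0" if "(a, b) \<in> \<Lambda>" for a b
    using pos[OF that] P by (simp add: \<theta>_def field_simps)
  have "eventually (\<lambda>x. \<forall>l\<in>\<Lambda>. of_int (fst l) + of_int (snd l) * x > 0) (nhds \<theta>)"
  proof (rule eventually_ball_finite[OF assms(1)], rule ballI)
    fix l assume "l \<in> \<Lambda>"
    then have 0: "of_int (fst l) + of_int (snd l) * \<theta> > 0" using pos\<theta>[of "fst l" "snd l"] by simp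
    have "((\<lambda>x. of_int (fst l) + of_int (snd l) * x) \<longlongrightarrow> of_int (fst l) + of_int (snd l) * \<theta>) (nhds \<theta>)"
      by (intro tendsto_intros filterlim_ident)
    then show "eventually (\<lambda>x. of_int (fst l) + of_int (snd l) * x > 0) (nhds \<theta>)"
      using 0 by (rule order_tendstoD)
  qed
  then obtain d where d: "d > 0" "\<And>x. dist x \<theta> < d \<Longrightarrow> \<forall>l\<in>\<Lambda>. of_int (fst l) + of_int (snd l) * x > 0"
    unfolding eventually_nhds_metric by blast
  obtain x where x: "x \<in> \<rat>" "\<theta> < x" "x < \<theta> + d" using Rats_dense_in_real[of \<theta> "\<theta> + d"] d(1) by auto
  obtain m k where mk: "x = of_int m / of_int k" "k > 0" using Rats_cases'[OF x(1)] by blast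
  show ?thesis
  proof (rule that[of k m])
    show "k \<ge> 1" using mk by simp
    fix a b assume "(a, b) \<in> \<Lambda>"
    then have "of_int a + of_int b * x > 0" using d(2)[of x] x by (force simp: dist_real_def)
    then have "of_int k * (of_int a + of_int b * x) > 0" using mk(2) by simp
    also have "of_int k * (of_int a + of_int b * x) = of_int (a * k + b * m)"
      using mk by (simp add: field_simps)
    finally show "a * k + b * m > 0" by (simp only: of_int_0_less_iff)
  qed
qed

lemma tendsto_power_int_at_0:
  assumes "m > (0::int)"
  shows "((\<lambda>s::complex. s powi m) \<longlongrightarrow> 0) (at 0)"
proof -
  have "((\<lambda>s::complex. s ^ nat m) \<longlongrightarrow> 0 ^ nat m) (at 0)" by (intro tendsto_intros)
  then show ?thesis using assms by (simp add: power_int_def zero_power)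
qed

lemma prod_list_ratio_tendsto_1:
  fixes a b :: "'b \<Rightarrow> 'a \<Rightarrow> complex"
  assumes "\<And>d. d \<in> set L \<Longrightarrow> ((\<lambda>x. a d x / b d x) \<longlongrightarrow> 1) F"
  shows "((\<lambda>x. (\<Prod>d\<leftarrow>L. a d x) / (\<Prod>d\<leftarrow>L. b d x)) \<longlongrightarrow> 1) F"
  using assms
proof (induction L)
  case (Cons d L)
  have "((\<lambda>x. (a d x / b d x) * ((\<Prod>d\<leftarrow>L. a d x) / (\<Prod>d\<leftarrow>L. b d x))) \<longlongrightarrow> 1 * 1) F"
    using Cons by (intro tendsto_mult) auto
  then show ?case by simp
qed simp

lemma meromorphic_at_0_prod_list:
  assumes "\<And>d. d \<in> set L \<Longrightarrow> D d meromorphic_on {0}"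
  shows "(\<lambda>x. \<Prod>d\<leftarrow>L. D d x) meromorphic_on {0}"
  using assms by (induction L) (auto intro!: meromorphic_intros)

lemma eventually_prod_list_nonzero:
  fixes D :: "'b \<Rightarrow> 'a \<Rightarrow> complex"
  assumes "\<And>d. d \<in> set L \<Longrightarrow> eventually (\<lambda>x. D d x \<noteq> 0) F"
  shows "eventually (\<lambda>x. (\<Prod>d\<leftarrow>L. D d x) \<noteq> 0) F"
  using assms
proof (induction L)
  case (Cons d L)
  then have "eventually (\<lambda>x. D d x \<noteq> 0) F" "eventually (\<lambda>x. (\<Prod>d\<leftarrow>L. D d x) \<noteq> 0) F" by auto
  then show ?case by eventually_elim simp
qed simp

lemma exists_roots_tending_to_0:
  fixes t :: "nat \<Rightarrow> complex"
  assumes "t \<longlonglongrightarrow> 0" "\<And>n. t n \<noteq> 0" "M \<ge> (1::nat)"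
  obtains \<tau> where "\<And>n. \<tau> n ^ M = t n" "filterlim \<tau> (at 0) sequentially"
proof -
  have "\<exists>z. z ^ M = t n" for n
    by (rule exI[of _ "exp (Ln (t n) / of_nat M)"])
       (use assms(2,3) in \<open>simp add: exp_of_nat_mult[symmetric]\<close>)
  then obtain \<tau> where \<tau>: "\<And>n. \<tau> n ^ M = t n" by metis
  have "norm (\<tau> n) = root M (norm (t n))" for n
    using assms(3) by (simp add: \<tau>[symmetric] norm_power real_root_power_cancel)
  moreover have "(\<lambda>n. root M (norm (t n))) \<longlonglongrightarrow> root M (norm (0::complex))"
    by (intro tendsto_intros assms)
  ultimately have "(\<lambda>n. norm (\<tau> n)) \<longlonglongrightarrow> 0" by simp
  then have "\<tau> \<longlonglongrightarrow> 0" by (rule tendsto_norm_zero_cancel)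
  moreover have "\<tau> n \<noteq> 0" for n using \<tau>[of n] assms(2)[of n] assms(3) by (auto simp: zero_power)
  ultimately have "filterlim \<tau> (at 0) sequentially" by (simp add: filterlim_at)
  then show ?thesis using that \<tau> by blast
qed

text \<open>Only limits 0 are recorded: a limit \<tau> of f / g is the limit 0 of (f - \<tau> g) /
  g, with f - \<tau> g as a further member of the family.\<close>

definition follows_ratios :: "'i set \<Rightarrow> ('i \<Rightarrow> complex poly poly) \<Rightarrow> ('i \<Rightarrow> nat \<Rightarrow> complex) \<Rightarrow>
    (complex \<Rightarrow> complex) \<Rightarrow> (complex \<Rightarrow> complex) \<Rightarrow> bool" where
  "follows_ratios I f E X Y \<longleftrightarrow> X meromorphic_on {0} \<and> Y meromorphic_on {0} \<and>
     (\<forall>i\<in>I. eventually (\<lambda>s. eval2 (f i) (X s) (Y s) \<noteq> 0) (at 0)) \<and>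
     (\<forall>i\<in>I. \<forall>j\<in>I. (\<lambda>n. E i n / E j n) \<longlonglongrightarrow> 0 \<longrightarrow>
        ((\<lambda>s. eval2 (f i) (X s) (Y s) / eval2 (f j) (X s) (Y s)) \<longlongrightarrow> 0) (at 0))"

text \<open>The values of the curve at the points \<open>\<sigma> n\<close> are asymptotic to those
  of the sequence, so the ratios tend to 0 along \<open>\<sigma>\<close>; for a meromorphic germ
  this is enough.\<close>

lemma follows_ratios_asymptotic:
  assumes X: "X meromorphic_on {0}" and Y: "Y meromorphic_on {0}"
    and r: "strict_mono (r :: nat \<Rightarrow> nat)" and \<sigma>: "filterlim \<sigma> (at 0) sequentially"
    and lim: "\<And>i. i \<in> I \<Longrightarrow> (\<lambda>n. E i (r n) / eval2 (f i) (X (\<sigma> n)) (Y (\<sigma> n))) \<longlonglongrightarrow> 1"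
  shows "follows_ratios I f E X Y"
proof -
  define G where "G i s = eval2 (f i) (X s) (Y s)" for i s
  have mG: "G i meromorphic_on {0}" for i unfolding G_def by (rule meromorphic_eval2[OF X Y])
  have lim': "(\<lambda>n. E i (r n) / G i (\<sigma> n)) \<longlonglongrightarrow> 1" if "i \<in> I" for i using lim[OF that] by (simp add: G_def)
  have evs: "eventually (\<lambda>n. E i (r n) / G i (\<sigma> n) \<noteq> 0) sequentially" if "i \<in> I" for i
    using tendsto_imp_eventually_ne[OF lim'[OF that], of 0] by simp
  have nzs: "eventually (\<lambda>n. G i (\<sigma> n) \<noteq> 0 \<and> E i (r n) \<noteq> 0) sequentially" if "i \<in> I" for i
    using evs[OF that] by eventually_elim auto
  have nz: "eventually (\<lambda>s. G i s \<noteq> 0) (at 0)" if "i \<in> I" for i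
  proof (rule meromorphic_at_0_eventually_nonzero[OF mG \<sigma>])
    have "eventually (\<lambda>n. G i (\<sigma> n) \<noteq> 0) sequentially" using nzs[OF that] by eventually_elim auto
    then show "frequently (\<lambda>n. G i (\<sigma> n) \<noteq> 0) sequentially"
      by (rule eventually_frequently[OF sequentially_bot])
  qed
  have "((\<lambda>s. G i s / G j s) \<longlongrightarrow> 0) (at 0)" if ij: "i \<in> I" "j \<in> I" "(\<lambda>n. E i n / E j n) \<longlonglongrightarrow> 0" for i j
  proof (rule meromorphic_at_0_tendsto_along_seq[OF _ \<sigma>])
    show "(\<lambda>s. G i s / G j s) meromorphic_on {0}" by (intro meromorphic_intros mG)
    have "(\<lambda>n. E i (r n) / E j (r n)) \<longlonglongrightarrow> 0"
      using LIMSEQ_subseq_LIMSEQ[OF ij(3) r] by (simp add: o_def)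
    then have "(\<lambda>n. (E i (r n) / E j (r n)) * (E j (r n) / G j (\<sigma> n)) / (E i (r n) / G i (\<sigma> n))) \<longlonglongrightarrow> 0 * 1 / 1"
      using ij by (intro tendsto_intros lim') auto
    then have "(\<lambda>n. (E i (r n) / E j (r n)) * (E j (r n) / G j (\<sigma> n)) / (E i (r n) / G i (\<sigma> n))) \<longlonglongrightarrow> 0" by simp
    moreover have "eventually (\<lambda>n. (E i (r n) / E j (r n)) * (E j (r n) / G j (\<sigma> n)) / (E i (r n) / G i (\<sigma> n)) = G i (\<sigma> n) / G j (\<sigma> n)) sequentially"
      using nzs[OF ij(1)] nzs[OF ij(2)] by eventually_elim (simp add: field_simps)
    ultimately show "(\<lambda>n. G i (\<sigma> n) / G j (\<sigma> n)) \<longlonglongrightarrow> 0" by (rule Lim_transform_eventually)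
  qed
  then show ?thesis using X Y nz by (simp add: follows_ratios_def G_def)
qed

text \<open>Along a subsequence one Puiseux branch \<open>\<phi>0\<close> of the curves \<open>f i = 0\<close> is nearest to \<open>y n\<close>. If the distance
  has an asymptotic \<open>C s powi e\<close>, the curve is \<open>\<phi>0 + C s powi e\<close>. Otherwise the distance is separated from
  the order of every other branch; all the ratios are then asymptotic to monomials in \<open>s\<close> and in the distance,
  and both are replaced by integral powers of a new parameter for which the same monomials tend to \<open>0\<close>.\<close>

theorem curve_selection:
  fixes f :: "'i \<Rightarrow> complex poly poly"
  assumes fin: "finite I" and fnz: "\<And>i. i \<in> I \<Longrightarrow> f i \<noteq> 0" and \<xi>: "\<xi> meromorphic_on {0}"
    and trans: "\<And>l. l \<noteq> 0 \<Longrightarrow> eventually (\<lambda>t. poly l (\<xi> t) \<noteq> 0) (at 0)"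
    and t: "t \<longlonglongrightarrow> 0" "\<And>n. t n \<noteq> 0"
    and E: "\<And>i n. E i n = eval2 (f i) (\<xi> (t n)) (y n)"
    and Enz: "\<And>i n. i \<in> I \<Longrightarrow> E i n \<noteq> 0"
  shows "\<exists>X Y. follows_ratios I f E X Y"
proof -
  define W where "W i t = fibre_poly (f i) (\<xi> t)" for i t
  have mW: "mero_poly (W i)" for i
    unfolding mero_poly_def W_def coeff_fibre_poly by (auto intro: meromorphic_poly_compose \<xi>)
  \<comment> \<open>On the curve \<xi> the leading coefficient in y does not vanish identically, so
    the degree in y is constant for small t.\<close>
  have dW: "eventually (\<lambda>t. degree (W i t) = degree (f i) \<and> W i t \<noteq> 0) (at 0)" if "i \<in> I" for i
  proof -
    have "eventually (\<lambda>t. poly (lead_coeff (f i)) (\<xi> t) \<noteq> 0) (at 0)"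
      by (rule trans) (use fnz[OF that] in simp)
    then show ?thesis
    proof eventually_elim
      case (elim t)
      then have "coeff (W i t) (degree (f i)) \<noteq> 0" by (simp add: W_def coeff_fibre_poly)
      moreover from this have "degree (f i) \<le> degree (W i t)" by (rule le_degree)
      ultimately show ?case using degree_fibre_poly_le[of "f i" "\<xi> t"] by (auto simp: W_def)
    qed
  qed
  have "\<exists>M \<phi>s. M \<ge> 1 \<and> (\<forall>i\<in>I. (\<forall>\<phi>\<in>set (\<phi>s i). \<phi> meromorphic_on {0}) \<and>
     eventually (\<lambda>t. W i (t ^ M) = smult (lead_coeff (W i (t ^ M))) (\<Prod>\<phi>\<leftarrow>\<phi>s i. [:- \<phi> t, 1:])) (at 0))"
    by (rule puiseux_family[OF fin mW]) (use dW in blast)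
  then obtain M \<phi>s where M0: "M \<ge> 1 \<and> (\<forall>i\<in>I. (\<forall>\<phi>\<in>set (\<phi>s i). \<phi> meromorphic_on {0}) \<and>
     eventually (\<lambda>t. W i (t ^ M) = smult (lead_coeff (W i (t ^ M))) (\<Prod>\<phi>\<leftarrow>\<phi>s i. [:- \<phi> t, 1:])) (at 0))"
    by blast
  then have M: "M \<ge> 1" and \<phi>m: "\<And>i \<phi>. i \<in> I \<Longrightarrow> \<phi> \<in> set (\<phi>s i) \<Longrightarrow> \<phi> meromorphic_on {0}"
    and split: "\<And>i. i \<in> I \<Longrightarrow> eventually (\<lambda>t. W i (t ^ M) = smult (lead_coeff (W i (t ^ M))) (\<Prod>\<phi>\<leftarrow>\<phi>s i. [:- \<phi> t, 1:])) (at 0)"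
    by blast+
  define l where "l i t = coeff (W i (t ^ M)) (degree (f i))" for i t
  have lm: "l i meromorphic_on {0}" for i
    using mero_poly_compose_power[OF mW[of i] M] unfolding mero_poly_def l_def by blast
  have fac: "eventually (\<lambda>t. (\<forall>y. eval2 (f i) (\<xi> (t ^ M)) y = l i t * (\<Prod>\<phi>\<leftarrow>\<phi>s i. y - \<phi> t)) \<and> l i t \<noteq> 0) (at 0)"
    if "i \<in> I" for i
    using split[OF that] eventually_at_0_compose_power[OF dW[OF that] M]
  proof eventually_elim
    case (elim t)
    then have l: "l i t = lead_coeff (W i (t ^ M))" by (simp add: l_def)
    have "eval2 (f i) (\<xi> (t ^ M)) y = l i t * (\<Prod>\<phi>\<leftarrow>\<phi>s i. y - \<phi> t)" for y
    proof -
      have "eval2 (f i) (\<xi> (t ^ M)) y = poly (W i (t ^ M)) y" by (simp add: eval2_fibre_poly W_def)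
      also have "\<dots> = poly (smult (l i t) (\<Prod>\<phi>\<leftarrow>\<phi>s i. [:- \<phi> t, 1:])) y" using elim(1) l by simp
      finally show ?thesis unfolding poly_smult poly_linear_prod_list .
    qed
    then show ?case using elim l by auto
  qed
  obtain \<tau> where \<tau>: "\<And>n. \<tau> n ^ M = t n" "filterlim \<tau> (at 0) sequentially"
    using exists_roots_tending_to_0[OF t M] by blast
  define X0 where "X0 s = \<xi> (s ^ M)" for s
  have mX0: "X0 meromorphic_on {0}" unfolding X0_def using \<xi> M by (rule meromorphic_at_0_compose_power)
  define \<Phi> where "\<Phi> = (\<Union>i\<in>I. set (\<phi>s i))"
  have fin\<Phi>: "finite \<Phi>" using fin by (simp add: \<Phi>_def)
  have m\<Phi>: "\<phi> meromorphic_on {0}" if "\<phi> \<in> \<Phi>" for \<phi> using that \<phi>m by (auto simp: \<Phi>_def)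
  show ?thesis
  proof (cases "\<Phi> = {}")
    case True
    \<comment> \<open>Without branches the values along the curve do not depend on y.\<close>
    have "follows_ratios I f E X0 (\<lambda>_. 0)"
    proof (rule follows_ratios_asymptotic[OF mX0 _ strict_mono_id \<tau>(2)])
      fix i assume i: "i \<in> I"
      have nil: "\<phi>s i = []" using True i by (auto simp: \<Phi>_def)
      have "eventually (\<lambda>n. (\<forall>y. eval2 (f i) (\<xi> (\<tau> n ^ M)) y = l i (\<tau> n) * (\<Prod>\<phi>\<leftarrow>\<phi>s i. y - \<phi> (\<tau> n))) \<and> l i (\<tau> n) \<noteq> 0) sequentially"
        using fac[OF i] \<tau>(2) by (rule eventually_compose_filterlim)
      then have "eventually (\<lambda>n. E i (id n) / eval2 (f i) (X0 (\<tau> n)) 0 = 1) sequentially"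
        by eventually_elim (use Enz[OF i] in \<open>auto simp: X0_def \<tau> E nil\<close>)
      then show "(\<lambda>n. E i (id n) / eval2 (f i) (X0 (\<tau> n)) 0) \<longlonglongrightarrow> 1" by (rule tendsto_eventually)
    qed (auto intro: meromorphic_intros)
    then show ?thesis by blast
  next
    case ne: False
    have "\<exists>\<phi>\<in>\<Phi>. \<forall>\<psi>\<in>\<Phi>. norm (y n - \<phi> (\<tau> n)) \<le> norm (y n - \<psi> (\<tau> n))" for n
      using fin\<Phi> ne ex_is_arg_min_if_finite[of \<Phi> "\<lambda>\<phi>. norm (y n - \<phi> (\<tau> n))"]
      by (auto simp: is_arg_min_linorder)
    then have "\<forall>n. \<exists>\<phi>. \<phi> \<in> \<Phi> \<and> (\<forall>\<psi>\<in>\<Phi>. norm (y n - \<phi> (\<tau> n)) \<le> norm (y n - \<psi> (\<tau> n)))" by blast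
    then obtain near where near0: "\<forall>n. near n \<in> \<Phi> \<and> (\<forall>\<psi>\<in>\<Phi>. norm (y n - near n (\<tau> n)) \<le> norm (y n - \<psi> (\<tau> n)))"
      by (rule choice[THEN exE]) blast
    then have near: "\<And>n. near n \<in> \<Phi>" "\<And>n \<psi>. \<psi> \<in> \<Phi> \<Longrightarrow> norm (y n - near n (\<tau> n)) \<le> norm (y n - \<psi> (\<tau> n))"
      by blast+
    obtain \<phi>0 r1 where r1: "\<phi>0 \<in> \<Phi>" "strict_mono (r1 :: nat \<Rightarrow> nat)" "\<And>n. near (r1 n) = \<phi>0"
      by (rule finite_range_constant_subseq[of \<Phi> near, OF fin\<Phi> near(1)]) (rule that, assumption+)
    define \<delta> where "\<delta> \<phi> t = \<phi> t - \<phi>0 t" for \<phi> t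
    have m\<delta>: "\<delta> \<phi> meromorphic_on {0}" if "\<phi> \<in> \<Phi>" for \<phi>
      unfolding \<delta>_def using that r1(1) by (intro meromorphic_intros m\<Phi>)
    obtain r2 where r2: "strict_mono (r2 :: nat \<Rightarrow> nat)"
      "\<And>\<phi>. \<phi> \<in> \<Phi> \<Longrightarrow> (\<exists>c. (\<lambda>n. (y (r1 (r2 n)) - \<phi>0 (\<tau> (r1 (r2 n)))) / \<delta> \<phi> (\<tau> (r1 (r2 n)))) \<longlonglongrightarrow> c) \<or>
        filterlim (\<lambda>n. (y (r1 (r2 n)) - \<phi>0 (\<tau> (r1 (r2 n)))) / \<delta> \<phi> (\<tau> (r1 (r2 n)))) at_infinity sequentially"
      using finite_sphere_convergent_subseq[OF fin\<Phi>, of "\<lambda>\<phi> n. (y (r1 n) - \<phi>0 (\<tau> (r1 n))) / \<delta> \<phi> (\<tau> (r1 n))"]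
      by auto
    define r where "r n = r1 (r2 n)" for n
    have r: "strict_mono r" unfolding r_def using strict_mono_o[OF r1(2) r2(1)] by (simp add: o_def)
    define \<sigma> where "\<sigma> n = \<tau> (r n)" for n
    have \<sigma>: "filterlim \<sigma> (at 0) sequentially"
      unfolding \<sigma>_def using filterlim_compose[OF \<tau>(2) filterlim_subseq[OF r]] .
    have \<sigma>M: "\<sigma> n ^ M = t (r n)" for n by (simp add: \<sigma>_def \<tau>)
    have \<sigma>nz: "\<sigma> n \<noteq> 0" for n using \<sigma>M[of n] t(2)[of "r n"] M by (auto simp: zero_power)
    have \<sigma>0: "\<sigma> \<longlonglongrightarrow> 0" using \<sigma> by (simp add: filterlim_at)
    define w where "w n = y (r n) - \<phi>0 (\<sigma> n)" for n
    have yw: "y (r n) - \<phi> (\<sigma> n) = w n - \<delta> \<phi> (\<sigma> n)" for \<phi> n by (simp add: w_def \<delta>_def)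
    have nearest: "norm (w n) \<le> norm (w n - \<delta> \<phi> (\<sigma> n))" if "\<phi> \<in> \<Phi>" for \<phi> n
      using near(2)[OF that, of "r n"] r1(3) unfolding yw[symmetric] by (simp add: w_def \<sigma>_def r_def)
    have facE: "eventually (\<lambda>n. E i (r n) = l i (\<sigma> n) * (\<Prod>\<phi>\<leftarrow>\<phi>s i. w n - \<delta> \<phi> (\<sigma> n)) \<and> l i (\<sigma> n) \<noteq> 0) sequentially"
      if "i \<in> I" for i
    proof -
      have "eventually (\<lambda>n. (\<forall>y. eval2 (f i) (\<xi> (\<sigma> n ^ M)) y = l i (\<sigma> n) * (\<Prod>\<phi>\<leftarrow>\<phi>s i. y - \<phi> (\<sigma> n))) \<and> l i (\<sigma> n) \<noteq> 0) sequentially"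
        using fac[OF that] \<sigma> by (rule eventually_compose_filterlim)
      then show ?thesis by eventually_elim (simp add: E \<sigma>M yw)
    qed
    have wnz: "eventually (\<lambda>n. w n \<noteq> 0) sequentially"
    proof -
      obtain i where i: "i \<in> I" "\<phi>0 \<in> set (\<phi>s i)" using r1(1) by (auto simp: \<Phi>_def)
      show ?thesis using facE[OF i(1)]
      proof eventually_elim
        case (elim n)
        then have "(\<Prod>\<phi>\<leftarrow>\<phi>s i. w n - \<delta> \<phi> (\<sigma> n)) \<noteq> 0" using Enz[OF i(1), of "r n"] by auto
        then have "w n - \<delta> \<phi>0 (\<sigma> n) \<noteq> 0" using i(2) by (auto simp: prod_list_zero_iff)
        then show ?case by (simp add: \<delta>_def)
      qed
    qed
    have ratio: "(\<exists>c. (\<lambda>n. w n / \<delta> \<phi> (\<sigma> n)) \<longlonglongrightarrow> c) \<or> filterlim (\<lambda>n. w n / \<delta> \<phi> (\<sigma> n)) at_infinity sequentially"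
      if "\<phi> \<in> \<Phi>" for \<phi>
      using r2(2)[OF that] by (simp add: w_def \<sigma>_def r_def)
    \<comment> \<open>A finite nonzero limit makes the distance w to the nearest branch comparable
      with a germ, hence with C s^e. Otherwise each of the ratios tends to 0 or to infinity.\<close>
    show ?thesis
    proof (cases "\<exists>\<phi>\<in>\<Phi>. \<exists>c. c \<noteq> 0 \<and> (\<lambda>n. w n / \<delta> \<phi> (\<sigma> n)) \<longlonglongrightarrow> c")
      case True
      then obtain \<phi> c where \<phi>: "\<phi> \<in> \<Phi>" "c \<noteq> 0" "(\<lambda>n. w n / \<delta> \<phi> (\<sigma> n)) \<longlonglongrightarrow> c" by blast
      obtain e A where A: "A \<noteq> 0" "((\<lambda>t. \<delta> \<phi> t * t powi (-e)) \<longlongrightarrow> A) (at 0)"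
      proof (rule meromorphic_at_0_cases[OF m\<delta>[OF \<phi>(1)]])
        assume "eventually (\<lambda>t. \<delta> \<phi> t = 0) (at 0)"
        then have "eventually (\<lambda>n. \<delta> \<phi> (\<sigma> n) = 0) sequentially" using \<sigma> by (rule eventually_compose_filterlim)
        then have "eventually (\<lambda>n. w n / \<delta> \<phi> (\<sigma> n) = 0) sequentially" by eventually_elim simp
        then have "(\<lambda>n. w n / \<delta> \<phi> (\<sigma> n)) \<longlonglongrightarrow> 0" by (rule tendsto_eventually)
        then have "c = 0" using LIMSEQ_unique \<phi>(3) by blast
        then show thesis using \<phi>(2) by simp
      qed (use that in blast)
      have A': "(\<lambda>n. \<delta> \<phi> (\<sigma> n) * \<sigma> n powi (-e)) \<longlonglongrightarrow> A" using filterlim_compose[OF A(2) \<sigma>] .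
      define C where "C = c * A"
      have C: "C \<noteq> 0" using A \<phi> by (simp add: C_def)
      have \<delta>nz: "eventually (\<lambda>n. \<delta> \<phi> (\<sigma> n) \<noteq> 0) sequentially"
        using tendsto_imp_eventually_ne[OF A' A(1)] by eventually_elim auto
      have wC: "(\<lambda>n. w n * \<sigma> n powi (-e)) \<longlonglongrightarrow> C"
      proof (rule Lim_transform_eventually)
        show "(\<lambda>n. (w n / \<delta> \<phi> (\<sigma> n)) * (\<delta> \<phi> (\<sigma> n) * \<sigma> n powi (-e))) \<longlonglongrightarrow> C"
          unfolding C_def by (intro tendsto_mult \<phi> A')
        show "eventually (\<lambda>n. (w n / \<delta> \<phi> (\<sigma> n)) * (\<delta> \<phi> (\<sigma> n) * \<sigma> n powi (-e)) = w n * \<sigma> n powi (-e)) sequentially"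
          using \<delta>nz by eventually_elim simp
      qed
      define Y where "Y s = \<phi>0 s + C * s powi e" for s
      have mY: "Y meromorphic_on {0}" unfolding Y_def using m\<Phi>[OF r1(1)] by (intro meromorphic_intros)
      have rat: "(\<lambda>n. (w n - \<delta> \<psi> (\<sigma> n)) / (C * \<sigma> n powi e - \<delta> \<psi> (\<sigma> n))) \<longlonglongrightarrow> 1" if \<psi>: "\<psi> \<in> \<Phi>" for \<psi>
      proof -
        define g where "g n = \<delta> \<psi> (\<sigma> n) * \<sigma> n powi (-e)" for n
        have mg: "(\<lambda>t. \<delta> \<psi> t * t powi (-e)) meromorphic_on {0}"
          by (intro meromorphic_intros m\<delta> \<psi>)
        have "\<exists>L. (\<lambda>n. 1 / (C - g n)) \<longlonglongrightarrow> L \<and> eventually (\<lambda>n. C - g n \<noteq> 0) sequentially"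
        proof (cases "\<exists>D. ((\<lambda>t. \<delta> \<psi> t * t powi (-e)) \<longlongrightarrow> D) (at 0)")
          case True
          then obtain D where "((\<lambda>t. \<delta> \<psi> t * t powi (-e)) \<longlongrightarrow> D) (at 0)" by blast
          then have D: "g \<longlonglongrightarrow> D" unfolding g_def by (rule filterlim_compose[OF _ \<sigma>])
          have "norm C \<le> norm (C - D)"
          proof (rule LIMSEQ_le)
            show "(\<lambda>n. norm (w n * \<sigma> n powi (-e))) \<longlonglongrightarrow> norm C" by (intro tendsto_intros wC)
            show "(\<lambda>n. norm (w n * \<sigma> n powi (-e) - g n)) \<longlonglongrightarrow> norm (C - D)" by (intro tendsto_intros wC D)
            have "norm (w n * \<sigma> n powi (-e)) \<le> norm (w n * \<sigma> n powi (-e) - g n)" for n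
            proof -
              have "w n * \<sigma> n powi (-e) - g n = (w n - \<delta> \<psi> (\<sigma> n)) * \<sigma> n powi (-e)"
                by (simp add: g_def algebra_simps)
              then show ?thesis using nearest[OF \<psi>, of n] by (simp add: norm_mult mult_right_mono)
            qed
            then show "\<exists>N. \<forall>n\<ge>N. norm (w n * \<sigma> n powi (-e)) \<le> norm (w n * \<sigma> n powi (-e) - g n)" by blast
          qed
          then have CD: "C - D \<noteq> 0" using C by auto
          have "(\<lambda>n. C - g n) \<longlonglongrightarrow> C - D" by (intro tendsto_intros D)
          then show ?thesis using CD
            by (intro exI[of _ "1 / (C - D)"] conjI tendsto_divide tendsto_const tendsto_imp_eventually_ne)
        next
          case False
          have "not_essential (\<lambda>t. \<delta> \<psi> t * t powi (-e)) 0" using mg by (simp add: meromorphic_at_iff)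
          then have "filterlim (\<lambda>t. \<delta> \<psi> t * t powi (-e)) at_infinity (at 0)"
            using False by (auto simp: not_essential_def is_pole_def)
          then have "filterlim g at_infinity sequentially" unfolding g_def by (rule filterlim_compose[OF _ \<sigma>])
          then have "filterlim (\<lambda>n. - g n) at_infinity sequentially" by (simp add: filterlim_at_infinity_conv_norm_at_top)
          then have inf: "filterlim (\<lambda>n. C + - g n) at_infinity sequentially"
            by (rule tendsto_add_filterlim_at_infinity[OF tendsto_const])
          then have "(\<lambda>n. 1 / (C + - g n)) \<longlonglongrightarrow> 0"
            by (rule tendsto_divide_0[OF tendsto_const])
          moreover have "eventually (\<lambda>n. C + - g n \<noteq> 0) sequentially"
            using filterlim_at_infinity_imp_eventually_ne[OF inf, of 0] by simp
          ultimately show ?thesis by (intro exI[of _ 0]) simp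
        qed
        then obtain L where L: "(\<lambda>n. 1 / (C - g n)) \<longlonglongrightarrow> L" "eventually (\<lambda>n. C - g n \<noteq> 0) sequentially" by blast
        have "(\<lambda>n. 1 + (w n * \<sigma> n powi (-e) - C) * (1 / (C - g n))) \<longlonglongrightarrow> 1 + (C - C) * L"
          by (intro tendsto_intros wC L)
        then have "(\<lambda>n. 1 + (w n * \<sigma> n powi (-e) - C) * (1 / (C - g n))) \<longlonglongrightarrow> 1" by simp
        moreover have "eventually (\<lambda>n. 1 + (w n * \<sigma> n powi (-e) - C) * (1 / (C - g n)) =
            (w n - \<delta> \<psi> (\<sigma> n)) / (C * \<sigma> n powi e - \<delta> \<psi> (\<sigma> n))) sequentially"
          using L(2)
        proof eventually_elim
          case (elim n)
          have p: "\<sigma> n powi (-e) * \<sigma> n powi e = 1" using \<sigma>nz[of n] by (simp add: power_int_minus)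
          have "1 + (w n * \<sigma> n powi (-e) - C) * (1 / (C - g n)) = (w n * \<sigma> n powi (-e) - g n) / (C - g n)"
            using elim by (simp add: field_simps)
          also have "\<dots> = ((w n - \<delta> \<psi> (\<sigma> n)) * \<sigma> n powi (-e)) / ((C * \<sigma> n powi e - \<delta> \<psi> (\<sigma> n)) * \<sigma> n powi (-e))"
            using p by (simp add: g_def algebra_simps)
          also have "\<dots> = (w n - \<delta> \<psi> (\<sigma> n)) / (C * \<sigma> n powi e - \<delta> \<psi> (\<sigma> n))"
            using \<sigma>nz[of n] by simp
          finally show ?case .
        qed
        ultimately show ?thesis by (rule Lim_transform_eventually)
      qed
      have "follows_ratios I f E X0 Y"
      proof (rule follows_ratios_asymptotic[OF mX0 mY r \<sigma>])
        fix i assume i: "i \<in> I"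
        have "(\<lambda>n. (\<Prod>\<psi>\<leftarrow>\<phi>s i. w n - \<delta> \<psi> (\<sigma> n)) / (\<Prod>\<psi>\<leftarrow>\<phi>s i. C * \<sigma> n powi e - \<delta> \<psi> (\<sigma> n))) \<longlonglongrightarrow> 1"
          by (rule prod_list_ratio_tendsto_1) (use rat i in \<open>auto simp: \<Phi>_def\<close>)
        moreover have "eventually (\<lambda>n. (\<forall>y. eval2 (f i) (\<xi> (\<sigma> n ^ M)) y = l i (\<sigma> n) * (\<Prod>\<phi>\<leftarrow>\<phi>s i. y - \<phi> (\<sigma> n))) \<and> l i (\<sigma> n) \<noteq> 0) sequentially"
          using fac[OF i] \<sigma> by (rule eventually_compose_filterlim)
        then have "eventually (\<lambda>n. (\<Prod>\<psi>\<leftarrow>\<phi>s i. w n - \<delta> \<psi> (\<sigma> n)) / (\<Prod>\<psi>\<leftarrow>\<phi>s i. C * \<sigma> n powi e - \<delta> \<psi> (\<sigma> n)) =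
            E i (r n) / eval2 (f i) (X0 (\<sigma> n)) (Y (\<sigma> n))) sequentially"
          using facE[OF i]
        proof eventually_elim
          case (elim n)
          have "Y (\<sigma> n) - \<psi> (\<sigma> n) = C * \<sigma> n powi e - \<delta> \<psi> (\<sigma> n)" for \<psi> by (simp add: Y_def \<delta>_def)
          then have "eval2 (f i) (X0 (\<sigma> n)) (Y (\<sigma> n)) = l i (\<sigma> n) * (\<Prod>\<psi>\<leftarrow>\<phi>s i. C * \<sigma> n powi e - \<delta> \<psi> (\<sigma> n))"
            using elim by (simp add: X0_def)
          then show ?case using elim by simp
        qed
        ultimately show "(\<lambda>n. E i (r n) / eval2 (f i) (X0 (\<sigma> n)) (Y (\<sigma> n))) \<longlonglongrightarrow> 1"
          by (rule Lim_transform_eventually)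
      qed
      then show ?thesis by blast
    next
      case False
      \<comment> \<open>\<open>S\<close> collects the branches whose distance from
        \<open>\<phi>0\<close> is small against w, including those that coincide with
        \<open>\<phi>0\<close>; in their factors w dominates.\<close>
      define Z where "Z \<phi> \<longleftrightarrow> eventually (\<lambda>t. \<delta> \<phi> t = 0) (at 0)" for \<phi>
      define S where "S \<phi> \<longleftrightarrow> Z \<phi> \<or> filterlim (\<lambda>n. w n / \<delta> \<phi> (\<sigma> n)) at_infinity sequentially" for \<phi>
      have small: "(\<lambda>n. \<delta> \<phi> (\<sigma> n) / w n) \<longlonglongrightarrow> 0" if "S \<phi>" for \<phi>
      proof (cases "Z \<phi>")
        case True
        then have "eventually (\<lambda>n. \<delta> \<phi> (\<sigma> n) = 0) sequentially"
          unfolding Z_def using \<sigma> by (rule eventually_compose_filterlim)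
        then have "eventually (\<lambda>n. \<delta> \<phi> (\<sigma> n) / w n = 0) sequentially" by eventually_elim simp
        then show ?thesis by (rule tendsto_eventually)
      next
        case False
        then have "filterlim (\<lambda>n. w n / \<delta> \<phi> (\<sigma> n)) at_infinity sequentially" using that by (simp add: S_def)
        then have "(\<lambda>n. 1 / (w n / \<delta> \<phi> (\<sigma> n))) \<longlonglongrightarrow> 0" by (rule tendsto_divide_0[OF tendsto_const])
        then show ?thesis by simp
      qed
      have ex: "\<exists>e A. A \<noteq> 0 \<and> ((\<lambda>t. \<delta> \<phi> t * t powi (-e)) \<longlongrightarrow> A) (at 0)" if "\<phi> \<in> \<Phi>" "\<not> Z \<phi>" for \<phi>
        by (rule meromorphic_at_0_cases[OF m\<delta>[OF that(1)]]) (use that(2) in \<open>auto simp: Z_def\<close>)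
      have "\<forall>\<phi>\<in>{\<phi>\<in>\<Phi>. \<not> Z \<phi>}. \<exists>p. snd p \<noteq> 0 \<and> ((\<lambda>t. \<delta> \<phi> t * t powi (- fst p)) \<longlongrightarrow> snd p) (at 0)"
        using ex by auto
      then obtain eA where eA: "\<forall>\<phi>\<in>{\<phi>\<in>\<Phi>. \<not> Z \<phi>}. snd (eA \<phi>) \<noteq> 0 \<and> ((\<lambda>t. \<delta> \<phi> t * t powi (- fst (eA \<phi>))) \<longlongrightarrow> snd (eA \<phi>)) (at 0)"
        by (rule bchoice[THEN exE]) blast
      define e A where "e = (\<lambda>\<phi>. fst (eA \<phi>))" and "A = (\<lambda>\<phi>. snd (eA \<phi>))"
      have A: "A \<phi> \<noteq> 0" "((\<lambda>t. \<delta> \<phi> t * t powi (- e \<phi>)) \<longlongrightarrow> A \<phi>) (at 0)" if "\<phi> \<in> \<Phi>" "\<not> Z \<phi>" for \<phi>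
        using eA that by (auto simp: e_def A_def)
      have A': "(\<lambda>n. \<delta> \<phi> (\<sigma> n) * \<sigma> n powi (- e \<phi>)) \<longlonglongrightarrow> A \<phi>" if "\<phi> \<in> \<Phi>" "\<not> Z \<phi>" for \<phi>
        using filterlim_compose[OF A(2)[OF that] \<sigma>] .
      have \<delta>ev: "eventually (\<lambda>t. \<delta> \<phi> t \<noteq> 0) (at 0)" if "\<phi> \<in> \<Phi>" "\<not> Z \<phi>" for \<phi>
        using tendsto_imp_eventually_ne[OF A(2)[OF that] A(1)[OF that]] by eventually_elim auto
      have \<delta>evn: "eventually (\<lambda>n. \<delta> \<phi> (\<sigma> n) \<noteq> 0) sequentially" if "\<phi> \<in> \<Phi>" "\<not> Z \<phi>" for \<phi>
        using \<delta>ev[OF that] \<sigma> by (rule eventually_compose_filterlim)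
      have big: "(\<lambda>n. w n / \<delta> \<phi> (\<sigma> n)) \<longlonglongrightarrow> 0" if "\<phi> \<in> \<Phi>" "\<not> S \<phi>" for \<phi>
      proof -
        have "\<not> filterlim (\<lambda>n. w n / \<delta> \<phi> (\<sigma> n)) at_infinity sequentially"
          using that(2) by (simp add: S_def)
        then have "\<exists>c. (\<lambda>n. w n / \<delta> \<phi> (\<sigma> n)) \<longlonglongrightarrow> c" using ratio[OF that(1)] by auto
        then obtain c where c: "(\<lambda>n. w n / \<delta> \<phi> (\<sigma> n)) \<longlonglongrightarrow> c" by blast
        then have "c = 0" using False that(1) by auto
        then show ?thesis using c by simp
      qed
      have SZ: "\<not> S \<phi> \<Longrightarrow> \<not> Z \<phi>" for \<phi> by (simp add: S_def)
      define b where "b i = length (filter S (\<phi>s i))" for i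
      define \<beta> where "\<beta> i t = l i t * (\<Prod>\<phi>\<leftarrow>filter (\<lambda>\<phi>. \<not> S \<phi>) (\<phi>s i). - \<delta> \<phi> t)" for i t
      have in\<Phi>: "\<phi> \<in> \<Phi>" if "i \<in> I" "\<phi> \<in> set (\<phi>s i)" for i \<phi> using that by (auto simp: \<Phi>_def)
      have m\<beta>: "\<beta> i meromorphic_on {0}" if "i \<in> I" for i
        unfolding \<beta>_def
        by (intro meromorphic_intros lm meromorphic_at_0_prod_list m\<delta>) (use in\<Phi>[OF that] in auto)
      have \<beta>nz: "eventually (\<lambda>t. \<beta> i t \<noteq> 0) (at 0)" if i: "i \<in> I" for i
      proof -
        have "eventually (\<lambda>t. (\<Prod>\<phi>\<leftarrow>filter (\<lambda>\<phi>. \<not> S \<phi>) (\<phi>s i). - \<delta> \<phi> t) \<noteq> 0) (at 0)"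
        proof (rule eventually_prod_list_nonzero)
          fix d assume "d \<in> set (filter (\<lambda>\<phi>. \<not> S \<phi>) (\<phi>s i))"
          then have "eventually (\<lambda>t. \<delta> d t \<noteq> 0) (at 0)" using \<delta>ev in\<Phi>[OF i] SZ by auto
          then show "eventually (\<lambda>t. - \<delta> d t \<noteq> 0) (at 0)" by eventually_elim simp
        qed
        then show ?thesis using fac[OF i] by eventually_elim (simp add: \<beta>_def)
      qed
      have "\<exists>p. snd p \<noteq> 0 \<and> ((\<lambda>t. \<beta> i t * t powi (- fst p)) \<longlongrightarrow> snd p) (at 0)" if i: "i \<in> I" for i
      proof (rule meromorphic_at_0_cases[OF m\<beta>[OF i]])
        assume "eventually (\<lambda>t. \<beta> i t = 0) (at 0)"
        then have "eventually (\<lambda>t. False) (at (0::complex))" using \<beta>nz[OF i] by eventually_elim simp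
        then show ?thesis by simp
      qed (auto)
      then have "\<forall>i\<in>I. \<exists>p. snd p \<noteq> 0 \<and> ((\<lambda>t. \<beta> i t * t powi (- fst p)) \<longlongrightarrow> snd p) (at 0)" by blast
      then obtain pB where pB: "\<forall>i\<in>I. snd (pB i) \<noteq> 0 \<and> ((\<lambda>t. \<beta> i t * t powi (- fst (pB i))) \<longlongrightarrow> snd (pB i)) (at 0)"
        by (rule bchoice[THEN exE]) blast
      define \<epsilon> B where "\<epsilon> = (\<lambda>i. fst (pB i))" and "B = (\<lambda>i. snd (pB i))"
      have B: "B i \<noteq> 0" "((\<lambda>t. \<beta> i t * t powi (- \<epsilon> i)) \<longlongrightarrow> B i) (at 0)" if "i \<in> I" for i
        using pB that by (auto simp: \<epsilon>_def B_def)
      \<comment> \<open>Each value is asymptotic to a nonzero constant times a monomial in w and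
        \<sigma>, so every ratio is a monomial up to a factor with a nonzero limit.\<close>
      have EB: "(\<lambda>n. E i (r n) / (w n powi int (b i) * \<sigma> n powi \<epsilon> i)) \<longlonglongrightarrow> B i" if i: "i \<in> I" for i
      proof -
        have "(\<lambda>n. (\<Prod>\<phi>\<leftarrow>\<phi>s i. w n - \<delta> \<phi> (\<sigma> n)) / (w n ^ length (filter S (\<phi>s i)) *
            (\<Prod>\<phi>\<leftarrow>filter (\<lambda>d. \<not> S d) (\<phi>s i). - \<delta> \<phi> (\<sigma> n)))) \<longlonglongrightarrow> 1"
          by (rule prod_list_dominant) (use small big \<delta>evn SZ wnz in\<Phi>[OF i] in auto)
        then have "(\<lambda>n. (\<Prod>\<phi>\<leftarrow>\<phi>s i. w n - \<delta> \<phi> (\<sigma> n)) / (w n ^ length (filter S (\<phi>s i)) *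
            (\<Prod>\<phi>\<leftarrow>filter (\<lambda>d. \<not> S d) (\<phi>s i). - \<delta> \<phi> (\<sigma> n))) * (\<beta> i (\<sigma> n) * \<sigma> n powi (- \<epsilon> i))) \<longlonglongrightarrow> 1 * B i"
          by (rule tendsto_mult) (rule filterlim_compose[OF B(2)[OF i] \<sigma>])
        then have "(\<lambda>n. (\<Prod>\<phi>\<leftarrow>\<phi>s i. w n - \<delta> \<phi> (\<sigma> n)) / (w n ^ length (filter S (\<phi>s i)) *
            (\<Prod>\<phi>\<leftarrow>filter (\<lambda>d. \<not> S d) (\<phi>s i). - \<delta> \<phi> (\<sigma> n))) * (\<beta> i (\<sigma> n) * \<sigma> n powi (- \<epsilon> i))) \<longlonglongrightarrow> B i" by simp
        moreover have "eventually (\<lambda>n. \<beta> i (\<sigma> n) \<noteq> 0) sequentially"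
          using \<beta>nz[OF i] \<sigma> by (rule eventually_compose_filterlim)
        then have "eventually (\<lambda>n. (\<Prod>\<phi>\<leftarrow>\<phi>s i. w n - \<delta> \<phi> (\<sigma> n)) / (w n ^ length (filter S (\<phi>s i)) *
            (\<Prod>\<phi>\<leftarrow>filter (\<lambda>d. \<not> S d) (\<phi>s i). - \<delta> \<phi> (\<sigma> n))) * (\<beta> i (\<sigma> n) * \<sigma> n powi (- \<epsilon> i)) =
            E i (r n) / (w n powi int (b i) * \<sigma> n powi \<epsilon> i)) sequentially"
          using facE[OF i] wnz
        proof eventually_elim
          case (elim n)
          have alg: "Q \<noteq> 0 \<Longrightarrow> R / (u * Q) * (k * Q * inverse z) = k * R / (u * z)" for R u Q k z :: complex
          proof -
            assume "Q \<noteq> 0"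
            then have "k * Q * inverse z = (k * inverse z) * Q" "R / (u * Q) * Q = R / u" by (simp_all add: mult_ac)
            then have "R / (u * Q) * (k * Q * inverse z) = R / u * (k * inverse z)"
              by (metis mult.assoc mult.commute)
            then show ?thesis by (simp add: divide_inverse mult_ac)
          qed
          have "(\<Prod>\<phi>\<leftarrow>filter (\<lambda>d. \<not> S d) (\<phi>s i). - \<delta> \<phi> (\<sigma> n)) \<noteq> 0" using elim(1) by (simp add: \<beta>_def)
          note alg = alg[OF this]
          have "E i (r n) = l i (\<sigma> n) * (\<Prod>\<phi>\<leftarrow>\<phi>s i. w n - \<delta> \<phi> (\<sigma> n))" using elim(2) by blast
          then show ?case
            unfolding \<beta>_def b_def power_int_minus power_int_of_nat by (simp only: alg)
        qed
        ultimately show ?thesis by (rule Lim_transform_eventually)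
      qed
      \<comment> \<open>The exponents of the monomials that have to tend to 0: \<sigma> itself, the
        comparisons of w with the other branches, and the ratios of values that tend to 0.\<close>
      define \<Lambda> where "\<Lambda> = {(1, 0)} \<union> (\<lambda>\<phi>. (e \<phi>, -1)) ` {\<phi>\<in>\<Phi>. S \<phi> \<and> \<not> Z \<phi>} \<union>
         (\<lambda>\<phi>. (- e \<phi>, 1)) ` {\<phi>\<in>\<Phi>. \<not> S \<phi>} \<union>
         (\<lambda>(i, j). (\<epsilon> i - \<epsilon> j, int (b i) - int (b j))) ` {(i, j) \<in> I \<times> I. (\<lambda>n. E i n / E j n) \<longlonglongrightarrow> 0}"
      have fin\<Lambda>: "finite \<Lambda>"
      proof -
        have "finite {(i, j) \<in> I \<times> I. (\<lambda>n. E i n / E j n) \<longlonglongrightarrow> 0}"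
          by (rule finite_subset[of _ "I \<times> I"]) (use fin in auto)
        then show ?thesis unfolding \<Lambda>_def using fin\<Phi> by auto
      qed
      have \<sigma>wnz: "eventually (\<lambda>n. \<sigma> n \<noteq> 0 \<and> w n \<noteq> 0) sequentially"
        using wnz by eventually_elim (simp add: \<sigma>nz)
      have \<Lambda>lim: "(\<lambda>n. \<sigma> n powi a * w n powi c) \<longlonglongrightarrow> 0" if "(a, c) \<in> \<Lambda>" for a c
      proof -
        consider "a = 1" "c = 0" | \<phi> where "\<phi> \<in> \<Phi>" "S \<phi>" "\<not> Z \<phi>" "a = e \<phi>" "c = -1"
          | \<phi> where "\<phi> \<in> \<Phi>" "\<not> S \<phi>" "a = - e \<phi>" "c = 1"
          | i j where "i \<in> I" "j \<in> I" "(\<lambda>n. E i n / E j n) \<longlonglongrightarrow> 0" "a = \<epsilon> i - \<epsilon> j" "c = int (b i) - int (b j)"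
          using \<open>(a, c) \<in> \<Lambda>\<close> unfolding \<Lambda>_def by fastforce
        then show ?thesis
        proof cases
          case 1
          then show ?thesis using \<sigma>0 by simp
        next
          case 2
          have "(\<lambda>n. (\<delta> \<phi> (\<sigma> n) / w n) / (\<delta> \<phi> (\<sigma> n) * \<sigma> n powi (- e \<phi>))) \<longlonglongrightarrow> 0 / A \<phi>"
            using 2 by (intro tendsto_divide small A' A)
          then have "(\<lambda>n. (\<delta> \<phi> (\<sigma> n) / w n) / (\<delta> \<phi> (\<sigma> n) * \<sigma> n powi (- e \<phi>))) \<longlonglongrightarrow> 0" by simp
          moreover have "eventually (\<lambda>n. (\<delta> \<phi> (\<sigma> n) / w n) / (\<delta> \<phi> (\<sigma> n) * \<sigma> n powi (- e \<phi>)) = \<sigma> n powi a * w n powi c) sequentially"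
            using \<delta>evn[OF 2(1,3)] \<sigma>wnz
            by eventually_elim (simp add: 2 power_int_minus field_simps)
          ultimately show ?thesis by (rule Lim_transform_eventually)
        next
          case 3
          have "(\<lambda>n. (w n / \<delta> \<phi> (\<sigma> n)) * (\<delta> \<phi> (\<sigma> n) * \<sigma> n powi (- e \<phi>))) \<longlonglongrightarrow> 0 * A \<phi>"
            using 3 by (intro tendsto_mult big A' SZ)
          then have "(\<lambda>n. (w n / \<delta> \<phi> (\<sigma> n)) * (\<delta> \<phi> (\<sigma> n) * \<sigma> n powi (- e \<phi>))) \<longlonglongrightarrow> 0" by simp
          moreover have "eventually (\<lambda>n. (w n / \<delta> \<phi> (\<sigma> n)) * (\<delta> \<phi> (\<sigma> n) * \<sigma> n powi (- e \<phi>)) = \<sigma> n powi a * w n powi c) sequentially"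
            using \<delta>evn[OF 3(1) SZ[OF 3(2)]] \<sigma>wnz
            by eventually_elim (simp add: 3 power_int_minus field_simps)
          ultimately show ?thesis by (rule Lim_transform_eventually)
        next
          case 4
          have "(\<lambda>n. E i (r n) / E j (r n)) \<longlonglongrightarrow> 0"
            using LIMSEQ_subseq_LIMSEQ[OF 4(3) r] by (simp add: o_def)
          then have "(\<lambda>n. (E i (r n) / E j (r n)) * (E j (r n) / (w n powi int (b j) * \<sigma> n powi \<epsilon> j)) /
             (E i (r n) / (w n powi int (b i) * \<sigma> n powi \<epsilon> i))) \<longlonglongrightarrow> 0 * B j / B i"
            using 4 by (intro tendsto_divide tendsto_mult EB B)
          then have "(\<lambda>n. (E i (r n) / E j (r n)) * (E j (r n) / (w n powi int (b j) * \<sigma> n powi \<epsilon> j)) /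
             (E i (r n) / (w n powi int (b i) * \<sigma> n powi \<epsilon> i))) \<longlonglongrightarrow> 0" by simp
          moreover have "eventually (\<lambda>n. (E i (r n) / E j (r n)) * (E j (r n) / (w n powi int (b j) * \<sigma> n powi \<epsilon> j)) /
             (E i (r n) / (w n powi int (b i) * \<sigma> n powi \<epsilon> i)) = \<sigma> n powi a * w n powi c) sequentially"
            using \<sigma>wnz
          proof eventually_elim
            case (elim n)
            have "\<sigma> n powi a * w n powi c = (\<sigma> n powi \<epsilon> i / \<sigma> n powi \<epsilon> j) * (w n powi int (b i) / w n powi int (b j))"
              using elim by (simp add: 4 power_int_diff)
            then show ?case using elim Enz[OF 4(1), of "r n"] Enz[OF 4(2), of "r n"] by (simp add: field_simps)
          qed
          ultimately show ?thesis by (rule Lim_transform_eventually)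
        qed
      qed
      have "(1, 0) \<in> \<Lambda>" by (simp add: \<Lambda>_def)
      then obtain p q where pq: "p \<ge> (1::int)" "\<And>a c. (a, c) \<in> \<Lambda> \<Longrightarrow> a * p + c * q > 0"
        using separating_exponents[of \<Lambda> \<sigma> w, OF fin\<Lambda> _ \<sigma>wnz \<Lambda>lim] by blast
      define P where "P = nat p"
      have P: "P \<ge> 1" "int P = p" using pq(1) by (auto simp: P_def)
      define X where "X s = X0 (s ^ P)" for s
      \<comment> \<open>s^P takes the place of \<sigma> and s^q that of w; q may be negative, hence
        the integer power.\<close>
      define v where "v s = s powi q" for s :: complex
      define Y where "Y s = \<phi>0 (s ^ P) + v s" for s
      have mX: "X meromorphic_on {0}" unfolding X_def using mX0 P(1) by (rule meromorphic_at_0_compose_power)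
      have mY: "Y meromorphic_on {0}" unfolding Y_def v_def
        using meromorphic_at_0_compose_power[OF m\<Phi>[OF r1(1)] P(1)] by (intro meromorphic_intros)
      have ev0: "eventually (\<lambda>s. s \<noteq> 0) (at (0::complex))" by (simp add: eventually_neq_at_within)
      have smallc: "((\<lambda>s. \<delta> \<phi> (s ^ P) / v s) \<longlongrightarrow> 0) (at 0)" if "\<phi> \<in> \<Phi>" "S \<phi>" for \<phi>
      proof (cases "Z \<phi>")
        case True
        have "eventually (\<lambda>s. \<delta> \<phi> (s ^ P) = 0) (at 0)"
          using True P(1) unfolding Z_def by (rule eventually_at_0_compose_power)
        then have "eventually (\<lambda>s. \<delta> \<phi> (s ^ P) / v s = 0) (at 0)" by eventually_elim simp
        then show ?thesis by (rule tendsto_eventually)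
      next
        case False
        have "(e \<phi>, -1) \<in> \<Lambda>" using that False by (auto simp: \<Lambda>_def)
        from pq(2)[OF this] have less: "q < int P * e \<phi>" using P(2) by (simp add: mult.commute)
        have "((\<lambda>s. \<delta> \<phi> (s ^ P) * s powi (- q)) \<longlongrightarrow> (if q = int P * e \<phi> then A \<phi> else 0)) (at 0)"
          by (rule mero_coeff_tendsto[OF A(2)[OF that(1) False] P(1)]) (use less in simp)
        then show ?thesis using less by (simp add: v_def power_int_minus divide_inverse)
      qed
      have Ac: "((\<lambda>s. \<delta> \<phi> (s ^ P) * s powi (- (int P * e \<phi>))) \<longlongrightarrow> A \<phi>) (at 0)" if "\<phi> \<in> \<Phi>" "\<not> Z \<phi>" for \<phi>
        using mero_coeff_tendsto[OF A(2)[OF that] P(1) order_refl] by simp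
      have bigc: "((\<lambda>s. v s / \<delta> \<phi> (s ^ P)) \<longlongrightarrow> 0) (at 0)" if "\<phi> \<in> \<Phi>" "\<not> S \<phi>" for \<phi>
      proof -
        have "(- e \<phi>, 1) \<in> \<Lambda>" using that by (auto simp: \<Lambda>_def)
        from pq(2)[OF this] have pos: "q - int P * e \<phi> > 0" using P(2) by (simp add: mult.commute)
        have "((\<lambda>s. s powi (q - int P * e \<phi>) / (\<delta> \<phi> (s ^ P) * s powi (- (int P * e \<phi>)))) \<longlongrightarrow> 0 / A \<phi>) (at 0)"
          using that SZ[OF that(2)] by (intro tendsto_divide tendsto_power_int_at_0 pos Ac A)
        then have "((\<lambda>s. s powi (q - int P * e \<phi>) / (\<delta> \<phi> (s ^ P) * s powi (- (int P * e \<phi>)))) \<longlongrightarrow> 0) (at 0)" by simp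
        moreover have "eventually (\<lambda>s. s powi (q - int P * e \<phi>) / (\<delta> \<phi> (s ^ P) * s powi (- (int P * e \<phi>))) = v s / \<delta> \<phi> (s ^ P)) (at 0)"
          using ev0 by eventually_elim (simp add: v_def power_int_diff power_int_minus field_simps)
        ultimately show ?thesis by (rule Lim_transform_eventually)
      qed
      define m where "m i = q * int (b i) + int P * \<epsilon> i" for i
      define G where "G i s = eval2 (f i) (X s) (Y s)" for i s
      have GB: "((\<lambda>s. G i s * s powi (- m i)) \<longlongrightarrow> B i) (at 0)" if i: "i \<in> I" for i
      proof -
        have "((\<lambda>s. (\<Prod>\<phi>\<leftarrow>\<phi>s i. v s - \<delta> \<phi> (s ^ P)) / (v s ^ length (filter S (\<phi>s i)) *
            (\<Prod>\<phi>\<leftarrow>filter (\<lambda>d. \<not> S d) (\<phi>s i). - \<delta> \<phi> (s ^ P)))) \<longlongrightarrow> 1) (at 0)"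
        proof (rule prod_list_dominant)
          show "eventually (\<lambda>s. v s \<noteq> 0) (at 0)" using ev0 by eventually_elim (simp add: v_def)
          show "((\<lambda>x. v x / \<delta> d (x ^ P)) \<longlongrightarrow> 0) (at 0) \<and> (\<forall>\<^sub>F x in at 0. \<delta> d (x ^ P) \<noteq> 0)"
            if "d \<in> set (\<phi>s i)" "\<not> S d" for d
            using bigc \<delta>ev in\<Phi>[OF i] that SZ eventually_at_0_compose_power[OF _ P(1)] by blast
        qed (use smallc in\<Phi>[OF i] in auto)
        then have "((\<lambda>s. (\<Prod>\<phi>\<leftarrow>\<phi>s i. v s - \<delta> \<phi> (s ^ P)) / (v s ^ length (filter S (\<phi>s i)) *
            (\<Prod>\<phi>\<leftarrow>filter (\<lambda>d. \<not> S d) (\<phi>s i). - \<delta> \<phi> (s ^ P))) * (\<beta> i (s ^ P) * s powi (- (int P * \<epsilon> i)))) \<longlongrightarrow> 1 * B i) (at 0)"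
          by (rule tendsto_mult) (use mero_coeff_tendsto[OF B(2)[OF i] P(1) order_refl] in simp)
        then have "((\<lambda>s. (\<Prod>\<phi>\<leftarrow>\<phi>s i. v s - \<delta> \<phi> (s ^ P)) / (v s ^ length (filter S (\<phi>s i)) *
            (\<Prod>\<phi>\<leftarrow>filter (\<lambda>d. \<not> S d) (\<phi>s i). - \<delta> \<phi> (s ^ P))) * (\<beta> i (s ^ P) * s powi (- (int P * \<epsilon> i)))) \<longlongrightarrow> B i) (at 0)"
          by simp
        moreover have "eventually (\<lambda>s. (\<Prod>\<phi>\<leftarrow>\<phi>s i. v s - \<delta> \<phi> (s ^ P)) / (v s ^ length (filter S (\<phi>s i)) *
            (\<Prod>\<phi>\<leftarrow>filter (\<lambda>d. \<not> S d) (\<phi>s i). - \<delta> \<phi> (s ^ P))) * (\<beta> i (s ^ P) * s powi (- (int P * \<epsilon> i))) =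
            G i s * s powi (- m i)) (at 0)"
          using eventually_at_0_compose_power[OF fac[OF i] P(1)] eventually_at_0_compose_power[OF \<beta>nz[OF i] P(1)] ev0
        proof eventually_elim
          case (elim s)
          have "Y s - \<phi> (s ^ P) = v s - \<delta> \<phi> (s ^ P)" for \<phi> by (simp add: Y_def \<delta>_def)
          then have 1: "G i s = l i (s ^ P) * (\<Prod>\<phi>\<leftarrow>\<phi>s i. v s - \<delta> \<phi> (s ^ P))"
            using elim by (simp add: X_def X0_def G_def)
          have "s powi (- m i) = s powi (- (q * int (b i))) * s powi (- (int P * \<epsilon> i))"
          proof -
            have "- m i = - (q * int (b i)) + - (int P * \<epsilon> i)" by (simp add: m_def)
            moreover have "s powi (a + c) = s powi a * s powi c" for a c
              using elim by (auto simp: power_int_add)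
            ultimately show ?thesis by metis
          qed
          moreover have "s powi (- (q * int (b i))) = 1 / v s ^ length (filter S (\<phi>s i))"
            by (simp only: power_int_minus v_def b_def power_int_mult power_int_of_nat inverse_eq_divide)
          ultimately have 2: "s powi (- m i) = s powi (- (int P * \<epsilon> i)) / v s ^ length (filter S (\<phi>s i))" by simp
          have "(\<Prod>\<phi>\<leftarrow>filter (\<lambda>d. \<not> S d) (\<phi>s i). - \<delta> \<phi> (s ^ P)) \<noteq> 0" using elim(2) by (simp add: \<beta>_def)
          then show ?case unfolding 1 2 \<beta>_def by (simp add: field_simps)
        qed
        ultimately show ?thesis by (rule Lim_transform_eventually)
      qed
      have Gnz: "eventually (\<lambda>s. G i s \<noteq> 0) (at 0)" if "i \<in> I" for i
        using tendsto_imp_eventually_ne[OF GB[OF that] B(1)[OF that]] by eventually_elim auto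
      have "((\<lambda>s. G i s / G j s) \<longlongrightarrow> 0) (at 0)" if ij: "i \<in> I" "j \<in> I" "(\<lambda>n. E i n / E j n) \<longlonglongrightarrow> 0" for i j
      proof -
        have "(\<epsilon> i - \<epsilon> j, int (b i) - int (b j)) \<in> \<Lambda>" using ij by (auto simp: \<Lambda>_def)
        from pq(2)[OF this] have pos: "m i - m j > 0" by (simp add: m_def P(2) algebra_simps)
        have "((\<lambda>s. (G i s * s powi (- m i)) / (G j s * s powi (- m j)) * s powi (m i - m j)) \<longlongrightarrow> B i / B j * 0) (at 0)"
          using ij by (intro tendsto_mult tendsto_divide GB B tendsto_power_int_at_0 pos)
        then have "((\<lambda>s. (G i s * s powi (- m i)) / (G j s * s powi (- m j)) * s powi (m i - m j)) \<longlongrightarrow> 0) (at 0)" by simp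
        moreover have "eventually (\<lambda>s. (G i s * s powi (- m i)) / (G j s * s powi (- m j)) * s powi (m i - m j) = G i s / G j s) (at 0)"
          using ev0 by eventually_elim (simp add: power_int_minus power_int_diff field_simps)
        ultimately show ?thesis by (rule Lim_transform_eventually)
      qed
      then have "follows_ratios I f E X Y" using mX mY Gnz by (simp add: follows_ratios_def G_def)
      then show ?thesis by blast
    qed
  qed
qed

section \<open>Fatou's bound for attracting cycles\<close>

definition qmap :: "complex \<Rightarrow> complex \<Rightarrow> complex \<Rightarrow> complex \<Rightarrow> complex \<Rightarrow> complex" where
  "qmap a b c d z = (a * z\<^sup>2 + b) / (c * z\<^sup>2 + d)"

definition qder :: "complex \<Rightarrow> complex \<Rightarrow> complex \<Rightarrow> complex \<Rightarrow> complex \<Rightarrow> complex" where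
  "qder a b c d z = 2 * (a * d - b * c) * z / (c * z\<^sup>2 + d)\<^sup>2"

definition qmult :: "complex \<Rightarrow> complex \<Rightarrow> complex \<Rightarrow> complex \<Rightarrow> nat \<Rightarrow> complex \<Rightarrow> complex" where
  "qmult a b c d l z = (\<Prod>i<l. qder a b c d ((qmap a b c d ^^ i) z))"

lemma qmap_has_field_derivative:
  assumes "c * z\<^sup>2 + d \<noteq> 0"
  shows "(qmap a b c d has_field_derivative qder a b c d z) (at z)"
  unfolding qmap_def[abs_def] qder_def
  by (rule derivative_eq_intros refl assms)+ (use assms in \<open>simp add: field_simps power2_eq_square\<close>)

lemma qmap_iterate_has_field_derivative:
  assumes "\<And>i. i < l \<Longrightarrow> c * ((qmap a b c d ^^ i) z)\<^sup>2 + d \<noteq> 0"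
  shows "((qmap a b c d ^^ l) has_field_derivative qmult a b c d l z) (at z)"
  using assms
proof (induction l)
  case 0
  then show ?case by (simp add: qmult_def id_def)
next
  case (Suc l)
  have "((qmap a b c d ^^ l) has_field_derivative qmult a b c d l z) (at z)" using Suc by simp
  moreover have "(qmap a b c d has_field_derivative qder a b c d ((qmap a b c d ^^ l) z)) (at ((qmap a b c d ^^ l) z))"
    using Suc.prems by (intro qmap_has_field_derivative) auto
  ultimately have "(qmap a b c d \<circ> (qmap a b c d ^^ l) has_field_derivative
      qder a b c d ((qmap a b c d ^^ l) z) * qmult a b c d l z) (at z)"
    by (rule DERIV_chain[rotated])
  then show ?case by (simp add: qmult_def mult.commute o_def)
qed

lemma funpow_mult_fixed:
  assumes "(f ^^ l) p = p"
  shows "(f ^^ (l * n)) p = p"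
  by (induction n) (use assms in \<open>simp_all add: funpow_add\<close>)

lemma funpow_mod_period:
  assumes "(f ^^ l) p = p"
  shows "(f ^^ k) p = (f ^^ (k mod l)) p"
proof -
  have "(f ^^ k) p = (f ^^ (k mod l + l * (k div l))) p" by simp
  also have "\<dots> = (f ^^ (k mod l)) p" by (simp only: funpow_add o_apply funpow_mult_fixed[OF assms])
  finally show ?thesis .
qed

text \<open>At a pole the formula of \<open>qder\<close> divides by 0 and gives 0. A nonzero
  multiplier therefore certifies that the orbit meets no pole.\<close>

lemma qmult_nonzero_imp_finite_orbit:
  assumes "qmult a b c d l p \<noteq> 0" "i < l"
  shows "c * ((qmap a b c d ^^ i) p)\<^sup>2 + d \<noteq> 0"
  using assms by (auto simp: qmult_def qder_def)

lemma qmult_nonzero_periodic_imp_finite_orbit: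
  assumes "qmult a b c d l p \<noteq> 0" "(qmap a b c d ^^ l) p = p" "l > 0"
  shows "c * ((qmap a b c d ^^ i) p)\<^sup>2 + d \<noteq> 0"
  using qmult_nonzero_imp_finite_orbit[OF assms(1), of "i mod l"] assms(3)
  by (simp add: funpow_mod_period[OF assms(2), of i])

lemma qmult_power:
  assumes "(qmap a b c d ^^ l) p = p"
  shows "qmult a b c d (l * n) p = qmult a b c d l p ^ n"
proof (induction n)
  case (Suc n)
  have "qmult a b c d (l * Suc n) p = (\<Prod>i<l * n. qder a b c d ((qmap a b c d ^^ i) p)) *
      (\<Prod>i\<in>{l * n..<l * n + l}. qder a b c d ((qmap a b c d ^^ i) p))"
    unfolding qmult_def
    by (subst prod.union_disjoint[symmetric]) (auto intro!: prod.cong)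
  also have "(\<Prod>i\<in>{l * n..<l * n + l}. qder a b c d ((qmap a b c d ^^ i) p)) =
      (\<Prod>i<l. qder a b c d ((qmap a b c d ^^ (i + l * n)) p))"
    using prod.shift_bounds_nat_ivl[of "\<lambda>i. qder a b c d ((qmap a b c d ^^ i) p)" 0 "l * n" l]
    by (simp add: atLeast0LessThan add.commute)
  also have "\<dots> = qmult a b c d l p"
    unfolding qmult_def by (simp add: funpow_add funpow_mult_fixed[OF assms])
  finally show ?case using Suc by (simp add: qmult_def mult.commute)
qed (simp add: qmult_def)

text \<open>Fatou's argument: if the orbits of the critical values \<open>b\<close> and \<open>1 / c\<close> avoid a disc around the attracting
  point \<open>p\<close>, all iterates have inverse branches on the disc. They omit a disc around \<open>q\<close>, so they
  are a normal family, but their derivatives at \<open>p\<close> are unbounded.\<close>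

lemma inverse_branch_contradiction:
  fixes b c p q :: complex and l :: nat
  defines "F \<equiv> qmap 1 b c 1"
  assumes bc: "b * c \<noteq> 1" and p: "(F ^^ l) p = p" "l > 0"
    and \<rho>: "qmult 1 b c 1 l p \<noteq> 0" "norm (qmult 1 b c 1 l p) < 1"
    and r: "r > 0" and nb: "\<And>k. (F ^^ k) b \<notin> ball p r" and nc: "\<And>k. (F ^^ k) (1 / c) \<notin> ball p r"
    and s: "s > 0" and q: "\<And>u k. u \<in> ball q s \<Longrightarrow> (F ^^ k) u \<notin> ball p r"
  shows False
proof -
  define \<rho> where "\<rho> = qmult 1 b c 1 l p"
  \<comment> \<open>Following the cycle backwards by n steps is the same as going forwards by n (l -
    1) steps; this fixes the branch at p.\<close>
  have branch: "\<exists>h. h holomorphic_on ball p r \<and> (\<forall>u\<in>ball p r. (F ^^ n) (h u) = u) \<and> h p = (F ^^ (n * (l - 1))) p" for n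
  proof (induction n)
    case 0
    show ?case by (rule exI[of _ "\<lambda>u. u"]) (auto intro: holomorphic_intros)
  next
    case (Suc n)
    then obtain h where h: "h holomorphic_on ball p r" "\<And>u. u \<in> ball p r \<Longrightarrow> (F ^^ n) (h u) = u"
      "h p = (F ^^ (n * (l - 1))) p" by blast
    have hb: "h u \<noteq> b" if "u \<in> ball p r" for u
      using h(2)[OF that] nb[of n] that by auto
    have hc: "1 - c * h u \<noteq> 0" if "u \<in> ball p r" for u
    proof
      assume e: "1 - c * h u = 0"
      then have "c \<noteq> 0" by auto
      then have "h u = 1 / c" using e by (simp add: field_simps)
      then show False using h(2)[OF that] nc[of n] that by auto
    qed
    \<comment> \<open>The solution v^2 of (v^2 + b) / (c v^2 + 1) = h. A zero of g means h = b and a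
      pole means h = 1 / c, so both are excluded by the orbits of the critical values, and g has a
      square root.\<close>
    define g where "g u = (h u - b) / (1 - c * h u)" for u
    have "g holomorphic_on ball p r" unfolding g_def by (intro holomorphic_intros h(1) hc)
    moreover have "g u \<noteq> 0" if "u \<in> ball p r" for u using hb[OF that] hc[OF that] by (simp add: g_def)
    ultimately obtain k where k: "k holomorphic_on ball p r" "\<And>u. u \<in> ball p r \<Longrightarrow> g u = (k u)\<^sup>2"
      using contractible_imp_holomorphic_sqrt[of g "ball p r"] by (auto intro: convex_imp_contractible)
    have Fk: "F v = h u" if "u \<in> ball p r" "v\<^sup>2 = g u" for u v
    proof -
      have nz: "1 - c * h u \<noteq> 0" by (rule hc[OF that(1)])
      have e: "v\<^sup>2 + b = h u * (1 - b * c) / (1 - c * h u)" "c * v\<^sup>2 + 1 = (1 - b * c) / (1 - c * h u)"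
        using nz unfolding that(2) g_def by (simp_all add: field_simps)
      have "F v = (v\<^sup>2 + b) / (c * v\<^sup>2 + 1)" by (simp add: F_def qmap_def)
      also have "\<dots> = h u" unfolding e using nz bc by simp
      finally show ?thesis .
    qed
    define x where "x = (F ^^ (Suc n * (l - 1))) p"
    have pin: "p \<in> ball p r" using r by simp
    have Fx: "F x = h p"
    proof -
      have "F x = (F ^^ Suc (Suc n * (l - 1))) p" by (simp add: x_def)
      also have "Suc (Suc n * (l - 1)) = n * (l - 1) + l" using p(2) by simp
      also have "(F ^^ (n * (l - 1) + l)) p = (F ^^ (n * (l - 1))) p"
        by (simp only: funpow_add o_apply p(1))
      finally show ?thesis using h(3) by simp
    qed
    have "c * x\<^sup>2 + 1 \<noteq> 0"
      unfolding x_def F_def using qmult_nonzero_periodic_imp_finite_orbit[OF \<rho>(1)] p unfolding F_def by blast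
    then have "x\<^sup>2 + b = h p * (c * x\<^sup>2 + 1)" using Fx by (simp add: F_def qmap_def field_simps)
    then have "x\<^sup>2 * (1 - c * h p) = h p - b" by (simp add: algebra_simps)
    then have "x\<^sup>2 = g p" using hc[OF pin] by (simp add: g_def field_simps)
    then have "x\<^sup>2 = (k p)\<^sup>2" using k(2)[OF pin] by simp
    then have "x = k p \<or> x = - k p" by (rule power2_eq_iff[THEN iffD1])
    then obtain k' where k': "k' holomorphic_on ball p r" "\<And>u. u \<in> ball p r \<Longrightarrow> g u = (k' u)\<^sup>2" "k' p = x"
    proof
      assume "x = - k p"
      then show thesis using k that[of "\<lambda>u. - k u"] by (auto intro: holomorphic_intros)
    qed (use k that[of k] in auto)
    show ?case
    proof (intro exI[of _ k'] conjI ballI k'(1))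
      fix u assume u: "u \<in> ball p r"
      show "(F ^^ Suc n) (k' u) = u"
        using Fk[OF u k'(2)[OF u, symmetric]] h(2)[OF u] by (simp add: funpow_swap1)
    qed (use k'(3) x_def in auto)
  qed
  \<comment> \<open>1 / (h - q) is bounded by 1 / s, and Cauchy's estimate on the disc of radius r /
    2 bounds its derivative by 2 / (s r); the factor |p - q|^2 converts this into a bound for the
    derivative of h at p.\<close>
  define K where "K = 2 * (norm (p - q))\<^sup>2 / (s * r)"
  have pq: "p \<noteq> q"
  proof
    assume "p = q"
    then show False using q[of p 0] r s by simp
  qed
  have bound: "1 \<le> K * norm \<rho> ^ N" for N
  proof -
    obtain h where h: "h holomorphic_on ball p r" "\<And>u. u \<in> ball p r \<Longrightarrow> (F ^^ (l * N)) (h u) = u"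
      "h p = (F ^^ (l * N * (l - 1))) p" using branch by blast
    have hp: "h p = p" using h(3) funpow_mult_fixed[OF p(1), of "N * (l - 1)"] by (simp add: mult.assoc)
    have dh: "(h has_field_derivative deriv h p) (at p)"
      using h(1) r by (intro holomorphic_derivI[of _ "ball p r"]) auto
    have fo: "c * ((qmap 1 b c 1 ^^ i) p)\<^sup>2 + 1 \<noteq> 0" for i
      using qmult_nonzero_periodic_imp_finite_orbit[OF \<rho>(1)] p unfolding F_def by blast
    have "((F ^^ (l * N)) has_field_derivative qmult 1 b c 1 (l * N) p) (at p)"
      unfolding F_def by (rule qmap_iterate_has_field_derivative) (rule fo)
    then have dF: "((F ^^ (l * N)) has_field_derivative \<rho> ^ N) (at (h p))"
      using qmult_power[OF p(1)[unfolded F_def], of N] by (simp add: \<rho>_def hp)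
    have "((F ^^ (l * N)) \<circ> h has_field_derivative \<rho> ^ N * deriv h p) (at p)"
      by (rule DERIV_chain[OF dF dh])
    moreover have "((F ^^ (l * N)) \<circ> h has_field_derivative 1) (at p)"
      by (rule has_field_derivative_transform_within_open[OF DERIV_ident, of "ball p r"]) (use r h(2) in auto)
    ultimately have 1: "\<rho> ^ N * deriv h p = 1" by (rule DERIV_unique)
    have far: "s \<le> norm (h u - q)" if "u \<in> ball p r" for u
    proof (rule ccontr)
      assume "\<not> s \<le> norm (h u - q)"
      then have "h u \<in> ball q s" by (simp add: dist_norm norm_minus_commute)
      then show False using q[of "h u" "l * N"] h(2)[OF that] that by simp
    qed
    then have hq: "h u - q \<noteq> 0" if "u \<in> ball p r" for u using s that by fastforce
    define k where "k u = 1 / (h u - q)" for u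
    have kh: "k holomorphic_on ball p r" unfolding k_def by (intro holomorphic_intros h(1) hq)
    have "norm ((deriv ^^ 1) k p) \<le> fact 1 * (1 / s) / (r / 2) ^ 1"
    proof (rule Cauchy_inequality)
      show "k holomorphic_on ball p (r / 2)" using kh by (rule holomorphic_on_subset) (use r in auto)
      have "cball p (r / 2) \<subseteq> ball p r" using r by auto
      then show "continuous_on (cball p (r / 2)) k"
        using holomorphic_on_imp_continuous_on[OF kh] continuous_on_subset by blast
      fix x assume "norm (p - x) = r / 2"
      then have "x \<in> ball p r" using r by (simp add: dist_norm)
      then show "norm (k x) \<le> 1 / s" using far[of x] s by (simp add: k_def norm_divide frac_le)
    qed (use r in simp)
    moreover have "(k has_field_derivative (- deriv h p / (p - q)\<^sup>2)) (at p)"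
      unfolding k_def
      by (rule derivative_eq_intros dh refl)+ (use hp pq in \<open>auto simp: power2_eq_square\<close>)
    then have "deriv k p = - deriv h p / (p - q)\<^sup>2" by (rule DERIV_imp_deriv)
    ultimately have "norm (deriv h p) / (norm (p - q))\<^sup>2 \<le> 2 / (s * r)"
      by (simp add: norm_divide norm_power)
    then have "norm (deriv h p) \<le> K" using pq by (simp add: K_def field_simps)
    moreover have "norm \<rho> ^ N * norm (deriv h p) = 1" using 1 by (metis norm_mult norm_one norm_power)
    ultimately show ?thesis by (metis mult.commute mult_left_mono norm_ge_zero zero_le_power)
  qed
  have "(\<lambda>N. K * norm \<rho> ^ N) \<longlonglongrightarrow> K * 0"
    using \<rho>(2) by (intro tendsto_intros LIMSEQ_power_zero) (simp add: \<rho>_def)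
  then have "1 \<le> K * 0" by (rule LIMSEQ_le_const) (use bound in auto)
  then show False by simp
qed

text \<open>Near p the l-th iterate does not increase the distance to p, so the iterates of order l
  n never leave the ball. The iterates in between are controlled by continuity at p of the finitely
  many powers below l.\<close>

lemma attracting_trap:
  assumes p: "(qmap a b c d ^^ l) p = p" "l > 0"
    and \<rho>: "qmult a b c d l p \<noteq> 0" "norm (qmult a b c d l p) < 1" and e: "e > 0"
  shows "\<exists>r>0. \<forall>u\<in>ball p r. \<forall>k. \<exists>m. dist ((qmap a b c d ^^ k) u) ((qmap a b c d ^^ m) p) < e"
proof -
  let ?F = "qmap a b c d"
  have der: "((?F ^^ j) has_field_derivative qmult a b c d j p) (at p)" for j
    by (rule qmap_iterate_has_field_derivative)
       (rule qmult_nonzero_periodic_imp_finite_orbit[OF \<rho>(1) p])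
  define \<kappa> where "\<kappa> = 1 - norm (qmult a b c d l p)"
  have \<kappa>: "\<kappa> > 0" using \<rho> by (simp add: \<kappa>_def)
  have "\<exists>r0>0. \<forall>u. dist u p < r0 \<longrightarrow> dist ((?F ^^ l) u) p \<le> dist u p"
  proof -
    have "((?F ^^ l) has_derivative (\<lambda>h. qmult a b c d l p * h)) (at p)"
      using der[of l] by (simp add: has_field_derivative_def)
    then obtain r0 where r0: "r0 > 0" "\<And>u. norm (u - p) < r0 \<Longrightarrow>
       norm ((?F ^^ l) u - (?F ^^ l) p - qmult a b c d l p * (u - p)) \<le> \<kappa> * norm (u - p)"
      using \<kappa> unfolding has_derivative_at_alt by blast
    have "dist ((?F ^^ l) u) p \<le> dist u p" if "dist u p < r0" for u
    proof -
      have "norm ((?F ^^ l) u - p) \<le> norm ((?F ^^ l) u - p - qmult a b c d l p * (u - p)) + norm (qmult a b c d l p * (u - p))"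
        using norm_triangle_ineq[of "(?F ^^ l) u - p - qmult a b c d l p * (u - p)" "qmult a b c d l p * (u - p)"] by simp
      also have "\<dots> \<le> \<kappa> * norm (u - p) + norm (qmult a b c d l p) * norm (u - p)"
        using r0(2)[of u] that p(1) by (simp add: dist_norm norm_mult)
      also have "\<dots> = norm (u - p)" by (simp add: \<kappa>_def algebra_simps)
      finally show ?thesis by (simp add: dist_norm)
    qed
    then show ?thesis using r0(1) by blast
  qed
  then obtain r0 where r0: "r0 > 0" "\<And>u. dist u p < r0 \<Longrightarrow> dist ((?F ^^ l) u) p \<le> dist u p" by blast
  have "\<exists>r>0. \<forall>u. dist u p < r \<longrightarrow> dist ((?F ^^ j) u) ((?F ^^ j) p) < e" for j
  proof -
    have "isCont (?F ^^ j) p" using der[of j] by (rule DERIV_isCont)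
    then show ?thesis using e unfolding continuous_at_eps_delta by blast
  qed
  then obtain R where R: "\<And>j. R j > 0" "\<And>j u. dist u p < R j \<Longrightarrow> dist ((?F ^^ j) u) ((?F ^^ j) p) < e" by metis
  define r where "r = Min (insert r0 (R ` {..<l}))"
  have r: "r > 0" "r \<le> r0" "\<And>j. j < l \<Longrightarrow> r \<le> R j"
    unfolding r_def using r0(1) R(1) by (auto intro: min.coboundedI2)
  have "\<exists>m. dist ((?F ^^ k) u) ((?F ^^ m) p) < e" if u: "u \<in> ball p r" for u k
  proof -
    have near: "dist ((?F ^^ (l * n)) u) p < r" for n
    proof (induction n)
      case 0
      then show ?case using u by (simp add: dist_commute)
    next
      case (Suc n)
      have "(?F ^^ (l * Suc n)) u = (?F ^^ l) ((?F ^^ (l * n)) u)" by (simp add: funpow_add)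
      then show ?case using r0(2)[of "(?F ^^ (l * n)) u"] Suc r(2) by simp
    qed
    have "(?F ^^ k) u = (?F ^^ (k mod l + l * (k div l))) u" by simp
    also have "\<dots> = (?F ^^ (k mod l)) ((?F ^^ (l * (k div l))) u)" by (simp only: funpow_add o_apply)
    finally have "(?F ^^ k) u = (?F ^^ (k mod l)) ((?F ^^ (l * (k div l))) u)" .
    moreover have "k mod l < l" using p(2) by simp
    ultimately show ?thesis using R(2)[of "(?F ^^ (l * (k div l))) u" "k mod l"] near[of "k div l"] r(3)[of "k mod l"]
      by (metis order_less_le_trans)
  qed
  then show ?thesis using r(1) by blast
qed

text \<open>Orbits that enter a small ball around one cycle stay near that cycle. Two critical
  values can enter the balls of at most two cycles, so around a point of the remaining one all
  inverse branches exist, and they omit the ball of another cycle.\<close>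

theorem no_three_attracting_cycles:
  fixes b c :: complex and z :: "nat \<Rightarrow> complex" and l :: "nat \<Rightarrow> nat"
  defines "F \<equiv> qmap 1 b c 1"
  assumes bc: "b * c \<noteq> 1"
    and per: "\<And>i. i < 3 \<Longrightarrow> l i > 0 \<and> (F ^^ l i) (z i) = z i"
    and \<rho>: "\<And>i. i < 3 \<Longrightarrow> qmult 1 b c 1 (l i) (z i) \<noteq> 0 \<and> norm (qmult 1 b c 1 (l i) (z i)) < 1"
    and disj: "\<And>i j k m. i < 3 \<Longrightarrow> j < 3 \<Longrightarrow> i \<noteq> j \<Longrightarrow> (F ^^ k) (z i) \<noteq> (F ^^ m) (z j)"
  shows False
proof -
  define T where "T = {(i, j, k, m). i < 3 \<and> j < 3 \<and> i \<noteq> j \<and> k < l i \<and> m < l j}"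
  have "T \<subseteq> {..<3} \<times> {..<3} \<times> {..<l 0 + l 1 + l 2} \<times> {..<l 0 + l 1 + l 2}"
  proof
    fix x assume "x \<in> T"
    then obtain i j k m where x: "x = (i, j, k, m)" "i < 3" "j < 3" "k < l i" "m < l j" by (auto simp: T_def)
    have "l i \<le> l 0 + l 1 + l 2" if "i < 3" for i
    proof -
      have "i = 0 \<or> i = 1 \<or> i = 2" using that by auto
      then show ?thesis by auto
    qed
    then show "x \<in> {..<3} \<times> {..<3} \<times> {..<l 0 + l 1 + l 2} \<times> {..<l 0 + l 1 + l 2}"
      using x by (auto intro: order_less_le_trans)
  qed
  then have finT: "finite T" by (rule finite_subset) auto
  \<comment> \<open>\<open>D\<close> is a lower bound for the distance between points of different
    cycles. Each ball and each trapped orbit stays within \<open>D / 3\<close> of its own cycle, so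
    two of them cannot meet.\<close>
  define D where "D = Min (insert 1 ((\<lambda>(i, j, k, m). dist ((F ^^ k) (z i)) ((F ^^ m) (z j))) ` T))"
  have D: "D > 0"
    unfolding D_def using finT disj by (subst Min_gr_iff) (auto simp: T_def)
  have sep: "D \<le> dist ((F ^^ k) (z i)) ((F ^^ m) (z j))" if "i < 3" "j < 3" "i \<noteq> j" for i j k m
  proof -
    have "(i, j, k mod l i, m mod l j) \<in> T" using per that by (auto simp: T_def)
    then have "D \<le> dist ((F ^^ (k mod l i)) (z i)) ((F ^^ (m mod l j)) (z j))"
      unfolding D_def using finT by (intro Min_le) force+
    then show ?thesis using funpow_mod_period[where f=F and l="l i" and p="z i" and k=k] funpow_mod_period[where f=F and l="l j" and p="z j" and k=m] per that by simp
  qed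
  have "\<exists>r>0. \<forall>u\<in>ball (z i) r. \<forall>k. \<exists>m. dist ((F ^^ k) u) ((F ^^ m) (z i)) < D / 3" if "i < 3" for i
    unfolding F_def using per[OF that] \<rho>[OF that] D by (intro attracting_trap[where l = "l i"]) (auto simp: F_def)
  then obtain R where R: "\<And>i. i < 3 \<Longrightarrow> R i > 0"
    "\<And>i u k. i < 3 \<Longrightarrow> u \<in> ball (z i) (R i) \<Longrightarrow> \<exists>m. dist ((F ^^ k) u) ((F ^^ m) (z i)) < D / 3" by metis
  define r where "r i = min (R i) (D / 3)" for i
  have r: "r i > 0" "r i \<le> D / 3" if "i < 3" for i using R(1)[OF that] D by (auto simp: r_def)
  have trap: "\<exists>m. dist ((F ^^ k) u) ((F ^^ m) (z i)) < D / 3" if "i < 3" "u \<in> ball (z i) (r i)" for i u k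
    using R(2)[OF that(1), of u k] that(2) by (auto simp: r_def)
  have notin: "(F ^^ k) u \<notin> ball (z j) (r j)" if ij: "i < 3" "j < 3" "i \<noteq> j" and u: "u \<in> ball (z i) (r i)" for i j u k
  proof
    assume in_j: "(F ^^ k) u \<in> ball (z j) (r j)"
    obtain m where m: "dist ((F ^^ k) u) ((F ^^ m) (z i)) < D / 3" using trap[OF ij(1) u] by blast
    have "dist ((F ^^ m) (z i)) ((F ^^ 0) (z j)) < D / 3 + D / 3"
      using dist_triangle[of "(F ^^ m) (z i)" "z j" "(F ^^ k) u"] m in_j r(2)[OF ij(2)] by (simp add: dist_commute)
    then show False using sep[OF ij, of m 0] D by simp
  qed
  \<comment> \<open>The orbits are those of the total function \<open>F\<close>, which sends a pole
    to 0; \<open>inverse_branch_contradiction\<close> follows the same convention. Likewise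
    \<open>1 / c\<close> is 0 for \<open>c\<close> = 0, and the pigeonhole still concerns just two
    starting points.\<close>
  define cap where "cap v i \<longleftrightarrow> (\<exists>k. (F ^^ k) v \<in> ball (z i) (r i))" for v i
  have capu: "False" if ij: "i < 3" "j < 3" "i \<noteq> j" "cap v i" "cap v j" for v i j
  proof -
    have aux: False if ij: "i < 3" "j < 3" "i \<noteq> j" "(F ^^ k) v \<in> ball (z i) (r i)" "(F ^^ m) v \<in> ball (z j) (r j)" "k \<le> m" for i j k m
    proof -
      have "(F ^^ m) v = (F ^^ (m - k)) ((F ^^ k) v)"
        using \<open>k \<le> m\<close> by (metis funpow_add le_add_diff_inverse2 o_apply)
      then show False using notin[OF ij(1-4), of "m - k"] ij(5) by simp
    qed
    obtain k m where km: "(F ^^ k) v \<in> ball (z i) (r i)" "(F ^^ m) v \<in> ball (z j) (r j)"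
      using ij by (auto simp: cap_def)
    show False
    proof (cases "k \<le> m")
      case True then show False using aux[OF ij(1-3) km] by blast
    next
      case False then show False using aux[OF ij(2,1) _ km(2,1)] ij(3) by auto
    qed
  qed
  have "\<exists>i<3. \<not> cap b i \<and> \<not> cap (1 / c) i"
  proof (rule ccontr)
    assume "\<not> (\<exists>i<3. \<not> cap b i \<and> \<not> cap (1 / c) i)"
    then have a: "cap b 0 \<or> cap (1 / c) 0" "cap b 1 \<or> cap (1 / c) 1" "cap b 2 \<or> cap (1 / c) 2" by auto
    show False using a capu[of 0 1 b] capu[of 0 2 b] capu[of 1 2 b] capu[of 0 1 "1 / c"] capu[of 0 2 "1 / c"] capu[of 1 2 "1 / c"]
      by auto
  qed
  then obtain i where i: "i < 3" "\<not> cap b i" "\<not> cap (1 / c) i" by blast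
  \<comment> \<open>The ball of any other cycle serves as the disc that the inverse branches
    omit.\<close>
  define j :: nat where "j = (if i = 0 then 1 else 0)"
  have j: "j < 3" "j \<noteq> i" by (auto simp: j_def)
  show False
    by (rule inverse_branch_contradiction[OF bc, of "l i" "z i" "r i" "r j" "z j"])
       (use per[OF i(1)] \<rho>[OF i(1)] r i j notin[of j i] in \<open>auto simp: cap_def F_def\<close>)
qed

section \<open>The multiplier polynomial\<close>

text \<open>Numerator and denominator are iterated in homogeneous form, so that passing through
  infinity is no exceptional case.\<close>

primrec iter_pair :: "complex \<Rightarrow> complex \<Rightarrow> complex \<Rightarrow> complex \<Rightarrow> nat \<Rightarrow> complex poly \<times> complex poly" where
  "iter_pair a b c d 0 = ([:0, 1:], 1)"
| "iter_pair a b c d (Suc m) = (let (p, q) = iter_pair a b c d m in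
     (smult a (p\<^sup>2) + smult b (q\<^sup>2), smult c (p\<^sup>2) + smult d (q\<^sup>2)))"

definition "iter_num a b c d m = fst (iter_pair a b c d m)"
definition "iter_den a b c d m = snd (iter_pair a b c d m)"

lemma iter_num_0 [simp]: "iter_num a b c d 0 = [:0, 1:]"
  and iter_den_0 [simp]: "iter_den a b c d 0 = 1"
  and iter_num_Suc: "iter_num a b c d (Suc m) = smult a ((iter_num a b c d m)\<^sup>2) + smult b ((iter_den a b c d m)\<^sup>2)"
  and iter_den_Suc: "iter_den a b c d (Suc m) = smult c ((iter_num a b c d m)\<^sup>2) + smult d ((iter_den a b c d m)\<^sup>2)"
  by (simp_all add: iter_num_def iter_den_def case_prod_unfold Let_def)

text \<open>The numerator N' D - N D' of the derivative of the iterate N / D, see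
  \<open>iter_wronskian_eq\<close>. This is the form given by the chain rule: its factors vanish
  where an earlier iterate is one of the critical points 0 and infinity.\<close>

definition iter_wronskian :: "complex \<Rightarrow> complex \<Rightarrow> complex \<Rightarrow> complex \<Rightarrow> nat \<Rightarrow> complex poly" where
  "iter_wronskian a b c d m = smult ((2 * (a * d - b * c)) ^ m) (\<Prod>k<m. iter_num a b c d k * iter_den a b c d k)"

definition fix_poly :: "complex \<Rightarrow> complex \<Rightarrow> complex \<Rightarrow> complex \<Rightarrow> nat \<Rightarrow> complex poly" where
  "fix_poly a b c d m = iter_num a b c d m - pCons 0 (iter_den a b c d m)"

lemma iter_wronskian_eq:
  "iter_wronskian a b c d m = pderiv (iter_num a b c d m) * iter_den a b c d m - iter_num a b c d m * pderiv (iter_den a b c d m)"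
proof (induction m)
  case 0
  show ?case by (simp add: iter_wronskian_def pderiv_pCons)
next
  case (Suc m)
  define p q where "p = iter_num a b c d m" and "q = iter_den a b c d m"
  have "iter_wronskian a b c d (Suc m) = smult (2 * (a * d - b * c)) (p * q * iter_wronskian a b c d m)"
    by (simp add: iter_wronskian_def p_def q_def mult_ac smult_smult)
  also have "\<dots> = smult (2 * (a * d - b * c)) (p * q * (pderiv p * q - p * pderiv q))"
    using Suc by (simp add: p_def q_def)
  also have "\<dots> = pderiv (smult a (p\<^sup>2) + smult b (q\<^sup>2)) * (smult c (p\<^sup>2) + smult d (q\<^sup>2)) -
      (smult a (p\<^sup>2) + smult b (q\<^sup>2)) * pderiv (smult c (p\<^sup>2) + smult d (q\<^sup>2))"
    by (rule poly_eq_poly_eq_iff[THEN iffD1], rule ext)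
       (simp add: pderiv_add pderiv_smult pderiv_mult power2_eq_square algebra_simps)
  finally show ?case by (simp add: iter_num_Suc iter_den_Suc p_def q_def)
qed

lemma iter_num_den_not_both_0:
  assumes "a * d - b * c \<noteq> 0"
  shows "poly (iter_num a b c d m) z \<noteq> 0 \<or> poly (iter_den a b c d m) z \<noteq> 0"
proof (induction m)
  case (Suc m)
  define p q where "p = (poly (iter_num a b c d m) z)\<^sup>2" and "q = (poly (iter_den a b c d m) z)\<^sup>2"
  show ?case
  proof (rule ccontr)
    assume "\<not> ?thesis"
    then have e: "a * p + b * q = 0" "c * p + d * q = 0"
      by (auto simp: iter_num_Suc iter_den_Suc p_def q_def poly_power)
    have "(a * d - b * c) * p = d * (a * p + b * q) - b * (c * p + d * q)" "(a * d - b * c) * q = a * (c * p + d * q) - c * (a * p + b * q)"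
      by (simp_all add: algebra_simps)
    then have "p = 0" "q = 0" using e assms by auto
    then show False using Suc by (simp add: p_def q_def)
  qed
qed simp

lemma poly_iter_den_Suc:
  assumes "poly (iter_den a b c d m) z \<noteq> 0" "(qmap a b c d ^^ m) z = poly (iter_num a b c d m) z / poly (iter_den a b c d m) z"
  shows "poly (iter_den a b c d (Suc m)) z = (poly (iter_den a b c d m) z)\<^sup>2 * (c * ((qmap a b c d ^^ m) z)\<^sup>2 + d)"
    and "poly (iter_num a b c d (Suc m)) z = (poly (iter_den a b c d m) z)\<^sup>2 * (a * ((qmap a b c d ^^ m) z)\<^sup>2 + b)"
  using assms(1) unfolding assms(2)
  by (simp_all add: iter_den_Suc iter_num_Suc poly_power power_divide field_simps)

lemma iterate_eq_quotient:
  assumes "\<And>i. i < m \<Longrightarrow> c * ((qmap a b c d ^^ i) z)\<^sup>2 + d \<noteq> 0"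
  shows "poly (iter_den a b c d m) z \<noteq> 0 \<and>
    (qmap a b c d ^^ m) z = poly (iter_num a b c d m) z / poly (iter_den a b c d m) z \<and>
    qmult a b c d m z = poly (iter_wronskian a b c d m) z / (poly (iter_den a b c d m) z)\<^sup>2"
  using assms
proof (induction m)
  case 0
  show ?case by (simp add: qmult_def iter_wronskian_def)
next
  case (Suc m)
  define p q x where "p = poly (iter_num a b c d m) z" and "q = poly (iter_den a b c d m) z" and "x = (qmap a b c d ^^ m) z"
  have IH: "q \<noteq> 0" "x = p / q" "qmult a b c d m z = poly (iter_wronskian a b c d m) z / q\<^sup>2"
    using Suc unfolding p_def q_def x_def by auto
  have nz: "c * x\<^sup>2 + d \<noteq> 0" using Suc.prems[of m] by (simp add: x_def)
  have den: "poly (iter_den a b c d (Suc m)) z = q\<^sup>2 * (c * x\<^sup>2 + d)"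
    and num: "poly (iter_num a b c d (Suc m)) z = q\<^sup>2 * (a * x\<^sup>2 + b)"
    using poly_iter_den_Suc[of a b c d m z] IH unfolding p_def q_def x_def by auto
  have it: "qmap a b c d ((qmap a b c d ^^ m) z) = (a * x\<^sup>2 + b) / (c * x\<^sup>2 + d)"
    by (simp add: x_def qmap_def)
  have W: "poly (iter_wronskian a b c d (Suc m)) z = 2 * (a * d - b * c) * p * q * poly (iter_wronskian a b c d m) z"
    by (simp add: iter_wronskian_def p_def q_def mult_ac)
  have "qmult a b c d (Suc m) z = qmult a b c d m z * qder a b c d x"
    by (simp add: qmult_def x_def)
  also have "\<dots> = poly (iter_wronskian a b c d m) z / q\<^sup>2 * (2 * (a * d - b * c) * x / (c * x\<^sup>2 + d)\<^sup>2)"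
    using IH by (simp add: qder_def)
  also have "\<dots> = 2 * (a * d - b * c) * p * q * poly (iter_wronskian a b c d m) z / (q\<^sup>2 * (c * x\<^sup>2 + d))\<^sup>2"
  proof -
    have "p = x * q" using IH by simp
    then show ?thesis using IH(1) nz by (simp add: power2_eq_square divide_simps)
  qed
  finally have "qmult a b c d (Suc m) z = poly (iter_wronskian a b c d (Suc m)) z / (poly (iter_den a b c d (Suc m)) z)\<^sup>2"
    by (simp add: W den)
  then show ?case using IH(1) nz by (simp add: den num it)
qed

lemma fixed_point_imp_root:
  assumes "(qmap a b c d ^^ m) z = z" "qmult a b c d m z \<noteq> 0"
  shows "poly (fix_poly a b c d m) z = 0" "poly (iter_den a b c d m) z \<noteq> 0"
    "qmult a b c d m z = poly (iter_wronskian a b c d m) z / (poly (iter_den a b c d m) z)\<^sup>2"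
proof -
  have fo: "c * ((qmap a b c d ^^ i) z)\<^sup>2 + d \<noteq> 0" if "i < m" for i
    using qmult_nonzero_imp_finite_orbit[OF assms(2) that] .
  note * = iterate_eq_quotient[OF fo, of m]
  show "poly (iter_den a b c d m) z \<noteq> 0"
    "qmult a b c d m z = poly (iter_wronskian a b c d m) z / (poly (iter_den a b c d m) z)\<^sup>2" using * by auto
  then show "poly (fix_poly a b c d m) z = 0" using * assms(1) by (simp add: fix_poly_def) (metis nonzero_eq_divide_eq)
qed

text \<open>Where the Wronskian is not 0, no earlier denominator vanishes. The orbit then avoids
  infinity, and the total function \<open>qmap\<close> agrees with the rational map along
  it.\<close>

lemma root_imp_fixed_point:
  assumes "a * d - b * c \<noteq> 0" "poly (fix_poly a b c d m) z = 0"
  shows "poly (iter_den a b c d m) z \<noteq> 0"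
    and "poly (iter_wronskian a b c d m) z \<noteq> 0 \<Longrightarrow> (qmap a b c d ^^ m) z = z \<and>
     qmult a b c d m z = poly (iter_wronskian a b c d m) z / (poly (iter_den a b c d m) z)\<^sup>2 \<and> qmult a b c d m z \<noteq> 0"
proof -
  have e: "poly (iter_num a b c d m) z = z * poly (iter_den a b c d m) z" using assms(2) by (simp add: fix_poly_def)
  show nz: "poly (iter_den a b c d m) z \<noteq> 0" using iter_num_den_not_both_0[OF assms(1), of m z] e by auto
  assume W: "poly (iter_wronskian a b c d m) z \<noteq> 0"
  then have den: "poly (iter_den a b c d k) z \<noteq> 0" if "k < m" for k
    using that by (auto simp: iter_wronskian_def poly_prod)
  have fo: "c * ((qmap a b c d ^^ i) z)\<^sup>2 + d \<noteq> 0" if "i < m" for i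
    using that
  proof (induction i rule: less_induct)
    case (less i)
    then have it: "poly (iter_den a b c d i) z \<noteq> 0 \<and> (qmap a b c d ^^ i) z = poly (iter_num a b c d i) z / poly (iter_den a b c d i) z"
      using iterate_eq_quotient[of i c a b d z] by auto
    have "poly (iter_den a b c d (Suc i)) z \<noteq> 0" using den[of "Suc i"] nz less.prems by (cases "Suc i = m") auto
    then show ?case using poly_iter_den_Suc(1)[of a b c d i z] it by auto
  qed
  from iterate_eq_quotient[OF fo, of m] show "(qmap a b c d ^^ m) z = z \<and>
     qmult a b c d m z = poly (iter_wronskian a b c d m) z / (poly (iter_den a b c d m) z)\<^sup>2 \<and> qmult a b c d m z \<noteq> 0"
    using e nz W by auto
qed

lemma degree_iter_le: "degree (iter_num a b c d m) \<le> 2 ^ m" "degree (iter_den a b c d m) \<le> 2 ^ m"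
proof (induction m)
  case (Suc m)
  have "degree ((iter_num a b c d m)\<^sup>2) \<le> 2 ^ Suc m" "degree ((iter_den a b c d m)\<^sup>2) \<le> 2 ^ Suc m"
    using Suc degree_power_le[of "iter_num a b c d m" 2] degree_power_le[of "iter_den a b c d m" 2] by auto
  then show "degree (iter_num a b c d (Suc m)) \<le> 2 ^ Suc m" "degree (iter_den a b c d (Suc m)) \<le> 2 ^ Suc m"
    unfolding iter_num_Suc iter_den_Suc
    by (meson degree_add_le degree_smult_le order_trans)+
qed auto

lemma degree_fix_poly_le: "degree (fix_poly a b c d m) \<le> 2 ^ m + 1"
  unfolding fix_poly_def
  by (intro degree_diff_le) (use degree_iter_le[of a b c d m] in \<open>auto intro: order_trans[OF degree_pCons_le]\<close>)

lemma degree_iter_wronskian_le: "degree (iter_wronskian a b c d m) \<le> 2 ^ (m + 1)"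
proof -
  have "degree (\<Prod>k<m. iter_num a b c d k * iter_den a b c d k) \<le> (\<Sum>k<m. 2 ^ Suc k)"
  proof -
    have "degree (iter_num a b c d k * iter_den a b c d k) \<le> 2 ^ Suc k" for k
      using degree_mult_le[of "iter_num a b c d k" "iter_den a b c d k"] degree_iter_le[of a b c d k] by simp
    then have "(\<Sum>k<m. degree (iter_num a b c d k * iter_den a b c d k)) \<le> (\<Sum>k<m. 2 ^ Suc k)"
      by (intro sum_mono)
    then show ?thesis using degree_prod_sum_le[of "{..<m}" "\<lambda>k. iter_num a b c d k * iter_den a b c d k"] by (simp add: o_def)
  qed
  also have "(\<Sum>k<m. 2 ^ Suc k) \<le> (2::nat) ^ (m + 1)"
    by (induction m) auto
  finally show ?thesis unfolding iter_wronskian_def using degree_smult_le order_trans by blast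
qed

text \<open>Divided by the square of the denominator, the right side is the multiplier minus 1. So
  the multiple roots are exactly the fixed points of multiplier 1.\<close>

lemma pderiv_fix_poly_at_root:
  assumes "poly (fix_poly a b c d m) z = 0"
  shows "poly (iter_den a b c d m) z * poly (pderiv (fix_poly a b c d m)) z =
     poly (iter_wronskian a b c d m) z - (poly (iter_den a b c d m) z)\<^sup>2"
proof -
  have e: "poly (iter_num a b c d m) z = z * poly (iter_den a b c d m) z" using assms by (simp add: fix_poly_def)
  show ?thesis
    unfolding iter_wronskian_eq
    by (simp add: fix_poly_def pderiv_diff pderiv_pCons e algebra_simps power2_eq_square)
qed

text \<open>For generic (b, c) the roots in x are the multipliers of the fixed points of the m-th
  iterate. The norm is visibly a polynomial in b and c as well, unlike a product over fixed points.
  The sizes 2^m + 1 and 2^(m+1) are degree bounds for the two arguments.\<close>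

definition mult_det :: "nat \<Rightarrow> complex \<Rightarrow> complex \<Rightarrow> complex \<Rightarrow> complex" where
  "mult_det m b c x = norm_det (2 ^ m + 1) (2 ^ (m + 1)) (fix_poly 1 b c 1 m)
      (smult x ((iter_den 1 b c 1 m)\<^sup>2) - iter_wronskian 1 b c 1 m)"

lemma polyfun3_iter:
  "polyfun3 (\<lambda>b c t. coeff (iter_num 1 b c 1 m) i)" "polyfun3 (\<lambda>b c t. coeff (iter_den 1 b c 1 m) i)"
proof -
  have "(\<forall>i. polyfun3 (\<lambda>b c t. coeff (iter_num 1 b c 1 m) i)) \<and> (\<forall>i. polyfun3 (\<lambda>b c t. coeff (iter_den 1 b c 1 m) i))"
  proof (induction m)
    case 0
    show ?case by (auto intro: polyfun3_const)
  next
    case (Suc m)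
    then have s: "polyfun3 (\<lambda>b c t. coeff ((iter_num 1 b c 1 m)\<^sup>2) i)" "polyfun3 (\<lambda>b c t. coeff ((iter_den 1 b c 1 m)\<^sup>2) i)" for i
      by (auto simp: power2_eq_square coeff_mult intro!: polyfun3_sum polyfun3_mult)
    show ?case unfolding iter_num_Suc iter_den_Suc coeff_add coeff_smult
      by (intro conjI allI polyfun3_add polyfun3_mult s polyfun3_const polyfun3_vars)
  qed
  then show "polyfun3 (\<lambda>b c t. coeff (iter_num 1 b c 1 m) i)" "polyfun3 (\<lambda>b c t. coeff (iter_den 1 b c 1 m) i)" by auto
qed

lemma polyfun3_fix_poly: "polyfun3 (\<lambda>b c t. coeff (fix_poly 1 b c 1 m) i)"
  unfolding fix_poly_def coeff_diff
  by (cases i) (auto intro: polyfun3_diff polyfun3_iter polyfun3_const)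

lemma polyfun3_coeff_prod:
  assumes "\<And>k i. polyfun3 (\<lambda>x y t. coeff (p k x y t) i)"
  shows "polyfun3 (\<lambda>x y t. coeff (\<Prod>k<(n::nat). p k x y t) i)"
proof (induction n arbitrary: i)
  case 0
  then show ?case by (cases i) (auto intro: polyfun3_const)
next
  case (Suc n)
  then show ?case by (auto simp: coeff_mult intro!: polyfun3_sum polyfun3_mult assms)
qed

lemma polyfun3_iter_wronskian: "polyfun3 (\<lambda>b c t. coeff (iter_wronskian 1 b c 1 m) i)"
proof -
  have "polyfun3 (\<lambda>b c t. coeff (iter_num 1 b c 1 k * iter_den 1 b c 1 k) i)" for k i
    unfolding coeff_mult by (intro polyfun3_sum polyfun3_mult polyfun3_iter)
  then have "polyfun3 (\<lambda>b c t. coeff (\<Prod>k<m. iter_num 1 b c 1 k * iter_den 1 b c 1 k) i)"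
    by (rule polyfun3_coeff_prod)
  then show ?thesis unfolding iter_wronskian_def coeff_smult
    by (intro polyfun3_mult polyfun3_power polyfun3_diff polyfun3_const polyfun3_vars)
qed

lemma polyfun3_mult_det: "polyfun3 (mult_det m)"
proof -
  have "polyfun3 (\<lambda>b c t. coeff (smult t ((iter_den 1 b c 1 m)\<^sup>2) - iter_wronskian 1 b c 1 m) i)" for i
    unfolding coeff_diff coeff_smult power2_eq_square coeff_mult
    by (intro polyfun3_diff polyfun3_mult polyfun3_sum polyfun3_iter polyfun3_iter_wronskian polyfun3_vars)
  then have "polyfun3 (\<lambda>b c t. mult_det m b c t)"
    unfolding mult_det_def by (intro polyfun3_norm_det polyfun3_fix_poly)
  then show ?thesis by simp
qed

text \<open>The three conditions say that the map has degree 2, that infinity is not fixed by the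
  m-th iterate, so that all 2^m + 1 fixed points are finite, and that none of them has multiplier 1,
  so that they are simple.\<close>

definition generic :: "nat \<Rightarrow> complex \<Rightarrow> complex \<Rightarrow> bool" where
  "generic m b c \<longleftrightarrow> b * c \<noteq> 1 \<and> coeff (fix_poly 1 b c 1 m) (2 ^ m + 1) \<noteq> 0 \<and> mult_det m b c 1 \<noteq> 0"

definition root_mult :: "nat \<Rightarrow> complex \<Rightarrow> complex \<Rightarrow> complex \<Rightarrow> complex" where
  "root_mult m b c z = poly (iter_wronskian 1 b c 1 m) z / (poly (iter_den 1 b c 1 m) z)\<^sup>2"

lemma degree_mult_numerator:
  "degree (smult x ((iter_den 1 b c 1 m)\<^sup>2) - iter_wronskian 1 b c 1 m) \<le> 2 ^ (m + 1)"
proof (rule degree_diff_le)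
  have "degree ((iter_den 1 b c 1 m)\<^sup>2) \<le> degree (iter_den 1 b c 1 m) * 2" by (rule degree_power_le)
  then show "degree (smult x ((iter_den 1 b c 1 m)\<^sup>2)) \<le> 2 ^ (m + 1)"
    using degree_iter_le(2)[of 1 b c 1 m] degree_smult_le[of x "(iter_den 1 b c 1 m)\<^sup>2"] by simp
qed (rule degree_iter_wronskian_le)

text \<open>Without multiplier 1 the fixed point polynomial is squarefree, hence has as many roots
  as its degree, and \<open>norm_det_prod\<close> applies.\<close>

lemma mult_det_factorization:
  assumes bc: "b * c \<noteq> 1" and lc: "coeff (fix_poly 1 b c 1 m) (2 ^ m + 1) \<noteq> 0"
    and simple: "\<And>z. poly (fix_poly 1 b c 1 m) z = 0 \<Longrightarrow> root_mult m b c z \<noteq> 1"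
  shows "\<exists>K. K \<noteq> 0 \<and> (\<forall>x. mult_det m b c x = K * (\<Prod>z | poly (fix_poly 1 b c 1 m) z = 0. x - root_mult m b c z))"
proof -
  define N e where "N = (2::nat) ^ m + 1" and "e = (2::nat) ^ (m + 1)"
  let ?\<phi> = "fix_poly 1 b c 1 m" and ?q = "iter_den 1 b c 1 m" and ?W = "iter_wronskian 1 b c 1 m"
  have dphi: "degree ?\<phi> = N"
    using degree_fix_poly_le[of 1 b c 1 m] le_degree[OF lc] by (simp add: N_def)
  have phinz: "?\<phi> \<noteq> 0" using dphi by (auto simp: N_def)
  have ad: "1 * 1 - b * c \<noteq> 0" using bc by simp
  have q: "poly ?q z \<noteq> 0" if "poly ?\<phi> z = 0" for z using root_imp_fixed_point(1)[OF ad that] .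
  have "rsquarefree ?\<phi>"
    unfolding rsquarefree_roots
  proof (intro allI notI)
    fix z assume z: "poly ?\<phi> z = 0 \<and> poly (pderiv ?\<phi>) z = 0"
    then have "poly ?W z = (poly ?q z)\<^sup>2" using pderiv_fix_poly_at_root[of 1 b c 1 m z] by simp
    then have "root_mult m b c z = 1" using q z by (simp add: root_mult_def)
    then show False using simple z by blast
  qed
  then have "?\<phi> = smult (lead_coeff ?\<phi>) (\<Prod>z\<in>#mset_set {z. poly ?\<phi> z = 0}. [:- z, 1:])"
    by (metis complex_poly_decompose_rsquarefree prod_unfold_prod_mset)
  then have "degree ?\<phi> = degree (\<Prod>z\<in>#mset_set {z. poly ?\<phi> z = 0}. [:- z, 1:])"
    using phinz by (metis degree_smult_eq leading_coeff_0_iff)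
  then have card: "card {z. poly ?\<phi> z = 0} = N"
    using dphi poly_roots_finite[OF phinz] by (simp add: degree_linear_prod_mset)
  define K where "K = (\<Prod>z | poly ?\<phi> z = 0. coeff ?\<phi> N ^ e * (poly ?q z)\<^sup>2)"
  have "K \<noteq> 0" unfolding K_def using poly_roots_finite[OF phinz] q lc by (auto simp: N_def)
  moreover have "mult_det m b c x = K * (\<Prod>z | poly ?\<phi> z = 0. x - root_mult m b c z)" for x
  proof -
    have "mult_det m b c x = (\<Prod>z | poly ?\<phi> z = 0. coeff ?\<phi> N ^ e * poly (smult x (?q\<^sup>2) - ?W) z)"
      unfolding mult_det_def N_def[symmetric] e_def[symmetric]
      by (rule norm_det_prod[OF dphi _ _ card]) (use degree_mult_numerator[of x b c m] in \<open>auto simp: N_def e_def\<close>)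
    also have "\<dots> = (\<Prod>z | poly ?\<phi> z = 0. (coeff ?\<phi> N ^ e * (poly ?q z)\<^sup>2) * (x - root_mult m b c z))"
      by (rule prod.cong[OF refl]) (use q in \<open>auto simp: root_mult_def field_simps\<close>)
    finally show ?thesis by (simp only: prod.distrib K_def)
  qed
  ultimately show ?thesis by blast
qed

lemma generic_simple:
  assumes "generic m b c" "poly (fix_poly 1 b c 1 m) z = 0"
  shows "root_mult m b c z \<noteq> 1"
proof
  assume 1: "root_mult m b c z = 1"
  have "poly (iter_den 1 b c 1 m) z \<noteq> 0"
    using root_imp_fixed_point(1)[of 1 1 b c m z] assms by (auto simp: generic_def)
  then have "poly (iter_wronskian 1 b c 1 m) z = (poly (iter_den 1 b c 1 m) z)\<^sup>2"
    using 1 by (simp add: root_mult_def)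
  moreover have "poly (smult 1 ((iter_den 1 b c 1 m)\<^sup>2) - iter_wronskian 1 b c 1 m) z \<noteq> 0"
    using assms(1) unfolding generic_def mult_det_def
    by (intro norm_det_nonzero_imp[OF _ assms(2) degree_fix_poly_le degree_mult_numerator]) auto
  ultimately show False by (simp add: poly_power)
qed

lemma generic_factorization:
  assumes "generic m b c"
  shows "\<exists>K. K \<noteq> 0 \<and> (\<forall>x. mult_det m b c x = K * (\<Prod>z | poly (fix_poly 1 b c 1 m) z = 0. x - root_mult m b c z))"
  using assms generic_simple[OF assms] by (intro mult_det_factorization) (auto simp: generic_def)

section \<open>Root counts and cardinalities of fixed point sets\<close>

definition root_count :: "complex poly \<Rightarrow> complex set \<Rightarrow> nat" where
  "root_count p S = size (filter_mset (\<lambda>x. x \<in> S) (proots p))"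

lemma proots_prod_linear:
  assumes "finite R"
  shows "proots (\<Prod>z\<in>R. [:- r z, 1 :: complex:]) = image_mset r (mset_set R)"
  using assms
proof (induction R)
  case (insert z R)
  have "(\<Prod>z\<in>R. [:- r z, 1:]) \<noteq> 0" using insert by (simp add: prod_zero_iff)
  then show ?case using insert by (simp add: proots_mult del: mult_pCons_left)
qed simp

lemma size_filter_image_mset_set:
  assumes "finite R"
  shows "size (filter_mset (\<lambda>x. x \<in> S) (image_mset r (mset_set R))) = card {z\<in>R. r z \<in> S}"
  using assms
proof (induction R)
  case (insert z R)
  have "{x\<in>insert z R. r x \<in> S} = (if r z \<in> S then insert z {x\<in>R. r x \<in> S} else {x\<in>R. r x \<in> S})" by auto
  then show ?case using insert by simp
qed simp

lemma root_count_smult: "K \<noteq> 0 \<Longrightarrow> root_count (smult K p) S = root_count p S"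
  by (simp add: root_count_def)

text \<open>The multiplicity of a root counts the fixed points that share this multiplier.
  \<open>S\<close> must omit 0: a fixed point whose orbit meets 0 or infinity has
  \<open>root_mult\<close> 0, and there \<open>qmap\<close> may differ from the rational
  map.\<close>

lemma root_count_eq_card_fixed_points:
  assumes g: "generic m b c" and S: "0 \<notin> S" and p: "\<And>x. poly p x = mult_det m b c x"
  shows "root_count p S = card {z. (qmap 1 b c 1 ^^ m) z = z \<and> qmult 1 b c 1 m z \<in> S}"
    and "finite {z. (qmap 1 b c 1 ^^ m) z = z \<and> qmult 1 b c 1 m z \<in> S}"
proof -
  let ?R = "{z. poly (fix_poly 1 b c 1 m) z = 0}"
  obtain K where K: "K \<noteq> 0" "\<And>x. mult_det m b c x = K * (\<Prod>z\<in>?R. x - root_mult m b c z)"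
    using generic_factorization[OF g] by blast
  have ad: "1 * 1 - b * c \<noteq> 0" using g by (auto simp: generic_def)
  have "fix_poly 1 b c 1 m \<noteq> 0" using g by (auto simp: generic_def)
  then have fin: "finite ?R" by (rule poly_roots_finite)
  have "p = smult K (\<Prod>z\<in>?R. [:- root_mult m b c z, 1:])"
    by (rule poly_eq_poly_eq_iff[THEN iffD1]) (rule ext, simp add: p K(2) poly_prod)
  then have "root_count p S = card {z\<in>?R. root_mult m b c z \<in> S}"
    using K(1) by (simp add: root_count_smult) (simp add: root_count_def proots_prod_linear[OF fin] size_filter_image_mset_set[OF fin])
  also have eq: "{z\<in>?R. root_mult m b c z \<in> S} = {z. (qmap 1 b c 1 ^^ m) z = z \<and> qmult 1 b c 1 m z \<in> S}"
  proof (intro equalityI subsetI)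
    fix z assume z: "z \<in> {z\<in>?R. root_mult m b c z \<in> S}"
    then have "root_mult m b c z \<noteq> 0" using S by auto
    then have "poly (iter_wronskian 1 b c 1 m) z \<noteq> 0" by (auto simp: root_mult_def)
    then show "z \<in> {z. (qmap 1 b c 1 ^^ m) z = z \<and> qmult 1 b c 1 m z \<in> S}"
      using root_imp_fixed_point(2)[OF ad, of m z] z by (auto simp: root_mult_def)
  next
    fix z assume z: "z \<in> {z. (qmap 1 b c 1 ^^ m) z = z \<and> qmult 1 b c 1 m z \<in> S}"
    then have "qmult 1 b c 1 m z \<noteq> 0" using S by auto
    then show "z \<in> {z\<in>?R. root_mult m b c z \<in> S}"
      using fixed_point_imp_root[of m 1 b c 1 z] z by (auto simp: root_mult_def)
  qed
  finally show "root_count p S = card {z. (qmap 1 b c 1 ^^ m) z = z \<and> qmult 1 b c 1 m z \<in> S}" .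
  show "finite {z. (qmap 1 b c 1 ^^ m) z = z \<and> qmult 1 b c 1 m z \<in> S}"
    using fin eq finite_subset[of "{z\<in>?R. root_mult m b c z \<in> S}" ?R] by auto
qed

lemma coeff_square_top:
  fixes p :: "complex poly"
  assumes "degree p \<le> n"
  shows "coeff (p\<^sup>2) (2 * n) = (coeff p n)\<^sup>2"
proof -
  have "coeff (p\<^sup>2) (2 * n) = (\<Sum>i\<le>2 * n. coeff p i * coeff p (2 * n - i))"
    by (simp add: power2_eq_square coeff_mult)
  also have "\<dots> = (\<Sum>i\<in>{n}. coeff p i * coeff p (2 * n - i))"
  proof (rule sum.mono_neutral_right)
    show "\<forall>i\<in>{..2 * n} - {n}. coeff p i * coeff p (2 * n - i) = 0"
    proof
      fix i assume "i \<in> {..2 * n} - {n}"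
      then have "n < i \<or> n < 2 * n - i" by auto
      then show "coeff p i * coeff p (2 * n - i) = 0" using assms by (auto simp: coeff_eq_0)
    qed
  qed auto
  finally show ?thesis by (simp add: power2_eq_square mult_2)
qed

text \<open>At \<open>b = 0, c = 12\<close> the map is conjugate to \<open>w \<mapsto> w\<^sup>2 + 12\<close> by \<open>w = 1 / z\<close>; its cycles other than
  \<open>\<infinity>\<close> are repelling. This hyperbolic map shows that the polynomials below do not vanish identically.\<close>

lemma base_map_leading_coeff:
  assumes "m \<ge> 1"
  shows "coeff (fix_poly 1 0 12 1 m) (2 ^ m + 1) \<noteq> 0"
proof -
  have sq: "coeff (p\<^sup>2) (2 ^ Suc m) = (coeff p (2 ^ m))\<^sup>2" if "degree p \<le> 2 ^ m" for p :: "complex poly" and m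
    using coeff_square_top[OF that] by simp
  \<comment> \<open>The quotient of the leading coefficients describes the orbit of infinity,
    inverted: u is followed by 12 + u^2, which is real and positive, so infinity is not fixed by any
    later iterate.\<close>
  have *: "coeff (iter_num 1 0 12 1 m) (2 ^ m) = 1 \<and> (\<exists>u::real. coeff (iter_den 1 0 12 1 m) (2 ^ m) = of_real u)" for m
  proof (induction m)
    case 0
    show ?case by (auto intro: exI[of _ 0])
  next
    case (Suc m)
    obtain u :: real where u: "coeff (iter_den 1 0 12 1 m) (2 ^ m) = of_real u" using Suc by blast
    have "coeff (iter_num 1 0 12 1 (Suc m)) (2 ^ Suc m) = 1"
      using Suc by (simp add: iter_num_Suc sq[OF degree_iter_le(1)] del: power_Suc)
    moreover have "coeff (iter_den 1 0 12 1 (Suc m)) (2 ^ Suc m) = of_real (12 + u\<^sup>2)"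
      using Suc u by (simp add: iter_den_Suc sq[OF degree_iter_le(1)] sq[OF degree_iter_le(2)] del: power_Suc)
    ultimately show ?case by blast
  qed
  obtain k where k: "m = Suc k" using assms by (cases m) auto
  obtain u :: real where u: "coeff (iter_den 1 0 12 1 k) (2 ^ k) = of_real u" using * by blast
  have "coeff (iter_den 1 0 12 1 m) (2 ^ m) = of_real (12 + u\<^sup>2)"
    using *[of k] u by (simp add: k iter_den_Suc sq[OF degree_iter_le(1)] sq[OF degree_iter_le(2)] del: power_Suc)
  moreover have "12 + u\<^sup>2 \<noteq> 0" using zero_le_power2[of u] by linarith
  ultimately have "coeff (iter_den 1 0 12 1 m) (2 ^ m) \<noteq> 0" by (simp only: of_real_eq_0_iff not_False_eq_True)
  moreover have "coeff (iter_num 1 0 12 1 m) (2 ^ m + 1) = 0"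
    using degree_iter_le(1)[of 1 0 12 1 m] by (intro coeff_eq_0) simp
  ultimately show ?thesis by (simp add: fix_poly_def)
qed

text \<open>In w = 1 / z the map is w^2 + 12. The largest modulus B on a cycle satisfies B^2 \<le> B
  + 12, so B \<le> 4. Then |w| < 1 is impossible, since 12 = w_(i+1) - w_i^2 would be at most 4 + 1.
  Each factor 2 w of the multiplier thus has modulus at least 2.\<close>

lemma base_map_multiplier:
  assumes m: "m \<ge> 1" and fx: "(qmap 1 0 12 1 ^^ m) z = z" and nz: "qmult 1 0 12 1 m z \<noteq> 0"
  shows "norm (qmult 1 0 12 1 m z) > 1"
proof -
  define x where "x i = (qmap 1 0 12 1 ^^ i) z" for i
  have fo: "12 * (x i)\<^sup>2 + 1 \<noteq> 0" for i
    unfolding x_def using qmult_nonzero_periodic_imp_finite_orbit[OF nz fx] m by simp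
  have xS: "x (Suc i) = (x i)\<^sup>2 / (12 * (x i)\<^sup>2 + 1)" for i by (simp add: x_def qmap_def)
  have x0: "x i \<noteq> 0" if "i < m" for i
    using nz that by (auto simp: qmult_def qder_def x_def)
  have per: "x (i mod m) = x i" for i
    unfolding x_def by (rule funpow_mod_period[OF fx, symmetric])
  have xnz: "x i \<noteq> 0" for i using x0[of "i mod m"] per[of i] m by simp
  define w where "w i = 1 / x i" for i
  have wnz: "w i \<noteq> 0" for i using xnz by (simp add: w_def)
  have wS: "w (Suc i) = (w i)\<^sup>2 + 12" for i
    using xnz[of i] fo[of i] by (simp add: w_def xS field_simps power2_eq_square)
  define B where "B = Max ((\<lambda>i. norm (w i)) ` {..<m})"
  have wper: "w (i mod m) = w i" for i by (simp add: w_def per)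
  have fin: "finite ((\<lambda>i. norm (w i)) ` {..<m})" "(\<lambda>i. norm (w i)) ` {..<m} \<noteq> {}" using m by (auto simp: lessThan_empty_iff)
  have wB: "norm (w i) \<le> B" for i
  proof -
    have "norm (w (i mod m)) \<le> B" unfolding B_def using m by (intro Max_ge fin) auto
    then show ?thesis by (simp add: wper)
  qed
  have "B \<in> (\<lambda>i. norm (w i)) ` {..<m}" unfolding B_def by (rule Max_in[OF fin])
  then obtain i where i: "B = norm (w i)" by auto
  have "(norm (w i))\<^sup>2 = norm (w (Suc i) - 12)" by (simp add: wS norm_power)
  also have "\<dots> \<le> norm (w (Suc i)) + 12" using norm_triangle_ineq4[of "w (Suc i)" 12] by simp
  also have "\<dots> \<le> B + 12" using wB by simp
  finally have "B\<^sup>2 \<le> B + 12" by (simp add: i)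
  then have "(B - 4) * (B + 3) \<le> 0" by (simp add: algebra_simps power2_eq_square)
  moreover have "B \<ge> 0" by (simp add: i)
  ultimately have B4: "B \<le> 4" by (simp add: mult_le_0_iff)
  have w1: "norm (w i) \<ge> 1" for i
  proof (rule ccontr)
    assume "\<not> ?thesis"
    then have "(norm (w i))\<^sup>2 \<le> 1" by (simp add: power_le_one)
    moreover have "12 = w (Suc i) - (w i)\<^sup>2" by (simp add: wS)
    then have "12 \<le> norm (w (Suc i)) + norm ((w i)\<^sup>2)" using norm_triangle_ineq4[of "w (Suc i)" "(w i)\<^sup>2"] by (metis norm_numeral)
    ultimately show False using wB[of "Suc i"] B4 by (simp add: norm_power)
  qed
  \<comment> \<open>The derivative 2 w of w^2 + 12, with the correction for the change of
    coordinate; the correction telescopes around the cycle.\<close>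
  have q: "qder 1 0 12 1 (x i) = 2 * w i * ((w i)\<^sup>2 / (w (Suc i))\<^sup>2)" for i
  proof -
    have "12 * (x i)\<^sup>2 + 1 = w (Suc i) * (x i)\<^sup>2"
      unfolding wS unfolding w_def using xnz[of i] by (simp add: field_simps)
    then have "qder 1 0 12 1 (x i) = 2 * x i / (w (Suc i) * (x i)\<^sup>2)\<^sup>2" by (simp add: qder_def)
    also have "\<dots> = 2 * w i * ((w i)\<^sup>2 / (w (Suc i))\<^sup>2)"
      using xnz[of i] wnz[of "Suc i"] by (simp add: w_def[of i] field_simps power2_eq_square)
    finally show ?thesis .
  qed
  have tel: "(\<Prod>i<k. (w i)\<^sup>2 / (w (Suc i))\<^sup>2) = (w 0)\<^sup>2 / (w k)\<^sup>2" for k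
    using wnz by (induction k) auto
  have "qmult 1 0 12 1 m z = (\<Prod>i<m. 2 * w i) * (\<Prod>i<m. (w i)\<^sup>2 / (w (Suc i))\<^sup>2)"
    unfolding qmult_def x_def[symmetric] q by (rule prod.distrib)
  also have "(\<Prod>i<m. (w i)\<^sup>2 / (w (Suc i))\<^sup>2) = 1"
    unfolding tel using wper[of m] wnz[of 0] by simp
  finally have "norm (qmult 1 0 12 1 m z) = (\<Prod>i<m. norm (2 * w i))" by (simp add: prod_norm[symmetric] norm_mult)
  also have "\<dots> \<ge> (\<Prod>i<m. 2)"
    by (rule prod_mono) (use w1 in \<open>auto simp: norm_mult\<close>)
  finally have "norm (qmult 1 0 12 1 m z) \<ge> 2 ^ m" by simp
  moreover have "(2::real) ^ m > 1" using m by (simp add: one_less_power)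
  ultimately show ?thesis by linarith
qed

lemma base_map_mult_det:
  assumes "m \<ge> 1" "norm \<rho> = 1"
  shows "mult_det m 0 12 \<rho> \<noteq> 0"
proof -
  have ne: "root_mult m 0 12 z \<noteq> \<sigma>" if "poly (fix_poly 1 0 12 1 m) z = 0" "norm \<sigma> = 1" for z \<sigma>
  proof
    assume s: "root_mult m 0 12 z = \<sigma>"
    then have "root_mult m 0 12 z \<noteq> 0" using that(2) by auto
    then have "poly (iter_wronskian 1 0 12 1 m) z \<noteq> 0" by (auto simp: root_mult_def)
    then have "norm (root_mult m 0 12 z) > 1"
      using root_imp_fixed_point(2)[of 1 1 0 12 m z] that(1) base_map_multiplier[OF assms(1), of z] by (auto simp: root_mult_def)
    then show False using s that(2) by simp
  qed
  have "\<exists>K. K \<noteq> 0 \<and> (\<forall>x. mult_det m 0 12 x = K * (\<Prod>z | poly (fix_poly 1 0 12 1 m) z = 0. x - root_mult m 0 12 z))"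
    using base_map_leading_coeff[OF assms(1)] ne[of _ 1] by (intro mult_det_factorization) auto
  then obtain K where K: "K \<noteq> 0" "mult_det m 0 12 \<rho> = K * (\<Prod>z | poly (fix_poly 1 0 12 1 m) z = 0. \<rho> - root_mult m 0 12 z)"
    by blast
  have "fix_poly 1 0 12 1 m \<noteq> 0" using base_map_leading_coeff[OF assms(1)] by auto
  then have "finite {z. poly (fix_poly 1 0 12 1 m) z = 0}" by (rule poly_roots_finite)
  then show ?thesis unfolding K(2) using K(1) ne[OF _ assms(2)] by (simp add: prod_zero_iff) metis
qed

section \<open>Stability of root counts\<close>

text \<open>Coefficientwise convergence allows the degree to drop in the limit.\<close>

definition coeffs_tendsto :: "('a \<Rightarrow> complex poly) \<Rightarrow> complex poly \<Rightarrow> 'a filter \<Rightarrow> bool" where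
  "coeffs_tendsto p q F \<longleftrightarrow> (\<forall>i. ((\<lambda>n. coeff (p n) i) \<longlongrightarrow> coeff q i) F)"

lemma coeffs_tendsto_mult:
  "coeffs_tendsto p q F \<Longrightarrow> coeffs_tendsto p' q' F \<Longrightarrow> coeffs_tendsto (\<lambda>n. p n * p' n) (q * q') F"
  unfolding coeffs_tendsto_def coeff_mult by (auto intro!: tendsto_intros)

lemma coeffs_tendsto_const: "coeffs_tendsto (\<lambda>n. p) p F"
  by (auto simp: coeffs_tendsto_def)

lemma coeffs_tendsto_prod:
  "(\<And>i. i \<in> I \<Longrightarrow> coeffs_tendsto (p i) (q i) F) \<Longrightarrow> coeffs_tendsto (\<lambda>n. \<Prod>i\<in>I. p i n) (\<Prod>i\<in>I. q i) F"
  by (induction I rule: infinite_finite_induct) (auto intro: coeffs_tendsto_const coeffs_tendsto_mult)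

lemma coeffs_tendsto_linear:
  assumes "(u \<longlongrightarrow> a) F" "(v \<longlongrightarrow> b) F"
  shows "coeffs_tendsto (\<lambda>n. [:u n, v n:]) [:a, b:] F"
  unfolding coeffs_tendsto_def
proof
  fix i
  consider "i = 0" | "i = 1" | k where "i = Suc (Suc k)" by (metis One_nat_def nat.exhaust)
  then show "((\<lambda>n. coeff [:u n, v n:] i) \<longlongrightarrow> coeff [:a, b:] i) F"
    by cases (use assms in auto)
qed

lemma poly_factorization_index:
  fixes p :: "complex poly"
  obtains f where "p = smult (lead_coeff p) (\<Prod>i<degree p. [:- f i, 1:])"
proof -
  obtain xs where xs: "mset xs = proots p" by (metis ex_mset)
  have len: "length xs = degree p"
    using xs by (metis size_mset size_proots_complex)
  have "(\<Prod>x\<in>#proots p. [:-x, 1:]) = (\<Prod>i<degree p. [:- (xs ! i), 1:])"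
    unfolding xs[symmetric] len[symmetric]
    by (metis (no_types, lifting) atLeast0LessThan length_map mset_map nth_map prod.cong prod.list_conv_set_nth prod_mset_prod_list lessThan_iff)
  then have "p = smult (lead_coeff p) (\<Prod>i<degree p. [:- (xs ! i), 1:])"
    by (metis complex_poly_decompose_multiset)
  then show ?thesis by (rule that)
qed

lemma root_count_factored:
  assumes "p = smult a (\<Prod>i\<in>I. [:- f i, 1:])" "a \<noteq> 0" "finite I"
  shows "root_count p S = card {i\<in>I. f i \<in> S}"
  unfolding assms(1) root_count_smult[OF assms(2)]
  by (simp add: root_count_def proots_prod_linear[OF assms(3)] size_filter_image_mset_set[OF assms(3)])

lemma coeff_prod_linear_card:
  assumes "finite I"
  shows "coeff (\<Prod>i\<in>I. [:- f i, 1 :: complex:]) (card I) = 1"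
proof -
  have "(\<Prod>i\<in>I. [:- f i, 1:]) = (\<Prod>x\<in>#image_mset f (mset_set I). [:- x, 1:])"
    by (simp add: prod_unfold_prod_mset image_mset.compositionality o_def)
  then show ?thesis
    using lead_coeff_linear_prod_mset[of "image_mset f (mset_set I)"] degree_linear_prod_mset[of "image_mset f (mset_set I)"]
    by simp
qed

text \<open>Hurwitz's theorem with a possible drop of the degree. Along a subsequence each root
  converges or tends to infinity; the escaping roots leave the bounded set, and the others converge
  to the roots of the limit with multiplicity, none of which is on the frontier.\<close>

lemma root_count_stable:
  assumes deg: "\<And>n. degree (p n) \<le> D" and lim: "coeffs_tendsto p q sequentially"
    and q: "q \<noteq> 0" and S: "bounded S" "open S" "\<And>x. x \<in> frontier S \<Longrightarrow> poly q x \<noteq> 0"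
  shows "eventually (\<lambda>n. root_count (p n) S = root_count q S) sequentially"
proof (rule ccontr)
  assume "\<not> ?thesis"
  then have fr: "frequently (\<lambda>n. root_count (p n) S \<noteq> root_count q S) sequentially"
    by (simp add: frequently_def)
  have "eventually (\<lambda>n. coeff (p n) (degree q) \<noteq> 0) sequentially"
    using lim q unfolding coeffs_tendsto_def by (intro tendsto_imp_eventually_ne) auto
  then have "eventually (\<lambda>n. p n \<noteq> 0) sequentially" by eventually_elim auto
  then have "frequently (\<lambda>n. root_count (p n) S \<noteq> root_count q S \<and> p n \<noteq> 0) sequentially"
    by (rule frequently_eventually_frequently[OF fr])
  then have "infinite {n. root_count (p n) S \<noteq> root_count q S \<and> p n \<noteq> 0}"
    by (simp add: cofinite_eq_sequentially[symmetric] frequently_cofinite)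
  then obtain r0 where r0: "strict_mono (r0 :: nat \<Rightarrow> nat)" "\<And>n. root_count (p (r0 n)) S \<noteq> root_count q S \<and> p (r0 n) \<noteq> 0"
    using infinite_enumerate by blast
  obtain d r1 where r1: "strict_mono (r1 :: nat \<Rightarrow> nat)" "\<And>n. degree (p (r0 (r1 n))) = d"
    by (rule finite_range_constant_subseq[of "{..D}" "\<lambda>n. degree (p (r0 n))"]) (use deg in auto)
  have "\<forall>n. \<exists>f. p (r0 (r1 n)) = smult (lead_coeff (p (r0 (r1 n)))) (\<Prod>i<d. [:- f i, 1:])"
    using poly_factorization_index r1(2) by metis
  then obtain f where f: "\<forall>n. p (r0 (r1 n)) = smult (lead_coeff (p (r0 (r1 n)))) (\<Prod>i<d. [:- f n i, 1:])"
    by (rule choice[THEN exE]) blast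
  obtain r2 where r2: "strict_mono (r2 :: nat \<Rightarrow> nat)"
    "\<And>i. i < d \<Longrightarrow> (\<exists>c. (\<lambda>n. f (r2 n) i) \<longlonglongrightarrow> c) \<or> filterlim (\<lambda>n. f (r2 n) i) at_infinity sequentially"
    using finite_sphere_convergent_subseq[of "{..<d}" "\<lambda>i n. f n i"] by auto
  define s where "s n = r0 (r1 (r2 n))" for n
  have s: "strict_mono s" using r0(1) r1(1) r2(1) by (auto simp: s_def strict_mono_def)
  define P F a where "P = (\<lambda>n. p (s n))" and "F = (\<lambda>n. f (r2 n))" and "a = (\<lambda>n. lead_coeff (P n))"
  have P: "P n = smult (a n) (\<Prod>i<d. [:- F n i, 1:])" for n
    using f unfolding P_def F_def a_def s_def by blast
  have a: "a n \<noteq> 0" for n using r0(2) by (simp add: a_def P_def s_def)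
  have limP: "coeffs_tendsto P q sequentially"
    using lim LIMSEQ_subseq_LIMSEQ[OF _ s] unfolding coeffs_tendsto_def P_def by (fastforce simp: o_def)
  define I0 where "I0 = {i. i < d \<and> (\<exists>c. (\<lambda>n. F n i) \<longlonglongrightarrow> c)}"
  define I1 where "I1 = {..<d} - I0"
  have fin: "finite I0" "finite I1" by (auto simp: I0_def I1_def)
  have "\<forall>i\<in>I0. \<exists>c. (\<lambda>n. F n i) \<longlonglongrightarrow> c" by (auto simp: I0_def)
  then obtain \<rho> where \<rho>: "\<And>i. i \<in> I0 \<Longrightarrow> (\<lambda>n. F n i) \<longlonglongrightarrow> \<rho> i" by metis
  have inf: "filterlim (\<lambda>n. F n i) at_infinity sequentially" if "i \<in> I1" for i
    using r2(2)[of i] that by (auto simp: I1_def I0_def F_def)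
  \<comment> \<open>An escaping root f enters as 1 - z / f, which tends to 1; the factors - f taken
    out go into the scalar \<open>m\<close>.\<close>
  define T where "T n = (\<Prod>i\<in>I0. [:- F n i, 1:]) * (\<Prod>i\<in>I1. [:1, - (1 / F n i):])" for n
  define m where "m n = a n * (\<Prod>i\<in>I1. - F n i)" for n
  have "eventually (\<lambda>n. \<forall>i\<in>I1. F n i \<noteq> 0) sequentially"
    by (intro eventually_ball_finite fin ballI filterlim_at_infinity_imp_eventually_ne inf)
  then have PT: "eventually (\<lambda>n. P n = smult (m n) (T n)) sequentially"
  proof eventually_elim
    case (elim n)
    have "(\<Prod>i<d. [:- F n i, 1:]) = (\<Prod>i\<in>I0. [:- F n i, 1:]) * (\<Prod>i\<in>I1. [:- F n i, 1:])"
      by (subst prod.union_disjoint[symmetric]) (auto simp: I0_def I1_def intro!: prod.cong)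
    also have "(\<Prod>i\<in>I1. [:- F n i, 1:]) = (\<Prod>i\<in>I1. smult (- F n i) [:1, - (1 / F n i):])"
      by (rule prod.cong[OF refl]) (use elim in simp)
    also have "\<dots> = smult (\<Prod>i\<in>I1. - F n i) (\<Prod>i\<in>I1. [:1, - (1 / F n i):])" by (rule prod_smult)
    finally show ?case by (simp add: P m_def T_def mult_smult_right)
  qed
  define T' where "T' = (\<Prod>i\<in>I0. [:- \<rho> i, 1:])"
  have "coeffs_tendsto T (T' * (\<Prod>i\<in>I1. [:1, - 0:])) sequentially"
    unfolding T_def T'_def
    by (intro coeffs_tendsto_mult coeffs_tendsto_prod coeffs_tendsto_linear tendsto_intros \<rho> tendsto_divide_0[OF tendsto_const inf])
  then have limT: "coeffs_tendsto T T' sequentially" by (simp add: one_pCons[symmetric])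
  define k where "k = card I0"
  have T'k: "coeff T' k = 1" unfolding T'_def k_def by (rule coeff_prod_linear_card[OF fin(1)])
  \<comment> \<open>The limit of \<open>T\<close> has coefficient 1 in degree k, so the coefficients
    of this degree recover the scalar.\<close>
  have limm: "m \<longlonglongrightarrow> coeff q k"
  proof -
    have "(\<lambda>n. coeff (P n) k / coeff (T n) k) \<longlonglongrightarrow> coeff q k / 1"
      using limP limT T'k unfolding coeffs_tendsto_def by (intro tendsto_divide) (auto, metis)
    moreover have "eventually (\<lambda>n. coeff (T n) k \<noteq> 0) sequentially"
      using limT T'k unfolding coeffs_tendsto_def by (intro tendsto_imp_eventually_ne[of _ 1]) (auto, metis)
    with PT have "eventually (\<lambda>n. coeff (P n) k / coeff (T n) k = m n) sequentially"
      by eventually_elim simp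
    ultimately show ?thesis using Lim_transform_eventually by fastforce
  qed
  have qT: "q = smult (coeff q k) T'"
  proof (rule poly_eqI)
    fix i
    have "(\<lambda>n. m n * coeff (T n) i) \<longlonglongrightarrow> coeff q k * coeff T' i"
      using limm limT by (auto simp: coeffs_tendsto_def intro: tendsto_mult)
    moreover have "eventually (\<lambda>n. m n * coeff (T n) i = coeff (P n) i) sequentially"
      using PT by eventually_elim simp
    ultimately have "(\<lambda>n. coeff (P n) i) \<longlonglongrightarrow> coeff q k * coeff T' i" by (rule Lim_transform_eventually)
    moreover have "(\<lambda>n. coeff (P n) i) \<longlonglongrightarrow> coeff q i" using limP by (simp add: coeffs_tendsto_def)
    ultimately show "coeff q i = coeff (smult (coeff q k) T') i" using LIMSEQ_unique by simp
  qed
  have qk: "coeff q k \<noteq> 0" using qT q by auto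
  have cq: "root_count q S = card {i\<in>I0. \<rho> i \<in> S}"
    using root_count_factored[OF qT[unfolded T'_def] qk fin(1)] .
  have ev: "eventually (\<lambda>n. F n i \<in> S \<longleftrightarrow> i \<in> I0 \<and> \<rho> i \<in> S) sequentially" if i: "i < d" for i
  proof (cases "i \<in> I0")
    case True
    show ?thesis
    proof (cases "\<rho> i \<in> S")
      case in_S: True
      have "eventually (\<lambda>n. F n i \<in> S) sequentially"
        using topological_tendstoD[OF \<rho>[OF True] S(2) in_S] .
      then show ?thesis by eventually_elim (simp add: True in_S)
    next
      case notin: False
      have "poly q (\<rho> i) = 0"
        by (subst qT) (use True fin in \<open>auto simp: T'_def poly_prod\<close>)
      then have "\<rho> i \<notin> frontier S" using S(3) by blast
      then have cl: "\<rho> i \<in> - closure S" using notin S(2) by (simp add: frontier_def interior_open)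
      have "eventually (\<lambda>n. F n i \<in> - closure S) sequentially"
        by (rule topological_tendstoD[OF \<rho>[OF True] _ cl]) (intro open_Compl closed_closure)
      then show ?thesis by eventually_elim (use notin closure_subset in auto)
    qed
  next
    case False
    obtain B where B: "\<And>x. x \<in> S \<Longrightarrow> norm x \<le> B" using S(1) by (auto simp: bounded_iff)
    have "i \<in> I1" using False i by (simp add: I1_def)
    then have "filterlim (\<lambda>n. norm (F n i)) at_top sequentially"
      using inf by (rule_tac filterlim_at_infinity_imp_norm_at_top) auto
    then have "eventually (\<lambda>n. norm (F n i) > B) sequentially" by (simp add: filterlim_at_top_dense)
    then show ?thesis by eventually_elim (use B False in force)
  qed
  have "eventually (\<lambda>n. \<forall>i\<in>{..<d}. F n i \<in> S \<longleftrightarrow> i \<in> I0 \<and> \<rho> i \<in> S) sequentially"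
    by (intro eventually_ball_finite) (auto intro: ev)
  then obtain n where n: "\<forall>i\<in>{..<d}. F n i \<in> S \<longleftrightarrow> i \<in> I0 \<and> \<rho> i \<in> S"
    using eventually_happens'[OF sequentially_bot] by blast
  have "root_count (P n) S = card {i\<in>{..<d}. F n i \<in> S}"
    by (rule root_count_factored[OF P a]) simp
  also have "{i\<in>{..<d}. F n i \<in> S} = {i\<in>I0. \<rho> i \<in> S}" using n by (auto simp: I0_def)
  finally have "root_count (p (s n)) S = root_count q S" using cq by (simp add: P_def)
  then show False using r0(2)[of "r1 (r2 n)"] by (simp add: s_def)
qed

section \<open>Balanced directions\<close>

lemma infinite_unit_circle: "infinite (sphere (0::complex) 1)"
proof
  assume "finite (sphere (0::complex) 1)"
  moreover have "connected (sphere (0::complex) 1)" by (rule connected_sphere) simp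
  ultimately have "sphere (0::complex) 1 = {} \<or> (\<exists>x. sphere (0::complex) 1 = {x})"
    using connected_finite_iff_sing by blast
  moreover have "1 \<in> sphere (0::complex) 1" "-1 \<in> sphere (0::complex) 1" by auto
  ultimately have "(1::complex) = -1" by (metis empty_iff singletonD)
  then show False by simp
qed

text \<open>Re v = 0 means v^2 = - |v|^2. For v = C w^k on the unit circle this is the polynomial
  equation w^(2k) = - |C|^2 / C^2.\<close>

lemma finite_imaginary_directions:
  assumes "C \<noteq> 0" "k \<ge> (1::nat)"
  shows "finite {w \<in> sphere (0::complex) 1. Re (C * w ^ k) = 0}"
proof -
  define u where "u = - of_real ((norm C)\<^sup>2) / C\<^sup>2"
  have "monom 1 (2 * k) - [:u:] \<noteq> (0 :: complex poly)"
  proof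
    assume "monom 1 (2 * k) - [:u:] = (0 :: complex poly)"
    then have "coeff (monom 1 (2 * k) - [:u:]) (2 * k) = (0 :: complex)" by simp
    then show False using assms(2) by (simp add: coeff_pCons split: nat.splits)
  qed
  then have fin: "finite {w. poly (monom 1 (2 * k) - [:u:]) w = 0}" by (rule poly_roots_finite)
  show ?thesis
  proof (rule finite_subset[OF _ fin], rule subsetI)
    fix w assume w: "w \<in> {w \<in> sphere (0::complex) 1. Re (C * w ^ k) = 0}"
    define v where "v = C * w ^ k"
    have n: "norm v = norm C" using w by (simp add: v_def norm_mult norm_power)
    have rv: "Re v = 0" using w unfolding v_def by blast
    then have "v = \<i> * of_real (Im v)" by (simp add: complex_eq_iff)
    then have "v\<^sup>2 = - of_real ((Im v)\<^sup>2)" by (metis mult_minus1 of_real_power power2_i power_mult_distrib)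
    moreover have "(Im v)\<^sup>2 = (norm v)\<^sup>2" using rv by (simp add: cmod_power2)
    ultimately have "v\<^sup>2 = - of_real ((norm C)\<^sup>2)" using n by simp
    then have "C\<^sup>2 * w ^ (2 * k) = - of_real ((norm C)\<^sup>2)"
      by (simp add: v_def power_mult_distrib power_mult[symmetric] mult.commute)
    then have "w ^ (2 * k) = u" using assms(1) by (simp add: u_def field_simps)
    then show "w \<in> {w. poly (monom 1 (2 * k) - [:u:]) w = 0}" by (simp add: poly_monom)
  qed
qed

lemma exists_odd_part: "n > 0 \<Longrightarrow> \<exists>v m. n = 2 ^ v * m \<and> odd (m::nat)"
proof (induction n rule: less_induct)
  case (less n)
  show ?case
  proof (cases "even n")
    case True
    then obtain k where k: "n = 2 * k" by (auto elim: evenE)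
    then obtain v m where "k = 2 ^ v * m" "odd m" using less.IH[of k] less.prems by auto
    then show ?thesis using k by (intro exI[of _ "Suc v"] exI[of _ m]) auto
  next
    case False
    then show ?thesis by (intro exI[of _ 0] exI[of _ n]) simp
  qed
qed

text \<open>If 2^v is the exact power of 2 in k, the shift of j by h = 2^(K-1-v) multiplies
  \<zeta>^(j k) by an odd power of -1. It therefore exchanges the negative and the positive indices;
  k < 2^K guarantees v < K.\<close>

lemma root_of_unity_balanced:
  fixes E :: complex and k K :: nat
  defines "J \<equiv> (2::nat) ^ K" and "\<zeta> \<equiv> exp (2 * of_real pi * \<i> / 2 ^ K)"
  assumes k: "k \<ge> 1" "k < 2 ^ K" and nz: "\<And>j. j < J \<Longrightarrow> Re (E * \<zeta> ^ (j * k)) \<noteq> 0"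
  shows "2 * card {j. j < J \<and> Re (E * \<zeta> ^ (j * k)) < 0} = J"
proof -
  have "k > 0" using k(1) by simp
  from exists_odd_part[OF this] obtain v o' where vo: "k = 2 ^ v * o'" "odd o'" by blast
  have "2 ^ v \<le> k" using vo k by (cases o') auto
  then have "(2::nat) ^ v < 2 ^ K" using k(2) by linarith
  then have vK: "v < K" by simp
  define h where "h = (2::nat) ^ (K - 1 - v)"
  have hk: "h * k = 2 ^ (K - 1) * o'" using vK by (simp add: h_def vo power_add[symmetric])
  have \<zeta>J: "\<zeta> ^ J = 1"
    by (simp add: \<zeta>_def J_def exp_of_nat_mult[symmetric] exp_two_pi_i)
  have "\<zeta> ^ (2 ^ (K - 1)) = exp (of_nat (2 ^ (K - 1)) * (2 * of_real pi * \<i> / 2 ^ K))"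
    unfolding \<zeta>_def by (rule exp_of_nat_mult[symmetric])
  also have "of_nat (2 ^ (K - 1)) * (2 * of_real pi * \<i> / 2 ^ K) = of_real pi * \<i>"
    using vK by (cases K) auto
  finally have "\<zeta> ^ (2 ^ (K - 1)) = -1" by (simp add: exp_pi_i')
  then have \<zeta>h: "\<zeta> ^ (h * k) = -1" using vo(2) by (simp add: hk power_mult)
  have \<zeta>mod: "\<zeta> ^ ((i mod J) * k) = \<zeta> ^ (i * k)" for i
  proof -
    have "i * k = ((i mod J) + J * (i div J)) * k" by (simp only: mod_mult_div_eq)
    also have "\<dots> = (i mod J) * k + J * ((i div J) * k)" by (simp only: distrib_right mult.assoc)
    finally have "\<zeta> ^ (i * k) = \<zeta> ^ ((i mod J) * k + J * ((i div J) * k))" by (rule arg_cong)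
    then show ?thesis by (simp add: power_add power_mult \<zeta>J)
  qed
  define \<sigma> where "\<sigma> j = (j + h) mod J" for j
  have J: "J > 0" by (simp add: J_def)
  define g where "g j = Re (E * \<zeta> ^ (j * k))" for j
  have flip: "g (\<sigma> j) = - g j" for j
    unfolding g_def by (simp add: \<sigma>_def \<zeta>mod distrib_right power_add \<zeta>h)
  have \<sigma>J: "\<sigma> j < J" for j using J by (simp add: \<sigma>_def)
  have inj: "inj_on \<sigma> {..<J}"
  proof (rule inj_onI)
    fix x y assume xy: "x \<in> {..<J}" "y \<in> {..<J}" "\<sigma> x = \<sigma> y"
    have h: "h < J" unfolding h_def J_def using vK by (intro power_strict_increasing) auto
    have "(j + h) mod J = (if j + h < J then j + h else j + h - J)" if "j < J" for j
      using that h by (simp add: mod_if)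
    then show "x = y" using xy h unfolding \<sigma>_def by (auto split: if_splits)
  qed
  define N where "N = {j. j < J \<and> g j < 0}"
  define Q where "Q = {j. j < J \<and> g j > 0}"
  have fin: "finite N" "finite Q" by (auto simp: N_def Q_def)
  have "card N \<le> card Q"
    by (rule card_inj_on_le[of \<sigma>]) (use flip \<sigma>J fin inj_on_subset[OF inj, of N] in \<open>auto simp: N_def Q_def\<close>)
  moreover have "card Q \<le> card N"
    by (rule card_inj_on_le[of \<sigma>]) (use flip \<sigma>J fin inj_on_subset[OF inj, of Q] in \<open>auto simp: N_def Q_def\<close>)
  moreover have "card N + card Q = J"
  proof -
    have "N \<union> Q = {..<J}" "N \<inter> Q = {}" using nz by (force simp: N_def Q_def g_def)+
    then show ?thesis using card_Un_disjoint[OF fin] by simp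
  qed
  ultimately show ?thesis by (simp add: N_def g_def)
qed

text \<open>With u = \<phi> - \<rho> one has |\<rho> + u|^2 - 1 = 2 Re (cnj \<rho> u) + |u|^2. After
  division by r^k the square still tends to 0, and the limit of the real part decides the
  sign.\<close>

lemma norm_less_1_direction:
  assumes lim: "((\<lambda>t. (\<phi> t - \<rho>) * t powi (- int k)) \<longlongrightarrow> A) (at 0)" and \<rho>: "norm \<rho> = 1" and k: "k \<ge> 1"
    and \<omega>: "norm \<omega> = 1" and nz: "Re (cnj \<rho> * A * \<omega> ^ k) \<noteq> 0"
  shows "eventually (\<lambda>r. norm (\<phi> (of_real r * \<omega>)) < 1 \<longleftrightarrow> Re (cnj \<rho> * A * \<omega> ^ k) < 0) (at_right 0)"
proof -
  have \<omega>0: "\<omega> \<noteq> 0" using \<omega> by auto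
  have fl: "filterlim (\<lambda>r. of_real r * \<omega>) (at 0) (at_right (0::real))"
  proof -
    have "((\<lambda>r. of_real r * \<omega>) \<longlongrightarrow> of_real 0 * \<omega>) (at_right (0::real))" by (intro tendsto_intros)
    moreover have "eventually (\<lambda>r. of_real r * \<omega> \<noteq> 0) (at_right (0::real))"
      using \<omega>0 by (auto simp: eventually_at_filter)
    ultimately show ?thesis by (simp add: filterlim_at)
  qed
  define u where "u r = \<phi> (of_real r * \<omega>) - \<rho>" for r :: real
  have "((\<lambda>r. u r * (of_real r * \<omega>) powi (- int k)) \<longlongrightarrow> A) (at_right 0)"
    unfolding u_def using filterlim_compose[OF lim fl] .
  then have "((\<lambda>r. u r * (of_real r * \<omega>) powi (- int k) * \<omega> ^ k) \<longlongrightarrow> A * \<omega> ^ k) (at_right 0)"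
    by (intro tendsto_intros)
  moreover have "eventually (\<lambda>r. u r * (of_real r * \<omega>) powi (- int k) * \<omega> ^ k = u r / of_real r ^ k) (at_right (0::real))"
    using eventually_at_right_less[of 0]
    by eventually_elim (use \<omega>0 in \<open>simp add: power_int_minus power_mult_distrib field_simps\<close>)
  ultimately have U: "((\<lambda>r. u r / of_real r ^ k) \<longlongrightarrow> A * \<omega> ^ k) (at_right 0)" by (rule Lim_transform_eventually)
  have U0: "((\<lambda>r. u r) \<longlongrightarrow> 0) (at_right 0)"
  proof -
    have "((\<lambda>r. (u r / of_real r ^ k) * of_real r ^ k) \<longlongrightarrow> (A * \<omega> ^ k) * of_real 0 ^ k) (at_right 0)"
      by (intro tendsto_intros U)
    then have "((\<lambda>r. (u r / of_real r ^ k) * of_real r ^ k) \<longlongrightarrow> 0) (at_right 0)" using k by (simp add: zero_power)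
    moreover have "eventually (\<lambda>r. (u r / of_real r ^ k) * of_real r ^ k = u r) (at_right (0::real))"
      using eventually_at_right_less[of 0] by eventually_elim simp
    ultimately show ?thesis by (rule Lim_transform_eventually)
  qed
  have "((\<lambda>r. 2 * Re (cnj \<rho> * (u r / of_real r ^ k)) + norm (u r) * norm (u r / of_real r ^ k)) \<longlongrightarrow>
     2 * Re (cnj \<rho> * (A * \<omega> ^ k)) + norm (0::complex) * norm (A * \<omega> ^ k)) (at_right 0)"
    by (intro tendsto_intros U U0)
  then have G: "((\<lambda>r. 2 * Re (cnj \<rho> * (u r / of_real r ^ k)) + norm (u r) * norm (u r / of_real r ^ k)) \<longlongrightarrow>
     2 * Re (cnj \<rho> * A * \<omega> ^ k)) (at_right 0)" by (simp add: mult.assoc)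
  have eq: "eventually (\<lambda>r. norm (\<phi> (of_real r * \<omega>)) < 1 \<longleftrightarrow>
      2 * Re (cnj \<rho> * (u r / of_real r ^ k)) + norm (u r) * norm (u r / of_real r ^ k) < 0) (at_right (0::real))"
    using eventually_at_right_less[of 0]
  proof eventually_elim
    case (elim r)
    have rk: "r ^ k > 0" using elim by simp
    have "\<phi> (of_real r * \<omega>) = \<rho> + u r" by (simp add: u_def)
    then have "(norm (\<phi> (of_real r * \<omega>)))\<^sup>2 = (norm \<rho>)\<^sup>2 + 2 * Re (cnj \<rho> * u r) + (norm (u r))\<^sup>2"
      unfolding cmod_power2 by (simp add: power2_eq_square algebra_simps)
    then have 1: "(norm (\<phi> (of_real r * \<omega>)))\<^sup>2 - 1 = 2 * Re (cnj \<rho> * u r) + (norm (u r))\<^sup>2"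
      using \<rho> by simp
    have "cnj \<rho> * (u r / of_real r ^ k) = (cnj \<rho> * u r) / of_real (r ^ k)" by simp
    then have 2: "Re (cnj \<rho> * (u r / of_real r ^ k)) = Re (cnj \<rho> * u r) / r ^ k" by (simp only: Re_divide_of_real)
    have 3: "norm (u r) * norm (u r / of_real r ^ k) = (norm (u r))\<^sup>2 / r ^ k"
      using elim by (simp add: norm_divide norm_power power2_eq_square)
    have "2 * Re (cnj \<rho> * (u r / of_real r ^ k)) + norm (u r) * norm (u r / of_real r ^ k) =
       ((norm (\<phi> (of_real r * \<omega>)))\<^sup>2 - 1) / r ^ k"
      unfolding 1 2 3 by (simp add: add_divide_distrib)
    moreover have "norm (\<phi> (of_real r * \<omega>)) < 1 \<longleftrightarrow> (norm (\<phi> (of_real r * \<omega>)))\<^sup>2 - 1 < 0"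
      using power_less_one_iff[of "norm (\<phi> (of_real r * \<omega>))" 2] by (simp add: abs_square_less_1[symmetric])
    moreover have "((norm (\<phi> (of_real r * \<omega>)))\<^sup>2 - 1) / r ^ k < 0 \<longleftrightarrow> (norm (\<phi> (of_real r * \<omega>)))\<^sup>2 - 1 < 0"
      using pos_divide_less_eq[OF rk, of "(norm (\<phi> (of_real r * \<omega>)))\<^sup>2 - 1" 0] by (simp only: mult_zero_left)
    ultimately show ?case by (simp only:)
  qed
  show ?thesis
  proof (cases "Re (cnj \<rho> * A * \<omega> ^ k) < 0")
    case True
    then have "eventually (\<lambda>r. 2 * Re (cnj \<rho> * (u r / of_real r ^ k)) + norm (u r) * norm (u r / of_real r ^ k) < 0) (at_right 0)"
      using order_tendstoD(2)[OF G, of 0] by simp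
    then show ?thesis using eq by eventually_elim (use True in simp)
  next
    case False
    then have "2 * Re (cnj \<rho> * A * \<omega> ^ k) > 0" using nz by simp
    then have "eventually (\<lambda>r. 2 * Re (cnj \<rho> * (u r / of_real r ^ k)) + norm (u r) * norm (u r / of_real r ^ k) > 0) (at_right 0)"
      using order_tendstoD(1)[OF G, of 0] by simp
    then show ?thesis using eq by eventually_elim (use False in simp)
  qed
qed

text \<open>For \<open>J\<close> a power of two that exceeds all the orders \<open>k\<close> of \<open>\<phi> i - \<rho> i\<close>, multiplication by a suitable
  \<open>J\<close>-th root of unity changes the sign of the leading term \<open>A t\<^sup>k\<close>, so the \<open>J\<close> directions pair off.\<close>

theorem balanced_directions:
  assumes fin: "finite I" and mero: "\<And>i. i \<in> I \<Longrightarrow> \<phi> i meromorphic_on {0}"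
    and lim: "\<And>i. i \<in> I \<Longrightarrow> (\<phi> i \<longlongrightarrow> \<rho> i) (at 0)" and \<rho>: "\<And>i. i \<in> I \<Longrightarrow> norm (\<rho> i) = 1"
    and ne: "\<And>i. i \<in> I \<Longrightarrow> eventually (\<lambda>t. \<phi> i t \<noteq> \<rho> i) (at 0)"
    and P: "eventually P (at 0)"
  shows "\<exists>J>0. \<exists>T. (\<forall>j<J. P (T j)) \<and> (\<forall>i\<in>I. 2 * card {j. j < J \<and> norm (\<phi> i (T j)) < 1} = J)"
proof -
  have "\<exists>k A. k \<ge> 1 \<and> A \<noteq> 0 \<and> ((\<lambda>t. (\<phi> i t - \<rho> i) * t powi (- int k)) \<longlongrightarrow> A) (at 0)" if i: "i \<in> I" for i
  proof (rule meromorphic_at_0_cases[of "\<lambda>t. \<phi> i t - \<rho> i"])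
    show "(\<lambda>t. \<phi> i t - \<rho> i) meromorphic_on {0}" by (intro meromorphic_intros mero i)
  next
    assume "eventually (\<lambda>t. \<phi> i t - \<rho> i = 0) (at 0)"
    then have "eventually (\<lambda>t. False) (at (0::complex))" using ne[OF i] by eventually_elim simp
    then show ?thesis by simp
  next
    fix k A assume A: "A \<noteq> 0" "((\<lambda>t. (\<phi> i t - \<rho> i) * t powi (- k)) \<longlongrightarrow> A) (at 0)"
    have "k \<ge> 1"
    proof (rule ccontr)
      assume "\<not> k \<ge> 1"
      then have e: "- k = int (nat (- k))" by simp
      have "((\<lambda>t. (\<phi> i t - \<rho> i) * t ^ nat (- k)) \<longlongrightarrow> (\<rho> i - \<rho> i) * 0 ^ nat (- k)) (at 0)"
        by (intro tendsto_intros lim i)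
      then have "((\<lambda>t. (\<phi> i t - \<rho> i) * t powi (- k)) \<longlongrightarrow> 0) (at 0)" by (subst e) (simp only: power_int_of_nat diff_self mult_zero_left)
      then have "A = 0" using A(2) tendsto_unique by (metis at_neq_bot)
      then show False using A(1) by simp
    qed
    then show ?thesis using A by (intro exI[of _ "nat k"] exI[of _ A]) auto
  qed
  then have "\<forall>i\<in>I. \<exists>p. fst p \<ge> 1 \<and> snd p \<noteq> 0 \<and> ((\<lambda>t. (\<phi> i t - \<rho> i) * t powi (- int (fst p))) \<longlongrightarrow> snd p) (at 0)"
    by auto
  then obtain kA where kA: "\<forall>i\<in>I. fst (kA i) \<ge> 1 \<and> snd (kA i) \<noteq> 0 \<and> ((\<lambda>t. (\<phi> i t - \<rho> i) * t powi (- int (fst (kA i)))) \<longlongrightarrow> snd (kA i)) (at 0)"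
    by (rule bchoice[THEN exE]) blast
  define k A where "k = (\<lambda>i. fst (kA i))" and "A = (\<lambda>i. snd (kA i))"
  have kA: "k i \<ge> 1" "A i \<noteq> 0" "((\<lambda>t. (\<phi> i t - \<rho> i) * t powi (- int (k i))) \<longlongrightarrow> A i) (at 0)" if "i \<in> I" for i
    using kA that by (auto simp: k_def A_def)
  \<comment> \<open>Each order is at most the sum K, and K < 2^K, so one power of two exceeds all
    the orders.\<close>
  define K where "K = (\<Sum>i\<in>I. k i)"
  have kK: "k i < 2 ^ K" if "i \<in> I" for i
  proof -
    have "k i \<le> K" unfolding K_def using fin that by (intro member_le_sum) auto
    then show ?thesis using less_exp[of K] by linarith
  qed
  define J where "J = (2::nat) ^ K"
  define \<zeta> where "\<zeta> = exp (2 * of_real pi * \<i> / 2 ^ K)"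
  have n\<zeta>: "norm \<zeta> = 1" by (simp add: \<zeta>_def norm_exp_eq_Re)
  have \<zeta>0: "\<zeta> \<noteq> 0" by (simp add: \<zeta>_def)
  \<comment> \<open>Directions in which some leading term is tangent to the unit circle, so that it
    does not decide the sign; each pair (i, j) contributes finitely many.\<close>
  define bad where "bad = (\<Union>(i, j)\<in>I \<times> {..<J}. {w \<in> sphere (0::complex) 1. Re ((cnj (\<rho> i) * A i * \<zeta> ^ (j * k i)) * w ^ k i) = 0})"
  have "finite bad" unfolding bad_def
  proof (rule finite_UN_I)
    fix p assume "p \<in> I \<times> {..<J}"
    then obtain i j where p: "p = (i, j)" "i \<in> I" by auto
    have "\<rho> i \<noteq> 0" using \<rho>[OF p(2)] by auto
    then show "finite (case p of (i, j) \<Rightarrow> {w \<in> sphere (0::complex) 1. Re ((cnj (\<rho> i) * A i * \<zeta> ^ (j * k i)) * w ^ k i) = 0})"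
      unfolding p(1) prod.case by (intro finite_imaginary_directions) (use kA[OF p(2)] \<zeta>0 in auto)
  qed (use fin in auto)
  then have "\<not> sphere (0::complex) 1 \<subseteq> bad" using infinite_unit_circle finite_subset by blast
  then obtain \<omega> where "\<omega> \<in> sphere 0 1" "\<omega> \<notin> bad" by blast
  then have \<omega>: "norm \<omega> = 1" "\<omega> \<notin> bad" by auto
  define E where "E i = cnj (\<rho> i) * A i * \<omega> ^ k i" for i
  have E: "Re (E i * \<zeta> ^ (j * k i)) \<noteq> 0" if "i \<in> I" "j < J" for i j
    using \<omega> that by (auto simp: bad_def E_def mult_ac)
  have dir: "eventually (\<lambda>r. norm (\<phi> i (of_real r * (\<omega> * \<zeta> ^ j))) < 1 \<longleftrightarrow> Re (E i * \<zeta> ^ (j * k i)) < 0) (at_right 0)"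
    if "i \<in> I" "j < J" for i j
  proof -
    have e: "cnj (\<rho> i) * A i * (\<omega> * \<zeta> ^ j) ^ k i = E i * \<zeta> ^ (j * k i)"
      by (simp add: E_def power_mult_distrib power_mult mult.assoc)
    have "norm (\<omega> * \<zeta> ^ j) = 1" using \<omega> n\<zeta> by (simp add: norm_mult norm_power)
    from norm_less_1_direction[OF kA(3) \<rho> kA(1) this, of i] show ?thesis using E[OF that] that(1) unfolding e by blast
  qed
  have Pev: "eventually (\<lambda>r. P (of_real r * (\<omega> * \<zeta> ^ j))) (at_right (0::real))" for j
  proof (rule eventually_compose_filterlim[OF P])
    have "((\<lambda>r. of_real r * (\<omega> * \<zeta> ^ j)) \<longlongrightarrow> of_real 0 * (\<omega> * \<zeta> ^ j)) (at_right (0::real))" by (intro tendsto_intros)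
    moreover have "\<omega> \<noteq> 0" using \<omega> by auto
    then have "eventually (\<lambda>r. of_real r * (\<omega> * \<zeta> ^ j) \<noteq> 0) (at_right (0::real))"
      using \<zeta>0 by (auto simp: eventually_at_filter)
    ultimately show "filterlim (\<lambda>r. of_real r * (\<omega> * \<zeta> ^ j)) (at 0) (at_right (0::real))" by (simp add: filterlim_at)
  qed
  have "eventually (\<lambda>r. (\<forall>j\<in>{..<J}. P (of_real r * (\<omega> * \<zeta> ^ j))) \<and>
     (\<forall>p\<in>I \<times> {..<J}. norm (\<phi> (fst p) (of_real r * (\<omega> * \<zeta> ^ snd p))) < 1 \<longleftrightarrow> Re (E (fst p) * \<zeta> ^ (snd p * k (fst p))) < 0)) (at_right 0)"
    by (intro eventually_conj eventually_ball_finite) (use fin Pev dir in auto)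
  then obtain r where r: "\<forall>j\<in>{..<J}. P (of_real r * (\<omega> * \<zeta> ^ j))"
     "\<forall>p\<in>I \<times> {..<J}. norm (\<phi> (fst p) (of_real r * (\<omega> * \<zeta> ^ snd p))) < 1 \<longleftrightarrow> Re (E (fst p) * \<zeta> ^ (snd p * k (fst p))) < 0"
    using eventually_happens'[OF trivial_limit_at_right_real] by blast
  have "2 * card {j. j < J \<and> norm (\<phi> i (of_real r * (\<omega> * \<zeta> ^ j))) < 1} = J" if i: "i \<in> I" for i
  proof -
    have "{j. j < J \<and> norm (\<phi> i (of_real r * (\<omega> * \<zeta> ^ j))) < 1} = {j. j < J \<and> Re (E i * \<zeta> ^ (j * k i)) < 0}"
      using r(2) i by force
    then show ?thesis
      using root_of_unity_balanced[OF kA(1)[OF i] kK[OF i], of "E i"] E[OF i] by (simp add: J_def \<zeta>_def)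
  qed
  then show ?thesis
    using r(1) by (intro exI[of _ J] conjI exI[of _ "\<lambda>j. of_real r * (\<omega> * \<zeta> ^ j)"]) (auto simp: J_def)
qed

section \<open>Counting cycles by multiplier\<close>

lemma exact_period_mod:
  assumes "exact_period f z l" "(f ^^ k) z = z"
  shows "l dvd k"
proof -
  have l: "l > 0" "(f ^^ l) z = z" using assms(1) by (auto simp: exact_period_def)
  have "(f ^^ (k mod l)) z = z" using funpow_mod_period[OF l(2), of k] assms(2) by simp
  moreover have "k mod l < l" using l(1) by simp
  ultimately have "k mod l = 0" using assms(1) unfolding exact_period_def by (metis gr0I)
  then show ?thesis by auto
qed

lemma exact_period_unique:
  assumes "exact_period f z l" "exact_period f z k"
  shows "l = k"
  using exact_period_mod[OF assms(1), of k] exact_period_mod[OF assms(2), of l] assms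
  by (auto simp: exact_period_def intro: dvd_antisym)

lemma exists_exact_period:
  assumes "(f ^^ m) z = z" "m > 0"
  obtains l where "exact_period f z l" "l dvd m"
proof -
  define l where "l = (LEAST k. 0 < k \<and> (f ^^ k) z = z)"
  have l: "0 < l \<and> (f ^^ l) z = z" unfolding l_def by (rule LeastI[of _ m]) (use assms in simp)
  have "(f ^^ k) z \<noteq> z" if "0 < k" "k < l" for k
    using not_less_Least[of k "\<lambda>k. 0 < k \<and> (f ^^ k) z = z"] that by (auto simp: l_def)
  then have ep: "exact_period f z l" using l by (auto simp: exact_period_def)
  show ?thesis by (rule that[OF ep exact_period_mod[OF ep assms(1)]])
qed

lemma exact_period_funpow_inj:
  assumes "exact_period f z l"
  shows "inj_on (\<lambda>i. (f ^^ i) z) {..<l}"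
proof (rule linorder_inj_onI')
  fix i j assume ij: "i \<in> {..<l}" "j \<in> {..<l}" "i < j"
  have l: "(f ^^ l) z = z" using assms by (simp add: exact_period_def)
  show "(f ^^ i) z \<noteq> (f ^^ j) z"
  proof
    assume e: "(f ^^ i) z = (f ^^ j) z"
    have "(f ^^ (l - j + i)) z = (f ^^ (l - j)) ((f ^^ j) z)" by (simp add: funpow_add e)
    also have "\<dots> = (f ^^ (l - j + j)) z" by (simp only: funpow_add o_apply)
    also have "\<dots> = z" using ij l by simp
    finally show False using assms ij unfolding exact_period_def by (auto dest!: spec[of _ "l - j + i"])
  qed
qed

lemma card_cycle_of: "exact_period f z l \<Longrightarrow> card (cycle_of f z l) = l"
  unfolding cycle_of_def using exact_period_funpow_inj[of f z l] by (simp add: card_image)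

lemma funpow_in_cycle_of:
  assumes "exact_period f z l"
  shows "(f ^^ k) z \<in> cycle_of f z l"
proof -
  have l: "l > 0" "(f ^^ l) z = z" using assms by (auto simp: exact_period_def)
  then show ?thesis unfolding cycle_of_def using funpow_mod_period[OF l(2), of k] by auto
qed

lemma cycle_of_eq:
  assumes "exact_period f z l" "exact_period f w l" "w \<in> cycle_of f z l"
  shows "cycle_of f w l = cycle_of f z l"
proof -
  obtain i where i: "w = (f ^^ i) z" using assms(3) by (auto simp: cycle_of_def)
  have sub: "cycle_of f w l \<subseteq> cycle_of f z l"
  proof
    fix v assume "v \<in> cycle_of f w l"
    then obtain j where "v = (f ^^ j) w" by (auto simp: cycle_of_def)
    then have "v = (f ^^ (j + i)) z" by (simp add: i funpow_add)
    then show "v \<in> cycle_of f z l" using funpow_in_cycle_of[OF assms(1)] by simp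
  qed
  have "finite (cycle_of f z l)" by (simp add: cycle_of_def)
  then show ?thesis using card_subset_eq[OF _ sub] card_cycle_of assms(1,2) by metis
qed

lemma card_union_of_cycles:
  assumes "finite A" "\<And>z. z \<in> A \<Longrightarrow> exact_period f z l" "f ` A \<subseteq> A"
  shows "card A = l * card ((\<lambda>z. cycle_of f z l) ` A)"
proof -
  have cl: "(f ^^ i) z \<in> A" if "z \<in> A" for i z using that assms(3) by (induction i) auto
  have un: "\<Union> ((\<lambda>z. cycle_of f z l) ` A) = A"
  proof
    show "\<Union> ((\<lambda>z. cycle_of f z l) ` A) \<subseteq> A" using cl by (auto simp: cycle_of_def)
    show "A \<subseteq> \<Union> ((\<lambda>z. cycle_of f z l) ` A)"
      using funpow_in_cycle_of[OF assms(2), of _ 0] by auto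
  qed
  have "l * card ((\<lambda>z. cycle_of f z l) ` A) = card (\<Union> ((\<lambda>z. cycle_of f z l) ` A))"
  proof (rule card_partition)
    fix c assume "c \<in> (\<lambda>z. cycle_of f z l) ` A"
    then obtain z where "z \<in> A" "c = cycle_of f z l" by auto
    then show "card c = l" using card_cycle_of[OF assms(2)] by simp
  next
    fix c1 c2 assume c: "c1 \<in> (\<lambda>z. cycle_of f z l) ` A" "c2 \<in> (\<lambda>z. cycle_of f z l) ` A" "c1 \<noteq> c2"
    show "c1 \<inter> c2 = {}"
    proof (rule ccontr)
      assume "c1 \<inter> c2 \<noteq> {}"
      then obtain w where w: "w \<in> c1" "w \<in> c2" by blast
      obtain z1 z2 where z: "z1 \<in> A" "c1 = cycle_of f z1 l" "z2 \<in> A" "c2 = cycle_of f z2 l" using c by auto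
      have "w \<in> A" using w(1) z cl by (auto simp: cycle_of_def)
      then have "cycle_of f w l = c1" "cycle_of f w l = c2"
        using cycle_of_eq assms(2) z w by metis+
      then show False using c(3) by simp
    qed
  qed (use assms(1) un in auto)
  then show ?thesis by (simp add: un)
qed

text \<open>Moebius inversion in linear form. The coefficients depend on the weights alone, so the
  same combination serves for all maps and all annuli. With the weights 1 / l it expresses the
  number of cycles by fixed point counts.\<close>

lemma divisor_sum_inversion:
  "\<exists>c :: nat \<Rightarrow> real. \<forall>e \<kappa>. (\<forall>m\<in>{1..L}. \<kappa> m = (\<Sum>l\<in>{l\<in>{1..m}. l dvd m}. e l)) \<longrightarrow>
     (\<Sum>l=1..L. w l * e l) = (\<Sum>m=1..L. c m * \<kappa> m)"
proof (induction L arbitrary: w)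
  case 0
  then show ?case by simp
next
  case (Suc L)
  \<comment> \<open>The count for \<open>Suc L\<close> also contains the points whose period is a
    proper divisor of it; their surplus is taken off the smaller weights.\<close>
  define w' where "w' l = w l - (if l dvd Suc L then w (Suc L) else 0)" for l
  obtain c :: "nat \<Rightarrow> real" where c: "\<And>e \<kappa>. (\<forall>m\<in>{1..L}. \<kappa> m = (\<Sum>l\<in>{l\<in>{1..m}. l dvd m}. e l)) \<Longrightarrow>
     (\<Sum>l=1..L. w' l * e l) = (\<Sum>m=1..L. c m * \<kappa> m)" using Suc[of w'] by blast
  show ?case
  proof (intro exI[of _ "c(Suc L := w (Suc L))"] allI impI)
    fix e \<kappa> :: "nat \<Rightarrow> real" assume k: "\<forall>m\<in>{1..Suc L}. \<kappa> m = (\<Sum>l\<in>{l\<in>{1..m}. l dvd m}. e l)"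
    have set: "{l\<in>{1..Suc L}. l dvd Suc L} = insert (Suc L) {l\<in>{1..L}. l dvd Suc L}" by (auto simp: le_Suc_eq)
    have kS: "\<kappa> (Suc L) = e (Suc L) + (\<Sum>l\<in>{l\<in>{1..L}. l dvd Suc L}. e l)"
      using k set by simp
    have "(\<Sum>l\<in>{l\<in>{1..L}. l dvd Suc L}. e l) = (\<Sum>l=1..L. if l dvd Suc L then e l else 0)"
      by (rule sum.mono_neutral_cong_left) auto
    then have "w (Suc L) * \<kappa> (Suc L) = w (Suc L) * e (Suc L) + (\<Sum>l=1..L. w (Suc L) * (if l dvd Suc L then e l else 0))"
      unfolding kS by (simp add: distrib_left sum_distrib_left)
    moreover have "(\<Sum>l=1..L. w' l * e l) = (\<Sum>l=1..L. w l * e l) - (\<Sum>l=1..L. w (Suc L) * (if l dvd Suc L then e l else 0))"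
      unfolding sum_subtractf[symmetric] by (rule sum.cong) (auto simp: w'_def algebra_simps)
    moreover have "(\<Sum>l=1..L. w' l * e l) = (\<Sum>m=1..L. c m * \<kappa> m)"
    proof (rule c)
      show "\<forall>m\<in>{1..L}. \<kappa> m = (\<Sum>l\<in>{l\<in>{1..m}. l dvd m}. e l)" 
      proof
        fix m assume "m \<in> {1..L}"
        then show "\<kappa> m = (\<Sum>l\<in>{l\<in>{1..m}. l dvd m}. e l)" using bspec[OF k, of m] by simp
      qed
    qed
    moreover have "(\<Sum>m=1..L. (c(Suc L := w (Suc L))) m * \<kappa> m) = (\<Sum>m=1..L. c m * \<kappa> m)"
      by (rule sum.cong) auto
    ultimately show "(\<Sum>l=1..Suc L. w l * e l) = (\<Sum>m=1..Suc L. (c(Suc L := w (Suc L))) m * \<kappa> m)"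
      by simp
  qed
qed

lemma exact_period_step:
  assumes "exact_period f z l"
  shows "exact_period f (f z) l"
proof -
  have l: "l > 0" "(f ^^ l) z = z" using assms by (auto simp: exact_period_def)
  have "(f ^^ l) (f z) = f z" using l(2) by (metis funpow_swap1)
  moreover have "(f ^^ k) (f z) \<noteq> f z" if k: "0 < k" "k < l" for k
  proof
    assume e: "(f ^^ k) (f z) = f z"
    have "(f ^^ k) z = (f ^^ k) ((f ^^ l) z)" by (simp add: l(2))
    also have "\<dots> = (f ^^ (l - 1)) ((f ^^ k) (f z))"
    proof -
      have "k + l = (l - 1) + k + 1" using l(1) by simp
      then have "(f ^^ (k + l)) z = (f ^^ ((l - 1) + k + 1)) z" by (rule arg_cong)
      then show ?thesis by (simp only: funpow_add o_apply One_nat_def funpow.simps id_apply)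
    qed
    also have "\<dots> = (f ^^ (l - 1)) (f z)" by (simp only: e)
    also have "\<dots> = (f ^^ (l - 1 + 1)) z" by (simp only: funpow_add o_apply One_nat_def funpow.simps id_apply)
    also have "\<dots> = z" using l by simp
    finally show False using assms k by (simp add: exact_period_def)
  qed
  ultimately show ?thesis using l(1) by (simp add: exact_period_def)
qed

lemma qmult_step:
  assumes "(qmap a b c d ^^ l) z = z" "qmult a b c d l z \<noteq> 0"
  shows "qmult a b c d l (qmap a b c d z) = qmult a b c d l z"
proof (cases "l = 0")
  case True
  then show ?thesis by (simp add: qmult_def)
next
  case False
  then have nz: "qder a b c d z \<noteq> 0" using assms(2) by (auto simp: qmult_def dest!: bspec[of _ _ 0])
  have "qder a b c d z * qmult a b c d l (qmap a b c d z) = (\<Prod>i<Suc l. qder a b c d ((qmap a b c d ^^ i) z))"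
    unfolding qmult_def by (subst prod.lessThan_Suc_shift) (simp add: funpow_swap1 o_def)
  also have "\<dots> = qder a b c d z * qmult a b c d l z" by (simp add: assms(1) qmult_def)
  finally show ?thesis using nz by simp
qed

lemma power_less_power_iff: "0 \<le> a \<Longrightarrow> 0 \<le> b \<Longrightarrow> k > 0 \<Longrightarrow> a ^ k < b ^ k \<longleftrightarrow> a < (b :: real)"
  by (metis linorder_not_le power_mono_iff)

section \<open>Cycles with multipliers in an annulus\<close>

definition cyc_pts :: "complex \<Rightarrow> complex \<Rightarrow> real \<Rightarrow> real \<Rightarrow> nat \<Rightarrow> complex set" where
  "cyc_pts b c lo hi l = {z. exact_period (qmap 1 b c 1) z l \<and>
     lo ^ l < norm (qmult 1 b c 1 l z) \<and> norm (qmult 1 b c 1 l z) < hi ^ l}"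

definition mult_zone :: "real \<Rightarrow> real \<Rightarrow> nat \<Rightarrow> complex set" where
  "mult_zone lo hi m = {x. lo ^ m < norm x \<and> norm x < hi ^ m}"

text \<open>For m = l k the multiplier of the m-th iterate is the k-th power of that of the l-th,
  and taking k-th powers preserves strict bounds; so the zones of m and l select the same points of
  period l.\<close>

lemma fixed_points_decomposition:
  assumes m: "m \<ge> 1" and lo: "0 \<le> lo" "0 \<le> hi"
  shows "{z. (qmap 1 b c 1 ^^ m) z = z \<and> qmult 1 b c 1 m z \<in> mult_zone lo hi m} =
     (\<Union>l\<in>{l\<in>{1..m}. l dvd m}. cyc_pts b c lo hi l)"
proof -
  have zone: "lo ^ m < norm (qmult 1 b c 1 m z) \<and> norm (qmult 1 b c 1 m z) < hi ^ m \<longleftrightarrow>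
      lo ^ l < norm (qmult 1 b c 1 l z) \<and> norm (qmult 1 b c 1 l z) < hi ^ l"
    if "(qmap 1 b c 1 ^^ l) z = z" "m = l * k" for l k z
  proof -
    have k: "k > 0" using m that(2) by (cases k) auto
    have e: "norm (qmult 1 b c 1 m z) = norm (qmult 1 b c 1 l z) ^ k"
      unfolding that(2) qmult_power[OF that(1)] by (simp add: norm_power)
    show ?thesis unfolding e unfolding that(2) power_mult
      using lo k by (simp add: power_less_power_iff)
  qed
  show ?thesis
  proof (intro equalityI subsetI)
    fix z assume z: "z \<in> {z. (qmap 1 b c 1 ^^ m) z = z \<and> qmult 1 b c 1 m z \<in> mult_zone lo hi m}"
    then obtain l where l: "exact_period (qmap 1 b c 1) z l" "l dvd m"
      using exists_exact_period[of m "qmap 1 b c 1" z] m by auto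
    obtain k where k: "m = l * k" using l(2) by blast
    have "z \<in> cyc_pts b c lo hi l"
      using zone[OF _ k, of z] l(1) z by (auto simp: cyc_pts_def mult_zone_def exact_period_def)
    moreover have "l \<in> {l\<in>{1..m}. l dvd m}" using l m by (auto simp: exact_period_def dvd_imp_le)
    ultimately show "z \<in> (\<Union>l\<in>{l\<in>{1..m}. l dvd m}. cyc_pts b c lo hi l)" by blast
  next
    fix z assume "z \<in> (\<Union>l\<in>{l\<in>{1..m}. l dvd m}. cyc_pts b c lo hi l)"
    then obtain l where l: "l dvd m" "z \<in> cyc_pts b c lo hi l" by auto
    obtain k where k: "m = l * k" using l(1) by blast
    have lz: "(qmap 1 b c 1 ^^ l) z = z" using l(2) by (auto simp: cyc_pts_def exact_period_def)
    then have "(qmap 1 b c 1 ^^ m) z = z" unfolding k by (rule funpow_mult_fixed)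
    then show "z \<in> {z. (qmap 1 b c 1 ^^ m) z = z \<and> qmult 1 b c 1 m z \<in> mult_zone lo hi m}"
      using zone[OF lz k] l(2) by (auto simp: cyc_pts_def mult_zone_def)
  qed
qed

lemma card_fixed_points_sum:
  assumes m: "m \<ge> 1" and lo: "0 \<le> lo" "0 \<le> hi"
    and fin: "finite {z. (qmap 1 b c 1 ^^ m) z = z \<and> qmult 1 b c 1 m z \<in> mult_zone lo hi m}"
  shows "card {z. (qmap 1 b c 1 ^^ m) z = z \<and> qmult 1 b c 1 m z \<in> mult_zone lo hi m} =
     (\<Sum>l\<in>{l\<in>{1..m}. l dvd m}. card (cyc_pts b c lo hi l))"
    and "finite (cyc_pts b c lo hi m)"
proof -
  note eq = fixed_points_decomposition[OF m lo, of b c]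
  have f: "finite (cyc_pts b c lo hi l)" if "l \<in> {l\<in>{1..m}. l dvd m}" for l
    using fin unfolding eq by (rule finite_subset[rotated]) (use that in blast)
  show "finite (cyc_pts b c lo hi m)" using f[of m] m by auto
  show "card {z. (qmap 1 b c 1 ^^ m) z = z \<and> qmult 1 b c 1 m z \<in> mult_zone lo hi m} =
     (\<Sum>l\<in>{l\<in>{1..m}. l dvd m}. card (cyc_pts b c lo hi l))"
    unfolding eq
  proof (rule card_UN_disjoint)
    show "\<forall>i\<in>{l\<in>{1..m}. l dvd m}. \<forall>j\<in>{l\<in>{1..m}. l dvd m}. i \<noteq> j \<longrightarrow> cyc_pts b c lo hi i \<inter> cyc_pts b c lo hi j = {}"
    proof (intro ballI impI)
      fix i j :: nat assume "i \<noteq> j"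
      then show "cyc_pts b c lo hi i \<inter> cyc_pts b c lo hi j = {}"
        using exact_period_unique[of "qmap 1 b c 1" _ i j] by (auto simp: cyc_pts_def)
    qed
  qed (use f in auto)
qed

text \<open>Tagging a cycle with its period makes the union over l disjoint.\<close>

definition cyc_count :: "nat \<Rightarrow> complex \<Rightarrow> complex \<Rightarrow> real \<Rightarrow> real \<Rightarrow> nat" where
  "cyc_count L b c lo hi = card (SIGMA l:{1..L}. (\<lambda>z. cycle_of (qmap 1 b c 1) z l) ` cyc_pts b c lo hi l)"

lemma cyc_count_eq:
  assumes fin: "\<And>l. l \<in> {1..L} \<Longrightarrow> finite (cyc_pts b c lo hi l)" and lo: "0 \<le> lo"
  shows "real (cyc_count L b c lo hi) = (\<Sum>l=1..L. (1 / real l) * real (card (cyc_pts b c lo hi l)))"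
proof -
  have "real (cyc_count L b c lo hi) = (\<Sum>l=1..L. real (card ((\<lambda>z. cycle_of (qmap 1 b c 1) z l) ` cyc_pts b c lo hi l)))"
    unfolding cyc_count_def using fin by (subst card_SigmaI) auto
  also have "\<dots> = (\<Sum>l=1..L. (1 / real l) * real (card (cyc_pts b c lo hi l)))"
  proof (rule sum.cong[OF refl])
    fix l assume l: "l \<in> {1..L}"
    have "card (cyc_pts b c lo hi l) = l * card ((\<lambda>z. cycle_of (qmap 1 b c 1) z l) ` cyc_pts b c lo hi l)"
    proof (rule card_union_of_cycles[OF fin[OF l]])
      show "qmap 1 b c 1 ` cyc_pts b c lo hi l \<subseteq> cyc_pts b c lo hi l"
      proof (rule image_subsetI)
        fix z assume z: "z \<in> cyc_pts b c lo hi l"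
        have "0 \<le> lo ^ l" using lo by simp
        also have "\<dots> < norm (qmult 1 b c 1 l z)" using z by (simp add: cyc_pts_def)
        finally have "qmult 1 b c 1 l z \<noteq> 0" by simp
        then have "qmult 1 b c 1 l (qmap 1 b c 1 z) = qmult 1 b c 1 l z"
          using z by (intro qmult_step) (auto simp: cyc_pts_def exact_period_def)
        then show "qmap 1 b c 1 z \<in> cyc_pts b c lo hi l"
          using z exact_period_step by (auto simp: cyc_pts_def)
      qed
    qed (auto simp: cyc_pts_def)
    then show "real (card ((\<lambda>z. cycle_of (qmap 1 b c 1) z l) ` cyc_pts b c lo hi l)) = (1 / real l) * real (card (cyc_pts b c lo hi l))"
      using l by simp
  qed
  finally show ?thesis .
qed

text \<open>The strict lower bound by a nonnegative number excludes superattracting cycles, and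
  distinct tagged cycles have disjoint orbits, so three of them would contradict
  \<open>no_three_attracting_cycles\<close>.\<close>

lemma cyc_count_attracting_le_2:
  assumes bc: "b * c \<noteq> 1" and lo: "0 \<le> lo"
  shows "cyc_count L b c lo 1 \<le> 2"
proof (rule ccontr)
  assume "\<not> ?thesis"
  then have "3 \<le> card (SIGMA l:{1..L}. (\<lambda>z. cycle_of (qmap 1 b c 1) z l) ` cyc_pts b c lo 1 l)"
    by (simp add: cyc_count_def)
  then obtain T where T: "T \<subseteq> (SIGMA l:{1..L}. (\<lambda>z. cycle_of (qmap 1 b c 1) z l) ` cyc_pts b c lo 1 l)" "card T = 3"
    by (rule obtain_subset_with_card_n) (rule that)
  obtain h where h: "bij_betw h {0..<3::nat} T"
    using ex_bij_betw_nat_finite[of T] T(2) by (metis card.infinite zero_neq_numeral)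
  have "\<exists>l z. h i = (l, cycle_of (qmap 1 b c 1) z l) \<and> z \<in> cyc_pts b c lo 1 l" if "i < 3" for i
  proof -
    have "h i \<in> T" using h that by (auto simp: bij_betw_def)
    then have "h i \<in> (SIGMA l:{1..L}. (\<lambda>z. cycle_of (qmap 1 b c 1) z l) ` cyc_pts b c lo 1 l)"
      using T(1) by (rule subsetD[rotated])
    then obtain l C where lC: "h i = (l, C)" "C \<in> (\<lambda>z. cycle_of (qmap 1 b c 1) z l) ` cyc_pts b c lo 1 l"
      by (rule SigmaE) simp
    then obtain z where "z \<in> cyc_pts b c lo 1 l" "C = cycle_of (qmap 1 b c 1) z l" by (elim imageE) simp
    then show ?thesis using lC(1) by (intro exI[of _ l] exI[of _ z]) simp
  qed
  note ex = this
  have "\<forall>i\<in>{..<3}. \<exists>p. h i = (fst p, cycle_of (qmap 1 b c 1) (snd p) (fst p)) \<and> snd p \<in> cyc_pts b c lo 1 (fst p)"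
  proof
    fix i :: nat assume "i \<in> {..<3}"
    then have "i < 3" by simp
    from ex[OF this] obtain l z where "h i = (l, cycle_of (qmap 1 b c 1) z l) \<and> z \<in> cyc_pts b c lo 1 l" by blast
    then show "\<exists>p. h i = (fst p, cycle_of (qmap 1 b c 1) (snd p) (fst p)) \<and> snd p \<in> cyc_pts b c lo 1 (fst p)"
      by (intro exI[of _ "(l, z)"]) simp
  qed
  then obtain p where p: "\<forall>i\<in>{..<3}. h i = (fst (p i), cycle_of (qmap 1 b c 1) (snd (p i)) (fst (p i))) \<and> snd (p i) \<in> cyc_pts b c lo 1 (fst (p i))"
    by (rule bchoice[THEN exE]) blast
  define l z where "l = (\<lambda>i. fst (p i))" and "z = (\<lambda>i. snd (p i))"
  have lz: "h i = (l i, cycle_of (qmap 1 b c 1) (z i) (l i)) \<and> z i \<in> cyc_pts b c lo 1 (l i)" if "i < 3" for i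
    using bspec[OF p, of i] that by (simp add: l_def z_def)
  have ep: "exact_period (qmap 1 b c 1) (z i) (l i)" if "i < 3" for i using lz[OF that] by (simp add: cyc_pts_def)
  have \<rho>: "qmult 1 b c 1 (l i) (z i) \<noteq> 0 \<and> norm (qmult 1 b c 1 (l i) (z i)) < 1" if "i < 3" for i
  proof -
    have "0 \<le> lo ^ l i" using lo by simp
    also have "\<dots> < norm (qmult 1 b c 1 (l i) (z i))" using lz[OF that] by (simp add: cyc_pts_def)
    finally show ?thesis using lz[OF that] by (simp add: cyc_pts_def)
  qed
  show False
  proof (rule no_three_attracting_cycles[OF bc, of l z])
    fix i :: nat assume "i < 3"
    then show "l i > 0 \<and> (qmap 1 b c 1 ^^ l i) (z i) = z i" using ep by (auto simp: exact_period_def)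
    show "qmult 1 b c 1 (l i) (z i) \<noteq> 0 \<and> norm (qmult 1 b c 1 (l i) (z i)) < 1" using \<rho>[OF \<open>i < 3\<close>] .
  next
    fix i j k m :: nat assume ij: "i < 3" "j < 3" "i \<noteq> j"
    show "(qmap 1 b c 1 ^^ k) (z i) \<noteq> (qmap 1 b c 1 ^^ m) (z j)"
    proof
      assume e: "(qmap 1 b c 1 ^^ k) (z i) = (qmap 1 b c 1 ^^ m) (z j)"
      define w where "w = (qmap 1 b c 1 ^^ k) (z i)"
      have step: "exact_period f z l \<Longrightarrow> exact_period f ((f ^^ n) z) l" for f :: "complex \<Rightarrow> complex" and z l n
        by (induction n) (auto intro: exact_period_step)
      have wi: "exact_period (qmap 1 b c 1) w (l i)" unfolding w_def by (rule step[OF ep[OF ij(1)]])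
      have wj: "exact_period (qmap 1 b c 1) w (l j)" unfolding w_def e by (rule step[OF ep[OF ij(2)]])
      have l: "l i = l j" using exact_period_unique[OF wi wj] .
      have "cycle_of (qmap 1 b c 1) w (l i) = cycle_of (qmap 1 b c 1) (z i) (l i)"
        by (rule cycle_of_eq[OF ep[OF ij(1)] wi]) (simp add: w_def funpow_in_cycle_of[OF ep[OF ij(1)]])
      moreover have "cycle_of (qmap 1 b c 1) w (l j) = cycle_of (qmap 1 b c 1) (z j) (l j)"
        by (rule cycle_of_eq[OF ep[OF ij(2)] wj]) (simp add: w_def e funpow_in_cycle_of[OF ep[OF ij(2)]])
      ultimately have "h i = h j" using lz ij l by simp
      then show False using h ij by (auto simp: bij_betw_def inj_on_def)
    qed
  qed
qed

section \<open>Degeneration along a sequence of maps\<close>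

lemma bivariate_nonvanishing_sequence:
  fixes P :: "complex poly poly"
  assumes "P \<noteq> 0"
  obtains xs ys where "xs \<longlonglongrightarrow> x" "ys \<longlonglongrightarrow> y" "\<And>k. eval2 P (xs k) (ys k) \<noteq> 0"
proof -
  have near: "\<exists>z'. dist z' z < e \<and> poly p z' \<noteq> 0" if p: "p \<noteq> 0" and e: "e > 0" for p :: "complex poly" and z e
  proof -
    have "infinite (ball z e)" using uncountable_ball[OF e, of z] countable_finite by blast
    then have "\<not> ball z e \<subseteq> {w. poly p w = 0}"
      using finite_subset[OF _ poly_roots_finite[OF p]] by blast
    then show ?thesis by (auto simp: dist_commute)
  qed
  have "\<exists>q. dist (fst q) x < inverse (Suc k) \<and> dist (snd q) y < inverse (Suc k) \<and> eval2 P (fst q) (snd q) \<noteq> 0" for k :: nat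
  proof -
    obtain x' where x': "dist x' x < inverse (Suc k)" "poly (lead_coeff P) x' \<noteq> 0"
      using near[of "lead_coeff P" "inverse (Suc k)"] assms by (auto simp: inverse_eq_divide)
    then have "coeff (fibre_poly P x') (degree P) \<noteq> 0" by (simp add: coeff_fibre_poly)
    then have "fibre_poly P x' \<noteq> 0" by auto
    then obtain y' where "dist y' y < inverse (Suc k)" "poly (fibre_poly P x') y' \<noteq> 0"
      using near[of "fibre_poly P x'" "inverse (Suc k)"] by (auto simp: inverse_eq_divide)
    then show ?thesis using x' by (intro exI[of _ "(x', y')"]) (simp add: eval2_fibre_poly)
  qed
  then obtain q where q: "\<And>k. dist (fst (q k)) x < inverse (Suc k)" "\<And>k. dist (snd (q k)) y < inverse (Suc k)"
    "\<And>k. eval2 P (fst (q k)) (snd (q k)) \<noteq> 0"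
    by metis
  have "(\<lambda>k. fst (q k)) \<longlonglongrightarrow> x" "(\<lambda>k. snd (q k)) \<longlonglongrightarrow> y"
    using q(1,2) LIMSEQ_inverse_real_of_nat
    by (auto intro!: metric_tendsto_imp_tendsto[OF LIMSEQ_inverse_real_of_nat] always_eventually less_imp_le simp: dist_real_def)
  then show ?thesis using q(3) by (rule that)
qed

lemma tendsto_eval2:
  assumes "(f \<longlongrightarrow> x) F" "(g \<longlongrightarrow> y) F"
  shows "((\<lambda>k. eval2 p (f k) (g k)) \<longlongrightarrow> eval2 p x y) F"
proof -
  have "eval2 p x y = (\<Sum>i\<le>degree p. poly (coeff p i) x * y ^ i)" for x y
    by (simp add: eval2_def poly_altdef[of p] poly_sum poly_power)
  then show ?thesis by (auto intro!: tendsto_intros assms)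
qed

text \<open>\<open>curve_selection\<close> requires nonzero values. A small move reaches a point
  where no member of the family vanishes, while each ratio with a nonzero denominator changes
  little; along a sequence the limits of the ratios survive.\<close>

lemma perturb_nonvanishing:
  fixes FS :: "complex poly poly set"
  assumes fin: "finite FS" "0 \<notin> FS" and e: "e > 0"
  shows "\<exists>x' y'. dist x' x < e \<and> (\<forall>p\<in>FS. eval2 p x' y' \<noteq> 0) \<and>
     (\<forall>p\<in>FS. \<forall>q\<in>FS. eval2 q x y \<noteq> 0 \<longrightarrow> dist (eval2 p x' y' / eval2 q x' y') (eval2 p x y / eval2 q x y) < e)"
proof -
  obtain xs ys where s: "xs \<longlonglongrightarrow> x" "ys \<longlonglongrightarrow> y" "\<And>k. eval2 (\<Prod>p\<in>FS. p) (xs k) (ys k) \<noteq> 0"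
    using bivariate_nonvanishing_sequence[of "\<Prod>p\<in>FS. p" x y] fin by (auto simp: prod_zero_iff)
  have nz: "\<forall>p\<in>FS. eval2 p (xs k) (ys k) \<noteq> 0" for k
    using s(3)[of k] fin(1) by (auto simp: prod_zero_iff)
  have "eventually (\<lambda>k. eval2 q x y \<noteq> 0 \<longrightarrow> dist (eval2 p (xs k) (ys k) / eval2 q (xs k) (ys k)) (eval2 p x y / eval2 q x y) < e) sequentially" for p q
  proof (cases "eval2 q x y = 0")
    case False
    then have "(\<lambda>k. eval2 p (xs k) (ys k) / eval2 q (xs k) (ys k)) \<longlonglongrightarrow> eval2 p x y / eval2 q x y"
      by (intro tendsto_divide tendsto_eval2 s)
    then show ?thesis using e by (auto dest: tendstoD)
  qed simp
  then have "eventually (\<lambda>k. dist (xs k) x < e \<and> (\<forall>p\<in>FS. \<forall>q\<in>FS. eval2 q x y \<noteq> 0 \<longrightarrow>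
     dist (eval2 p (xs k) (ys k) / eval2 q (xs k) (ys k)) (eval2 p x y / eval2 q x y) < e)) sequentially"
    using fin(1) e s(1) by (intro eventually_conj eventually_ball_finite ballI) (auto dest: tendstoD)
  then obtain k where "dist (xs k) x < e" "\<forall>p\<in>FS. \<forall>q\<in>FS. eval2 q x y \<noteq> 0 \<longrightarrow>
     dist (eval2 p (xs k) (ys k) / eval2 q (xs k) (ys k)) (eval2 p x y / eval2 q x y) < e"
    by (auto simp: eventually_sequentially)
  then show ?thesis using nz[of k] by blast
qed

theorem curve_through_sequence:
  fixes FS :: "complex poly poly set" and u v :: "nat \<Rightarrow> complex"
  assumes fin: "finite FS" "0 \<notin> FS" and lim: "(\<exists>b. u \<longlonglongrightarrow> b) \<or> filterlim u at_infinity sequentially"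
  shows "\<exists>X Y. X meromorphic_on {0} \<and> Y meromorphic_on {0} \<and>
    (\<forall>p\<in>FS. eventually (\<lambda>s. eval2 p (X s) (Y s) \<noteq> 0) (at 0)) \<and>
    (\<forall>p\<in>FS. \<forall>q\<in>FS. (\<forall>n. eval2 q (u n) (v n) \<noteq> 0) \<longrightarrow> (\<lambda>n. eval2 p (u n) (v n) / eval2 q (u n) (v n)) \<longlonglongrightarrow> 0 \<longrightarrow>
        ((\<lambda>s. eval2 p (X s) (Y s) / eval2 q (X s) (Y s)) \<longlongrightarrow> 0) (at 0))"
proof -
  \<comment> \<open>\<xi> parametrises x near the limit of u, as b + t or as 1 / t, and the function
    t is its inverse. The polynomial g vanishes at the one value of x, namely b or 0, for which t
    would be 0.\<close>
  have "\<exists>\<xi> g t. g \<noteq> 0 \<and> \<xi> meromorphic_on {0} \<and> (\<forall>l. l \<noteq> 0 \<longrightarrow> eventually (\<lambda>t. poly l (\<xi> t) \<noteq> 0) (at (0::complex))) \<and>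
     (\<forall>u'. (\<lambda>n. dist (u' n) (u n)) \<longlonglongrightarrow> 0 \<longrightarrow> (\<lambda>n. t (u' n)) \<longlonglongrightarrow> 0) \<and>
     (\<forall>x. poly g x \<noteq> 0 \<longrightarrow> t x \<noteq> 0 \<and> \<xi> (t x) = x)"
    (is "\<exists>\<xi> g t. ?P \<xi> g t")
    using lim
  proof
    assume "\<exists>b. u \<longlonglongrightarrow> b"
    then obtain b where b: "u \<longlonglongrightarrow> b" by blast
    have "eventually (\<lambda>t. poly l (b + t) \<noteq> 0) (at 0)" if "l \<noteq> 0" for l :: "complex poly"
    proof -
      have "eventually (\<lambda>x. poly l x \<noteq> 0) (at b)"
        unfolding eventually_at_topological
      proof (intro exI conjI ballI impI)
        show "open (- ({x. poly l x = 0} - {b}))"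
          using poly_roots_finite[OF that] by (intro open_Compl finite_imp_closed finite_Diff)
      qed auto
      then show ?thesis unfolding at_to_0[of b] by (simp add: eventually_filtermap add.commute)
    qed
    moreover have "(\<lambda>n. u' n - b) \<longlonglongrightarrow> 0" if "(\<lambda>n. dist (u' n) (u n)) \<longlonglongrightarrow> 0" for u'
    proof -
      have "(\<lambda>n. u' n - u n) \<longlonglongrightarrow> 0" using that by (simp add: dist_norm tendsto_norm_zero_iff)
      from tendsto_add[OF this b] show ?thesis by (simp add: LIM_zero_iff)
    qed
    ultimately have "?P (\<lambda>t. b + t) [:- b, 1:] (\<lambda>x. x - b)"
      by (auto intro!: meromorphic_intros)
    then show ?thesis by (intro exI)
  next
    assume inf: "filterlim u at_infinity sequentially"
    have "eventually (\<lambda>t. poly l (inverse t) \<noteq> 0) (at 0)" if "l \<noteq> 0" for l :: "complex poly"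
    proof -
      have "bounded {x. poly l x = 0}" using poly_roots_finite[OF that] by (rule finite_imp_bounded)
      then obtain B where "\<And>x. poly l x = 0 \<Longrightarrow> norm x \<le> B" unfolding bounded_iff by blast
      then have "eventually (\<lambda>x. poly l x \<noteq> 0) at_infinity"
        unfolding eventually_at_infinity by (intro exI[of _ "B + 1"]) force
      then show ?thesis using filterlim_inverse_at_infinity by (rule eventually_compose_filterlim)
    qed
    moreover have "(\<lambda>n. inverse (u' n)) \<longlonglongrightarrow> 0" if "(\<lambda>n. dist (u' n) (u n)) \<longlonglongrightarrow> 0" for u'
    proof -
      have "(\<lambda>n. u' n - u n) \<longlonglongrightarrow> 0" using that by (simp add: dist_norm tendsto_norm_zero_iff)
      then have "filterlim (\<lambda>n. (u' n - u n) + u n) at_infinity sequentially"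
        using inf by (rule tendsto_add_filterlim_at_infinity)
      then have "filterlim u' at_infinity sequentially" by simp
      then show ?thesis using filterlim_compose[OF tendsto_inverse_0] by blast
    qed
    ultimately have "?P inverse [:0, 1:] inverse"
      by (auto intro!: meromorphic_intros)
    then show ?thesis by (intro exI)
  qed
  then obtain \<xi> g t where H: "?P \<xi> g t" by (elim exE)
  have g: "g \<noteq> 0" and \<xi>: "\<xi> meromorphic_on {0}"
    and trans: "\<And>l. l \<noteq> 0 \<Longrightarrow> eventually (\<lambda>t. poly l (\<xi> t) \<noteq> 0) (at (0::complex))"
    and t: "\<And>u'. (\<lambda>n. dist (u' n) (u n)) \<longlonglongrightarrow> 0 \<Longrightarrow> (\<lambda>n. t (u' n)) \<longlonglongrightarrow> 0"
    and tg: "\<And>x. poly g x \<noteq> 0 \<Longrightarrow> t x \<noteq> 0 \<and> \<xi> (t x) = x"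
    using H by blast+
  \<comment> \<open>With g in the family the perturbed points have g(x) nonzero, hence a nonzero
    parameter t.\<close>
  let ?FS = "insert [:g:] FS"
  have f': "finite ?FS" "0 \<notin> ?FS" using fin g by auto
  define Q where "Q n z \<longleftrightarrow> dist (fst z) (u n) < inverse (Suc n) \<and> (\<forall>p\<in>?FS. eval2 p (fst z) (snd z) \<noteq> 0) \<and>
     (\<forall>p\<in>?FS. \<forall>q\<in>?FS. eval2 q (u n) (v n) \<noteq> 0 \<longrightarrow>
        dist (eval2 p (fst z) (snd z) / eval2 q (fst z) (snd z)) (eval2 p (u n) (v n) / eval2 q (u n) (v n)) < inverse (Suc n))" for n z
  have "\<exists>z. Q n z" for n
    using perturb_nonvanishing[OF f', of "inverse (Suc n)" "u n" "v n"] by (simp add: Q_def split_paired_Ex inverse_eq_divide)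
  then obtain z where Q: "\<And>n. Q n (z n)" by metis
  have z: "\<And>n. dist (fst (z n)) (u n) < inverse (Suc n)" "\<And>n p. p\<in>?FS \<Longrightarrow> eval2 p (fst (z n)) (snd (z n)) \<noteq> 0"
     "\<And>n p q. p\<in>?FS \<Longrightarrow> q\<in>?FS \<Longrightarrow> eval2 q (u n) (v n) \<noteq> 0 \<Longrightarrow>
        dist (eval2 p (fst (z n)) (snd (z n)) / eval2 q (fst (z n)) (snd (z n))) (eval2 p (u n) (v n) / eval2 q (u n) (v n)) < inverse (Suc n)"
    using Q unfolding Q_def by blast+
  have gz: "poly g (fst (z n)) \<noteq> 0" for n
    using z(2)[of "[:g:]" n] by (simp add: eval2_def)
  have small: "X \<longlonglongrightarrow> 0" if "\<And>n. dist (X n) 0 < inverse (Suc n)" for X :: "nat \<Rightarrow> real"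
    using that by (intro metric_tendsto_imp_tendsto[OF LIMSEQ_inverse_real_of_nat] always_eventually allI less_imp_le) (auto simp: dist_real_def)
  have "(\<lambda>n. dist (fst (z n)) (u n)) \<longlonglongrightarrow> 0" using z(1) by (intro small) simp
  then have t0: "(\<lambda>n. t (fst (z n))) \<longlonglongrightarrow> 0" by (rule t)
  have "\<exists>X Y. follows_ratios ?FS (\<lambda>p. p) (\<lambda>p n. eval2 p (fst (z n)) (snd (z n))) X Y"
  proof (rule curve_selection[OF f'(1) _ \<xi> trans t0, where y = "\<lambda>n. snd (z n)"])
    show "p \<noteq> 0" if "p \<in> ?FS" for p using f'(2) that by metis
    show "t (fst (z n)) \<noteq> 0" for n using tg[OF gz] by simp
    show "eval2 p (fst (z n)) (snd (z n)) = eval2 p (\<xi> (t (fst (z n)))) (snd (z n))" for p n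
      using tg[OF gz[of n]] by simp
  qed (use z(2) in auto)
  then obtain X Y where XY: "follows_ratios ?FS (\<lambda>p. p) (\<lambda>p n. eval2 p (fst (z n)) (snd (z n))) X Y"
    by (elim exE)
  show ?thesis
  proof (intro exI conjI ballI impI)
    show "X meromorphic_on {0}" "Y meromorphic_on {0}" using XY by (auto simp: follows_ratios_def)
    show "eventually (\<lambda>s. eval2 p (X s) (Y s) \<noteq> 0) (at 0)" if "p \<in> FS" for p using XY that by (auto simp: follows_ratios_def)
    fix p q assume pq: "p \<in> FS" "q \<in> FS" "\<forall>n. eval2 q (u n) (v n) \<noteq> 0"
      and l: "(\<lambda>n. eval2 p (u n) (v n) / eval2 q (u n) (v n)) \<longlonglongrightarrow> 0"
    have "(\<lambda>n. dist (eval2 p (fst (z n)) (snd (z n)) / eval2 q (fst (z n)) (snd (z n))) (eval2 p (u n) (v n) / eval2 q (u n) (v n))) \<longlonglongrightarrow> 0"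
      using z(3) pq by (intro small) simp
    then have "(\<lambda>n. eval2 p (fst (z n)) (snd (z n)) / eval2 q (fst (z n)) (snd (z n)) - eval2 p (u n) (v n) / eval2 q (u n) (v n)) \<longlonglongrightarrow> 0"
      by (simp add: dist_norm tendsto_norm_zero_iff)
    from tendsto_add[OF this l] have "(\<lambda>n. eval2 p (fst (z n)) (snd (z n)) / eval2 q (fst (z n)) (snd (z n))) \<longlonglongrightarrow> 0" by simp
    then show "((\<lambda>s. eval2 p (X s) (Y s) / eval2 q (X s) (Y s)) \<longlongrightarrow> 0) (at 0)"
      using XY pq(1,2) by (auto simp: follows_ratios_def)
  qed
qed

text \<open>Compactness of projective space: division by the coordinate of largest modulus bounds
  all coordinates by 1, and on a subsequence this coordinate has a constant index.\<close>

lemma normalized_limit_single: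
  fixes w :: "nat \<Rightarrow> nat \<Rightarrow> complex"
  assumes nz: "\<And>n. \<exists>j\<le>d. w j n \<noteq> 0"
  shows "\<exists>r piv \<tau>. strict_mono (r :: nat \<Rightarrow> nat) \<and> piv \<le> d \<and> \<tau> piv = 1 \<and> (\<forall>n. w piv (r n) \<noteq> 0) \<and>
     (\<forall>j\<le>d. (\<lambda>n. w j (r n) / w piv (r n)) \<longlonglongrightarrow> \<tau> j)"
proof -
  have "\<exists>k. k \<le> d \<and> (\<forall>j\<le>d. norm (w j n) \<le> norm (w k n))" for n
    using Max_in[of "(\<lambda>j. norm (w j n)) ` {..d}"] Max_ge[of "(\<lambda>j. norm (w j n)) ` {..d}"] by fastforce
  then obtain k where k: "\<And>n. k n \<le> d" "\<And>n j. j \<le> d \<Longrightarrow> norm (w j n) \<le> norm (w (k n) n)" by metis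
  obtain piv r1 where piv: "piv \<in> {..d}" "strict_mono (r1 :: nat \<Rightarrow> nat)" "\<And>n. k (r1 n) = piv"
    using finite_range_constant_subseq[of "{..d}" k] k(1) by auto
  have le: "norm (w j (r1 n)) \<le> norm (w piv (r1 n))" if "j \<le> d" for j n
    using k(2)[OF that, of "r1 n"] piv(3) by simp
  have pnz: "w piv (r1 n) \<noteq> 0" for n
    using nz[of "r1 n"] le[of _ n] by force
  have b: "norm (w j (r1 n) / w piv (r1 n)) \<le> 1" if "j \<le> d" for j n
    using le[OF that, of n] pnz[of n] by (simp add: norm_divide)
  obtain r2 where r2: "strict_mono (r2 :: nat \<Rightarrow> nat)"
     "\<And>j. j \<in> {..d} \<Longrightarrow> (\<exists>c. (\<lambda>n. w j (r1 (r2 n)) / w piv (r1 (r2 n))) \<longlonglongrightarrow> c) \<or>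
        filterlim (\<lambda>n. w j (r1 (r2 n)) / w piv (r1 (r2 n))) at_infinity sequentially"
    using finite_sphere_convergent_subseq[of "{..d}" "\<lambda>j n. w j (r1 n) / w piv (r1 n)"] by auto
  have "\<exists>c. (\<lambda>n. w j (r1 (r2 n)) / w piv (r1 (r2 n))) \<longlonglongrightarrow> c" if "j \<le> d" for j
  proof -
    have "\<not> filterlim (\<lambda>n. w j (r1 (r2 n)) / w piv (r1 (r2 n))) at_infinity sequentially"
    proof
      assume "filterlim (\<lambda>n. w j (r1 (r2 n)) / w piv (r1 (r2 n))) at_infinity sequentially"
      then have "eventually (\<lambda>n. 2 \<le> norm (w j (r1 (r2 n)) / w piv (r1 (r2 n)))) sequentially"
        by (simp add: filterlim_at_infinity[OF order_refl])
      then obtain n where "2 \<le> norm (w j (r1 (r2 n)) / w piv (r1 (r2 n)))" by (auto simp: eventually_sequentially)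
      then show False using b[OF that, of "r2 n"] by linarith
    qed
    then show ?thesis using r2(2)[of j] that by auto
  qed
  then obtain \<tau> where \<tau>: "\<And>j. j \<le> d \<Longrightarrow> (\<lambda>n. w j (r1 (r2 n)) / w piv (r1 (r2 n))) \<longlonglongrightarrow> \<tau> j" by metis
  have "(\<lambda>n. w piv (r1 (r2 n)) / w piv (r1 (r2 n))) \<longlonglongrightarrow> 1" using pnz by simp
  then have "\<tau> piv = 1" using \<tau>[of piv] piv(1) LIMSEQ_unique by auto
  moreover have "strict_mono (\<lambda>n. r1 (r2 n))" using strict_mono_o[OF piv(2) r2(1)] by (simp add: o_def)
  ultimately show ?thesis using \<tau> pnz piv(1) 
    by (intro exI[of _ "\<lambda>n. r1 (r2 n)"] exI[of _ piv] exI[of _ \<tau>]) auto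
qed

lemma normalized_limit:
  fixes w :: "'m \<Rightarrow> nat \<Rightarrow> nat \<Rightarrow> complex"
  assumes "finite M" "\<And>m n. m \<in> M \<Longrightarrow> \<exists>j\<le>d m. w m j n \<noteq> 0"
  shows "\<exists>r piv \<tau>. strict_mono (r :: nat \<Rightarrow> nat) \<and> (\<forall>m\<in>M. piv m \<le> d m \<and> \<tau> m (piv m) = 1 \<and> (\<forall>n. w m (piv m) (r n) \<noteq> 0) \<and>
     (\<forall>j\<le>d m. (\<lambda>n. w m j (r n) / w m (piv m) (r n)) \<longlonglongrightarrow> \<tau> m j))"
  using assms
proof (induction M)
  case empty
  show ?case by (rule exI[of _ id]) (auto simp: strict_mono_def)
next
  case (insert m M)
  have "\<exists>r piv \<tau>. strict_mono (r :: nat \<Rightarrow> nat) \<and> (\<forall>m\<in>M. piv m \<le> d m \<and> \<tau> m (piv m) = 1 \<and> (\<forall>n. w m (piv m) (r n) \<noteq> 0) \<and>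
     (\<forall>j\<le>d m. (\<lambda>n. w m j (r n) / w m (piv m) (r n)) \<longlonglongrightarrow> \<tau> m j))"
    using insert.prems by (intro insert.IH) simp
  then obtain r piv \<tau> where r: "strict_mono (r :: nat \<Rightarrow> nat)"
    and IH: "\<And>m. m \<in> M \<Longrightarrow> piv m \<le> d m \<and> \<tau> m (piv m) = 1 \<and> (\<forall>n. w m (piv m) (r n) \<noteq> 0) \<and>
     (\<forall>j\<le>d m. (\<lambda>n. w m j (r n) / w m (piv m) (r n)) \<longlonglongrightarrow> \<tau> m j)"
    by (elim exE conjE) (rule that, assumption, rule bspec)
  obtain r2 p t where r2: "strict_mono (r2 :: nat \<Rightarrow> nat)"
    and p: "p \<le> d m \<and> t p = 1 \<and> (\<forall>n. w m p (r (r2 n)) \<noteq> 0) \<and>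
     (\<forall>j\<le>d m. (\<lambda>n. w m j (r (r2 n)) / w m p (r (r2 n))) \<longlonglongrightarrow> t j)"
    using normalized_limit_single[of "d m" "\<lambda>j n. w m j (r n)"] insert.prems[of m] by auto
  have "strict_mono (\<lambda>n. r (r2 n))" using strict_mono_o[OF r r2] by (simp add: o_def)
  moreover have "(piv(m := p)) k \<le> d k \<and> (\<tau>(m := t)) k ((piv(m := p)) k) = 1 \<and> (\<forall>n. w k ((piv(m := p)) k) (r (r2 n)) \<noteq> 0) \<and>
     (\<forall>j\<le>d k. (\<lambda>n. w k j (r (r2 n)) / w k ((piv(m := p)) k) (r (r2 n))) \<longlonglongrightarrow> (\<tau>(m := t)) k j)" if k: "k \<in> insert m M" for k
  proof (cases "k = m")
    case True then show ?thesis using p by simp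
  next
    case False
    then have kM: "k \<in> M" using k by simp
    have "(\<lambda>n. w k j (r (r2 n)) / w k (piv k) (r (r2 n))) \<longlonglongrightarrow> \<tau> k j" if "j \<le> d k" for j
      using LIMSEQ_subseq_LIMSEQ[OF _ r2, of "\<lambda>n. w k j (r n) / w k (piv k) (r n)"] IH[OF kM] that by (simp add: o_def)
    then show ?thesis using IH[OF kM] False by simp
  qed
  ultimately show ?case by (intro exI[of _ "\<lambda>n. r (r2 n)"] exI[of _ "piv(m := p)"] exI[of _ "\<tau>(m := t)"]) blast
qed

text \<open>Each of the finitely many coefficient germs is either identically 0 or nowhere 0 near t
  = 0.\<close>

lemma mero_poly_eventually_degree_const:
  assumes W: "mero_poly W" and D: "\<And>t. degree (W t) \<le> D" and nz: "eventually (\<lambda>t. W t \<noteq> 0) (at 0)"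
  shows "\<exists>d. eventually (\<lambda>t. degree (W t) = d \<and> W t \<noteq> 0) (at 0)"
proof -
  define A where "A = {i. i \<le> D \<and> eventually (\<lambda>t. coeff (W t) i \<noteq> 0) (at 0)}"
  have "eventually (\<lambda>t. coeff (W t) i \<noteq> 0 \<longleftrightarrow> i \<in> A) (at 0)" if "i \<le> D" for i
  proof (cases "i \<in> A")
    case True
    then show ?thesis by (auto simp: A_def elim: eventually_mono)
  next
    case False
    then have "\<not> eventually (\<lambda>t. coeff (W t) i \<noteq> 0) (at 0)" using that by (simp add: A_def)
    then have "eventually (\<lambda>t. coeff (W t) i = 0) (at 0)"
      using meromorphic_at_0_zero_or_nonzero[of "\<lambda>t. coeff (W t) i"] W by (auto simp: mero_poly_def)
    then show ?thesis by (rule eventually_mono) (use False in simp)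
  qed
  then have "eventually (\<lambda>t. \<forall>i\<in>{..D}. coeff (W t) i \<noteq> 0 \<longleftrightarrow> i \<in> A) (at 0)"
    by (intro eventually_ball_finite) auto
  then have "eventually (\<lambda>t. degree (W t) = Max A \<and> W t \<noteq> 0) (at 0)"
    using nz
  proof eventually_elim
    case (elim t)
    have fA: "finite A" by (simp add: A_def)
    have "coeff (W t) (degree (W t)) \<noteq> 0" using elim(2) by simp
    then have "degree (W t) \<in> A" using bspec[OF elim(1), of "degree (W t)"] D[of t] by simp
    moreover have "i \<le> degree (W t)" if "i \<in> A" for i
    proof -
      have "i \<le> D" using that by (simp add: A_def)
      then have "coeff (W t) i \<noteq> 0" using bspec[OF elim(1), of i] that by simp
      then show ?thesis by (rule le_degree)
    qed
    ultimately show ?case using fA elim by (metis Max_eqI)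
  qed
  then show ?thesis by blast
qed

lemma tendsto_poly_coeffs:
  assumes D: "\<And>t. degree (W t) \<le> D" and lim: "coeffs_tendsto W q F" and \<phi>: "(\<phi> \<longlongrightarrow> \<rho>) F" and F: "F \<noteq> bot"
  shows "((\<lambda>t. poly (W t) (\<phi> t)) \<longlongrightarrow> poly q \<rho>) F"
proof -
  have e: "poly p x = (\<Sum>i\<le>D. coeff p i * x ^ i)" if "degree p \<le> D" for p and x :: complex
    unfolding poly_altdef by (rule sum.mono_neutral_left) (use that in \<open>auto simp: coeff_eq_0\<close>)
  have "degree q \<le> D"
  proof (rule degree_le, intro allI impI)
    fix i assume "D < i"
    then have "coeff (W t) i = 0" for t using D[of t] by (simp add: coeff_eq_0)
    then have "((\<lambda>t. 0) \<longlongrightarrow> coeff q i) F" using lim by (auto simp: coeffs_tendsto_def dest: spec[of _ i])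
    then show "coeff q i = 0" using tendsto_unique[OF F _ tendsto_const] by blast
  qed
  then show ?thesis unfolding e[OF D] e[OF \<open>degree q \<le> D\<close>]
    using lim by (intro tendsto_intros \<phi>) (auto simp: coeffs_tendsto_def)
qed

lemma meromorphic_root_limit:
  assumes \<phi>: "\<phi> meromorphic_on {0}" and D: "\<And>t. degree (W t) \<le> D" and lim: "coeffs_tendsto W q (at 0)"
    and root: "eventually (\<lambda>t. poly (W t) (\<phi> t) = 0) (at 0)"
  shows "(\<exists>\<rho>. (\<phi> \<longlongrightarrow> \<rho>) (at 0) \<and> poly q \<rho> = 0) \<or> filterlim \<phi> at_infinity (at 0)"
proof -
  have fin: "poly q \<rho> = 0" if "(\<phi> \<longlongrightarrow> \<rho>) (at 0)" for \<rho>
  proof -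
    have "((\<lambda>t. poly (W t) (\<phi> t)) \<longlongrightarrow> poly q \<rho>) (at 0)" by (rule tendsto_poly_coeffs[OF D lim that]) simp
    moreover have "((\<lambda>t. poly (W t) (\<phi> t)) \<longlongrightarrow> 0) (at 0)" using root by (rule tendsto_eventually)
    ultimately show ?thesis using tendsto_unique[OF trivial_limit_at] by blast
  qed
  have "isolated_singularity_at \<phi> 0" "not_essential \<phi> 0"
    using \<phi> by (simp_all add: meromorphic_at_iff)
  then show ?thesis using fin by (auto simp: not_essential_def is_pole_def)
qed

text \<open>Both bounds tend to 1 as \<eta> tends to 0, and only finitely many roots have to be left
  outside.\<close>

lemma unit_roots_isolated_annulus:
  fixes q :: "nat \<Rightarrow> complex poly"
  assumes "finite M" "\<And>m. m \<in> M \<Longrightarrow> q m \<noteq> 0"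
  obtains \<eta> where "0 < \<eta>" "\<eta> < 1"
    "\<And>m x. m \<in> M \<Longrightarrow> poly (q m) x = 0 \<Longrightarrow> norm x \<noteq> 1 \<Longrightarrow> norm x < (1 - \<eta>) ^ m \<or> (1 + \<eta>) ^ m < norm x"
proof -
  have "eventually (\<lambda>\<eta>. norm x \<noteq> 1 \<longrightarrow> norm x < (1 - \<eta>) ^ m \<or> (1 + \<eta>) ^ m < norm x) (at_right 0)" for x :: complex and m :: nat
  proof -
    have "((\<lambda>\<eta>::real. (1 - \<eta>) ^ m) \<longlongrightarrow> (1 - 0) ^ m) (at_right 0)" "((\<lambda>\<eta>::real. (1 + \<eta>) ^ m) \<longlongrightarrow> (1 + 0) ^ m) (at_right 0)"
      by (intro tendsto_intros)+
    then have l: "((\<lambda>\<eta>::real. (1 - \<eta>) ^ m) \<longlongrightarrow> 1) (at_right 0)" "((\<lambda>\<eta>::real. (1 + \<eta>) ^ m) \<longlongrightarrow> 1) (at_right 0)" by simp_all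
    consider "norm x < 1" | "norm x > 1" | "norm x = 1" by linarith
    then show ?thesis
    proof cases
      case 1 from order_tendstoD(1)[OF l(1) this] show ?thesis by eventually_elim simp
    next
      case 2 from order_tendstoD(2)[OF l(2) this] show ?thesis by eventually_elim simp
    qed simp
  qed
  then have "eventually (\<lambda>\<eta>. \<forall>m\<in>M. \<forall>x\<in>{x. poly (q m) x = 0}. norm x \<noteq> 1 \<longrightarrow> norm x < (1 - \<eta>) ^ m \<or> (1 + \<eta>) ^ m < norm x) (at_right (0::real))"
    using assms by (intro eventually_ball_finite ballI) (auto intro: poly_roots_finite)
  moreover have "eventually (\<lambda>\<eta>. \<eta> < 1) (at_right (0::real))" by (rule order_tendstoD(2)[OF tendsto_ident_at]) simp
  moreover have "eventually (\<lambda>\<eta>. 0 < \<eta>) (at_right (0::real))" by (rule eventually_at_right_less)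
  ultimately have "eventually (\<lambda>\<eta>. 0 < \<eta> \<and> \<eta> < 1 \<and> (\<forall>m\<in>M. \<forall>x\<in>{x. poly (q m) x = 0}. norm x \<noteq> 1 \<longrightarrow> norm x < (1 - \<eta>) ^ m \<or> (1 + \<eta>) ^ m < norm x)) (at_right (0::real))"
    by eventually_elim blast
  then obtain \<eta> :: real where "0 < \<eta> \<and> \<eta> < 1 \<and> (\<forall>m\<in>M. \<forall>x\<in>{x. poly (q m) x = 0}. norm x \<noteq> 1 \<longrightarrow> norm x < (1 - \<eta>) ^ m \<or> (1 + \<eta>) ^ m < norm x)"
    using eventually_happens'[OF trivial_limit_at_right_real] by blast
  then show ?thesis by (intro that[of \<eta>]) auto
qed

lemma mult_zone_topology:
  "open (mult_zone lo hi m)" "bounded (mult_zone lo hi m)"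
  "x \<in> frontier (mult_zone lo hi m) \<Longrightarrow> lo ^ m \<le> norm x \<and> norm x \<le> hi ^ m \<and> \<not> (lo ^ m < norm x \<and> norm x < hi ^ m)"
proof -
  show o: "open (mult_zone lo hi m)" unfolding mult_zone_def by (intro open_Collect_conj open_Collect_less continuous_intros)
  show "bounded (mult_zone lo hi m)" unfolding mult_zone_def bounded_iff by (auto intro!: exI[of _ "hi ^ m"])
  assume x: "x \<in> frontier (mult_zone lo hi m)"
  have "closed {x::complex. lo ^ m \<le> norm x \<and> norm x \<le> hi ^ m}"
    by (intro closed_Collect_conj closed_Collect_le continuous_intros)
  moreover have "mult_zone lo hi m \<subseteq> {x. lo ^ m \<le> norm x \<and> norm x \<le> hi ^ m}" by (auto simp: mult_zone_def)
  ultimately have "closure (mult_zone lo hi m) \<subseteq> {x. lo ^ m \<le> norm x \<and> norm x \<le> hi ^ m}" by (rule closure_minimal[rotated])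
  then show "lo ^ m \<le> norm x \<and> norm x \<le> hi ^ m \<and> \<not> (lo ^ m < norm x \<and> norm x < hi ^ m)"
    using x o by (auto simp: frontier_def interior_open mult_zone_def)
qed

lemma no_root_on_annulus_frontier:
  assumes m: "m \<ge> 1" and \<eta>: "0 < \<eta>" "\<eta> < 1"
    and iso: "poly q x = 0 \<Longrightarrow> norm x \<noteq> 1 \<Longrightarrow> norm x < (1 - \<eta>) ^ m \<or> (1 + \<eta>) ^ m < norm x"
    and x: "x \<in> frontier (mult_zone (1 - \<eta>) (1 + \<eta>) m)"
  shows "poly q x \<noteq> 0"
proof
  have lo: "(1 - \<eta>) ^ m < 1" using \<eta> m by (intro power_less_one_iff[THEN iffD2]) auto
  have hi: "1 < (1 + \<eta>) ^ m" using \<eta> m by (intro one_less_power) auto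
  note x = mult_zone_topology(3)[OF x]
  assume "poly q x = 0"
  moreover have "norm x \<noteq> 1" using x lo hi by auto
  ultimately show False using iso x by linarith
qed

lemma filterlim_recip_at_0: "filterlim (\<lambda>n. inverse (of_nat (Suc n)) :: complex) (at 0) sequentially"
  unfolding filterlim_at
proof
  show "(\<lambda>n. inverse (of_nat (Suc n)) :: complex) \<longlonglongrightarrow> 0"
  proof (rule tendsto_norm_zero_cancel)
    show "(\<lambda>n. norm (inverse (of_nat (Suc n)) :: complex)) \<longlonglongrightarrow> 0"
      using LIMSEQ_inverse_real_of_nat by (simp only: norm_inverse norm_of_nat)
  qed
  show "\<forall>\<^sub>F n in sequentially. (inverse (of_nat (Suc n)) :: complex) \<in> UNIV \<and> (inverse (of_nat (Suc n)) :: complex) \<noteq> 0"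
    by (rule always_eventually) (simp del: of_nat_Suc)
qed

text \<open>For small t the roots of \<open>W m\<close> in the annulus are the Puiseux branches
  whose limit is on the unit circle. The condition \<open>unit\<close> keeps such a branch different
  from its limit, so \<open>balanced_directions\<close> puts it inside the disc for exactly half of
  J parameters, which are common to all m.\<close>

theorem balanced_roots:
  fixes W :: "nat \<Rightarrow> complex \<Rightarrow> complex poly"
  assumes M: "finite M" "\<And>m. m \<in> M \<Longrightarrow> m \<ge> 1" and W: "\<And>m. m \<in> M \<Longrightarrow> mero_poly (W m)"
    and D: "\<And>m t. m \<in> M \<Longrightarrow> degree (W m t) \<le> D m"
    and lim: "\<And>m. m \<in> M \<Longrightarrow> coeffs_tendsto (W m) (q m) (at 0)" and q: "\<And>m. m \<in> M \<Longrightarrow> q m \<noteq> 0"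
    and unit: "\<And>m \<rho>. m \<in> M \<Longrightarrow> poly (q m) \<rho> = 0 \<Longrightarrow> norm \<rho> = 1 \<Longrightarrow> eventually (\<lambda>t. poly (W m t) \<rho> \<noteq> 0) (at 0)"
    and \<eta>: "0 < \<eta>" "\<eta> < 1"
      "\<And>m x. m \<in> M \<Longrightarrow> poly (q m) x = 0 \<Longrightarrow> norm x \<noteq> 1 \<Longrightarrow> norm x < (1 - \<eta>) ^ m \<or> (1 + \<eta>) ^ m < norm x"
    and Q: "eventually Q (at 0)"
  shows "\<exists>J>0. \<exists>T. (\<forall>j<J. Q (T j)) \<and> (\<forall>m\<in>M.
     2 * (\<Sum>j<J. root_count (W m (T j)) (mult_zone (1 - \<eta>) 1 m)) = J * root_count (q m) (mult_zone (1 - \<eta>) (1 + \<eta>) m))"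
proof -
  have Wnz: "eventually (\<lambda>t. W m t \<noteq> 0) (at 0)" if m: "m \<in> M" for m
  proof -
    have "eventually (\<lambda>t. coeff (W m t) (degree (q m)) \<noteq> 0) (at 0)"
      using lim[OF m] q[OF m] unfolding coeffs_tendsto_def by (intro tendsto_imp_eventually_ne) auto
    then show ?thesis by eventually_elim auto
  qed
  have "\<exists>d. eventually (\<lambda>t. degree (W m t) = d \<and> W m t \<noteq> 0) (at 0)" if m: "m \<in> M" for m
    using mero_poly_eventually_degree_const[OF W[OF m] D[OF m] Wnz[OF m]] .
  with M(1) W have "\<exists>K \<phi>s. K \<ge> 1 \<and> (\<forall>m\<in>M. (\<forall>\<phi>\<in>set (\<phi>s m). \<phi> meromorphic_on {0}) \<and>
     eventually (\<lambda>t. W m (t ^ K) = smult (lead_coeff (W m (t ^ K))) (\<Prod>\<phi>\<leftarrow>\<phi>s m. [:- \<phi> t, 1:])) (at 0))"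
    by (rule puiseux_family)
  then obtain K \<phi>s where K: "K \<ge> 1"
    and \<phi>s: "\<And>m \<phi>. m \<in> M \<Longrightarrow> \<phi> \<in> set (\<phi>s m) \<Longrightarrow> \<phi> meromorphic_on {0}"
      "\<And>m. m \<in> M \<Longrightarrow> eventually (\<lambda>t. W m (t ^ K) = smult (lead_coeff (W m (t ^ K))) (\<Prod>\<phi>\<leftarrow>\<phi>s m. [:- \<phi> t, 1:])) (at 0)"
    by (elim exE conjE) (rule that, assumption, blast, blast)
  have atK: "filterlim (\<lambda>t::complex. t ^ K) (at 0) (at 0)" using K by (rule filterlim_power_at_0)
  define V where "V m t = W m (t ^ K)" for m t
  define I where "I = (SIGMA m:M. {..<length (\<phi>s m)})"
  define \<phi> where "\<phi> i = \<phi>s (fst i) ! snd i" for i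
  define Z where "Z m = mult_zone (1 - \<eta>) (1 + \<eta>) m" for m
  define I1 where "I1 = {i\<in>I. \<exists>\<rho>. norm \<rho> = 1 \<and> (\<phi> i \<longlongrightarrow> \<rho>) (at 0)}"
  have finI: "finite I" using M(1) by (simp add: I_def)
  have VD: "degree (V m t) \<le> D m" if "m \<in> M" for m t using D[OF that] by (simp add: V_def)
  have Vlim: "coeffs_tendsto (V m) (q m) (at 0)" if m: "m \<in> M" for m
    using lim[OF m] atK unfolding coeffs_tendsto_def V_def by (auto intro: filterlim_compose)
  have Vnz: "eventually (\<lambda>t. V m t \<noteq> 0) (at 0)" if m: "m \<in> M" for m
    unfolding V_def using Wnz[OF m] atK by (rule eventually_compose_filterlim)
  have Vfac: "eventually (\<lambda>t. V m t = smult (lead_coeff (V m t)) (\<Prod>k<length (\<phi>s m). [:- \<phi> (m, k) t, 1:])) (at 0)" if m: "m \<in> M" for m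
    using \<phi>s(2)[OF m]
  proof eventually_elim
    case (elim t)
    have "(\<Prod>\<phi>\<leftarrow>\<phi>s m. [:- \<phi> t, 1:]) = (\<Prod>k<length (\<phi>s m). [:- \<phi> (m, k) t, 1:])"
      by (simp add: prod.list_conv_set_nth \<phi>_def atLeast0LessThan)
    then show ?case using elim by (simp add: V_def)
  qed
  have mero: "\<phi> i meromorphic_on {0}" if "i \<in> I" for i
    using that \<phi>s(1) by (auto simp: I_def \<phi>_def)
  have root: "eventually (\<lambda>t. poly (V (fst i) t) (\<phi> i t) = 0) (at 0)" if i: "i \<in> I" for i
  proof -
    obtain m k where mk: "i = (m, k)" "m \<in> M" "k < length (\<phi>s m)" using i by (auto simp: I_def)
    show ?thesis using Vfac[OF mk(2)]
    proof eventually_elim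
      case (elim t)
      have "(\<Prod>l<length (\<phi>s m). poly [:- \<phi> (m, l) t, 1:] (\<phi> (m, k) t)) = 0"
        using mk(3) by (intro prod_zero) auto
      then have "poly (\<Prod>k<length (\<phi>s m). [:- \<phi> (m, k) t, 1:]) (\<phi> (m, k) t) = 0" unfolding poly_prod .
      then show ?case unfolding mk(1) fst_conv by (subst elim) (simp only: poly_smult mult_zero_right)
    qed
  qed
  \<comment> \<open>A branch tends to a root on the unit circle, to a root off it, which the choice
    of \<eta> keeps out of the closed annulus, or to infinity.\<close>
  have zone: "eventually (\<lambda>t. \<phi> i t \<in> Z (fst i) \<longleftrightarrow> i \<in> I1) (at 0)" if i: "i \<in> I" for i
  proof -
    obtain m k where mk: "i = (m, k)" "m \<in> M" using i by (auto simp: I_def)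
    have m1: "m \<ge> 1" using M(2) mk by simp
    have lo: "(1 - \<eta>) ^ m < 1" using \<eta> m1 by (intro power_less_one_iff[THEN iffD2]) auto
    have hi: "1 < (1 + \<eta>) ^ m" using \<eta> m1 by (intro one_less_power) auto
    from meromorphic_root_limit[OF mero[OF i] VD Vlim root[OF i]] mk
    consider \<rho> where "(\<phi> i \<longlongrightarrow> \<rho>) (at 0)" "poly (q m) \<rho> = 0" "norm \<rho> = 1"
      | \<rho> where "(\<phi> i \<longlongrightarrow> \<rho>) (at 0)" "poly (q m) \<rho> = 0" "norm \<rho> \<noteq> 1" | "filterlim (\<phi> i) at_infinity (at 0)"
      by auto
    then show ?thesis
    proof cases
      case 1
      then have "\<rho> \<in> Z m" using lo hi by (simp add: Z_def mult_zone_def)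
      then have "eventually (\<lambda>t. \<phi> i t \<in> Z m) (at 0)"
        using 1(1) mult_zone_topology(1) unfolding Z_def by (intro topological_tendstoD)
      moreover have "i \<in> I1" using 1 i by (auto simp: I1_def)
      ultimately show ?thesis by (auto simp: mk(1) elim: eventually_mono)
    next
      case 2
      have n: "((\<lambda>t. norm (\<phi> i t)) \<longlongrightarrow> norm \<rho>) (at 0)" by (intro tendsto_intros 2)
      have "eventually (\<lambda>t. \<phi> i t \<notin> Z m) (at 0)"
      proof (cases "norm \<rho> < (1 - \<eta>) ^ m")
        case True
        from order_tendstoD(2)[OF n this] show ?thesis by eventually_elim (simp add: Z_def mult_zone_def)
      next
        case False
        then have "norm \<rho> > (1 + \<eta>) ^ m" using \<eta>(3)[OF mk(2) 2(2,3)] by simp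
        from order_tendstoD(1)[OF n this] show ?thesis by eventually_elim (simp add: Z_def mult_zone_def)
      qed
      moreover have "i \<notin> I1"
      proof
        assume "i \<in> I1"
        then obtain \<rho>' where "norm \<rho>' = 1" "(\<phi> i \<longlongrightarrow> \<rho>') (at 0)" by (auto simp: I1_def)
        then show False using 2(3) tendsto_unique[OF trivial_limit_at 2(1)] by metis
      qed
      ultimately show ?thesis by (auto simp: mk(1) elim: eventually_mono)
    next
      case 3
      then have "eventually (\<lambda>t. (1 + \<eta>) ^ m \<le> norm (\<phi> i t)) (at 0)"
        using \<eta>(1) by (auto simp: filterlim_at_infinity[OF order_refl])
      moreover have "i \<notin> I1" using 3 not_tendsto_and_filterlim_at_infinity[OF trivial_limit_at, of "\<phi> i"] by (auto simp: I1_def)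
      ultimately show ?thesis by (auto simp: mk(1) Z_def mult_zone_def elim: eventually_mono)
    qed
  qed
  define P where "P t \<longleftrightarrow> Q (t ^ K) \<and> (\<forall>m\<in>M. V m t \<noteq> 0 \<and> V m t = smult (lead_coeff (V m t)) (\<Prod>k<length (\<phi>s m). [:- \<phi> (m, k) t, 1:]))
     \<and> (\<forall>i\<in>I. \<phi> i t \<in> Z (fst i) \<longleftrightarrow> i \<in> I1)" for t
  have P: "eventually P (at 0)"
    unfolding P_def using Vnz Vfac zone eventually_compose_filterlim[OF Q atK]
    by (intro eventually_conj eventually_ball_finite M(1) finI ballI) auto
  have count: "root_count (V m t) S = card {k. k < length (\<phi>s m) \<and> \<phi> (m, k) t \<in> S}" if "P t" "m \<in> M" for m t S
    using root_count_factored[of "V m t" "lead_coeff (V m t)" "\<lambda>k. \<phi> (m, k) t" "{..<length (\<phi>s m)}" S] that by (auto simp: P_def)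
  define A where "A m = {k. (m, k) \<in> I1}" for m
  have finA: "finite (A m)" for m
    by (rule finite_subset[of _ "{..<length (\<phi>s m)}"]) (auto simp: A_def I1_def I_def)
  have A: "k \<in> A m \<longleftrightarrow> k < length (\<phi>s m) \<and> \<phi> (m, k) t \<in> Z m" if "P t" "m \<in> M" for m t k
  proof
    assume "k \<in> A m"
    then have "(m, k) \<in> I1" "(m, k) \<in> I" by (auto simp: A_def I1_def)
    then show "k < length (\<phi>s m) \<and> \<phi> (m, k) t \<in> Z m" using that by (force simp: P_def I_def)
  next
    assume k: "k < length (\<phi>s m) \<and> \<phi> (m, k) t \<in> Z m"
    then have "(m, k) \<in> I" using that by (simp add: I_def)
    then show "k \<in> A m" using k that by (force simp: P_def A_def)
  qed
  \<comment> \<open>The number of branches in the annulus is constant for small t and is compared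
    with that of the limit polynomial along t = 1 / (n + 1).\<close>
  have kA: "root_count (q m) (Z m) = card (A m)" if m: "m \<in> M" for m
  proof -
    let ?s = "\<lambda>n. inverse (of_nat (Suc n)) :: complex"
    have "eventually (\<lambda>n. root_count (V m (?s n)) (Z m) = root_count (q m) (Z m)) sequentially"
    proof (rule root_count_stable)
      show "degree (V m (?s n)) \<le> D m" for n using VD[OF m] .
      show "coeffs_tendsto (\<lambda>n. V m (?s n)) (q m) sequentially"
        using Vlim[OF m] filterlim_recip_at_0 unfolding coeffs_tendsto_def by (auto intro: filterlim_compose)
      show "q m \<noteq> 0" using q[OF m] .
      show "bounded (Z m)" "open (Z m)" unfolding Z_def by (rule mult_zone_topology)+
      show "poly (q m) x \<noteq> 0" if "x \<in> frontier (Z m)" for x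
        by (rule no_root_on_annulus_frontier[OF M(2)[OF m] \<eta>(1,2) \<eta>(3)[OF m] that[unfolded Z_def]])
    qed
    moreover have "eventually (\<lambda>n. P (?s n)) sequentially"
      using P filterlim_recip_at_0 by (rule eventually_compose_filterlim)
    ultimately have "eventually (\<lambda>n. P (?s n) \<and> root_count (V m (?s n)) (Z m) = root_count (q m) (Z m)) sequentially"
      by eventually_elim simp
    then obtain n where n: "P (?s n)" "root_count (V m (?s n)) (Z m) = root_count (q m) (Z m)"
      by (auto simp: eventually_sequentially simp del: of_nat_Suc)
    have "{k. k < length (\<phi>s m) \<and> \<phi> (m, k) (?s n) \<in> Z m} = A m" using A[OF n(1) m] by blast
    then show ?thesis using count[OF n(1) m, of "Z m"] n(2) by simp
  qed
  have "\<forall>i\<in>I1. \<exists>\<rho>. norm \<rho> = 1 \<and> (\<phi> i \<longlongrightarrow> \<rho>) (at 0)" by (auto simp: I1_def)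
  then obtain \<rho> where \<rho>: "\<And>i. i \<in> I1 \<Longrightarrow> norm (\<rho> i) = 1" "\<And>i. i \<in> I1 \<Longrightarrow> (\<phi> i \<longlongrightarrow> \<rho> i) (at 0)" by metis
  have I1I: "i \<in> I1 \<Longrightarrow> i \<in> I" for i by (simp add: I1_def)
  \<comment> \<open>The limit of a branch is a root of \<open>q\<close>; if the branch were equal to
    it, \<open>W\<close> would vanish there, contrary to \<open>unit\<close>.\<close>
  have ne: "eventually (\<lambda>t. \<phi> i t \<noteq> \<rho> i) (at 0)" if i: "i \<in> I1" for i
  proof -
    have m: "fst i \<in> M" using I1I[OF i] by (auto simp: I_def)
    have "((\<lambda>t. poly (V (fst i) t) (\<phi> i t)) \<longlongrightarrow> poly (q (fst i)) (\<rho> i)) (at 0)"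
      by (rule tendsto_poly_coeffs[OF VD[OF m] Vlim[OF m] \<rho>(2)[OF i]]) simp
    moreover have "((\<lambda>t. poly (V (fst i) t) (\<phi> i t)) \<longlongrightarrow> 0) (at 0)" using root[OF I1I[OF i]] by (rule tendsto_eventually)
    ultimately have "poly (q (fst i)) (\<rho> i) = 0" using tendsto_unique[OF trivial_limit_at] by blast
    from eventually_compose_filterlim[OF unit[OF m this \<rho>(1)[OF i]] atK] root[OF I1I[OF i]]
    show ?thesis by eventually_elim (auto simp: V_def)
  qed
  obtain J T where J: "J > 0" "\<And>j. j < J \<Longrightarrow> P (T j)"
    and bal: "\<And>i. i \<in> I1 \<Longrightarrow> 2 * card {j. j < J \<and> norm (\<phi> i (T j)) < 1} = J"
    using balanced_directions[of I1 \<phi> \<rho>, OF _ mero \<rho>(2,1) ne P] I1I finI finite_subset[of I1 I] by blast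
  have "2 * (\<Sum>j<J. root_count (V m (T j)) (mult_zone (1 - \<eta>) 1 m)) = J * root_count (q m) (Z m)" if m: "m \<in> M" for m
  proof -
    have hi: "1 < (1 + \<eta>) ^ m" using \<eta> M(2)[OF m] by (intro one_less_power) auto
    have "root_count (V m (T j)) (mult_zone (1 - \<eta>) 1 m) = card {k\<in>A m. norm (\<phi> (m, k) (T j)) < 1}" if j: "j < J" for j
    proof -
      have "{k. k < length (\<phi>s m) \<and> \<phi> (m, k) (T j) \<in> mult_zone (1 - \<eta>) 1 m} = {k\<in>A m. norm (\<phi> (m, k) (T j)) < 1}"
        unfolding A[OF J(2)[OF j] m] using hi by (auto simp: Z_def mult_zone_def)
      then show ?thesis using count[OF J(2)[OF j] m] by simp
    qed
    then have "(\<Sum>j<J. root_count (V m (T j)) (mult_zone (1 - \<eta>) 1 m)) = (\<Sum>j<J. card {k\<in>A m. norm (\<phi> (m, k) (T j)) < 1})" by simp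
    also have "\<dots> = (\<Sum>j<J. \<Sum>k\<in>A m. if norm (\<phi> (m, k) (T j)) < 1 then 1 else 0)"
      using finA by (simp add: sum.If_cases Int_def)
    also have "\<dots> = (\<Sum>k\<in>A m. \<Sum>j<J. if norm (\<phi> (m, k) (T j)) < 1 then 1 else 0)" by (rule sum.swap)
    also have "\<dots> = (\<Sum>k\<in>A m. card {j. j < J \<and> norm (\<phi> (m, k) (T j)) < 1})"
      by (simp add: sum.If_cases Int_def)
    finally have "2 * (\<Sum>j<J. root_count (V m (T j)) (mult_zone (1 - \<eta>) 1 m)) = (\<Sum>k\<in>A m. 2 * card {j. j < J \<and> norm (\<phi> (m, k) (T j)) < 1})"
      by (simp add: sum_distrib_left)
    also have "\<dots> = (\<Sum>k\<in>A m. J)" by (rule sum.cong[OF refl], rule bal) (simp add: A_def)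
    finally show ?thesis by (simp add: kA[OF m])
  qed
  then show ?thesis using J by (intro exI[of _ J] conjI exI[of _ "\<lambda>j. T j ^ K"]) (auto simp: P_def V_def Z_def)
qed

lemma cyc_count_from_root_counts:
  assumes cc: "\<forall>e \<kappa>. (\<forall>m\<in>{1..L}. \<kappa> m = (\<Sum>l\<in>{l\<in>{1..m}. l dvd m}. e l)) \<longrightarrow> (\<Sum>l=1..L. (1 / real l) * e l) = (\<Sum>m=1..L. cc m * \<kappa> m)"
    and gen: "\<And>m. m \<in> {1..L} \<Longrightarrow> generic m b c" and p: "\<And>m x. m \<in> {1..L} \<Longrightarrow> poly (p m) x = mult_det m b c x"
    and K: "\<And>m. m \<in> {1..L} \<Longrightarrow> K m \<noteq> 0" and lo: "0 \<le> lo" "0 \<le> hi"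
  shows "real (cyc_count L b c lo hi) = (\<Sum>m=1..L. cc m * real (root_count (smult (K m) (p m)) (mult_zone lo hi m)))"
    and "l \<in> {1..L} \<Longrightarrow> finite (cyc_pts b c lo hi l)"
proof -
  have z: "0 \<notin> mult_zone lo hi m" for m using lo by (auto simp: mult_zone_def not_less)
  have f: "finite {z. (qmap 1 b c 1 ^^ m) z = z \<and> qmult 1 b c 1 m z \<in> mult_zone lo hi m}" if "m \<in> {1..L}" for m
    using root_count_eq_card_fixed_points(2)[OF gen[OF that] z p[OF that]] .
  have k: "real (root_count (smult (K m) (p m)) (mult_zone lo hi m)) = (\<Sum>l\<in>{l\<in>{1..m}. l dvd m}. real (card (cyc_pts b c lo hi l)))"
    if m: "m \<in> {1..L}" for m
  proof -
    have "m \<ge> 1" using m by simp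
    have "root_count (smult (K m) (p m)) (mult_zone lo hi m) = (\<Sum>l\<in>{l\<in>{1..m}. l dvd m}. card (cyc_pts b c lo hi l))"
      unfolding root_count_smult[OF K[OF m]] root_count_eq_card_fixed_points(1)[OF gen[OF m] z p[OF m]]
      by (rule card_fixed_points_sum(1)[OF \<open>m \<ge> 1\<close> lo f[OF m]])
    then show ?thesis by simp
  qed
  show fin: "finite (cyc_pts b c lo hi l)" if "l \<in> {1..L}" for l
    using card_fixed_points_sum(2)[OF _ lo f[OF that]] that by simp
  show "real (cyc_count L b c lo hi) = (\<Sum>m=1..L. cc m * real (root_count (smult (K m) (p m)) (mult_zone lo hi m)))"
    by (rule trans[OF cyc_count_eq[OF fin lo(1)]], assumption, rule cc[rule_format]) (rule k)
qed

lemma cyc_count_mono: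
  assumes "\<And>l. l \<in> {1..L} \<Longrightarrow> finite (cyc_pts b c lo' hi' l)" "0 \<le> lo'" "lo' \<le> lo" "0 \<le> hi" "hi \<le> hi'"
  shows "cyc_count L b c lo hi \<le> cyc_count L b c lo' hi'"
  unfolding cyc_count_def
proof (rule card_mono)
  show "finite (SIGMA l:{1..L}. (\<lambda>z. cycle_of (qmap 1 b c 1) z l) ` cyc_pts b c lo' hi' l)" using assms(1) by auto
  have "cyc_pts b c lo hi l \<subseteq> cyc_pts b c lo' hi' l" for l
    using power_mono[OF assms(3,2), of l] power_mono[OF assms(5,4), of l] by (auto simp: cyc_pts_def)
  then show "(SIGMA l:{1..L}. (\<lambda>z. cycle_of (qmap 1 b c 1) z l) ` cyc_pts b c lo hi l)
     \<subseteq> (SIGMA l:{1..L}. (\<lambda>z. cycle_of (qmap 1 b c 1) z l) ` cyc_pts b c lo' hi' l)"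
    by (intro Sigma_mono image_mono) auto
qed

text \<open>Genericity is the nonvanishing of a single polynomial. At (0, 12) neither
  \<open>G m\<close> nor \<open>R m \<rho>\<close> vanishes, for m \<ge> 1 and |\<rho>| = 1, so
  these polynomials are not 0.\<close>

lemma generic_polynomials:
  obtains G :: "nat \<Rightarrow> complex poly poly" and R where
    "\<And>m x y. generic m x y \<longleftrightarrow> eval2 (G m) x y \<noteq> 0" "\<And>m \<rho> x y. mult_det m x y \<rho> = eval2 (R m \<rho>) x y"
    "\<And>m. m \<ge> 1 \<Longrightarrow> G m \<noteq> 0" "\<And>m \<rho>. m \<ge> 1 \<Longrightarrow> norm \<rho> = 1 \<Longrightarrow> R m \<rho> \<noteq> 0"
proof -
  have "\<exists>p. \<forall>x y. g x y \<rho> = eval2 p x y" if "polyfun3 g" for g \<rho>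
    using that unfolding polyfun3_def by blast
  note ex = this
  have "\<forall>m. \<exists>p. \<forall>x y. coeff (fix_poly 1 x y 1 m) (2 ^ m + 1) = eval2 p x y"
    using ex[OF polyfun3_fix_poly] by blast
  then obtain lc where lc: "\<And>m x y. coeff (fix_poly 1 x y 1 m) (2 ^ m + 1) = eval2 (lc m) x y" by metis
  have "\<forall>z. \<exists>p. \<forall>x y. mult_det (fst z) x y (snd z) = eval2 p x y"
    using ex[OF polyfun3_mult_det] by blast
  then obtain R0 where R0: "\<And>z x y. mult_det (fst z) x y (snd z) = eval2 (R0 z) x y" by metis
  define R where "R m \<rho> = R0 (m, \<rho>)" for m \<rho>
  have R: "mult_det m x y \<rho> = eval2 (R m \<rho>) x y" for m \<rho> x y using R0[of "(m, \<rho>)"] by (simp add: R_def)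
  define G where "G m = ([:[:0, 1:]:] * [:0, 1:] - 1) * lc m * R m 1" for m
  have G: "generic m x y \<longleftrightarrow> eval2 (G m) x y \<noteq> 0" for m x y
    unfolding G_def generic_def lc R by (simp del: mult_pCons_left mult_pCons_right)
  have "generic m 0 12" if "m \<ge> 1" for m
    using base_map_leading_coeff[OF that] base_map_mult_det[OF that, of 1] by (simp add: generic_def)
  then have "G m \<noteq> 0" if "m \<ge> 1" for m using G[of m 0 12] that by auto
  moreover have "R m \<rho> \<noteq> 0" if "m \<ge> 1" "norm \<rho> = 1" for m \<rho>
    using base_map_mult_det[OF that] R[of m 0 12 \<rho>] by auto
  ultimately show ?thesis using that[of G R] G R by blast
qed

section \<open>The bound for generic maps\<close>

theorem weakly_repelling_generic_bound:
  assumes eps: "\<epsilon> \<longlonglongrightarrow> 0" "\<And>n. \<epsilon> n > 0" and gen: "\<And>n m. m \<in> {1..L} \<Longrightarrow> generic m (b n) (c n)" and L: "L \<ge> 1"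
  shows "\<exists>n. cyc_count L (b n) (c n) 1 (1 + \<epsilon> n) \<le> 4"
proof (rule ccontr)
  assume neg: "\<not> ?thesis"
  have five: "cyc_count L (b n) (c n) 1 (1 + \<epsilon> n) \<ge> 5" for n
  proof -
    have "4 < cyc_count L (b n) (c n) 1 (1 + \<epsilon> n)" using neg by (auto simp: not_le)
    then show ?thesis by linarith
  qed
  define M where "M = {1..L}"
  have finM: "finite M" and M1: "\<And>m. m \<in> M \<Longrightarrow> m \<ge> 1" by (auto simp: M_def)
  have "\<forall>m. \<exists>p. \<forall>x y t. mult_det m x y t = (\<Sum>j\<le>snd p. eval2 (fst p j) x y * t ^ j)"
  proof
    fix m
    obtain C d where "\<And>x y t. mult_det m x y t = (\<Sum>j\<le>d. eval2 (C j) x y * t ^ j)"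
      using polyfun3_coeffs[OF polyfun3_mult_det] by blast
    then show "\<exists>p. \<forall>x y t. mult_det m x y t = (\<Sum>j\<le>snd p. eval2 (fst p j) x y * t ^ j)"
      by (intro exI[of _ "(C, d)"]) simp
  qed
  then obtain Cd where Cd: "\<And>m x y t. mult_det m x y t = (\<Sum>j\<le>snd (Cd m). eval2 (fst (Cd m) j) x y * t ^ j)"
    by (rule choice[THEN exE]) blast
  define C d where "C m = fst (Cd m)" and "d m = snd (Cd m)" for m
  define pm where "pm m x y = (\<Sum>j\<le>d m. monom (eval2 (C m j) x y) j)" for m x y
  have pm: "poly (pm m x y) t = mult_det m x y t" for m x y t
    by (simp add: pm_def poly_sum poly_monom Cd C_def d_def)
  have cpm: "coeff (pm m x y) j = (if j \<le> d m then eval2 (C m j) x y else 0)" for m x y j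
    by (simp add: pm_def coeff_sum)
  have dpm: "degree (pm m x y) \<le> d m" for m x y by (rule degree_le) (simp add: cpm)
  obtain G R where G: "\<And>m x y. generic m x y \<longleftrightarrow> eval2 (G m) x y \<noteq> 0" and R: "\<And>m \<rho> x y. mult_det m x y \<rho> = eval2 (R m \<rho>) x y"
    and Gnz: "\<And>m. m \<ge> 1 \<Longrightarrow> G m \<noteq> 0" and Rnz: "\<And>m \<rho>. m \<ge> 1 \<Longrightarrow> norm \<rho> = 1 \<Longrightarrow> R m \<rho> \<noteq> 0"
    by (rule generic_polynomials) blast
  \<comment> \<open>\<open>curve_through_sequence\<close> asks for convergence on the sphere of one
    parameter only; the other one may behave arbitrarily.\<close>
  obtain r0 where r0: "strict_mono (r0 :: nat \<Rightarrow> nat)" "(\<exists>l. (b \<circ> r0) \<longlonglongrightarrow> l) \<or> filterlim (b \<circ> r0) at_infinity sequentially"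
    using sphere_convergent_subseq[of b] .
  have "\<exists>j\<le>d m. eval2 (C m j) (b (r0 n)) (c (r0 n)) \<noteq> 0" if m: "m \<in> M" for m n
  proof (rule ccontr)
    assume "\<not> ?thesis"
    then have "mult_det m (b (r0 n)) (c (r0 n)) 1 = 0" by (simp add: Cd C_def d_def)
    then show False using gen[of m "r0 n"] m by (simp add: generic_def M_def)
  qed
  note nz = this
  have "\<exists>r piv \<tau>. strict_mono (r :: nat \<Rightarrow> nat) \<and> (\<forall>m\<in>M. piv m \<le> d m \<and> \<tau> m (piv m) = 1 \<and> (\<forall>n. eval2 (C m (piv m)) (b (r0 (r n))) (c (r0 (r n))) \<noteq> 0) \<and>
       (\<forall>j\<le>d m. (\<lambda>n. eval2 (C m j) (b (r0 (r n))) (c (r0 (r n))) / eval2 (C m (piv m)) (b (r0 (r n))) (c (r0 (r n)))) \<longlonglongrightarrow> \<tau> m j))"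
    by (rule normalized_limit[OF finM]) (rule nz)
  then obtain r piv \<tau> where r: "strict_mono (r :: nat \<Rightarrow> nat)"
    and H: "\<forall>m\<in>M. piv m \<le> d m \<and> \<tau> m (piv m) = 1 \<and> (\<forall>n. eval2 (C m (piv m)) (b (r0 (r n))) (c (r0 (r n))) \<noteq> 0) \<and>
       (\<forall>j\<le>d m. (\<lambda>n. eval2 (C m j) (b (r0 (r n))) (c (r0 (r n))) / eval2 (C m (piv m)) (b (r0 (r n))) (c (r0 (r n)))) \<longlonglongrightarrow> \<tau> m j)"
    by (elim exE conjE)
  define u v e where "u n = b (r0 (r n))" and "v n = c (r0 (r n))" and "e n = \<epsilon> (r0 (r n))" for n
  have sub: "filterlim (\<lambda>n. r0 (r n)) sequentially sequentially"
    using filterlim_subseq[OF strict_mono_o[OF r0(1) r]] by (simp add: o_def)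
  have e0: "e \<longlonglongrightarrow> 0" unfolding e_def using filterlim_compose[OF eps(1) sub] .
  have ulim: "(\<exists>l. u \<longlonglongrightarrow> l) \<or> filterlim u at_infinity sequentially"
    using r0(2) filterlim_compose[OF _ filterlim_subseq[OF r]] unfolding u_def o_def by blast
  have piv: "piv m \<le> d m" "\<tau> m (piv m) = 1" "\<And>n. eval2 (C m (piv m)) (u n) (v n) \<noteq> 0"
    "\<And>j. j \<le> d m \<Longrightarrow> (\<lambda>n. eval2 (C m j) (u n) (v n) / eval2 (C m (piv m)) (u n) (v n)) \<longlonglongrightarrow> \<tau> m j"
    if "m \<in> M" for m using bspec[OF H that] unfolding u_def v_def by blast+
  define q where "q m = (\<Sum>j\<le>d m. monom (\<tau> m j) j)" for m
  have cq: "coeff (q m) j = (if j \<le> d m then \<tau> m j else 0)" for m j by (simp add: q_def coeff_sum)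
  have q: "q m \<noteq> 0" if "m \<in> M" for m
  proof
    assume "q m = 0"
    then have "coeff (q m) (piv m) = 0" by simp
    then show False using piv[OF that] by (simp add: cq)
  qed
  \<comment> \<open>In this annulus the limit polynomials have no roots except on the unit circle,
    and none on its frontier, so the root counts in it are stable.\<close>
  obtain \<eta> where \<eta>: "0 < \<eta>" "\<eta> < 1"
    "\<And>m x. m \<in> M \<Longrightarrow> poly (q m) x = 0 \<Longrightarrow> norm x \<noteq> 1 \<Longrightarrow> norm x < (1 - \<eta>) ^ m \<or> (1 + \<eta>) ^ m < norm x"
    using unit_roots_isolated_annulus[of M q, OF finM q] by blast
  obtain cc where cc: "\<forall>e \<kappa>. (\<forall>m\<in>{1..L}. \<kappa> m = (\<Sum>l\<in>{l\<in>{1..m}. l dvd m}. e l)) \<longrightarrow> (\<Sum>l=1..L. (1 / real l) * e l) = (\<Sum>m=1..L. cc m * \<kappa> m)"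
    using divisor_sum_inversion[of L "\<lambda>l. 1 / real l"] by blast
  define \<kappa> where "\<kappa> m = root_count (q m) (mult_zone (1 - \<eta>) (1 + \<eta>) m)" for m
  have "eventually (\<lambda>n. root_count (smult (1 / eval2 (C m (piv m)) (u n) (v n)) (pm m (u n) (v n))) (mult_zone (1 - \<eta>) (1 + \<eta>) m) = \<kappa> m) sequentially"
    if m: "m \<in> M" for m
    unfolding \<kappa>_def
  proof (rule root_count_stable)
    show "degree (smult (1 / eval2 (C m (piv m)) (u n) (v n)) (pm m (u n) (v n))) \<le> d m" for n
      using degree_smult_le dpm le_trans by blast
    show "coeffs_tendsto (\<lambda>n. smult (1 / eval2 (C m (piv m)) (u n) (v n)) (pm m (u n) (v n))) (q m) sequentially"
      unfolding coeffs_tendsto_def using piv(4)[OF m] by (auto simp: cpm cq)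
    show "q m \<noteq> 0" using q[OF m] .
    show "bounded (mult_zone (1 - \<eta>) (1 + \<eta>) m)" "open (mult_zone (1 - \<eta>) (1 + \<eta>) m)" by (rule mult_zone_topology)+
    show "poly (q m) x \<noteq> 0" if "x \<in> frontier (mult_zone (1 - \<eta>) (1 + \<eta>) m)" for x
      by (rule no_root_on_annulus_frontier[OF M1[OF m] \<eta>(1,2) \<eta>(3)[OF m] that])
  qed
  then have "eventually (\<lambda>n. \<forall>m\<in>M. root_count (smult (1 / eval2 (C m (piv m)) (u n) (v n)) (pm m (u n) (v n))) (mult_zone (1 - \<eta>) (1 + \<eta>) m) = \<kappa> m) sequentially"
    by (intro eventually_ball_finite finM) auto
  moreover have "eventually (\<lambda>n. e n < \<eta>) sequentially" using order_tendstoD(2)[OF e0 \<eta>(1)] .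
  ultimately have "eventually (\<lambda>n. e n < \<eta> \<and> (\<forall>m\<in>M. root_count (smult (1 / eval2 (C m (piv m)) (u n) (v n)) (pm m (u n) (v n))) (mult_zone (1 - \<eta>) (1 + \<eta>) m) = \<kappa> m)) sequentially"
    by eventually_elim simp
  then obtain n where n: "e n < \<eta>" "\<And>m. m \<in> M \<Longrightarrow> root_count (smult (1 / eval2 (C m (piv m)) (u n) (v n)) (pm m (u n) (v n))) (mult_zone (1 - \<eta>) (1 + \<eta>) m) = \<kappa> m"
    by (auto simp: eventually_sequentially)
  have gn: "generic m (u n) (v n)" if "m \<in> {1..L}" for m using gen[OF that] by (simp add: u_def v_def)
  have K: "1 / eval2 (C m (piv m)) (u n) (v n) \<noteq> 0" if "m \<in> {1..L}" for m using piv(3)[of m n] that by (simp add: M_def)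
  have zn: "0 \<le> 1 - \<eta>" "0 \<le> 1 + \<eta>" using \<eta> by auto
  \<comment> \<open>The number of cycles with multipliers in the annulus is determined by the limit
    polynomials, through the same combination \<open>cc\<close> that is used along the curve
    below.\<close>
  have N: "real (cyc_count L (u n) (v n) (1 - \<eta>) (1 + \<eta>)) = (\<Sum>m=1..L. cc m * real (\<kappa> m))"
  proof -
    have "real (cyc_count L (u n) (v n) (1 - \<eta>) (1 + \<eta>)) =
        (\<Sum>m=1..L. cc m * real (root_count (smult (1 / eval2 (C m (piv m)) (u n) (v n)) (pm m (u n) (v n))) (mult_zone (1 - \<eta>) (1 + \<eta>) m)))"
      by (rule cyc_count_from_root_counts(1)[OF cc _ pm _ zn]) (use gn K in auto)
    also have "\<dots> = (\<Sum>m=1..L. cc m * real (\<kappa> m))"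
      by (rule sum.cong[OF refl]) (use n(2) in \<open>simp add: M_def\<close>)
    finally show ?thesis .
  qed
  have "cyc_count L (u n) (v n) 1 (1 + e n) \<le> cyc_count L (u n) (v n) (1 - \<eta>) (1 + \<eta>)"
    using eps(2)[of "r0 (r n)"] n(1) \<eta>
    by (intro cyc_count_mono cyc_count_from_root_counts(2)[OF cc gn pm K zn]) (auto simp: e_def)
  then have ge5: "(\<Sum>m=1..L. cc m * real (\<kappa> m)) \<ge> 5"
    using five[of "r0 (r n)"] unfolding N[symmetric] u_def v_def e_def by linarith
  define U where "U m = {\<rho>. poly (q m) \<rho> = 0 \<and> norm \<rho> = 1}" for m
  have finU: "finite (U m)" if "m \<in> M" for m
    using poly_roots_finite[OF q[OF that]] by (rule finite_subset[rotated]) (auto simp: U_def)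
  define Df where "Df m j = C m j - [:[:\<tau> m j:]:] * C m (piv m)" for m j
  \<comment> \<open>The curve has to avoid nongeneric maps (\<open>G\<close>), maps having a limit
    value on the unit circle as multiplier (\<open>R\<close>), and zeros of the pivot coefficients.
    The differences \<open>Df\<close> turn the limits \<open>\<tau>\<close> of the coefficients into
    limits 0; those that vanish identically satisfy this trivially and are left out.\<close>
  define FS where "FS = G ` M \<union> (\<Union>m\<in>M. R m ` U m) \<union> (\<lambda>m. C m (piv m)) ` M \<union> ((\<Union>m\<in>M. Df m ` {..d m}) - {0})"
  have finFS: "finite FS" unfolding FS_def using finM finU by auto
  have Cnz: "C m (piv m) \<noteq> 0" if "m \<in> M" for m using piv(3)[OF that, of 0] by auto
  have nzFS: "0 \<notin> FS"
  proof
    assume "0 \<in> FS"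
    then consider m where "m \<in> M" "0 = G m" | m \<rho> where "m \<in> M" "norm \<rho> = 1" "0 = R m \<rho>" | m where "m \<in> M" "0 = C m (piv m)"
      unfolding FS_def U_def by blast
    then show False by cases (use Gnz Rnz M1 Cnz in metis)+
  qed
  obtain X Y where XY: "X meromorphic_on {0}" "Y meromorphic_on {0}"
    and XY3: "\<forall>p\<in>FS. eventually (\<lambda>s. eval2 p (X s) (Y s) \<noteq> 0) (at 0)"
    and XY4: "\<forall>p\<in>FS. \<forall>q\<in>FS. (\<forall>n. eval2 q (u n) (v n) \<noteq> 0) \<longrightarrow> (\<lambda>n. eval2 p (u n) (v n) / eval2 q (u n) (v n)) \<longlonglongrightarrow> 0 \<longrightarrow>
        ((\<lambda>s. eval2 p (X s) (Y s) / eval2 q (X s) (Y s)) \<longlongrightarrow> 0) (at 0)"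
    using curve_through_sequence[OF finFS nzFS ulim, of v] by (elim exE conjE)
  have Cin: "C m (piv m) \<in> FS" if "m \<in> M" for m using that by (auto simp: FS_def)
  have ratio: "((\<lambda>s. eval2 (C m j) (X s) (Y s) / eval2 (C m (piv m)) (X s) (Y s)) \<longlongrightarrow> \<tau> m j) (at 0)" if m: "m \<in> M" and j: "j \<le> d m" for m j
  proof -
    have split: "eval2 (C m j) x y / eval2 (C m (piv m)) x y - \<tau> m j = eval2 (Df m j) x y / eval2 (C m (piv m)) x y"
      if "eval2 (C m (piv m)) x y \<noteq> 0" for x y
      using that unfolding Df_def eval2_ring by (simp add: field_simps)
    have "((\<lambda>s. eval2 (Df m j) (X s) (Y s) / eval2 (C m (piv m)) (X s) (Y s)) \<longlongrightarrow> 0) (at 0)"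
    proof (cases "Df m j = 0")
      case False
      have "Df m j \<in> FS" using False m j by (auto simp: FS_def)
      then show ?thesis
      proof (rule bspec[OF bspec[OF XY4] Cin[OF m], THEN mp, THEN mp])
        show "\<forall>n. eval2 (C m (piv m)) (u n) (v n) \<noteq> 0" using piv(3)[OF m] by simp
        show "(\<lambda>n. eval2 (Df m j) (u n) (v n) / eval2 (C m (piv m)) (u n) (v n)) \<longlonglongrightarrow> 0"
          unfolding split[OF piv(3)[OF m], symmetric] using piv(4)[OF m j] by (rule LIM_zero)
      qed
    qed simp
    moreover have "eventually (\<lambda>s. eval2 (Df m j) (X s) (Y s) / eval2 (C m (piv m)) (X s) (Y s) = eval2 (C m j) (X s) (Y s) / eval2 (C m (piv m)) (X s) (Y s) - \<tau> m j) (at 0)"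
      using bspec[OF XY3 Cin[OF m]] by eventually_elim (rule split[symmetric])
    ultimately have "((\<lambda>s. eval2 (C m j) (X s) (Y s) / eval2 (C m (piv m)) (X s) (Y s) - \<tau> m j) \<longlongrightarrow> 0) (at 0)"
      by (rule Lim_transform_eventually)
    then show ?thesis by (rule LIM_zero_cancel)
  qed
  define K' where "K' m s = 1 / eval2 (C m (piv m)) (X s) (Y s)" for m s
  define W where "W m s = smult (K' m s) (pm m (X s) (Y s))" for m s
  have "\<exists>J>0. \<exists>T. (\<forall>j<J. (\<forall>m\<in>M. generic m (X (T j)) (Y (T j)) \<and> K' m (T j) \<noteq> 0)) \<and> (\<forall>m\<in>M.
     2 * (\<Sum>j<J. root_count (W m (T j)) (mult_zone (1 - \<eta>) 1 m)) = J * root_count (q m) (mult_zone (1 - \<eta>) (1 + \<eta>) m))"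
  proof (rule balanced_roots[OF finM M1 _ _ _ q _ \<eta>])
    show "mero_poly (W m)" for m
      unfolding mero_poly_def W_def K'_def coeff_smult cpm
    proof
      fix i show "(\<lambda>s. 1 / eval2 (C m (piv m)) (X s) (Y s) * (if i \<le> d m then eval2 (C m i) (X s) (Y s) else 0)) meromorphic_on {0}"
        by (cases "i \<le> d m") (auto intro!: meromorphic_intros meromorphic_eval2 XY(1,2))
    qed
    show "degree (W m t) \<le> d m" for m t unfolding W_def using degree_smult_le dpm le_trans by blast
    show "coeffs_tendsto (W m) (q m) (at 0)" if "m \<in> M" for m
      unfolding coeffs_tendsto_def W_def K'_def using ratio[OF that] by (auto simp: cpm cq)
    show "eventually (\<lambda>t. poly (W m t) \<rho> \<noteq> 0) (at 0)" if m: "m \<in> M" and "poly (q m) \<rho> = 0" "norm \<rho> = 1" for m \<rho>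
    proof -
      have "R m \<rho> \<in> FS" using that by (auto simp: FS_def U_def)
      from bspec[OF XY3 this] bspec[OF XY3 Cin[OF m]] show ?thesis by eventually_elim (simp add: W_def K'_def pm R)
    qed
    show "eventually (\<lambda>s. \<forall>m\<in>M. generic m (X s) (Y s) \<and> K' m s \<noteq> 0) (at 0)"
    proof (intro eventually_ball_finite finM ballI)
      fix m assume m: "m \<in> M"
      have "G m \<in> FS" using m by (auto simp: FS_def)
      from bspec[OF XY3 this] bspec[OF XY3 Cin[OF m]] show "eventually (\<lambda>s. generic m (X s) (Y s) \<and> K' m s \<noteq> 0) (at 0)"
        by eventually_elim (simp add: G K'_def)
    qed
  qed
  then obtain J T where J: "J > 0" and T0: "\<forall>j<J. \<forall>m\<in>M. generic m (X (T j)) (Y (T j)) \<and> K' m (T j) \<noteq> 0"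
    and bal: "\<forall>m\<in>M. 2 * (\<Sum>j<J. root_count (W m (T j)) (mult_zone (1 - \<eta>) 1 m)) = J * \<kappa> m"
    unfolding \<kappa>_def by (elim exE conjE)
  have T: "generic m (X (T j)) (Y (T j))" "K' m (T j) \<noteq> 0" if "j < J" "m \<in> {1..L}" for j m
    using T0 that by (auto simp: M_def)
  have "(\<Sum>m=1..L. cc m * real (root_count (W m (T j)) (mult_zone (1 - \<eta>) 1 m))) \<le> 2" if j: "j < J" for j
  proof -
    have bc: "X (T j) * Y (T j) \<noteq> 1" using T(1)[OF j, of 1] L by (simp add: generic_def)
    have "real (cyc_count L (X (T j)) (Y (T j)) (1 - \<eta>) 1) = (\<Sum>m=1..L. cc m * real (root_count (W m (T j)) (mult_zone (1 - \<eta>) 1 m)))"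
      unfolding W_def
      by (rule cyc_count_from_root_counts(1)[OF cc T(1)[OF j] pm T(2)[OF j] zn(1)]) auto
    moreover have "real (cyc_count L (X (T j)) (Y (T j)) (1 - \<eta>) 1) \<le> 2"
      using cyc_count_attracting_le_2[OF bc zn(1), of L] by simp
    ultimately show ?thesis by simp
  qed
  \<comment> \<open>Fatou's bound 2 for each of the J maps is set against the exact average: by
    \<open>bal\<close> the total is J / 2 times a count of at least 5.\<close>
  then have "(\<Sum>j<J. \<Sum>m=1..L. cc m * real (root_count (W m (T j)) (mult_zone (1 - \<eta>) 1 m))) \<le> (\<Sum>j<J. 2)"
    by (intro sum_mono) simp
  moreover have "(\<Sum>j<J. \<Sum>m=1..L. cc m * real (root_count (W m (T j)) (mult_zone (1 - \<eta>) 1 m))) =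
      (\<Sum>m=1..L. cc m * (\<Sum>j<J. real (root_count (W m (T j)) (mult_zone (1 - \<eta>) 1 m))))"
    by (subst sum.swap) (simp add: sum_distrib_left)
  moreover have "(\<Sum>m=1..L. cc m * (\<Sum>j<J. real (root_count (W m (T j)) (mult_zone (1 - \<eta>) 1 m)))) = (\<Sum>m=1..L. cc m * (real J / 2 * real (\<kappa> m)))"
  proof (rule sum.cong[OF refl])
    fix m assume "m \<in> {1..L}"
    then have "real (2 * (\<Sum>j<J. root_count (W m (T j)) (mult_zone (1 - \<eta>) 1 m))) = real (J * \<kappa> m)" using bspec[OF bal, of m] by (simp add: M_def)
    then have "(\<Sum>j<J. real (root_count (W m (T j)) (mult_zone (1 - \<eta>) 1 m))) = real J / 2 * real (\<kappa> m)" by simp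
    then show "cc m * (\<Sum>j<J. real (root_count (W m (T j)) (mult_zone (1 - \<eta>) 1 m))) = cc m * (real J / 2 * real (\<kappa> m))" by simp
  qed
  moreover have "(\<Sum>m=1..L. cc m * (real J / 2 * real (\<kappa> m))) = real J / 2 * (\<Sum>m=1..L. cc m * real (\<kappa> m))"
    by (simp add: sum_distrib_left mult.left_commute)
  moreover have "real J / 2 * (\<Sum>m=1..L. cc m * real (\<kappa> m)) \<ge> real J / 2 * 5" by (rule mult_left_mono[OF ge5]) simp
  ultimately have "real J / 2 * 5 \<le> real J * 2" by simp
  then show False using J by simp
qed

section \<open>Persistence of cycles\<close>

lemma coeffs_tendsto_add:
  "coeffs_tendsto p q F \<Longrightarrow> coeffs_tendsto p' q' F \<Longrightarrow> coeffs_tendsto (\<lambda>n. p n + p' n) (q + q') F"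
  unfolding coeffs_tendsto_def by (auto intro!: tendsto_intros)

lemma coeffs_tendsto_diff:
  "coeffs_tendsto p q F \<Longrightarrow> coeffs_tendsto p' q' F \<Longrightarrow> coeffs_tendsto (\<lambda>n. p n - p' n) (q - q') F"
  unfolding coeffs_tendsto_def by (auto intro!: tendsto_intros)

lemma coeffs_tendsto_smult:
  "(a \<longlongrightarrow> a') F \<Longrightarrow> coeffs_tendsto p q F \<Longrightarrow> coeffs_tendsto (\<lambda>n. smult (a n) (p n)) (smult a' q) F"
  unfolding coeffs_tendsto_def by (auto intro!: tendsto_intros)

lemma coeffs_tendsto_pCons_0:
  assumes "coeffs_tendsto p q F"
  shows "coeffs_tendsto (\<lambda>n. pCons 0 (p n)) (pCons 0 q) F"
  unfolding coeffs_tendsto_def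
proof
  fix i show "((\<lambda>n. coeff (pCons 0 (p n)) i) \<longlongrightarrow> coeff (pCons 0 q) i) F"
    using assms by (cases i) (auto simp: coeffs_tendsto_def)
qed

lemma root_count_eq_0_iff: "root_count p S = 0 \<longleftrightarrow> (\<forall>x\<in>#proots p. x \<notin> S)"
proof -
  have "size (filter_mset P M) = 0 \<longleftrightarrow> (\<forall>x\<in>#M. \<not> P x)" for P and M :: "complex multiset"
    by (induction M) auto
  then show ?thesis by (simp add: root_count_def)
qed

text \<open>Root counts in small discs show that roots of \<open>p n\<close> come arbitrarily close
  to z; the nearest root for each n gives one sequence for all radii.\<close>

lemma roots_converge:
  assumes D: "\<And>n. degree (p n) \<le> D" and lim: "coeffs_tendsto p q sequentially" and q: "q \<noteq> 0" and z: "poly q z = 0"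
  obtains zs where "zs \<longlonglongrightarrow> z" "eventually (\<lambda>n. poly (p n) (zs n) = 0) sequentially"
proof -
  have near: "eventually (\<lambda>n. p n \<noteq> 0 \<and> (\<exists>w. poly (p n) w = 0 \<and> dist w z < \<delta>)) sequentially" if \<delta>: "\<delta> > 0" for \<delta>
  proof -
    \<comment> \<open>Only finitely many circles around z carry roots of q, so a free radius below
      \<delta> exists.\<close>
    have "finite ((\<lambda>w. dist z w) ` {w. poly q w = 0})" using poly_roots_finite[OF q] by simp
    then have "\<not> {0<..<\<delta>} \<subseteq> (\<lambda>w. dist z w) ` {w. poly q w = 0}"
      using infinite_Ioo[OF \<delta>] finite_subset by blast
    then obtain r where r: "0 < r" "r < \<delta>" "\<And>w. poly q w = 0 \<Longrightarrow> dist z w \<noteq> r" by fastforce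
    have "eventually (\<lambda>n. root_count (p n) (ball z r) = root_count q (ball z r)) sequentially"
      by (rule root_count_stable[OF D lim q]) (use r in \<open>auto simp: frontier_ball\<close>)
    then show ?thesis
    proof eventually_elim
      case (elim n)
      have "root_count q (ball z r) \<noteq> 0" using z q r(1) by (auto simp: root_count_eq_0_iff)
      then have "root_count (p n) (ball z r) \<noteq> 0" using elim by simp
      then obtain w where w: "w \<in># proots (p n)" "w \<in> ball z r" by (auto simp only: root_count_eq_0_iff)
      then have "p n \<noteq> 0" by auto
      then show ?case using w r(2) by (intro conjI exI[of _ w]) (auto simp: dist_commute)
    qed
  qed
  define zs where "zs n = arg_min_on (\<lambda>w. dist w z) {w. poly (p n) w = 0}" for n
  have zs: "poly (p n) (zs n) = 0 \<and> dist (zs n) z < \<delta>"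
    if n: "p n \<noteq> 0 \<and> (\<exists>w. poly (p n) w = 0 \<and> dist w z < \<delta>)" for n \<delta>
  proof -
    obtain w where w: "poly (p n) w = 0" "dist w z < \<delta>" using n by blast
    have fin: "finite {w. poly (p n) w = 0}" "{w. poly (p n) w = 0} \<noteq> {}" using n poly_roots_finite[of "p n"] by auto
    have "zs n \<in> {w. poly (p n) w = 0}" "\<not> (\<exists>x\<in>{w. poly (p n) w = 0}. dist x z < dist (zs n) z)"
      unfolding zs_def by (rule arg_min_if_finite[OF fin])+
    then show ?thesis using w by force
  qed
  have "zs \<longlonglongrightarrow> z"
  proof (rule tendstoI)
    fix \<delta> :: real assume "0 < \<delta>"
    from near[OF this] show "eventually (\<lambda>n. dist (zs n) z < \<delta>) sequentially" by eventually_elim (use zs in blast)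
  qed
  moreover have "eventually (\<lambda>n. poly (p n) (zs n) = 0) sequentially"
    using near[of 1] by (rule eventually_mono) (use zs in \<open>auto\<close>)
  ultimately show ?thesis by (rule that)
qed

text \<open>All four coefficients vary because the perturbation also starts from maps with
  \<open>a\<close> = 0 or \<open>d\<close> = 0, which cannot be rescaled to (z^2 + b) / (c z^2 +
  1).\<close>

locale converging_maps =
  fixes A B C D :: "nat \<Rightarrow> complex" and a b c d :: complex
  assumes A: "A \<longlonglongrightarrow> a" and B: "B \<longlonglongrightarrow> b" and C: "C \<longlonglongrightarrow> c" and D: "D \<longlonglongrightarrow> d"
begin

abbreviation "F n \<equiv> qmap (A n) (B n) (C n) (D n)"
abbreviation "F\<^sub>0 \<equiv> qmap a b c d"
abbreviation "\<mu> n \<equiv> qmult (A n) (B n) (C n) (D n)"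
abbreviation "\<mu>\<^sub>0 \<equiv> qmult a b c d"

lemma coeffs_tendsto_iter:
  "coeffs_tendsto (\<lambda>n. iter_num (A n) (B n) (C n) (D n) m) (iter_num a b c d m) sequentially \<and>
   coeffs_tendsto (\<lambda>n. iter_den (A n) (B n) (C n) (D n) m) (iter_den a b c d m) sequentially"
proof (induction m)
  case 0
  then show ?case by (auto intro: coeffs_tendsto_const)
next
  case (Suc m)
  then show ?case unfolding iter_num_Suc iter_den_Suc power2_eq_square
    by (auto intro!: coeffs_tendsto_add coeffs_tendsto_smult coeffs_tendsto_mult A B C D)
qed

lemma coeffs_tendsto_fix_poly:
  "coeffs_tendsto (\<lambda>n. fix_poly (A n) (B n) (C n) (D n) m) (fix_poly a b c d m) sequentially"
  unfolding fix_poly_def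
  by (intro coeffs_tendsto_diff coeffs_tendsto_pCons_0 coeffs_tendsto_iter[THEN conjunct1] coeffs_tendsto_iter[THEN conjunct2])

lemma coeffs_tendsto_iter_wronskian:
  "coeffs_tendsto (\<lambda>n. iter_wronskian (A n) (B n) (C n) (D n) m) (iter_wronskian a b c d m) sequentially"
  unfolding iter_wronskian_def using coeffs_tendsto_iter
  by (auto intro!: coeffs_tendsto_smult coeffs_tendsto_prod coeffs_tendsto_mult tendsto_intros A B C D)

lemma iterate_tendsto:
  assumes "zs \<longlonglongrightarrow> z" "\<And>i. c * ((F\<^sub>0 ^^ i) z)\<^sup>2 + d \<noteq> 0"
  shows "(\<lambda>n. (F n ^^ k) (zs n)) \<longlonglongrightarrow> (F\<^sub>0 ^^ k) z"
proof (induction k)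
  case (Suc k)
  define w w0 where "w n = (F n ^^ k) (zs n)" and "w0 = (F\<^sub>0 ^^ k) z" for n
  have "w \<longlonglongrightarrow> w0" "c * w0\<^sup>2 + d \<noteq> 0" using Suc assms(2) by (simp_all add: w_def[abs_def] w0_def)
  then have "(\<lambda>n. F n (w n)) \<longlonglongrightarrow> F\<^sub>0 w0"
    unfolding qmap_def by (intro tendsto_intros A B C D)
  then show ?case by (simp add: w_def w0_def)
qed (use assms in simp)

lemma qmult_tendsto:
  assumes "zs \<longlonglongrightarrow> z" "\<And>i. c * ((F\<^sub>0 ^^ i) z)\<^sup>2 + d \<noteq> 0"
  shows "(\<lambda>n. \<mu> n l (zs n)) \<longlonglongrightarrow> \<mu>\<^sub>0 l z"
  unfolding qmult_def qder_def
  by (intro tendsto_intros A B C D iterate_tendsto assms) (use assms(2) in auto)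

text \<open>The multiplier is not 1, so the fixed point polynomial is not 0 and
  \<open>roots_converge\<close> gives roots near z. There the Wronskian is not 0, so they are fixed
  points with finite orbits; smaller periods are excluded by continuity.\<close>

lemma cycle_persists:
  assumes ad: "a * d - b * c \<noteq> 0" and per: "exact_period F\<^sub>0 z l"
    and mult: "1 < norm (\<mu>\<^sub>0 l z)" "norm (\<mu>\<^sub>0 l z) < r"
  shows "\<exists>zs. (\<forall>k. (\<lambda>n. (F n ^^ k) (zs n)) \<longlonglongrightarrow> (F\<^sub>0 ^^ k) z) \<and>
    eventually (\<lambda>n. exact_period (F n) (zs n) l \<and>
      1 < norm (\<mu> n l (zs n)) \<and> norm (\<mu> n l (zs n)) < r) sequentially"
proof -
  have l: "l > 0" "(F\<^sub>0 ^^ l) z = z" using per by (auto simp: exact_period_def)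
  have nz: "\<mu>\<^sub>0 l z \<noteq> 0" using mult(1) by auto
  note root = fixed_point_imp_root[OF l(2) nz]
  have fo: "c * ((F\<^sub>0 ^^ i) z)\<^sup>2 + d \<noteq> 0" for i
    using qmult_nonzero_periodic_imp_finite_orbit[OF nz l(2,1)] .
  have fnz: "fix_poly a b c d l \<noteq> 0"
  proof
    assume "fix_poly a b c d l = 0"
    then have "poly (iter_wronskian a b c d l) z = (poly (iter_den a b c d l) z)\<^sup>2"
      using pderiv_fix_poly_at_root[of a b c d l z] by simp
    then show False using root(2,3) mult(1) by simp
  qed
  obtain zs where zs: "zs \<longlonglongrightarrow> z" "eventually (\<lambda>n. poly (fix_poly (A n) (B n) (C n) (D n) l) (zs n) = 0) sequentially"
    using roots_converge[OF degree_fix_poly_le coeffs_tendsto_fix_poly fnz root(1)] .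
  have "(\<lambda>n. poly (iter_wronskian (A n) (B n) (C n) (D n) l) (zs n)) \<longlonglongrightarrow> poly (iter_wronskian a b c d l) z"
    by (rule tendsto_poly_coeffs[OF degree_iter_wronskian_le coeffs_tendsto_iter_wronskian zs(1)]) simp
  then have W: "eventually (\<lambda>n. poly (iter_wronskian (A n) (B n) (C n) (D n) l) (zs n) \<noteq> 0) sequentially"
    by (rule tendsto_imp_eventually_ne) (use root(3) nz in auto)
  have "(\<lambda>n. A n * D n - B n * C n) \<longlonglongrightarrow> a * d - b * c" by (intro tendsto_intros A B C D)
  then have ad': "eventually (\<lambda>n. A n * D n - B n * C n \<noteq> 0) sequentially"
    using ad by (rule tendsto_imp_eventually_ne)
  note it = iterate_tendsto[OF zs(1) fo]
  have "eventually (\<lambda>n. (F n ^^ k) (zs n) \<noteq> zs n) sequentially" if "k \<in> {1..<l}" for k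
  proof -
    have "(\<lambda>n. (F n ^^ k) (zs n) - zs n) \<longlonglongrightarrow> (F\<^sub>0 ^^ k) z - z"
      by (intro tendsto_intros it zs(1))
    then have "eventually (\<lambda>n. (F n ^^ k) (zs n) - zs n \<noteq> 0) sequentially"
      by (rule tendsto_imp_eventually_ne) (use that per in \<open>auto simp: exact_period_def\<close>)
    then show ?thesis by eventually_elim simp
  qed
  then have "eventually (\<lambda>n. \<forall>k\<in>{1..<l}. (F n ^^ k) (zs n) \<noteq> zs n) sequentially"
    by (intro eventually_ball_finite) auto
  then have ep: "eventually (\<lambda>n. exact_period (F n) (zs n) l) sequentially"
    using zs(2) W ad'
  proof eventually_elim
    case (elim n)
    have "(F n ^^ l) (zs n) = zs n"
      using root_imp_fixed_point(2)[OF elim(4,2,3)] by blast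
    then show ?case using elim(1) l(1) by (auto simp: exact_period_def)
  qed
  have m: "(\<lambda>n. norm (\<mu> n l (zs n))) \<longlonglongrightarrow> norm (\<mu>\<^sub>0 l z)"
    by (intro tendsto_intros qmult_tendsto[OF zs(1) fo])
  have "eventually (\<lambda>n. exact_period (F n) (zs n) l \<and>
      1 < norm (\<mu> n l (zs n)) \<and> norm (\<mu> n l (zs n)) < r) sequentially"
    using ep order_tendstoD(1)[OF m mult(1)] order_tendstoD(2)[OF m mult(2)] by eventually_elim simp
  then show ?thesis using it by blast
qed

theorem cycles_persist:
  assumes ad: "a * d - b * c \<noteq> 0" and fin: "finite I"
    and per: "\<And>i. i \<in> I \<Longrightarrow> exact_period F\<^sub>0 (z i) (l i)"
    and mult: "\<And>i. i \<in> I \<Longrightarrow> 1 < norm (\<mu>\<^sub>0 (l i) (z i)) \<and> norm (\<mu>\<^sub>0 (l i) (z i)) < r i"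
    and inj: "inj_on (\<lambda>i. cycle_of F\<^sub>0 (z i) (l i)) I"
  shows "eventually (\<lambda>n. \<exists>w. (\<forall>i\<in>I. exact_period (F n) (w i) (l i) \<and>
      1 < norm (\<mu> n (l i) (w i)) \<and> norm (\<mu> n (l i) (w i)) < r i) \<and>
      inj_on (\<lambda>i. (l i, cycle_of (F n) (w i) (l i))) I) sequentially"
proof -
  have "\<forall>i\<in>I. \<exists>zs. (\<forall>k. (\<lambda>n. (F n ^^ k) (zs n)) \<longlonglongrightarrow> (F\<^sub>0 ^^ k) (z i)) \<and>
    eventually (\<lambda>n. exact_period (F n) (zs n) (l i) \<and>
      1 < norm (\<mu> n (l i) (zs n)) \<and> norm (\<mu> n (l i) (zs n)) < r i) sequentially"
    using cycle_persists[OF ad per] mult by blast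
  then obtain zs where zs: "\<And>i k. i \<in> I \<Longrightarrow> (\<lambda>n. (F n ^^ k) (zs i n)) \<longlonglongrightarrow> (F\<^sub>0 ^^ k) (z i)"
    "\<And>i. i \<in> I \<Longrightarrow> eventually (\<lambda>n. exact_period (F n) (zs i n) (l i) \<and>
      1 < norm (\<mu> n (l i) (zs i n)) \<and> norm (\<mu> n (l i) (zs i n)) < r i) sequentially"
    by (rule bchoice[THEN exE]) blast
  have "eventually (\<lambda>n. zs i n \<noteq> (F n ^^ k) (zs j n)) sequentially"
    if ij: "i \<in> I" "j \<in> I" "i \<noteq> j" "l i = l j" for i j k
  proof -
    have ne: "z i \<noteq> (F\<^sub>0 ^^ k) (z j)"
    proof
      assume "z i = (F\<^sub>0 ^^ k) (z j)"
      then have "z i \<in> cycle_of F\<^sub>0 (z j) (l j)" using funpow_in_cycle_of[OF per[OF ij(2)]] by simp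
      then have "cycle_of F\<^sub>0 (z i) (l i) = cycle_of F\<^sub>0 (z j) (l j)"
        using cycle_of_eq[OF per[OF ij(2)], of "z i"] per[OF ij(1)] ij(4) by simp
      then show False using inj_onD[OF inj _ ij(1,2)] ij(3) by simp
    qed
    have "(\<lambda>n. zs i n - (F n ^^ k) (zs j n)) \<longlonglongrightarrow> z i - (F\<^sub>0 ^^ k) (z j)"
      using zs(1)[OF ij(1), of 0] by (intro tendsto_intros zs(1) ij) simp
    then have "eventually (\<lambda>n. zs i n - (F n ^^ k) (zs j n) \<noteq> 0) sequentially"
      by (rule tendsto_imp_eventually_ne) (use ne in auto)
    then show ?thesis by eventually_elim simp
  qed
  then have "eventually (\<lambda>n. \<forall>i\<in>I. \<forall>j\<in>I. \<forall>k\<in>{..<l j}. i \<noteq> j \<and> l i = l j \<longrightarrow> zs i n \<noteq> (F n ^^ k) (zs j n)) sequentially"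
  proof (intro eventually_ball_finite fin ballI finite_lessThan)
    fix i j k assume ij: "i \<in> I" "j \<in> I"
    note d = \<open>\<And>i j k. \<lbrakk>i \<in> I; j \<in> I; i \<noteq> j; l i = l j\<rbrakk> \<Longrightarrow> eventually (\<lambda>n. zs i n \<noteq> (F n ^^ k) (zs j n)) sequentially\<close>
    show "eventually (\<lambda>n. i \<noteq> j \<and> l i = l j \<longrightarrow> zs i n \<noteq> (F n ^^ k) (zs j n)) sequentially"
      using d[OF ij, of k] by (cases "i \<noteq> j \<and> l i = l j") (auto elim: eventually_mono)
  qed
  moreover have "eventually (\<lambda>n. \<forall>i\<in>I. exact_period (F n) (zs i n) (l i) \<and>
      1 < norm (\<mu> n (l i) (zs i n)) \<and> norm (\<mu> n (l i) (zs i n)) < r i) sequentially"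
    using zs(2) fin by (intro eventually_ball_finite) auto
  ultimately show ?thesis
  proof eventually_elim
    case (elim n)
    have "inj_on (\<lambda>i. (l i, cycle_of (F n) (zs i n) (l i))) I"
    proof (rule inj_onI, rule ccontr)
      fix i j assume ij: "i \<in> I" "j \<in> I" "i \<noteq> j"
        and eq: "(l i, cycle_of (F n) (zs i n) (l i)) = (l j, cycle_of (F n) (zs j n) (l j))"
      have "zs i n \<in> cycle_of (F n) (zs i n) (l i)"
        using funpow_in_cycle_of[of _ "zs i n" "l i" 0] elim(2) ij(1) by auto
      moreover have "cycle_of (F n) (zs i n) (l i) = cycle_of (F n) (zs j n) (l j)"
        using eq by (rule Pair_inject)
      ultimately have "zs i n \<in> cycle_of (F n) (zs j n) (l j)" by (simp only:)
      then obtain k where "k < l j" "zs i n = (F n ^^ k) (zs j n)" by (auto simp: cycle_of_def)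
      then show False using elim(1) ij eq by auto
    qed
    then show ?case using elim(2) by (intro exI[of _ "\<lambda>i. zs i n"]) simp
  qed
qed

end

section \<open>Perturbation to a generic normal form\<close>

text \<open>The scaling z = w a / d is the one for which both coefficients \<open>a\<close> and
  \<open>d\<close> become 1.\<close>

lemma qmap_rescale:
  assumes "a \<noteq> 0" "d \<noteq> 0"
  shows "(qmap 1 (a * b / d\<^sup>2) (c * d / a\<^sup>2) 1 ^^ k) (w / (d / a)) = (qmap a b c d ^^ k) w / (d / a)"
    and "qmult 1 (a * b / d\<^sup>2) (c * d / a\<^sup>2) 1 l (w / (d / a)) = qmult a b c d l w"
proof -
  have den: "c * d / a\<^sup>2 * (w / (d / a))\<^sup>2 + 1 = (c * w\<^sup>2 + d) / d" for w
    using assms by (simp add: field_simps power2_eq_square)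
  have num: "(w / (d / a))\<^sup>2 + a * b / d\<^sup>2 = (a * w\<^sup>2 + b) * a / d\<^sup>2" for w
    using assms by (simp add: field_simps power2_eq_square)
  have map: "qmap 1 (a * b / d\<^sup>2) (c * d / a\<^sup>2) 1 (w / (d / a)) = qmap a b c d w / (d / a)" for w
  proof -
    have "qmap 1 (a * b / d\<^sup>2) (c * d / a\<^sup>2) 1 (w / (d / a)) = ((a * w\<^sup>2 + b) * a / d\<^sup>2) / ((c * w\<^sup>2 + d) / d)"
      unfolding qmap_def mult_1 den num ..
    also have "\<dots> = qmap a b c d w / (d / a)" using assms by (simp add: qmap_def power2_eq_square)
    finally show ?thesis .
  qed
  show it: "(qmap 1 (a * b / d\<^sup>2) (c * d / a\<^sup>2) 1 ^^ k) (w / (d / a)) = (qmap a b c d ^^ k) w / (d / a)" for k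
    by (induction k) (simp_all only: funpow.simps o_apply id_apply map)
  have det: "1 * 1 - a * b / d\<^sup>2 * (c * d / a\<^sup>2) = (a * d - b * c) / (a * d)"
    using assms by (simp add: field_simps power2_eq_square)
  have "qder 1 (a * b / d\<^sup>2) (c * d / a\<^sup>2) 1 (w / (d / a)) = qder a b c d w" for w
    unfolding qder_def den det using assms by (simp add: power2_eq_square)
  then show "qmult 1 (a * b / d\<^sup>2) (c * d / a\<^sup>2) 1 l (w / (d / a)) = qmult a b c d l w"
    unfolding qmult_def it by simp
qed

lemma generic_perturbation:
  obtains A B C D where "converging_maps A B C D a b c d" "\<And>n. A n \<noteq> 0" "\<And>n. D n \<noteq> 0"
    "\<And>n m. m \<in> {1..L} \<Longrightarrow> generic m (A n * B n / (D n)\<^sup>2) (C n * D n / (A n)\<^sup>2)"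
proof -
  obtain G :: "nat \<Rightarrow> complex poly poly" where G: "\<And>m x y. generic m x y \<longleftrightarrow> eval2 (G m) x y \<noteq> 0" "\<And>m. m \<ge> 1 \<Longrightarrow> G m \<noteq> 0"
    by (rule generic_polynomials) blast
  have P: "(\<Prod>m\<in>{1..L}. G m) \<noteq> 0" using G(2) by (auto simp: prod_zero_iff)
  \<comment> \<open>Vanishing coefficients \<open>a\<close> and \<open>d\<close> are replaced by 1 /
    (n + 1) so that rescaling is possible; \<open>b\<close> and \<open>c\<close> are moved by less
    than 1 / (n + 1) to make the rescaled pair generic.\<close>
  define nzseq where "nzseq x n = (if x = 0 then inverse (of_nat (Suc n)) else x)" for x :: complex and n :: nat
  have nz: "nzseq x n \<noteq> 0" "nzseq x \<longlonglongrightarrow> x" for x n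
    using filterlim_recip_at_0 unfolding nzseq_def[abs_def] filterlim_at by (cases "x = 0"; simp del: of_nat_Suc)+
  define A D where "A = nzseq a" and "D = nzseq d"
  have "\<exists>q. dist (fst q) b < inverse (Suc n) \<and> dist (snd q) c < inverse (Suc n) \<and>
     (\<forall>m\<in>{1..L}. generic m (A n * fst q / (D n)\<^sup>2) (snd q * D n / (A n)\<^sup>2))" for n
  proof -
    obtain xs ys where xy: "xs \<longlonglongrightarrow> A n * b / (D n)\<^sup>2" "ys \<longlonglongrightarrow> c * D n / (A n)\<^sup>2" "\<And>k. eval2 (\<Prod>m\<in>{1..L}. G m) (xs k) (ys k) \<noteq> 0"
      using bivariate_nonvanishing_sequence[OF P] by blast
    have "(\<lambda>k. xs k * (D n)\<^sup>2 / A n) \<longlonglongrightarrow> A n * b / (D n)\<^sup>2 * (D n)\<^sup>2 / A n" using nz by (intro tendsto_intros xy) (auto simp: A_def)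
    then have "(\<lambda>k. xs k * (D n)\<^sup>2 / A n) \<longlonglongrightarrow> b" using nz by (simp add: A_def D_def)
    then have 1: "eventually (\<lambda>k. dist (xs k * (D n)\<^sup>2 / A n) b < inverse (Suc n)) sequentially" by (rule tendstoD) simp
    have "(\<lambda>k. ys k * (A n)\<^sup>2 / D n) \<longlonglongrightarrow> c * D n / (A n)\<^sup>2 * (A n)\<^sup>2 / D n" using nz by (intro tendsto_intros xy) (auto simp: D_def)
    then have "(\<lambda>k. ys k * (A n)\<^sup>2 / D n) \<longlonglongrightarrow> c" using nz by (simp add: A_def D_def)
    then have 2: "eventually (\<lambda>k. dist (ys k * (A n)\<^sup>2 / D n) c < inverse (Suc n)) sequentially" by (rule tendstoD) simp
    from eventually_conj[OF 1 2] obtain k where k: "dist (xs k * (D n)\<^sup>2 / A n) b < inverse (Suc n)" "dist (ys k * (A n)\<^sup>2 / D n) c < inverse (Suc n)"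
      by (auto simp: eventually_sequentially)
    have "A n * (xs k * (D n)\<^sup>2 / A n) / (D n)\<^sup>2 = xs k" "(ys k * (A n)\<^sup>2 / D n) * D n / (A n)\<^sup>2 = ys k"
      using nz by (simp_all add: A_def D_def)
    then show ?thesis using k xy(3)[of k]
      by (intro exI[of _ "(xs k * (D n)\<^sup>2 / A n, ys k * (A n)\<^sup>2 / D n)"]) (simp add: G(1) prod_zero_iff)
  qed
  then obtain q where q: "\<And>n. dist (fst (q n)) b < inverse (Suc n)" "\<And>n. dist (snd (q n)) c < inverse (Suc n)"
     "\<And>n m. m\<in>{1..L} \<Longrightarrow> generic m (A n * fst (q n) / (D n)\<^sup>2) (snd (q n) * D n / (A n)\<^sup>2)"
    by metis
  have "(\<lambda>n. fst (q n)) \<longlonglongrightarrow> b" "(\<lambda>n. snd (q n)) \<longlonglongrightarrow> c"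
    using q(1,2)
    by (auto intro!: metric_tendsto_imp_tendsto[OF LIMSEQ_inverse_real_of_nat] always_eventually less_imp_le simp: dist_real_def)
  then have "converging_maps A (\<lambda>n. fst (q n)) (\<lambda>n. snd (q n)) D a b c d"
    using nz by (simp add: converging_maps_def A_def D_def)
  then show ?thesis using q(3) nz by (intro that[of A "\<lambda>n. fst (q n)" "\<lambda>n. snd (q n)" D]) (auto simp: A_def D_def)
qed

text \<open>The bounds on the multipliers are strict and the cycles finite in number, so all of them
  persist, and remain distinct, for one sufficiently close generic map.\<close>

theorem weakly_repelling_to_generic:
  assumes ad: "a * d - b * c \<noteq> 0" and fin: "finite I" and L: "\<And>i. i \<in> I \<Longrightarrow> l i \<le> L"
    and per: "\<And>i. i \<in> I \<Longrightarrow> exact_period (qmap a b c d) (z i) (l i)"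
    and mult: "\<And>i. i \<in> I \<Longrightarrow> 1 < norm (qmult a b c d (l i) (z i)) \<and> norm (qmult a b c d (l i) (z i)) < (1 + \<epsilon>) ^ l i"
    and inj: "inj_on (\<lambda>i. cycle_of (qmap a b c d) (z i) (l i)) I" and \<epsilon>: "\<epsilon> > 0"
  shows "\<exists>b c. (\<forall>m\<in>{1..L}. generic m b c) \<and> card I \<le> cyc_count L b c 1 (1 + \<epsilon>)"
proof -
  obtain A B C D where conv: "converging_maps A B C D a b c d" and nz: "\<And>n. A n \<noteq> 0" "\<And>n. D n \<noteq> 0"
    and gen: "\<And>n m. m \<in> {1..L} \<Longrightarrow> generic m (A n * B n / (D n)\<^sup>2) (C n * D n / (A n)\<^sup>2)"
    by (rule generic_perturbation[where a = a and b = b and c = c and d = d and L = L]) blast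
  have "eventually (\<lambda>n. \<exists>w. (\<forall>i\<in>I. exact_period (qmap (A n) (B n) (C n) (D n)) (w i) (l i) \<and>
      1 < norm (qmult (A n) (B n) (C n) (D n) (l i) (w i)) \<and> norm (qmult (A n) (B n) (C n) (D n) (l i) (w i)) < (1 + \<epsilon>) ^ l i) \<and>
      inj_on (\<lambda>i. (l i, cycle_of (qmap (A n) (B n) (C n) (D n)) (w i) (l i))) I) sequentially"
    by (rule converging_maps.cycles_persist[OF conv ad fin _ _ inj]) (use per mult in auto)
  from eventually_happens'[OF sequentially_bot this] obtain n where "\<exists>w. (\<forall>i\<in>I. exact_period (qmap (A n) (B n) (C n) (D n)) (w i) (l i) \<and>
      1 < norm (qmult (A n) (B n) (C n) (D n) (l i) (w i)) \<and> norm (qmult (A n) (B n) (C n) (D n) (l i) (w i)) < (1 + \<epsilon>) ^ l i) \<and>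
      inj_on (\<lambda>i. (l i, cycle_of (qmap (A n) (B n) (C n) (D n)) (w i) (l i))) I"
    by (rule exE)
  then obtain w where w: "\<And>i. i \<in> I \<Longrightarrow> exact_period (qmap (A n) (B n) (C n) (D n)) (w i) (l i) \<and>
      1 < norm (qmult (A n) (B n) (C n) (D n) (l i) (w i)) \<and> norm (qmult (A n) (B n) (C n) (D n) (l i) (w i)) < (1 + \<epsilon>) ^ l i"
    and winj: "inj_on (\<lambda>i. (l i, cycle_of (qmap (A n) (B n) (C n) (D n)) (w i) (l i))) I"
    by (elim exE conjE) (rule that, rule bspec)
  define b' c' k where "b' = A n * B n / (D n)\<^sup>2" and "c' = C n * D n / (A n)\<^sup>2" and "k = D n / A n"
  have k: "k \<noteq> 0" using nz by (simp add: k_def)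
  note resc = qmap_rescale[OF nz(1)[of n] nz(2)[of n], where b = "B n" and c = "C n", folded b'_def c'_def k_def]
  have pts: "w i / k \<in> cyc_pts b' c' 1 (1 + \<epsilon>) (l i)" if i: "i \<in> I" for i
    using w[OF i] k by (simp add: cyc_pts_def exact_period_def resc)
  have cyc: "cycle_of (qmap 1 b' c' 1) (w i / k) (l i) = (\<lambda>x. x / k) ` cycle_of (qmap (A n) (B n) (C n) (D n)) (w i) (l i)" for i
    by (simp add: cycle_of_def resc image_image)
  have injk: "inj (\<lambda>x. x / k)" using k by (auto simp: inj_def)
  have lpos: "l i \<ge> 1" if "i \<in> I" for i using per[OF that] by (simp add: exact_period_def)
  have inj': "inj_on (\<lambda>i. (l i, cycle_of (qmap 1 b' c' 1) (w i / k) (l i))) I"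
  proof (rule inj_onI)
    fix i j assume ij: "i \<in> I" "j \<in> I" and eq: "(l i, cycle_of (qmap 1 b' c' 1) (w i / k) (l i)) = (l j, cycle_of (qmap 1 b' c' 1) (w j / k) (l j))"
    have l: "l i = l j" using eq by (rule Pair_inject)
    have "cycle_of (qmap 1 b' c' 1) (w i / k) (l i) = cycle_of (qmap 1 b' c' 1) (w j / k) (l j)"
      using eq by (rule Pair_inject)
    then have c:  "cycle_of (qmap (A n) (B n) (C n) (D n)) (w i) (l i) = cycle_of (qmap (A n) (B n) (C n) (D n)) (w j) (l j)"
      by (simp only: cyc inj_image_eq_iff[OF injk])
    have "(l i, cycle_of (qmap (A n) (B n) (C n) (D n)) (w i) (l i)) = (l j, cycle_of (qmap (A n) (B n) (C n) (D n)) (w j) (l j))"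
      using l c by (rule arg_cong2)
    then show "i = j" by (rule inj_onD[OF winj _ ij])
  qed
  have sub: "(\<lambda>i. (l i, cycle_of (qmap 1 b' c' 1) (w i / k) (l i))) ` I \<subseteq>
      (SIGMA l:{1..L}. (\<lambda>z. cycle_of (qmap 1 b' c' 1) z l) ` cyc_pts b' c' 1 (1 + \<epsilon>) l)"
    using pts L lpos by auto
  have gen': "generic m b' c'" if "m \<in> {1..L}" for m using gen[OF that] by (simp add: b'_def c'_def)
  have "finite (SIGMA l:{1..L}. (\<lambda>z. cycle_of (qmap 1 b' c' 1) z l) ` cyc_pts b' c' 1 (1 + \<epsilon>) l)"
  proof (intro finite_SigmaI finite_imageI)
    fix m assume m: "m \<in> {1..L}"
    have z0: "0 \<notin> mult_zone 1 (1 + \<epsilon>) m" by (simp add: mult_zone_def)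
    obtain q d where q: "\<And>x y t. mult_det m x y t = (\<Sum>j\<le>d. eval2 (q j) x y * t ^ j)"
      using polyfun3_coeffs[OF polyfun3_mult_det] by blast
    have "poly (\<Sum>j\<le>d. monom (eval2 (q j) b' c') j) x = mult_det m b' c' x" for x by (simp add: q poly_sum poly_monom)
    from root_count_eq_card_fixed_points(2)[OF gen'[OF m] z0 this]
    show "finite (cyc_pts b' c' 1 (1 + \<epsilon>) m)"
      using \<epsilon> m by (intro card_fixed_points_sum(2)) auto
  qed simp
  then have "card I \<le> cyc_count L b' c' 1 (1 + \<epsilon>)"
    unfolding cyc_count_def by (rule card_inj_on_le[OF inj' sub])
  then show ?thesis using gen' by blast
qed

section \<open>Reduction to the normal form\<close>

text \<open>\<open>proj x y\<close> is the point of the sphere with homogeneous coordinates \<open>[x : y]\<close>.\<close>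

definition proj :: "complex \<Rightarrow> complex \<Rightarrow> complex option" where
  "proj x y = (if y = 0 then None else Some (x / y))"

lemma proj_cases:
  obtains x y where "p = proj x y" "x \<noteq> 0 \<or> y \<noteq> 0"
  by (cases p) (use that[of 1 0] that[of _ 1] in \<open>auto simp: proj_def\<close>)

lemma proj_eqD: "proj x y = proj x' y' \<Longrightarrow> x * y' = x' * y"
  by (auto simp: proj_def field_simps split: if_splits)

lemma chart_inv_eq_proj:
  "chart_inv (Some z) w = proj w 1" "chart_inv None w = proj 1 w"
  by (auto simp: chart_inv_def proj_def)

lemma chart_inv_chart_self: "chart_inv p (chart p p) = p"
  by (cases p) (auto simp: chart_def chart_inv_def)

text \<open>The second conjunct keeps the image in the domain of the chart, where \<open>chart_inv\<close> inverts \<open>chart\<close>; it is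
  needed for the chain rule because \<open>chart\<close> is \<open>0\<close> outside its domain.\<close>

definition sphere_has_deriv :: "(complex option \<Rightarrow> complex option) \<Rightarrow> complex option \<Rightarrow> complex \<Rightarrow> bool" where
  "sphere_has_deriv g p D \<longleftrightarrow> ((\<lambda>w. chart (g p) (g (chart_inv p w))) has_field_derivative D) (at (chart p p)) \<and>
     eventually (\<lambda>w. chart_inv (g p) (chart (g p) (g (chart_inv p w))) = g (chart_inv p w)) (nhds (chart p p))"

lemma sphere_has_deriv_imp_sphere_deriv: "sphere_has_deriv g p D \<Longrightarrow> sphere_deriv g p = D"
  by (auto simp: sphere_has_deriv_def sphere_deriv_def intro: DERIV_imp_deriv)

lemma sphere_has_deriv_comp:
  assumes h: "sphere_has_deriv h p D" and g: "sphere_has_deriv g (h p) E"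
  shows "sphere_has_deriv (\<lambda>q. g (h q)) p (E * D)"
proof -
  define \<phi> where "\<phi> w = chart (h p) (h (chart_inv p w))" for w
  define \<psi> where "\<psi> v = chart (g (h p)) (g (chart_inv (h p) v))" for v
  have \<phi>0: "\<phi> (chart p p) = chart (h p) (h p)" by (simp add: \<phi>_def chart_inv_chart_self)
  have d\<phi>: "(\<phi> has_field_derivative D) (at (chart p p))" using h by (simp add: sphere_has_deriv_def \<phi>_def[abs_def])
  have d\<psi>: "(\<psi> has_field_derivative E) (at (\<phi> (chart p p)))" using g by (simp add: sphere_has_deriv_def \<psi>_def[abs_def] \<phi>0)
  have rh: "eventually (\<lambda>w. chart_inv (h p) (\<phi> w) = h (chart_inv p w)) (nhds (chart p p))"
    using h by (simp add: sphere_has_deriv_def \<phi>_def)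
  have rg: "eventually (\<lambda>v. chart_inv (g (h p)) (\<psi> v) = g (chart_inv (h p) v)) (nhds (\<phi> (chart p p)))"
    using g by (simp add: sphere_has_deriv_def \<psi>_def \<phi>0)
  have "filterlim \<phi> (nhds (\<phi> (chart p p))) (nhds (chart p p))"
    using DERIV_isCont[OF d\<phi>] by (simp add: isCont_def tendsto_at_iff_tendsto_nhds)
  with rg have "eventually (\<lambda>w. chart_inv (g (h p)) (\<psi> (\<phi> w)) = g (chart_inv (h p) (\<phi> w))) (nhds (chart p p))"
    by (rule eventually_compose_filterlim)
  with rh have ev: "eventually (\<lambda>w. \<psi> (\<phi> w) = chart (g (h p)) (g (h (chart_inv p w))) \<and>
      chart_inv (g (h p)) (chart (g (h p)) (g (h (chart_inv p w)))) = g (h (chart_inv p w))) (nhds (chart p p))"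
    by eventually_elim (simp add: \<psi>_def)
  have chain: "((\<lambda>w. \<psi> (\<phi> w)) has_field_derivative E * D) (at (chart p p))"
    using DERIV_chain[OF d\<psi> d\<phi>] by (simp add: o_def)
  have cong: "eventually (\<lambda>w. \<psi> (\<phi> w) = chart (g (h p)) (g (h (chart_inv p w)))) (nhds (chart p p))"
    using ev by eventually_elim simp
  have "((\<lambda>w. chart (g (h p)) (g (h (chart_inv p w)))) has_field_derivative E * D) (at (chart p p))"
    by (rule iffD1[OF DERIV_cong_ev[OF refl cong refl] chain])
  then show ?thesis unfolding sphere_has_deriv_def using ev by (auto elim: eventually_mono)
qed

lemma sphere_has_deriv_funpow:
  assumes "\<And>i. i < l \<Longrightarrow> sphere_has_deriv f ((f ^^ i) p) (D i)"
  shows "sphere_has_deriv (f ^^ l) p (\<Prod>i<l. D i)"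
  using assms
proof (induction l)
  case 0
  have "(\<lambda>w. chart p (chart_inv p w)) = (\<lambda>w. w)" by (cases p) (auto simp: chart_def chart_inv_def fun_eq_iff)
  moreover have "chart_inv p (chart p (chart_inv p w)) = chart_inv p w" for w
    by (cases p) (auto simp: chart_def chart_inv_def)
  ultimately show ?case by (simp add: sphere_has_deriv_def)
next
  case (Suc l)
  have "sphere_has_deriv (\<lambda>q. f ((f ^^ l) q)) p (D l * (\<Prod>i<l. D i))"
    using Suc by (intro sphere_has_deriv_comp) auto
  then show ?case by (simp add: o_def mult.commute)
qed

lemma chart_proj:
  "b0 \<noteq> 0 \<Longrightarrow> chart (proj a0 b0) (proj a b) = a / b"
  "b0 = 0 \<Longrightarrow> chart (proj a0 b0) (proj a b) = b / a"
  by (auto simp: chart_def proj_def)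

lemma chart_inv_proj:
  "b0 \<noteq> 0 \<Longrightarrow> b \<noteq> 0 \<Longrightarrow> chart_inv (proj a0 b0) (a / b) = proj a b"
  "b0 = 0 \<Longrightarrow> a \<noteq> 0 \<Longrightarrow> chart_inv (proj a0 b0) (b / a) = proj a b"
  by (auto simp: chart_inv_def proj_def)

text \<open>g is given in homogeneous coordinates by \<alpha> and \<beta>; the two cases are the
  charts at a finite value and at the value infinity.\<close>

lemma sphere_has_derivI:
  assumes g: "\<And>w. g (chart_inv p w) = proj (\<alpha> w) (\<beta> w)"
    and \<alpha>: "(\<alpha> has_field_derivative \<alpha>') (at (chart p p))" and \<beta>: "(\<beta> has_field_derivative \<beta>') (at (chart p p))"
  shows "\<beta> (chart p p) \<noteq> 0 \<Longrightarrow>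
      sphere_has_deriv g p ((\<alpha>' * \<beta> (chart p p) - \<alpha> (chart p p) * \<beta>') / (\<beta> (chart p p))\<^sup>2)"
    and "\<beta> (chart p p) = 0 \<Longrightarrow> \<alpha> (chart p p) \<noteq> 0 \<Longrightarrow> sphere_has_deriv g p (\<beta>' / \<alpha> (chart p p))"
proof -
  have gp: "g p = proj (\<alpha> (chart p p)) (\<beta> (chart p p))" using g[of "chart p p"] by (simp add: chart_inv_chart_self)
  have ev: "eventually (\<lambda>w. f w \<noteq> 0) (nhds (chart p p))"
    if "(f has_field_derivative f') (at (chart p p))" "f (chart p p) \<noteq> 0" for f f'
    using DERIV_isCont[OF that(1)] that(2)
    by (simp add: isCont_def tendsto_at_iff_tendsto_nhds tendsto_imp_eventually_ne)
  {
    assume 0: "\<beta> (chart p p) \<noteq> 0"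
    have eq: "(\<lambda>w. chart (g p) (g (chart_inv p w))) = (\<lambda>w. \<alpha> w / \<beta> w)"
      by (simp add: g gp chart_proj(1)[OF 0])
    have "((\<lambda>w. \<alpha> w / \<beta> w) has_field_derivative ((\<alpha>' * \<beta> (chart p p) - \<alpha> (chart p p) * \<beta>') / (\<beta> (chart p p))\<^sup>2)) (at (chart p p))"
      using DERIV_divide[OF \<alpha> \<beta> 0] by (simp add: power2_eq_square)
    moreover have "eventually (\<lambda>w. chart_inv (g p) (chart (g p) (g (chart_inv p w))) = g (chart_inv p w)) (nhds (chart p p))"
      using ev[OF \<beta> 0] by eventually_elim (simp add: g gp chart_proj(1)[OF 0] chart_inv_proj(1)[OF 0])
    ultimately show "sphere_has_deriv g p ((\<alpha>' * \<beta> (chart p p) - \<alpha> (chart p p) * \<beta>') / (\<beta> (chart p p))\<^sup>2)"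
      by (simp add: sphere_has_deriv_def eq)
  }
  {
    assume 0: "\<beta> (chart p p) = 0" "\<alpha> (chart p p) \<noteq> 0"
    have eq: "(\<lambda>w. chart (g p) (g (chart_inv p w))) = (\<lambda>w. \<beta> w / \<alpha> w)"
      by (simp add: g gp chart_proj(2)[OF 0(1)])
    have "((\<lambda>w. \<beta> w / \<alpha> w) has_field_derivative (\<beta>' / \<alpha> (chart p p))) (at (chart p p))"
      using DERIV_divide[OF \<beta> \<alpha> 0(2)] 0 by simp
    moreover have "eventually (\<lambda>w. chart_inv (g p) (chart (g p) (g (chart_inv p w))) = g (chart_inv p w)) (nhds (chart p p))"
      using ev[OF \<alpha> 0(2)] by eventually_elim (simp add: g gp chart_proj(2)[OF 0(1)] chart_inv_proj(2)[OF 0(1)])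
    ultimately show "sphere_has_deriv g p (\<beta>' / \<alpha> (chart p p))"
      by (simp add: sphere_has_deriv_def eq)
  }
qed

section \<open>Binary quadratic forms and the critical points\<close>

definition quad :: "complex poly \<Rightarrow> complex \<Rightarrow> complex \<Rightarrow> complex" where
  "quad P x y = coeff P 2 * x\<^sup>2 + coeff P 1 * x * y + coeff P 0 * y\<^sup>2"

lemma quad_eq_poly:
  assumes "degree P \<le> 2" "y \<noteq> 0"
  shows "quad P x y = y\<^sup>2 * poly P (x / y)"
proof -
  have "poly P t = (\<Sum>i\<le>2. coeff P i * t ^ i)" for t
    unfolding poly_altdef by (rule sum.mono_neutral_left) (use assms(1) in \<open>auto simp: coeff_eq_0\<close>)
  then show ?thesis using assms(2) by (simp add: quad_def numeral_2_eq_2 field_simps)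
qed

text \<open>The two forms have no common zero: coprimality excludes the finite points, and infinity
  is excluded because one of the degrees is 2.\<close>

lemma rat_map_proj:
  assumes "deg2_pair P Q" "x \<noteq> 0 \<or> y \<noteq> 0"
  shows "rat_map P Q (proj x y) = proj (quad P x y) (quad Q x y)" "quad P x y \<noteq> 0 \<or> quad Q x y \<noteq> 0"
proof -
  have deg: "degree P \<le> 2" "degree Q \<le> 2" and mx: "degree P = 2 \<or> degree Q = 2" and cp: "coprime P Q"
    using assms(1) by (auto simp: deg2_pair_def max_def split: if_splits)
  have c2: "coeff R 2 \<noteq> 0 \<longleftrightarrow> degree R = 2" if "degree R \<le> 2" for R :: "complex poly"
    using that by (metis coeff_eq_0 le_neq_implies_less leading_coeff_0_iff degree_0 zero_neq_numeral)
  have "rat_map P Q (proj x y) = proj (quad P x y) (quad Q x y) \<and> (quad P x y \<noteq> 0 \<or> quad Q x y \<noteq> 0)"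
  proof (cases "y = 0")
    case False
    then show ?thesis using coprime_poly_0[OF cp, of "x / y"] deg
      by (auto simp: quad_eq_poly proj_def rat_map_def)
  next
    case True
    then have x: "x \<noteq> 0" using assms(2) by simp
    show ?thesis
    proof (cases "degree Q = 2")
      case True
      then have "coeff Q 2 \<noteq> 0" using c2[OF deg(2)] by simp
      then show ?thesis using True \<open>y = 0\<close> x deg by (auto simp: quad_def proj_def rat_map_def)
    next
      case False
      then have "degree P = 2" using mx by simp
      then have "coeff P 2 \<noteq> 0" "coeff Q 2 = 0" "degree Q < degree P" using c2 deg False by auto
      then show ?thesis using \<open>y = 0\<close> x by (auto simp: quad_def proj_def rat_map_def)
    qed
  qed
  then show "rat_map P Q (proj x y) = proj (quad P x y) (quad Q x y)" "quad P x y \<noteq> 0 \<or> quad Q x y \<noteq> 0" by auto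
qed

lemma quadratic_form_zero:
  fixes A B C :: complex
  obtains s t where "s \<noteq> 0 \<or> t \<noteq> 0" "A * s\<^sup>2 + B * s * t + C * t\<^sup>2 = 0"
proof (cases "A = 0")
  case True
  then show ?thesis by (intro that[of 1 0]) auto
next
  case False
  define s where "s = (- B + csqrt (B\<^sup>2 - 4 * A * C)) / (2 * A)"
  have s: "2 * A * s + B = csqrt (B\<^sup>2 - 4 * A * C)" using False by (simp add: s_def)
  have "4 * A * (A * s\<^sup>2 + B * s + C) = (2 * A * s + B)\<^sup>2 - (B\<^sup>2 - 4 * A * C)" by (simp add: power2_eq_square algebra_simps)
  also have "\<dots> = 0" unfolding s by simp
  finally show ?thesis using False by (intro that[of s 1]) auto
qed

lemma square_form:
  fixes r2 r1 r0 :: complex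
  assumes "r1\<^sup>2 = 4 * r2 * r0"
  obtains u v where "\<And>x y. r2 * x\<^sup>2 + r1 * x * y + r0 * y\<^sup>2 = (u * x + v * y)\<^sup>2"
proof (cases "r2 = 0")
  case True
  then have "r1 = 0" using assms by simp
  then show ?thesis using True by (intro that[of 0 "csqrt r0"]) (simp add: power_mult_distrib)
next
  case False
  define u where "u = csqrt r2"
  have u: "u\<^sup>2 = r2" "u \<noteq> 0" using False by (auto simp: u_def)
  define v where "v = r1 / (2 * u)"
  have r1: "r1 = 2 * u * v" using u by (simp add: v_def)
  have r0: "r0 = v\<^sup>2" using assms u(2) unfolding r1 u(1)[symmetric] by (auto simp: power2_eq_square)
  show ?thesis
    by (rule that[of u v]) (simp add: r1 r0 u(1)[symmetric] power2_eq_square algebra_simps)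
qed

text \<open>The discriminant of the form minus k (u x + v y)^2 is affine in k with slope 4 R, where
  R is the value of the form at (v, -u), so some k leaves a square. At (v, -u) the first linear form
  is 0 and the second has square R, hence they are independent.\<close>

lemma complete_square:
  fixes r2 r1 r0 u v :: complex
  assumes nz: "r2 * v\<^sup>2 - r1 * u * v + r0 * u\<^sup>2 \<noteq> 0"
  obtains k u2 v2 where "u * v2 - u2 * v \<noteq> 0"
    "\<And>x y. r2 * x\<^sup>2 + r1 * x * y + r0 * y\<^sup>2 = k * (u * x + v * y)\<^sup>2 + (u2 * x + v2 * y)\<^sup>2"
proof -
  define R where "R = r2 * v\<^sup>2 - r1 * u * v + r0 * u\<^sup>2"
  define k where "k = (4 * r2 * r0 - r1\<^sup>2) / (4 * R)"
  have "R \<noteq> 0" using nz by (simp add: R_def)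
  then have k: "4 * k * R = 4 * r2 * r0 - r1\<^sup>2" by (simp add: k_def)
  have "(r1 - 2 * k * u * v)\<^sup>2 - 4 * (r2 - k * u\<^sup>2) * (r0 - k * v\<^sup>2) = r1\<^sup>2 - 4 * r2 * r0 + 4 * k * R"
    by (simp add: R_def power2_eq_square algebra_simps)
  then have "(r1 - 2 * k * u * v)\<^sup>2 = 4 * (r2 - k * u\<^sup>2) * (r0 - k * v\<^sup>2)" unfolding k by simp
  then obtain u2 v2 where sq: "\<And>x y. (r2 - k * u\<^sup>2) * x\<^sup>2 + (r1 - 2 * k * u * v) * x * y + (r0 - k * v\<^sup>2) * y\<^sup>2 = (u2 * x + v2 * y)\<^sup>2"
    by (rule square_form) blast
  have eq: "r2 * x\<^sup>2 + r1 * x * y + r0 * y\<^sup>2 = k * (u * x + v * y)\<^sup>2 + (u2 * x + v2 * y)\<^sup>2" for x y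
    unfolding sq[symmetric] by (simp add: power2_eq_square algebra_simps)
  have "(u2 * v + v2 * - u)\<^sup>2 = R" using eq[of v "- u"] by (simp add: R_def algebra_simps)
  then have "u * v2 - u2 * v \<noteq> 0" using nz R_def by (auto simp: algebra_simps)
  then show ?thesis using eq by (rule that)
qed

text \<open>The discriminant of s P + t Q is a quadratic form in (s, t), so the pencil contains a
  square (u x + v y)^2. Completing the square in P or in Q expresses both forms by the same two
  squares. In these coordinates the map factors through squaring, which puts its critical points at
  0 and infinity.\<close>

lemma simultaneous_diagonalization:
  assumes nz: "\<And>x y. x \<noteq> 0 \<or> y \<noteq> 0 \<Longrightarrow> quad P x y \<noteq> 0 \<or> quad Q x y \<noteq> 0"
  obtains u1 v1 u2 v2 a b c d where "u1 * v2 - u2 * v1 \<noteq> 0" "a * d - b * c \<noteq> 0"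
    "\<And>x y. quad P x y = a * (u1 * x + v1 * y)\<^sup>2 + b * (u2 * x + v2 * y)\<^sup>2"
    "\<And>x y. quad Q x y = c * (u1 * x + v1 * y)\<^sup>2 + d * (u2 * x + v2 * y)\<^sup>2"
proof -
  let ?p = "coeff P" and ?q = "coeff Q"
  obtain s t where st: "s \<noteq> 0 \<or> t \<noteq> 0"
    "((?p 1)\<^sup>2 - 4 * ?p 2 * ?p 0) * s\<^sup>2 + (2 * ?p 1 * ?q 1 - 4 * ?p 2 * ?q 0 - 4 * ?p 0 * ?q 2) * s * t + ((?q 1)\<^sup>2 - 4 * ?q 2 * ?q 0) * t\<^sup>2 = 0"
    by (rule quadratic_form_zero)
  have "(s * ?p 1 + t * ?q 1)\<^sup>2 = 4 * (s * ?p 2 + t * ?q 2) * (s * ?p 0 + t * ?q 0)"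
    using st(2) by (simp add: power2_eq_square algebra_simps)
  then obtain u v where uv0: "\<And>x y. (s * ?p 2 + t * ?q 2) * x\<^sup>2 + (s * ?p 1 + t * ?q 1) * x * y + (s * ?p 0 + t * ?q 0) * y\<^sup>2 = (u * x + v * y)\<^sup>2"
    by (rule square_form) blast
  have uv: "s * quad P x y + t * quad Q x y = (u * x + v * y)\<^sup>2" for x y
    unfolding uv0[symmetric] quad_def by (simp add: algebra_simps)
  \<comment> \<open>If the square were 0, the forms would be linearly dependent and a zero of a
    suitable one of them would be a common zero.\<close>
  have uvnz: "u \<noteq> 0 \<or> v \<noteq> 0"
  proof (rule ccontr)
    assume "\<not> ?thesis"
    then have z: "s * quad P x y + t * quad Q x y = 0" for x y using uv[of x y] by simp
    obtain x y where xy: "x \<noteq> 0 \<or> y \<noteq> 0" "(if s = 0 then quad P x y else quad Q x y) = 0"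
      unfolding quad_def by (cases "s = 0") (use quadratic_form_zero[of "?p 2" "?p 1" "?p 0"] quadratic_form_zero[of "?q 2" "?q 1" "?q 0"] in auto)
    then have "quad P x y = 0 \<and> quad Q x y = 0" using z[of x y] st(1) by (auto split: if_splits)
    then show False using nz[OF xy(1)] by simp
  qed
  have ker: "s * quad P v (- u) + t * quad Q v (- u) = 0" unfolding uv by simp
  have kernz: "quad P v (- u) \<noteq> 0 \<or> quad Q v (- u) \<noteq> 0" using nz[of v "- u"] uvnz by auto
  have "\<exists>a b c d u2 v2. u * v2 - u2 * v \<noteq> 0 \<and> (\<forall>x y. quad P x y = a * (u * x + v * y)\<^sup>2 + b * (u2 * x + v2 * y)\<^sup>2) \<and>
     (\<forall>x y. quad Q x y = c * (u * x + v * y)\<^sup>2 + d * (u2 * x + v2 * y)\<^sup>2)"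
  proof (cases "s = 0")
    case False
    then have "quad Q v (- u) \<noteq> 0" using ker kernz by auto
    then have "?q 2 * v\<^sup>2 - ?q 1 * u * v + ?q 0 * u\<^sup>2 \<noteq> 0" by (simp add: quad_def algebra_simps)
    then obtain k u2 v2 where k: "u * v2 - u2 * v \<noteq> 0"
      "\<And>x y. ?q 2 * x\<^sup>2 + ?q 1 * x * y + ?q 0 * y\<^sup>2 = k * (u * x + v * y)\<^sup>2 + (u2 * x + v2 * y)\<^sup>2"
      by (rule complete_square) blast
    have Q: "quad Q x y = k * (u * x + v * y)\<^sup>2 + 1 * (u2 * x + v2 * y)\<^sup>2" for x y using k(2) by (simp add: quad_def)
    have "quad P x y = ((1 - t * k) / s) * (u * x + v * y)\<^sup>2 + (- t / s) * (u2 * x + v2 * y)\<^sup>2" for x y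
    proof -
      have "s * quad P x y = (u * x + v * y)\<^sup>2 - t * quad Q x y" using uv[of x y] by (simp add: algebra_simps)
      then have "quad P x y = ((u * x + v * y)\<^sup>2 - t * quad Q x y) / s" using False by (simp add: field_simps)
      moreover have "(A - t * (k * A + 1 * B)) / s = (1 - t * k) / s * A + (- t / s) * B" for A B
        using False by (simp add: field_simps)
      ultimately show ?thesis unfolding Q by simp
    qed
    then show ?thesis using k(1) Q by blast
  next
    case True
    then have t: "t \<noteq> 0" using st(1) by simp
    then have "quad P v (- u) \<noteq> 0" using ker kernz True by auto
    then have "?p 2 * v\<^sup>2 - ?p 1 * u * v + ?p 0 * u\<^sup>2 \<noteq> 0" by (simp add: quad_def algebra_simps)
    then obtain k u2 v2 where k: "u * v2 - u2 * v \<noteq> 0"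
      "\<And>x y. ?p 2 * x\<^sup>2 + ?p 1 * x * y + ?p 0 * y\<^sup>2 = k * (u * x + v * y)\<^sup>2 + (u2 * x + v2 * y)\<^sup>2"
      by (rule complete_square) blast
    have P: "quad P x y = k * (u * x + v * y)\<^sup>2 + 1 * (u2 * x + v2 * y)\<^sup>2" for x y using k(2) by (simp add: quad_def)
    have "quad Q x y = (1 / t) * (u * x + v * y)\<^sup>2 + 0 * (u2 * x + v2 * y)\<^sup>2" for x y
      using uv[of x y] True t by (simp add: field_simps)
    then show ?thesis using k(1) P by blast
  qed
  then obtain a b c d u2 v2 where det: "u * v2 - u2 * v \<noteq> 0"
    and P: "\<And>x y. quad P x y = a * (u * x + v * y)\<^sup>2 + b * (u2 * x + v2 * y)\<^sup>2"
    and Q: "\<And>x y. quad Q x y = c * (u * x + v * y)\<^sup>2 + d * (u2 * x + v2 * y)\<^sup>2" by blast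
  \<comment> \<open>A kernel vector (X, Y) of the coefficient matrix is the pair of squares at some
    point (x, y), which would be a common zero of both forms.\<close>
  have "a * d - b * c \<noteq> 0"
  proof
    assume 0: "a * d - b * c = 0"
    have "\<exists>X Y. (X \<noteq> 0 \<or> Y \<noteq> 0) \<and> a * X + b * Y = 0 \<and> c * X + d * Y = 0"
    proof (cases "a = 0 \<and> b = 0")
      case True
      show ?thesis
      proof (cases "c = 0 \<and> d = 0")
        case False
        then show ?thesis using True by (intro exI[of _ d] exI[of _ "- c"]) auto
      qed (use True in \<open>auto intro: exI[of _ 1]\<close>)
    next
      case False
      then show ?thesis using 0 by (intro exI[of _ b] exI[of _ "- a"]) (auto simp: algebra_simps)
    qed
    then obtain X Y where XY: "X \<noteq> 0 \<or> Y \<noteq> 0" "a * X + b * Y = 0" "c * X + d * Y = 0" by blast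
    define \<Delta> where "\<Delta> = u * v2 - u2 * v"
    define x y where "x = (v2 * csqrt X - v * csqrt Y) / \<Delta>" and "y = (u * csqrt Y - u2 * csqrt X) / \<Delta>"
    have xy: "\<Delta> * x = v2 * csqrt X - v * csqrt Y" "\<Delta> * y = u * csqrt Y - u2 * csqrt X"
      using det by (simp_all add: x_def y_def \<Delta>_def)
    have "\<Delta> * (u * x + v * y) = u * (\<Delta> * x) + v * (\<Delta> * y)" "\<Delta> * (u2 * x + v2 * y) = u2 * (\<Delta> * x) + v2 * (\<Delta> * y)"
      by (simp_all add: algebra_simps)
    then have "\<Delta> * (u * x + v * y) = \<Delta> * csqrt X" "\<Delta> * (u2 * x + v2 * y) = \<Delta> * csqrt Y"
      unfolding xy by (simp_all add: \<Delta>_def algebra_simps)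
    then have l: "u * x + v * y = csqrt X" "u2 * x + v2 * y = csqrt Y" using det by (simp_all add: \<Delta>_def)
    then have "x \<noteq> 0 \<or> y \<noteq> 0" using XY(1) by auto
    moreover have "quad P x y = 0" "quad Q x y = 0" unfolding P Q l using XY by simp_all
    ultimately show False using nz by blast
  qed
  then show ?thesis using det P Q that by blast
qed

section \<open>Moebius conjugation and the transfer of cycles\<close>

definition mob :: "complex \<Rightarrow> complex \<Rightarrow> complex \<Rightarrow> complex \<Rightarrow> complex option \<Rightarrow> complex option" where
  "mob u1 v1 u2 v2 p = (case p of Some z \<Rightarrow> proj (u1 * z + v1) (u2 * z + v2) | None \<Rightarrow> proj u1 u2)"

definition qsph :: "complex \<Rightarrow> complex \<Rightarrow> complex \<Rightarrow> complex \<Rightarrow> complex option \<Rightarrow> complex option" where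
  "qsph a b c d p = (case p of Some z \<Rightarrow> proj (a * z\<^sup>2 + b) (c * z\<^sup>2 + d) | None \<Rightarrow> proj a c)"

lemma mob_proj:
  assumes "x \<noteq> 0 \<or> y \<noteq> 0"
  shows "mob u1 v1 u2 v2 (proj x y) = proj (u1 * x + v1 * y) (u2 * x + v2 * y)"
proof (cases "y = 0")
  case False
  have "u2 * (x / y) + v2 = (u2 * x + v2 * y) / y" "u1 * (x / y) + v1 = (u1 * x + v1 * y) / y" using False by (simp_all add: field_simps)
  then show ?thesis using False by (simp add: mob_def proj_def)
qed (use assms in \<open>auto simp: mob_def proj_def\<close>)

lemma qsph_proj:
  assumes "x \<noteq> 0 \<or> y \<noteq> 0"
  shows "qsph a b c d (proj x y) = proj (a * x\<^sup>2 + b * y\<^sup>2) (c * x\<^sup>2 + d * y\<^sup>2)"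
proof (cases "y = 0")
  case False
  have "c * (x / y)\<^sup>2 + d = (c * x\<^sup>2 + d * y\<^sup>2) / y\<^sup>2" "a * (x / y)\<^sup>2 + b = (a * x\<^sup>2 + b * y\<^sup>2) / y\<^sup>2"
    using False by (simp_all add: field_simps)
  then show ?thesis using False by (simp add: qsph_def proj_def)
qed (use assms in \<open>auto simp: qsph_def proj_def\<close>)

lemma qsph_Some:
  "qsph a b c d (Some z) \<noteq> None \<longleftrightarrow> c * z\<^sup>2 + d \<noteq> 0"
  "c * z\<^sup>2 + d \<noteq> 0 \<Longrightarrow> qsph a b c d (Some z) = Some (qmap a b c d z)"
  by (auto simp: qsph_def proj_def qmap_def)

lemma mob_inj:
  assumes "u1 * v2 - u2 * v1 \<noteq> 0"
  shows "inj (mob u1 v1 u2 v2)"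
proof (rule injI)
  fix p q assume eq: "mob u1 v1 u2 v2 p = mob u1 v1 u2 v2 q"
  obtain x y where p: "p = proj x y" "x \<noteq> 0 \<or> y \<noteq> 0" by (rule proj_cases)
  obtain x' y' where q: "q = proj x' y'" "x' \<noteq> 0 \<or> y' \<noteq> 0" by (rule proj_cases)
  have "(u1 * x + v1 * y) * (u2 * x' + v2 * y') = (u1 * x' + v1 * y') * (u2 * x + v2 * y)"
    using eq unfolding p(1) q(1) mob_proj[OF p(2)] mob_proj[OF q(2)] by (rule proj_eqD)
  then have "(u1 * v2 - u2 * v1) * (x * y' - x' * y) = 0" by (simp add: algebra_simps)
  then have "x * y' = x' * y" using assms by simp
  then show "p = q" using p(2) q(2) unfolding p(1) q(1) by (auto simp: proj_def field_simps)
qed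

lemma rat_map_has_deriv:
  assumes "deg2_pair P Q"
  shows "\<exists>D. sphere_has_deriv (rat_map P Q) p D"
proof (cases p)
  case None
  have "\<exists>D. ((\<lambda>w. quad R 1 w) has_field_derivative D) (at w0)" for R w0
    unfolding quad_def by (rule exI, (rule derivative_eq_intros refl)+)
  then obtain D1 D2 where D: "((\<lambda>w. quad P 1 w) has_field_derivative D1) (at (chart p p))" "((\<lambda>w. quad Q 1 w) has_field_derivative D2) (at (chart p p))"
    by metis
  have "rat_map P Q (chart_inv p w) = proj (quad P 1 w) (quad Q 1 w)" for w
    using rat_map_proj(1)[OF assms, of 1 w] by (simp add: None chart_inv_eq_proj)
  from sphere_has_derivI[OF this D] show ?thesis using rat_map_proj(2)[OF assms, of 1 "chart p p"] by auto
next
  case (Some z)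
  have "\<exists>D. ((\<lambda>w. quad R w 1) has_field_derivative D) (at w0)" for R w0
    unfolding quad_def by (rule exI, (rule derivative_eq_intros refl)+)
  then obtain D1 D2 where D: "((\<lambda>w. quad P w 1) has_field_derivative D1) (at (chart p p))" "((\<lambda>w. quad Q w 1) has_field_derivative D2) (at (chart p p))"
    by metis
  have "rat_map P Q (chart_inv p w) = proj (quad P w 1) (quad Q w 1)" for w
    using rat_map_proj(1)[OF assms, of w 1] by (simp add: Some chart_inv_eq_proj)
  from sphere_has_derivI[OF this D] show ?thesis using rat_map_proj(2)[OF assms, of "chart p p" 1] by auto
qed

lemma mob_has_deriv:
  assumes det: "u1 * v2 - u2 * v1 \<noteq> 0"
  shows "\<exists>D. D \<noteq> 0 \<and> sphere_has_deriv (mob u1 v1 u2 v2) p D"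
proof (cases p)
  case None
  have w0: "chart p p = 0" by (simp add: None chart_def)
  have g: "mob u1 v1 u2 v2 (chart_inv p w) = proj (u1 + v1 * w) (u2 + v2 * w)" for w
    using mob_proj[of 1 w u1 v1 u2 v2] by (simp add: None chart_inv_eq_proj)
  have d: "((\<lambda>w. u1 + v1 * w) has_field_derivative v1) (at (chart p p))" "((\<lambda>w. u2 + v2 * w) has_field_derivative v2) (at (chart p p))"
    by (auto intro!: derivative_eq_intros)
  show ?thesis
  proof (cases "u2 = 0")
    case True
    then show ?thesis using sphere_has_derivI(2)[OF g d] det by (intro exI[of _ "v2 / u1"]) (auto simp: w0)
  next
    case False
    then show ?thesis using sphere_has_derivI(1)[OF g d] det
      by (intro exI[of _ "(v1 * u2 - u1 * v2) / u2\<^sup>2"]) (auto simp: w0 algebra_simps)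
  qed
next
  case (Some z)
  have w0: "chart p p = z" by (simp add: Some chart_def)
  have g: "mob u1 v1 u2 v2 (chart_inv p w) = proj (u1 * w + v1) (u2 * w + v2)" for w
    using mob_proj[of w 1 u1 v1 u2 v2] by (simp add: Some chart_inv_eq_proj)
  have d: "((\<lambda>w. u1 * w + v1) has_field_derivative u1) (at (chart p p))" "((\<lambda>w. u2 * w + v2) has_field_derivative u2) (at (chart p p))"
    by (auto intro!: derivative_eq_intros)
  show ?thesis
  proof (cases "u2 * z + v2 = 0")
    case True
    have "u2 \<noteq> 0" using True det by auto
    moreover have "u2 * (u1 * z + v1) = u1 * (u2 * z + v2) - (u1 * v2 - u2 * v1)" by (simp add: algebra_simps)
    then have "u2 * (u1 * z + v1) = - (u1 * v2 - u2 * v1)" using True by simp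
    then have "u1 * z + v1 \<noteq> 0" using det by auto
    ultimately show ?thesis using sphere_has_derivI(2)[OF g d] True by (intro exI[of _ "u2 / (u1 * z + v1)"]) (auto simp: w0)
  next
    case False
    have "u1 * (u2 * z + v2) - (u1 * z + v1) * u2 = u1 * v2 - u2 * v1" by (simp add: algebra_simps)
    then show ?thesis using sphere_has_derivI(1)[OF g d] det False
      by (intro exI[of _ "(u1 * (u2 * z + v2) - (u1 * z + v1) * u2) / (u2 * z + v2)\<^sup>2"]) (simp add: w0)
  qed
qed

lemma qsph_has_deriv:
  assumes det: "a * d - b * c \<noteq> 0"
  shows "\<exists>D. sphere_has_deriv (qsph a b c d) p D \<and> (p = None \<or> p = Some 0 \<longrightarrow> D = 0) \<and>
     (\<forall>z. p = Some z \<and> c * z\<^sup>2 + d \<noteq> 0 \<longrightarrow> D = qder a b c d z)"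
proof (cases p)
  case None
  have w0: "chart p p = 0" by (simp add: None chart_def)
  have g: "qsph a b c d (chart_inv p w) = proj (a + b * w\<^sup>2) (c + d * w\<^sup>2)" for w
    using qsph_proj[of 1 w a b c d] by (simp add: None chart_inv_eq_proj)
  have e: "((\<lambda>w. a + b * w\<^sup>2) has_field_derivative 0) (at (chart p p))" "((\<lambda>w. c + d * w\<^sup>2) has_field_derivative 0) (at (chart p p))"
    by (auto intro!: derivative_eq_intros simp: w0)
  have "sphere_has_deriv (qsph a b c d) p 0"
    using sphere_has_derivI[OF g e] det by (cases "c = 0") (auto simp: w0)
  then show ?thesis using None by auto
next
  case (Some z)
  have w0: "chart p p = z" by (simp add: Some chart_def)
  have g: "qsph a b c d (chart_inv p w) = proj (a * w\<^sup>2 + b) (c * w\<^sup>2 + d)" for w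
    using qsph_proj[of w 1 a b c d] by (simp add: Some chart_inv_eq_proj)
  have e: "((\<lambda>w. a * w\<^sup>2 + b) has_field_derivative 2 * a * z) (at (chart p p))" "((\<lambda>w. c * w\<^sup>2 + d) has_field_derivative 2 * c * z) (at (chart p p))"
    by (auto intro!: derivative_eq_intros simp: w0)
  show ?thesis
  proof (cases "c * z\<^sup>2 + d = 0")
    case True
    have "a * z\<^sup>2 + b \<noteq> 0"
    proof
      assume "a * z\<^sup>2 + b = 0"
      then have "b = - (a * z\<^sup>2)" by (simp add: eq_neg_iff_add_eq_0 add.commute)
      moreover have "d = - (c * z\<^sup>2)" using True by (simp add: eq_neg_iff_add_eq_0 add.commute)
      ultimately show False using det by simp
    qed
    then show ?thesis using sphere_has_derivI(2)[OF g e] True unfolding w0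
      by (intro exI[of _ "2 * c * z / (a * z\<^sup>2 + b)"]) (auto simp: Some)
  next
    case False
    have "2 * a * z * (c * z\<^sup>2 + d) - (a * z\<^sup>2 + b) * (2 * c * z) = 2 * (a * d - b * c) * z"
      by (simp add: algebra_simps)
    then have "sphere_has_deriv (qsph a b c d) p (qder a b c d z)"
      using sphere_has_derivI(1)[OF g e] False by (simp add: w0 qder_def)
    then show ?thesis by (intro exI[of _ "qder a b c d z"]) (auto simp: Some qder_def)
  qed
qed

text \<open>The chain rule on both sides of M f^l = F^l M at the fixed point gives equal
  multipliers, as the derivative of M is not 0. A nonzero multiplier keeps the image cycle away from
  the critical point infinity, so the cycle lies in the plane, where F is
  \<open>qmap\<close>.\<close>

lemma noncritical_cycle_transfer:
  assumes det: "a * d - b * c \<noteq> 0" and conj: "\<And>p. M (f p) = qsph a b c d (M p)" and inj: "inj M"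
    and df: "\<And>p. \<exists>D. sphere_has_deriv f p D" and dM: "\<And>p. \<exists>D. D \<noteq> 0 \<and> sphere_has_deriv M p D"
    and per: "exact_period f p l" and mult: "sphere_deriv (f ^^ l) p \<noteq> 0"
  shows "\<exists>z. exact_period (qmap a b c d) z l \<and> qmult a b c d l z = sphere_deriv (f ^^ l) p \<and>
     Some ` cycle_of (qmap a b c d) z l = M ` cycle_of f p l"
proof -
  let ?F = "qsph a b c d"
  have conj_it: "M ((f ^^ i) q) = (?F ^^ i) (M q)" for i q by (induction i) (simp_all add: conj)
  have l: "l > 0" "(f ^^ l) p = p" using per by (auto simp: exact_period_def)
  obtain Df where Df: "\<And>q. sphere_has_deriv f q (Df q)" using df by metis
  obtain D where D: "\<And>q. sphere_has_deriv ?F q (D q)" "\<And>q. q = None \<or> q = Some 0 \<Longrightarrow> D q = 0"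
    "\<And>z. c * z\<^sup>2 + d \<noteq> 0 \<Longrightarrow> D (Some z) = qder a b c d z"
    using qsph_has_deriv[OF det] by metis
  obtain \<nu> where \<nu>: "\<nu> \<noteq> 0" "sphere_has_deriv M p \<nu>" using dM by blast
  define E where "E = (\<Prod>i<l. Df ((f ^^ i) p))"
  have E: "sphere_has_deriv (f ^^ l) p E" unfolding E_def by (rule sphere_has_deriv_funpow) (rule Df)
  have "sphere_has_deriv (\<lambda>q. M ((f ^^ l) q)) p (\<nu> * E)"
    by (rule sphere_has_deriv_comp[OF E]) (simp add: l \<nu>)
  moreover have "sphere_has_deriv (\<lambda>q. (?F ^^ l) (M q)) p ((\<Prod>i<l. D ((?F ^^ i) (M p))) * \<nu>)"
    by (rule sphere_has_deriv_comp[OF \<nu>(2)], rule sphere_has_deriv_funpow) (rule D)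
  ultimately have "\<nu> * E = (\<Prod>i<l. D ((?F ^^ i) (M p))) * \<nu>"
    unfolding conj_it using sphere_has_deriv_imp_sphere_deriv by metis
  then have "E = (\<Prod>i<l. D ((?F ^^ i) (M p)))" using \<nu>(1) by simp
  then have prod: "sphere_deriv (f ^^ l) p = (\<Prod>i<l. D ((?F ^^ i) (M p)))"
    using sphere_has_deriv_imp_sphere_deriv[OF E] by simp
  have perF: "(?F ^^ l) (M p) = M p" using conj_it[of l p] l by simp
  have "D ((?F ^^ i) (M p)) \<noteq> 0" if "i < l" for i using mult that unfolding prod by auto
  then have "D ((?F ^^ i) (M p)) \<noteq> 0" for i
    using l(1) by (subst funpow_mod_period[OF perF]) simp
  then have fin: "(?F ^^ i) (M p) \<noteq> None" for i using D(2) by metis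
  obtain z where z: "M p = Some z" using fin[of 0] by auto
  have it: "(?F ^^ i) (M p) = Some ((qmap a b c d ^^ i) z) \<and> c * ((qmap a b c d ^^ i) z)\<^sup>2 + d \<noteq> 0" for i
  proof (induction i)
    case 0
    show ?case using fin[of 1] qsph_Some(1)[of a b c d z] by (simp add: z)
  next
    case (Suc i)
    then have "(?F ^^ Suc i) (M p) = Some ((qmap a b c d ^^ Suc i) z)" by (simp add: qsph_Some(2))
    moreover from this have "c * ((qmap a b c d ^^ Suc i) z)\<^sup>2 + d \<noteq> 0"
      using fin[of "Suc (Suc i)"] qsph_Some(1)[of a b c d "(qmap a b c d ^^ Suc i) z"] by simp
    ultimately show ?case by blast
  qed
  have Mi: "M ((f ^^ i) p) = Some ((qmap a b c d ^^ i) z)" for i using it conj_it by simp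
  have "(qmap a b c d ^^ i) z = z \<longleftrightarrow> (f ^^ i) p = p" for i
    using Mi[of i] Mi[of 0] inj_eq[OF inj, of "(f ^^ i) p" p] by simp
  then have "exact_period (qmap a b c d) z l" using per by (simp add: exact_period_def)
  moreover have "qmult a b c d l z = sphere_deriv (f ^^ l) p"
    unfolding prod qmult_def using it D(3) by simp
  moreover have "Some ` cycle_of (qmap a b c d) z l = M ` cycle_of f p l"
    by (simp add: cycle_of_def image_image Mi)
  ultimately show ?thesis by blast
qed

section \<open>Arbitrary rational maps of degree 2\<close>

theorem rat_map_to_generic:
  assumes PQ: "deg2_pair P Q" and \<epsilon>: "\<epsilon> > 0" and T: "finite T"
    "T \<subseteq> {cycle_of (rat_map P Q) p l | p l. l \<le> L \<and> exact_period (rat_map P Q) p l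
        \<and> norm (sphere_deriv (rat_map P Q ^^ l) p) > 1 \<and> norm (sphere_deriv (rat_map P Q ^^ l) p) < (1 + \<epsilon>) ^ l}"
  shows "\<exists>b c. (\<forall>m\<in>{1..L}. generic m b c) \<and> card T \<le> cyc_count L b c 1 (1 + \<epsilon>)"
proof -
  let ?f = "rat_map P Q"
  obtain u1 v1 u2 v2 a b c d where det: "u1 * v2 - u2 * v1 \<noteq> 0" and ad: "a * d - b * c \<noteq> 0"
    and P: "\<And>x y. quad P x y = a * (u1 * x + v1 * y)\<^sup>2 + b * (u2 * x + v2 * y)\<^sup>2"
    and Q: "\<And>x y. quad Q x y = c * (u1 * x + v1 * y)\<^sup>2 + d * (u2 * x + v2 * y)\<^sup>2"
    using simultaneous_diagonalization[OF rat_map_proj(2)[OF PQ]] by metis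
  define M where "M = mob u1 v1 u2 v2"
  \<comment> \<open>In the coordinates given by M the map squares both homogeneous coordinates and
    applies the matrix (a b; c d), with values in the old coordinates; passing to the new ones
    multiplies from the left by the matrix of M.\<close>
  define a' b' c' d' where "a' = u1 * a + v1 * c" and "b' = u1 * b + v1 * d" and "c' = u2 * a + v2 * c" and "d' = u2 * b + v2 * d"
  have "a' * d' - b' * c' = (u1 * v2 - u2 * v1) * (a * d - b * c)"
    by (simp add: a'_def b'_def c'_def d'_def algebra_simps)
  then have ad': "a' * d' - b' * c' \<noteq> 0" using det ad by simp
  have conj: "M (?f p) = qsph a' b' c' d' (M p)" for p
  proof -
    obtain x y where p: "p = proj x y" "x \<noteq> 0 \<or> y \<noteq> 0" by (rule proj_cases)
    have l: "u1 * x + v1 * y \<noteq> 0 \<or> u2 * x + v2 * y \<noteq> 0"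
    proof (rule ccontr)
      assume "\<not> ?thesis"
      then have "v2 * (u1 * x + v1 * y) - v1 * (u2 * x + v2 * y) = 0" "u1 * (u2 * x + v2 * y) - u2 * (u1 * x + v1 * y) = 0" by simp_all
      then have "(u1 * v2 - u2 * v1) * x = 0" "(u1 * v2 - u2 * v1) * y = 0" by (simp_all add: algebra_simps)
      then show False using det p(2) by simp
    qed
    have "M (?f p) = proj (u1 * quad P x y + v1 * quad Q x y) (u2 * quad P x y + v2 * quad Q x y)"
      unfolding p(1) M_def rat_map_proj(1)[OF PQ p(2)] by (rule mob_proj[OF rat_map_proj(2)[OF PQ p(2)]])
    also have "\<dots> = qsph a' b' c' d' (M p)"
      unfolding p(1) M_def mob_proj[OF p(2)] qsph_proj[OF l] P Q
      by (simp add: a'_def b'_def c'_def d'_def algebra_simps)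
    finally show ?thesis .
  qed
  have inj: "inj M" unfolding M_def by (rule mob_inj[OF det])
  have "\<forall>K\<in>T. \<exists>q. snd q \<le> L \<and> exact_period (qmap a' b' c' d') (fst q) (snd q) \<and>
     1 < norm (qmult a' b' c' d' (snd q) (fst q)) \<and> norm (qmult a' b' c' d' (snd q) (fst q)) < (1 + \<epsilon>) ^ snd q \<and>
     Some ` cycle_of (qmap a' b' c' d') (fst q) (snd q) = M ` K"
  proof
    fix K assume "K \<in> T"
    then obtain p l where p: "K = cycle_of ?f p l" "l \<le> L" "exact_period ?f p l"
      "norm (sphere_deriv (?f ^^ l) p) > 1" "norm (sphere_deriv (?f ^^ l) p) < (1 + \<epsilon>) ^ l" using T(2) by blast
    have "sphere_deriv (?f ^^ l) p \<noteq> 0" using p(4) by auto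
    from noncritical_cycle_transfer[OF ad' conj inj rat_map_has_deriv[OF PQ] mob_has_deriv[OF det, folded M_def] p(3) this]
    obtain z where "exact_period (qmap a' b' c' d') z l" "qmult a' b' c' d' l z = sphere_deriv (?f ^^ l) p"
      "Some ` cycle_of (qmap a' b' c' d') z l = M ` cycle_of ?f p l" by blast
    then show "\<exists>q. snd q \<le> L \<and> exact_period (qmap a' b' c' d') (fst q) (snd q) \<and>
     1 < norm (qmult a' b' c' d' (snd q) (fst q)) \<and> norm (qmult a' b' c' d' (snd q) (fst q)) < (1 + \<epsilon>) ^ snd q \<and>
     Some ` cycle_of (qmap a' b' c' d') (fst q) (snd q) = M ` K"
      using p by (intro exI[of _ "(z, l)"]) simp
  qed
  then obtain q where q: "\<forall>K\<in>T. snd (q K) \<le> L \<and> exact_period (qmap a' b' c' d') (fst (q K)) (snd (q K)) \<and>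
     1 < norm (qmult a' b' c' d' (snd (q K)) (fst (q K))) \<and> norm (qmult a' b' c' d' (snd (q K)) (fst (q K))) < (1 + \<epsilon>) ^ snd (q K) \<and>
     Some ` cycle_of (qmap a' b' c' d') (fst (q K)) (snd (q K)) = M ` K"
    by (rule bchoice[THEN exE])
  show ?thesis
  proof (rule weakly_repelling_to_generic[OF ad' T(1), where l = "\<lambda>K. snd (q K)" and z = "\<lambda>K. fst (q K)"])
    show "inj_on (\<lambda>K. cycle_of (qmap a' b' c' d') (fst (q K)) (snd (q K))) T"
    proof (rule inj_onI)
      fix K K' assume K: "K \<in> T" "K' \<in> T"
        "cycle_of (qmap a' b' c' d') (fst (q K)) (snd (q K)) = cycle_of (qmap a' b' c' d') (fst (q K')) (snd (q K'))"
      then have "M ` K = M ` K'" using q by metis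
      then show "K = K'" using inj by (simp add: inj_image_eq_iff)
    qed
  qed (use q \<epsilon> in auto)
qed

theorem theoremB:
  fixes L :: nat
  assumes "L \<ge> 1"
  shows "\<exists>\<epsilon>::real. \<epsilon> > 0 \<and>
    (\<forall>P Q. deg2_pair P Q \<longrightarrow>
       (let f = rat_map P Q;
            S = {cycle_of f p l | p l. l \<le> L \<and> exact_period f p l
                   \<and> norm (sphere_deriv (f ^^ l) p) > 1
                   \<and> norm (sphere_deriv (f ^^ l) p) < (1 + \<epsilon>) ^ l}
        in finite S \<and> card S \<le> 4))"
proof (rule ccontr)
  assume neg: "\<not> ?thesis"
  define S where "S \<epsilon> P Q = {cycle_of (rat_map P Q) p l | p l. l \<le> L \<and> exact_period (rat_map P Q) p l
        \<and> norm (sphere_deriv (rat_map P Q ^^ l) p) > 1 \<and> norm (sphere_deriv (rat_map P Q ^^ l) p) < (1 + \<epsilon>) ^ l}"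
    for \<epsilon> :: real and P Q
  have "\<exists>z. (\<forall>m\<in>{1..L}. generic m (fst z) (snd z)) \<and> 5 \<le> cyc_count L (fst z) (snd z) 1 (1 + \<epsilon>)" if \<epsilon>: "\<epsilon> > 0" for \<epsilon>
  proof -
    have "\<exists>P Q. deg2_pair P Q \<and> \<not> (finite (S \<epsilon> P Q) \<and> card (S \<epsilon> P Q) \<le> 4)"
      using neg \<epsilon> unfolding S_def Let_def by blast
    then obtain P Q where PQ: "deg2_pair P Q" "\<not> (finite (S \<epsilon> P Q) \<and> card (S \<epsilon> P Q) \<le> 4)" by blast
    \<comment> \<open>An infinite set also contains five elements, so finiteness and the bound
      follow from the same contradiction.\<close>
    have "\<exists>T. finite T \<and> card T = 5 \<and> T \<subseteq> S \<epsilon> P Q"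
    proof (cases "finite (S \<epsilon> P Q)")
      case True
      then have "5 \<le> card (S \<epsilon> P Q)" using PQ(2) by simp
      then show ?thesis using obtain_subset_with_card_n by metis
    next
      case False
      then show ?thesis using infinite_arbitrarily_large by blast
    qed
    then obtain T where T: "finite T" "card T = 5" "T \<subseteq> S \<epsilon> P Q" by blast
    from rat_map_to_generic[OF PQ(1) \<epsilon> T(1) T(3)[unfolded S_def]] T(2)
    obtain b c where "\<forall>m\<in>{1..L}. generic m b c" "5 \<le> cyc_count L b c 1 (1 + \<epsilon>)" by auto
    then show ?thesis by (intro exI[of _ "(b, c)"]) simp
  qed
  then have "\<forall>n. \<exists>z. (\<forall>m\<in>{1..L}. generic m (fst z) (snd z)) \<and> 5 \<le> cyc_count L (fst z) (snd z) 1 (1 + inverse (real (Suc n)))"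
    by simp
  then obtain z where z: "\<And>n m. m \<in> {1..L} \<Longrightarrow> generic m (fst (z n)) (snd (z n))"
    "\<And>n. 5 \<le> cyc_count L (fst (z n)) (snd (z n)) 1 (1 + inverse (real (Suc n)))"
    by (rule choice[THEN exE]) blast
  obtain n where "cyc_count L (fst (z n)) (snd (z n)) 1 (1 + inverse (real (Suc n))) \<le> 4"
    using weakly_repelling_generic_bound[OF LIMSEQ_inverse_real_of_nat, of L "\<lambda>n. fst (z n)" "\<lambda>n. snd (z n)"] z(1) assms by auto
  then show False using z(2)[of n] by simp
qed

end
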